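(* Let $c\in(1,6/5)$. There exist $N_{0}=N_{0}(c)>0$ and $\delta=\delta(c)>0$ such that for every $N>N_{0}$ and for all sets $\mathcal{A},\mathcal{B}\subseteq[N/2,N)\cap\mathbb{N}$ with \[ |\mathcal{A}||\mathcal{B}|\gg N^{2-2\delta}, \] the equation \[ ab=[n^{c}],\qquad a\in\mathcal{A},\ b\in\mathcal{B},\ n\in\mathbb{N}, \] has a solution.
   Context: $\mathbb{N}$ denotes the set of positive integers, $[x]$ denotes the integer part of the real number $x$, and $|\mathcal{S}|$ denotes the cardinality of a finite set $\mathcal{S}$. The notation $U\gg V$ means $U\geq CV$ for some positive constant $C$ not depending on $N$, $\mathcal{A}$ or $\mathcal{B}$. *)

theory Defs
  imports Complex_Main
begin

end

theory Submission
  imports Defs "HOL-Complex_Analysis.Complex_Analysis" "HOL-Real_Asymp.Real_Asymp"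
    "HOL-Library.Discrete_Functions"
begin

text \<open>
  Put \<open>\<gamma> = 1/c\<close>. If \<open>m = a b\<close> is not of the form \<open>\<lfloor>n\<^sup>c\<rfloor>\<close>, then no integer lies between \<open>m\<^sup>\<gamma>\<close> and
  \<open>(m + 1)\<^sup>\<gamma>\<close>, an interval of length \<open>\<gg> N\<close> to the power \<open>2\<gamma> - 2\<close>. If this happens for all
  \<open>(a, b) \<in> A \<times> B\<close>, a power of the Fejer kernel shows that
  \<open>|A||B| \<le> 4 \<Sum>\<^sub>h |\<Sum>\<^sub>a \<Sum>\<^sub>b e(h a\<^sup>\<gamma> b\<^sup>\<gamma>)|\<close>, where \<open>h\<close> runs up to \<open>N\<close> to the power \<open>2 - 2\<gamma> + \<epsilon>\<close>.
  The Cauchy-Schwarz inequality and the double large sieve bound the right-hand side by the number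
  of nearly equal products \<open>h a\<^sup>\<gamma> \<approx> h' a'\<^sup>\<gamma>\<close>, which is essentially diagonal, and the additive
  energy of the sequence \<open>b\<^sup>\<gamma>\<close>, smoothed at scale \<open>1/X\<close>.

  The energy is \<open>\<ll> N\<close> to the power \<open>2 + \<epsilon>\<close> (a theorem of Robert and Sargos). It is comparable to a
  fourth moment of \<open>\<Sum> e(u b\<^sup>\<gamma>)\<close> over \<open>u \<le> X\<close>. On each dyadic range of \<open>u\<close> the van der Corput B-process
  (truncated Poisson summation followed by stationary phase) turns the sum into a shorter
  sum with the exponent \<open>\<gamma>/(\<gamma> - 1)\<close> in place of \<open>\<gamma>\<close>; as this substitution is an involution, an
  induction on the dyadic level closes.
  The total is a saving over \<open>N\<^sup>2\<close> exactly when \<open>\<gamma> > 5/6\<close>.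
\<close>

section \<open>Oscillatory integrals with concave phase\<close>

definition ec :: "real \<Rightarrow> complex" where "ec x = cis (2 * pi * x)"

lemma ec_add: "ec (x + y) = ec x * ec y"
  by (simp add: ec_def cis_mult distrib_left)

lemma ec_diff: "ec (x - y) = ec x * cnj (ec y)"
  by (simp add: ec_def cis_mult cis_cnj right_diff_distrib)

lemma ec_0 [simp]: "ec 0 = 1"
  by (simp add: ec_def)

lemma ec_minus: "ec (- x) = cnj (ec x)"
  by (simp add: ec_def cis_cnj)

lemma norm_ec [simp]: "norm (ec x) = 1"
  by (simp add: ec_def)

lemma Re_ec: "Re (ec x) = cos (2 * pi * x)"
  by (simp add: ec_def)

lemma ec_of_int [simp]: "ec (of_int n) = 1"
  using cis_multiple_2pi[of "of_int n"] by (simp add: ec_def)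

lemma ec_mult_of_nat: "ec (of_nat n * x) = ec x ^ n"
  by (simp add: ec_def Complex.DeMoivre algebra_simps)

lemma continuous_on_ec [continuous_intros]:
  "continuous_on S f \<Longrightarrow> continuous_on S (\<lambda>x. ec (f x))"
  unfolding ec_def by (intro continuous_intros)

lemma ec_has_vector_derivative:
  assumes "(q has_real_derivative q') (at x within S)"
  shows "((\<lambda>x. ec (q x)) has_vector_derivative (2 * pi * \<i> * q' * ec (q x))) (at x within S)"
proof -
  have "((\<lambda>x. cis (2 * pi * q x)) has_derivative
      (\<lambda>h. (2 * pi * (q' * h)) *\<^sub>R (\<i> * cis (2 * pi * q x)))) (at x within S)"
    using assms unfolding has_field_derivative_def
    by (auto intro!: derivative_eq_intros)
  thus ?thesis
    unfolding ec_def has_vector_derivative_def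
    by (rule has_derivative_eq_rhs) (auto simp: scaleR_conv_of_real algebra_simps)
qed

lemma norm_sum_ec_le_card: "norm (\<Sum>i\<in>I. ec (f i)) \<le> real (card I)"
  using sum_norm_bound[of I "\<lambda>i. ec (f i)" 1] by simp

lemma norm_sum_ec_uminus: "norm (\<Sum>i\<in>I. ec (- f i)) = norm (\<Sum>i\<in>I. ec (f i))"
  by (simp only: ec_minus cnj_sum[symmetric] complex_mod_cnj)

lemma norm_integral_three_pieces_le:
  fixes f :: "real \<Rightarrow> 'a::banach"
  assumes f_integrable: "f integrable_on {a..d}" and order: "a \<le> b" "b \<le> c" "c \<le> d"
  shows "norm (integral {a..d} f - z)
    \<le> norm (integral {a..b} f) + norm (integral {b..c} f - z) + norm (integral {c..d} f)"
proof -
  have "integral {a..b} f + integral {b..d} f = integral {a..d} f"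
    using f_integrable order by (intro Henstock_Kurzweil_Integration.integral_combine) auto
  moreover have "integral {b..c} f + integral {c..d} f = integral {b..d} f"
    using integrable_on_subinterval[OF f_integrable, of b d] order
    by (intro Henstock_Kurzweil_Integration.integral_combine) auto
  ultimately have "integral {a..d} f - z = integral {a..b} f + (integral {b..c} f - z) + integral {c..d} f"
    by (simp add: algebra_simps)
  thus ?thesis by (simp only: norm_triangle_mono order_refl)
qed

locale concave_phase =
  fixes q q' q'' :: "real \<Rightarrow> real" and a b :: real
  assumes a_le_b: "a \<le> b"
    and phase_deriv: "\<And>x. x \<in> {a..b} \<Longrightarrow> (q has_real_derivative q' x) (at x)"
    and phase_deriv2: "\<And>x. x \<in> {a..b} \<Longrightarrow> (q' has_real_derivative q'' x) (at x)"
    and continuous_on_deriv2: "continuous_on {a..b} q''"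
    and deriv2_nonpos: "\<And>x. x \<in> {a..b} \<Longrightarrow> q'' x \<le> 0"
begin

lemma continuous_on_phase: "continuous_on {a..b} q"
  by (auto intro!: continuous_at_imp_continuous_on DERIV_isCont phase_deriv)

lemma continuous_on_deriv: "continuous_on {a..b} q'"
  by (auto intro!: continuous_at_imp_continuous_on DERIV_isCont phase_deriv2)

lemma integrable_ec_phase: "(\<lambda>x. ec (q x)) integrable_on {a..b}"
  by (intro integrable_continuous_real continuous_intros continuous_on_phase)

lemma deriv_antimono: "a \<le> x \<Longrightarrow> x \<le> y \<Longrightarrow> y \<le> b \<Longrightarrow> q' y \<le> q' x"
  by (rule DERIV_nonpos_imp_nonincreasing, assumption)
     (meson atLeastAtMost_iff deriv2_nonpos order_trans phase_deriv2)

lemma concave_phase_subinterval: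
  assumes "a \<le> c" "c \<le> d" "d \<le> b"
  shows "concave_phase q q' q'' c d"
proof
  show "continuous_on {c..d} q''"
    using continuous_on_subset[OF continuous_on_deriv2] assms by auto
qed (use assms phase_deriv phase_deriv2 deriv2_nonpos in auto)

lemma concave_phase_minus_linear:
  "concave_phase (\<lambda>x. q x - v * x) (\<lambda>x. q' x - v) q'' a b"
proof
  fix x assume x_in: "x \<in> {a..b}"
  show "((\<lambda>x. q x - v * x) has_real_derivative q' x - v) (at x)"
    using phase_deriv[OF x_in] by (auto intro!: derivative_eq_intros)
  show "((\<lambda>x. q' x - v) has_real_derivative q'' x) (at x)"
    using phase_deriv2[OF x_in] by (auto intro!: derivative_eq_intros)
qed (use a_le_b continuous_on_deriv2 deriv2_nonpos in auto)

lemma norm_integral_ec_le_length: "norm (integral {a..b} (\<lambda>x. ec (q x))) \<le> b - a"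
  using integral_bound[OF a_le_b, of "\<lambda>x. ec (q x)" 1] continuous_on_ec[OF continuous_on_phase]
  by simp

lemma inverse_deriv_has_derivative:
  assumes "x \<in> {a..b}" "q' x \<noteq> 0"
  shows "((\<lambda>x. 1 / q' x) has_real_derivative - (q'' x / (q' x)\<^sup>2)) (at x within {a..b})"
  using DERIV_inverse_fun[OF has_field_derivative_at_within[OF phase_deriv2[OF assms(1)]] assms(2)]
  by (simp add: field_simps power2_eq_square)

lemma ec_div_deriv_has_derivative:
  assumes x_in: "x \<in> {a..b}" "q' x \<noteq> 0"
  shows "((\<lambda>x. ec (q x) / (2 * pi * \<i> * q' x)) has_vector_derivative
           ec (q x) - ec (q x) * of_real (q'' x / (q' x)\<^sup>2) / (2 * pi * \<i>)) (at x within {a..b})"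
proof -
  have "((\<lambda>x. ec (q x) * of_real (1 / q' x) / (2 * pi * \<i>)) has_vector_derivative
      (ec (q x) * of_real (- (q'' x / (q' x)\<^sup>2)) + (2 * pi * \<i> * q' x * ec (q x)) * of_real (1 / q' x))
        / (2 * pi * \<i>))
      (at x within {a..b})"
    by (intro has_vector_derivative_divide has_vector_derivative_mult ec_has_vector_derivative
        has_vector_derivative_of_real inverse_deriv_has_derivative x_in
        has_field_derivative_at_within[OF phase_deriv])
  moreover have "(ec (q x) * of_real (- (q'' x / (q' x)\<^sup>2))
      + (2 * pi * \<i> * q' x * ec (q x)) * of_real (1 / q' x)) / (2 * pi * \<i>)
      = ec (q x) - ec (q x) * of_real (q'' x / (q' x)\<^sup>2) / (2 * pi * \<i>)"
    using x_in by (simp add: field_simps)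
  ultimately show ?thesis by (simp add: mult_ac)
qed

lemma integral_ec_by_parts:
  assumes nonzero: "\<And>x. x \<in> {a..b} \<Longrightarrow> q' x \<noteq> 0"
  shows "norm (integral {a..b} (\<lambda>x. ec (q x))
      - (ec (q b) / (2 * pi * \<i> * q' b) - ec (q a) / (2 * pi * \<i> * q' a)))
           \<le> (1 / q' b - 1 / q' a) / (2 * pi)"
proof -
  define E where "E = (\<lambda>x. ec (q x) * of_real (q'' x / (q' x)\<^sup>2) / (2 * pi * \<i>))"
  have E_integrable: "E integrable_on {a..b}"
    unfolding E_def
    by (intro integrable_continuous_real continuous_intros continuous_on_phase continuous_on_deriv
        continuous_on_deriv2) (use nonzero in auto)
  have "((\<lambda>x. ec (q x) - E x) has_integral
      (ec (q b) / (2 * pi * \<i> * q' b) - ec (q a) / (2 * pi * \<i> * q' a))) {a..b}"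
    unfolding E_def
    by (rule fundamental_theorem_of_calculus[OF a_le_b]) (intro ec_div_deriv_has_derivative nonzero)
  hence "integral {a..b} (\<lambda>x. ec (q x) - E x)
      = ec (q b) / (2 * pi * \<i> * q' b) - ec (q a) / (2 * pi * \<i> * q' a)"
    by (rule integral_unique)
  hence error: "integral {a..b} (\<lambda>x. ec (q x))
      - (ec (q b) / (2 * pi * \<i> * q' b) - ec (q a) / (2 * pi * \<i> * q' a))
      = integral {a..b} E"
    using integral_diff[OF integrable_ec_phase E_integrable] by (simp only: diff_eq_eq add.commute)
  have majorant: "((\<lambda>x. - (q'' x / (q' x)\<^sup>2) / (2 * pi)) has_integral (1 / q' b - 1 / q' a) / (2 * pi)) {a..b}"
    by (intro has_integral_divide fundamental_theorem_of_calculus[OF a_le_b])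
       (simp add: inverse_deriv_has_derivative nonzero flip: has_real_derivative_iff_has_vector_derivative)
  have "norm (integral {a..b} E) \<le> integral {a..b} (\<lambda>x. - (q'' x / (q' x)\<^sup>2) / (2 * pi))"
  proof (rule integral_norm_bound_integral[OF E_integrable has_integral_integrable[OF majorant]])
    fix x assume "x \<in> {a..b}"
    thus "norm (E x) \<le> - (q'' x / (q' x)\<^sup>2) / (2 * pi)"
      using deriv2_nonpos[of x] by (simp add: E_def norm_mult norm_divide norm_power abs_of_nonpos)
  qed
  thus ?thesis unfolding error integral_unique[OF majorant] .
qed

lemma first_derivative_test:
  assumes l_pos: "l > 0" and large: "(\<forall>x\<in>{a..b}. l \<le> q' x) \<or> (\<forall>x\<in>{a..b}. q' x \<le> - l)"
  shows "norm (integral {a..b} (\<lambda>x. ec (q x))) \<le> 1 / l"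
proof -
  define boundary where "boundary = (\<lambda>x. ec (q x) / (2 * pi * \<i> * q' x))"
  have abs_inverse: "\<bar>1 / q' x\<bar> \<le> 1 / l" if "x \<in> {a..b}" for x
  proof -
    have "l \<le> \<bar>q' x\<bar>" using large that by force
    thus ?thesis using l_pos by (simp add: frac_le)
  qed
  have "a \<in> {a..b}" "b \<in> {a..b}" using a_le_b by auto
  with large have "(0 < q' a \<and> 0 < q' b) \<or> (q' a < 0 \<and> q' b < 0)"
    using l_pos by (metis less_le_trans le_less_trans neg_less_0_iff_less)
  hence "(0 < 1 / q' a \<and> 0 < 1 / q' b) \<or> (1 / q' a < 0 \<and> 1 / q' b < 0)"
    by simp
  moreover have "\<bar>1 / q' a\<bar> \<le> 1 / l" "\<bar>1 / q' b\<bar> \<le> 1 / l"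
    using abs_inverse a_le_b by auto
  ultimately have inverse_diff: "1 / q' b - 1 / q' a \<le> 1 / l" by argo
  have norm_boundary: "norm (boundary x) \<le> 1 / l / (2 * pi)" if "x \<in> {a..b}" for x
    using divide_right_mono[OF abs_inverse[OF that], of "2 * pi"]
    by (simp add: boundary_def norm_divide norm_mult mult_ac)
  have "q' x \<noteq> 0" if "x \<in> {a..b}" for x
    using large l_pos that by force
  hence "norm (integral {a..b} (\<lambda>x. ec (q x)) - (boundary b - boundary a)) \<le> (1 / q' b - 1 / q' a) / (2 * pi)"
    unfolding boundary_def by (rule integral_ec_by_parts)
  also have "\<dots> \<le> 1 / l / (2 * pi)" using inverse_diff by (rule divide_right_mono) simp
  moreover have "norm (boundary a) \<le> 1 / l / (2 * pi)" "norm (boundary b) \<le> 1 / l / (2 * pi)"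
    using norm_boundary a_le_b by auto
  ultimately have "norm (integral {a..b} (\<lambda>x. ec (q x)))
      \<le> 1 / l / (2 * pi) + (1 / l / (2 * pi) + 1 / l / (2 * pi))"
    using norm_triangle_ineq4[of "boundary b" "boundary a"]
      norm_triangle_sub[of "integral {a..b} (\<lambda>x. ec (q x))" "boundary b - boundary a"] by linarith
  also have "\<dots> = (1 / l) * (3 / (2 * pi))" by (simp add: field_simps)
  also have "\<dots> \<le> 1 / l * 1" by (intro mult_left_mono) (use pi_gt3 l_pos in auto)
  finally show ?thesis by simp
qed

lemma deriv_diff_le:
  assumes curved: "\<And>x. x \<in> {a..b} \<Longrightarrow> q'' x \<le> - l" and order: "a \<le> x" "x \<le> y" "y \<le> b"
  shows "q' y - q' x \<le> - l * (y - x)"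
proof (cases "x = y")
  case False
  hence "x < y" using order by simp
  then obtain z where mvt: "x < z" "z < y" "q' y - q' x = (y - x) * q'' z"
    using MVT2[of x y q' q''] phase_deriv2 order by auto
  have "(y - x) * q'' z \<le> (y - x) * (- l)"
    using curved[of z] mvt order by (intro mult_left_mono) auto
  thus ?thesis using mvt by (simp add: algebra_simps)
qed simp

lemma first_derivative_test_subinterval:
  assumes "a \<le> s" "s \<le> t" "t \<le> b" "l > 0"
    and large: "s = t \<or> (\<forall>x\<in>{s..t}. l \<le> q' x) \<or> (\<forall>x\<in>{s..t}. q' x \<le> - l)"
  shows "norm (integral {s..t} (\<lambda>x. ec (q x))) \<le> 1 / l"
proof (cases "s = t")
  case False
  interpret subinterval: concave_phase q q' q'' s t by (rule concave_phase_subinterval[OF assms(1-3)])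
  show ?thesis using subinterval.first_derivative_test large False \<open>l > 0\<close> by simp
qed (use \<open>l > 0\<close> in simp)

lemma deriv_away_from_stationary_point:
  assumes curved: "\<And>x. x \<in> {a..b} \<Longrightarrow> q'' x \<le> - l" and "l > 0"
  obtains c where "c \<in> {a..b}" "\<And>x r. a \<le> x \<Longrightarrow> r > 0 \<Longrightarrow> x \<le> c - r \<Longrightarrow> l * r \<le> q' x"
    "\<And>x r. x \<le> b \<Longrightarrow> r > 0 \<Longrightarrow> c + r \<le> x \<Longrightarrow> q' x \<le> - (l * r)"
proof -
  consider "q' a \<le> 0" | "q' b \<ge> 0" | "q' b < 0" "0 < q' a" by linarith
  then obtain c where c_bounds: "a \<le> c" "c \<le> b" "c \<noteq> a \<Longrightarrow> 0 \<le> q' c" "c \<noteq> b \<Longrightarrow> q' c \<le> 0"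
  proof cases
    case 3
    then obtain c where "a \<le> c" "c \<le> b" "q' c = 0"
      using IVT2'[of q' b 0 a] a_le_b continuous_on_deriv by auto
    thus ?thesis using that by simp
  qed (use that[of a] that[of b] a_le_b in auto)
  show thesis
  proof (rule that[of c])
    fix x r :: real assume x_bounds: "a \<le> x" "r > 0" "x \<le> c - r"
    have "l * r \<le> l * (c - x)" using x_bounds \<open>l > 0\<close> by (intro mult_left_mono) auto
    thus "l * r \<le> q' x" using deriv_diff_le[OF curved, of x c] x_bounds c_bounds by auto
  next
    fix x r :: real assume x_bounds: "x \<le> b" "r > 0" "c + r \<le> x"
    have "l * r \<le> l * (x - c)" using x_bounds \<open>l > 0\<close> by (intro mult_left_mono) auto
    thus "q' x \<le> - (l * r)" using deriv_diff_le[OF curved, of c x] x_bounds c_bounds by auto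
  qed (use c_bounds in auto)
qed

text \<open>
  The phase has slope at least \<open>\<surd>l\<close> outside the interval of radius \<open>1 / \<surd>l\<close> around its stationary point.
\<close>
lemma second_derivative_test:
  assumes "l > 0" and curved: "\<And>x. x \<in> {a..b} \<Longrightarrow> q'' x \<le> - l"
  shows "norm (integral {a..b} (\<lambda>x. ec (q x))) \<le> 4 / sqrt l"
proof -
  obtain c where c_in: "c \<in> {a..b}"
    and left: "\<And>x r. a \<le> x \<Longrightarrow> r > 0 \<Longrightarrow> x \<le> c - r \<Longrightarrow> l * r \<le> q' x"
    and right: "\<And>x r. x \<le> b \<Longrightarrow> r > 0 \<Longrightarrow> c + r \<le> x \<Longrightarrow> q' x \<le> - (l * r)"
    using deriv_away_from_stationary_point[OF curved \<open>l > 0\<close>] by blast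
  define r where "r = 1 / sqrt l"
  define u where "u = max a (c - r)"
  define v where "v = min b (c + r)"
  define I where "I = (\<lambda>s t. integral {s..t} (\<lambda>x. ec (q x)))"
  have r_bounds: "r > 0" "l * r = sqrt l" using \<open>l > 0\<close> by (simp_all add: r_def real_div_sqrt)
  have order: "a \<le> u" "u \<le> c" "c \<le> v" "v \<le> b" using c_in r_bounds by (auto simp: u_def v_def)
  have "a = u \<or> (\<forall>x\<in>{a..u}. sqrt l \<le> q' x)"
    using left[OF _ r_bounds(1)] r_bounds(2) by (cases "a \<le> c - r") (auto simp: u_def)
  hence left_part: "norm (I a u) \<le> r"
    unfolding I_def r_def using order \<open>l > 0\<close> by (intro first_derivative_test_subinterval) auto
  have "v = b \<or> (\<forall>x\<in>{v..b}. q' x \<le> - sqrt l)"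
    using right[OF _ r_bounds(1)] r_bounds(2) by (cases "c + r \<le> b") (auto simp: v_def)
  hence right_part: "norm (I v b) \<le> r"
    unfolding I_def r_def using order \<open>l > 0\<close> by (intro first_derivative_test_subinterval) auto
  have "norm (I u v) \<le> v - u"
    unfolding I_def
    by (rule concave_phase.norm_integral_ec_le_length[OF concave_phase_subinterval]) (use order in auto)
  hence middle_part: "norm (I u v) \<le> 2 * r" by (auto simp: u_def v_def)
  have "norm (I a b) \<le> norm (I a u) + norm (I u v) + norm (I v b)"
    using norm_integral_three_pieces_le[OF integrable_ec_phase order(1) _ order(4), of 0] order(2,3)
    by (simp add: I_def)
  thus ?thesis using left_part middle_part right_part by (simp add: I_def r_def)
qed

end

section \<open>Truncated Poisson summation\<close>

lemma abel_summation_bound: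
  fixes z :: "nat \<Rightarrow> 'a::real_normed_vector" and w :: "nat \<Rightarrow> real"
  assumes partial_sums: "\<And>m. m \<le> n \<Longrightarrow> norm (\<Sum>i<m. z i) \<le> B"
    and decreasing: "\<And>i. Suc i < n \<Longrightarrow> w (Suc i) \<le> w i" and nonneg: "\<And>i. i < n \<Longrightarrow> 0 \<le> w i"
    and "0 < n"
  shows "norm (\<Sum>i<n. w i *\<^sub>R z i) \<le> w 0 * B"
proof -
  define S where "S = (\<lambda>m. \<Sum>i<m. z i)"
  have norm_S: "norm (S m) \<le> B" if "m \<le> n" for m
    using partial_sums[OF that] by (simp add: S_def)
  have by_parts: "(\<Sum>i<Suc k. w i *\<^sub>R z i) = w k *\<^sub>R S (Suc k) + (\<Sum>i<k. (w i - w (Suc i)) *\<^sub>R S (Suc i))" for k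
    by (induction k) (simp_all add: S_def algebra_simps)
  obtain k where n_eq: "n = Suc k" using \<open>0 < n\<close> gr0_implies_Suc by blast
  have "norm (\<Sum>i<n. w i *\<^sub>R z i) \<le> norm (w k *\<^sub>R S (Suc k)) + (\<Sum>i<k. norm ((w i - w (Suc i)) *\<^sub>R S (Suc i)))"
    unfolding n_eq by_parts by (intro order_trans[OF norm_triangle_ineq] add_left_mono norm_sum)
  also have "\<dots> \<le> w k * B + (\<Sum>i<k. (w i - w (Suc i)) * B)"
  proof (intro add_mono sum_mono)
    show "norm (w k *\<^sub>R S (Suc k)) \<le> w k * B"
      using norm_S[of "Suc k"] nonneg[of k] n_eq by (simp add: mult_left_mono)
    show "norm ((w i - w (Suc i)) *\<^sub>R S (Suc i)) \<le> (w i - w (Suc i)) * B" if "i \<in> {..<k}" for i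
      using norm_S[of "Suc i"] decreasing[of i] n_eq that by (simp add: mult_left_mono)
  qed
  also have "\<dots> = w 0 * B"
    by (simp only: sum_distrib_right[symmetric] sum_lessThan_telescope') (simp add: algebra_simps)
  finally show ?thesis .
qed

lemma abel_summation_bound_interval:
  fixes z :: "nat \<Rightarrow> 'a::real_normed_vector" and w :: "nat \<Rightarrow> real"
  assumes partial_sums: "\<And>r. p \<le> r \<Longrightarrow> r \<le> q \<Longrightarrow> norm (\<Sum>m\<in>{p..<r}. z m) \<le> B"
    and decreasing: "\<And>m. p \<le> m \<Longrightarrow> Suc m < q \<Longrightarrow> w (Suc m) \<le> w m"
    and nonneg: "\<And>m. p \<le> m \<Longrightarrow> m < q \<Longrightarrow> 0 \<le> w m" and "p < q"
  shows "norm (\<Sum>m\<in>{p..<q}. w m *\<^sub>R z m) \<le> w p * B"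
proof -
  have shift: "(\<Sum>m\<in>{p..<p+k}. f m) = (\<Sum>i<k. f (p + i))" for f :: "nat \<Rightarrow> 'a" and k
    using sum.shift_bounds_nat_ivl[of f 0 p k] by (simp add: lessThan_atLeast0 add.commute)
  have "norm (\<Sum>i<q-p. w (p + i) *\<^sub>R z (p + i)) \<le> w (p + 0) * B"
  proof (rule abel_summation_bound)
    show "norm (\<Sum>i<k. z (p + i)) \<le> B" if "k \<le> q - p" for k
      using partial_sums[of "p + k"] that \<open>p < q\<close> unfolding shift by simp
  qed (use decreasing nonneg \<open>p < q\<close> in auto)
  thus ?thesis using shift[of "\<lambda>m. w m *\<^sub>R z m" "q - p"] \<open>p < q\<close> by simp
qed

lemma jordan_sin_ge:
  fixes y :: real
  assumes "0 \<le> y" "y \<le> pi / 2"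
  shows "2 * y / pi \<le> sin y"
proof -
  have "concave_on {0..pi/2} sin"
    by (rule f''_le0_imp_concave[where f' = cos and f'' = "\<lambda>x. - sin x"])
       (auto intro!: derivative_eq_intros sin_ge_zero)
  from concave_onD_Icc[OF this, of "2 * y / pi"] show ?thesis
    using assms by (simp add: field_simps)
qed

lemma abs_sin_pi_ge:
  fixes x :: real
  assumes "\<bar>x\<bar> \<le> 1 / 2"
  shows "2 * \<bar>x\<bar> \<le> \<bar>sin (pi * x)\<bar>"
proof -
  have "2 * (pi * \<bar>x\<bar>) / pi \<le> sin (pi * \<bar>x\<bar>)"
    using assms by (intro jordan_sin_ge) auto
  moreover have "sin (pi * \<bar>x\<bar>) \<le> \<bar>sin (pi * x)\<bar>" by (cases "x \<ge> 0") auto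
  ultimately show ?thesis by simp
qed

definition dirichlet_kernel :: "nat \<Rightarrow> real \<Rightarrow> complex" where
  "dirichlet_kernel V x = (\<Sum>v\<in>{- int V..int V}. ec (of_int v * x))"

lemma sin_mult_dirichlet_kernel:
  "of_real (sin (pi * x)) * dirichlet_kernel V x = of_real (sin (real (2 * V + 1) * pi * x))"
proof (induction V)
  case 0
  show ?case by (simp add: dirichlet_kernel_def)
next
  case (Suc V)
  have "{- int (Suc V)..int (Suc V)} = insert (- int (Suc V)) (insert (int (Suc V)) {- int V..int V})" by auto
  hence "dirichlet_kernel (Suc V) x = dirichlet_kernel V x
      + (ec (- (real (Suc V) * x)) + ec (real (Suc V) * x))"
    by (simp add: dirichlet_kernel_def algebra_simps)
  also have "ec (- (real (Suc V) * x)) + ec (real (Suc V) * x)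
      = of_real (2 * cos (2 * pi * (real (Suc V) * x)))"
    by (simp add: ec_def complex_eq_iff)
  finally have "of_real (sin (pi * x)) * dirichlet_kernel (Suc V) x
      = of_real (sin (real (2 * V + 1) * pi * x) + 2 * (sin (pi * x) * cos (2 * pi * (real (Suc V) * x))))"
    by (simp only: distrib_left Suc.IH) (simp add: algebra_simps)
  also have "2 * (sin (pi * x) * cos (2 * pi * (real (Suc V) * x)))
      = sin (real (2 * Suc V + 1) * pi * x) - sin (real (2 * V + 1) * pi * x)"
  proof -
    have angles: "real (2 * Suc V + 1) * pi * x = 2 * pi * (real (Suc V) * x) + pi * x"
      "real (2 * V + 1) * pi * x = 2 * pi * (real (Suc V) * x) - pi * x"
      by (simp_all add: algebra_simps)
    show ?thesis unfolding angles sin_add sin_diff by simp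
  qed
  finally show ?case by simp
qed

lemma abs_mult_norm_dirichlet_kernel_le:
  assumes "\<bar>x\<bar> \<le> 1 / 2"
  shows "\<bar>x\<bar> * norm (dirichlet_kernel V x) \<le> 1"
proof -
  have "\<bar>x\<bar> * norm (dirichlet_kernel V x) \<le> \<bar>sin (pi * x)\<bar> * norm (dirichlet_kernel V x)"
    using abs_sin_pi_ge[OF assms] by (intro mult_right_mono) auto
  also have "\<dots> = norm (of_real (sin (pi * x)) * dirichlet_kernel V x)" by (simp add: norm_mult)
  also have "\<dots> \<le> 1" by (simp add: sin_mult_dirichlet_kernel)
  finally show ?thesis .
qed

lemma continuous_on_dirichlet_kernel [continuous_intros]: "continuous_on S (dirichlet_kernel V)"
  unfolding dirichlet_kernel_def[abs_def] by (intro continuous_intros)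

lemma dirichlet_kernel_add_of_int: "dirichlet_kernel V (x + of_int n) = dirichlet_kernel V x"
proof -
  have "ec (of_int v * (x + of_int n)) = ec (of_int v * x)" for v
    using ec_of_int[of "v * n"] by (simp add: distrib_left ec_add)
  thus ?thesis by (simp add: dirichlet_kernel_def)
qed

lemma ec_mult_has_integral:
  assumes "y \<noteq> 0" "a \<le> b"
  shows "((\<lambda>x. ec (x * y)) has_integral (ec (b * y) - ec (a * y)) / (2 * pi * \<i> * y)) {a..b}"
proof -
  have "((\<lambda>x. ec (x * y) / (2 * pi * \<i> * y))
      has_vector_derivative 2 * pi * \<i> * y * ec (x * y) / (2 * pi * \<i> * y))
      (at x within {a..b})" for x
    by (intro has_vector_derivative_divide ec_has_vector_derivative) (auto intro!: derivative_eq_intros)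
  hence "((\<lambda>x. ec (x * y)) has_integral ec (b * y) / (2 * pi * \<i> * y) - ec (a * y) / (2 * pi * \<i> * y)) {a..b}"
    using assms by (intro fundamental_theorem_of_calculus) auto
  thus ?thesis by (simp only: diff_divide_distrib)
qed

lemma integral_ec_int_multiple:
  "((\<lambda>x. ec (of_int v * x)) has_integral (if v = 0 then 1 else 0)) {-1/2..1/2}"
proof (cases "v = 0")
  case True
  thus ?thesis using has_integral_const_real[of "1::complex" "-1/2" "1/2"] by simp
next
  case False
  have "ec (1/2 * of_int v) = ec (of_int v + -1/2 * of_int v)" by (simp add: algebra_simps)
  hence "ec (1/2 * of_int v) = ec (-1/2 * of_int v)" by (simp only: ec_add ec_of_int mult_1)
  thus ?thesis using False ec_mult_has_integral[of "of_int v" "-1/2" "1/2"] by (simp add: mult.commute)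
qed

lemma dirichlet_kernel_has_integral: "(dirichlet_kernel V has_integral 1) {-1/2..1/2}"
proof -
  have "((\<lambda>x. \<Sum>v\<in>{- int V..int V}. ec (of_int v * x)) has_integral
      (\<Sum>v\<in>{- int V..int V}. if v = 0 then 1 else 0)) {-1/2..1/2}"
    by (intro has_integral_sum integral_ec_int_multiple) auto
  thus ?thesis by (simp add: dirichlet_kernel_def[abs_def])
qed

lemma norm_integral_mult_sin_le:
  fixes H H' :: "real \<Rightarrow> complex"
  assumes "a \<le> b"
    and H_deriv: "\<And>x. x \<in> {a..b} \<Longrightarrow> (H has_vector_derivative H' x) (at x within {a..b})"
    and H'_continuous: "continuous_on {a..b} H'" and w_pos: "w > 0"
  shows "norm (integral {a..b} (\<lambda>x. H x * of_real (sin (w * x))))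
    \<le> (norm (H a) + norm (H b) + integral {a..b} (\<lambda>x. norm (H' x))) / w"
proof -
  have continuous_H: "continuous_on {a..b} H"
    using H_deriv has_vector_derivative_continuous continuous_on_eq_continuous_within by blast
  define S where "S = (\<lambda>x. complex_of_real (- cos (w * x) / w))"
  have norm_mult_S: "norm (z * S x) \<le> norm z / w" for z x
    using w_pos by (simp add: S_def norm_mult norm_divide divide_right_mono mult_left_le)
  have "((\<lambda>x. H x * of_real (sin (w * x)) + H' x * S x) has_integral (H b * S b - H a * S a)) {a..b}"
  proof (rule fundamental_theorem_of_calculus[OF \<open>a \<le> b\<close>])
    fix x assume x_in: "x \<in> {a..b}"
    have "((\<lambda>x. - cos (w * x) / w) has_real_derivative sin (w * x)) (at x within {a..b})"
      using w_pos by (auto intro!: derivative_eq_intros)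
    thus "((\<lambda>x. H x * S x)
        has_vector_derivative (H x * of_real (sin (w * x)) + H' x * S x)) (at x within {a..b})"
      unfolding S_def by (intro has_vector_derivative_mult H_deriv x_in has_vector_derivative_of_real)
  qed
  moreover have integrable: "(\<lambda>x. H' x * S x) integrable_on {a..b}" "(\<lambda>x. norm (H' x) / w) integrable_on {a..b}"
    unfolding S_def using w_pos by (auto intro!: integrable_continuous_real continuous_intros H'_continuous)
  ultimately have "integral {a..b} (\<lambda>x. H x * of_real (sin (w * x)))
      = H b * S b - H a * S a - integral {a..b} (\<lambda>x. H' x * S x)"
    using has_integral_diff[OF _ integrable_integral[OF integrable(1)]] by (intro integral_unique) fastforce
  hence "norm (integral {a..b} (\<lambda>x. H x * of_real (sin (w * x))))
      \<le> norm (H b * S b) + norm (H a * S a) + norm (integral {a..b} (\<lambda>x. H' x * S x))"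
    using norm_triangle_ineq4[of "H b * S b - H a * S a" "integral {a..b} (\<lambda>x. H' x * S x)"]
      norm_triangle_ineq4[of "H b * S b" "H a * S a"] by simp
  also have "\<dots> \<le> norm (H b) / w + norm (H a) / w + integral {a..b} (\<lambda>x. norm (H' x) / w)"
    using norm_mult_S by (intro add_mono integral_norm_bound_integral integrable) auto
  also have "\<dots> = (norm (H a) + norm (H b) + integral {a..b} (\<lambda>x. norm (H' x))) / w"
    by (simp add: add_divide_distrib)
  finally show ?thesis .
qed

lemma dirichlet_kernel_integral_tendsto_0_away:
  fixes F F' :: "real \<Rightarrow> complex"
  assumes "c \<le> d" and away: "{c..d} \<subseteq> {-1/2..1/2}" "0 \<notin> {c..d}"
    and F_deriv: "\<And>x. x \<in> {c..d} \<Longrightarrow> (F has_vector_derivative F' x) (at x within {c..d})"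
    and F'_continuous: "continuous_on {c..d} F'"
  shows "(\<lambda>V. integral {c..d} (\<lambda>x. F x * dirichlet_kernel V x)) \<longlonglongrightarrow> 0"
proof -
  have sin_nonzero: "sin (pi * x) \<noteq> 0" if "x \<in> {c..d}" for x
    using abs_sin_pi_ge[of x] that away by force
  have continuous_F: "continuous_on {c..d} F"
    using F_deriv has_vector_derivative_continuous continuous_on_eq_continuous_within by blast
  define H where "H = (\<lambda>x. F x * of_real (1 / sin (pi * x)))"
  define H'
    where "H' = (\<lambda>x. F x * of_real (- (pi * cos (pi * x)) / (sin (pi * x))\<^sup>2)
        + F' x * of_real (1 / sin (pi * x)))"
  define C where "C = norm (H c) + norm (H d) + integral {c..d} (\<lambda>x. norm (H' x))"
  have "norm (integral {c..d} (\<lambda>x. H x * of_real (sin (w * x)))) \<le> C / w" if "w > 0" for w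
    unfolding C_def
  proof (rule norm_integral_mult_sin_le[OF \<open>c \<le> d\<close> _ _ that])
    fix x assume x_in: "x \<in> {c..d}"
    have "((\<lambda>x. 1 / sin (pi * x))
        has_real_derivative (- (pi * cos (pi * x)) / (sin (pi * x))\<^sup>2)) (at x within {c..d})"
      using sin_nonzero[OF x_in] by (auto intro!: derivative_eq_intros simp: power2_eq_square)
    thus "(H has_vector_derivative H' x) (at x within {c..d})"
      unfolding H_def H'_def by (intro has_vector_derivative_mult F_deriv x_in has_vector_derivative_of_real)
  next
    show "continuous_on {c..d} H'"
      unfolding H'_def using sin_nonzero by (intro continuous_intros continuous_F F'_continuous) auto
  qed
  moreover have "F x * dirichlet_kernel V x = H x * of_real (sin (real (2 * V + 1) * pi * x))"
    if "x \<in> {c..d}" for x V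
    unfolding H_def sin_mult_dirichlet_kernel[symmetric] using sin_nonzero[OF that] by simp
  hence "integral {c..d} (\<lambda>x. F x * dirichlet_kernel V x)
      = integral {c..d} (\<lambda>x. H x * of_real (sin (real (2 * V + 1) * pi * x)))" for V
    by (intro integral_cong)
  ultimately have "norm (integral {c..d} (\<lambda>x. F x * dirichlet_kernel V x)) \<le> C / (real (2 * V + 1) * pi)" for V
    by simp
  hence "\<forall>V. norm (integral {c..d} (\<lambda>x. F x * dirichlet_kernel V x)) \<le> C / (real (2 * V + 1) * pi)" ..
  moreover have "(\<lambda>V. C / (real (2 * V + 1) * pi)) \<longlonglongrightarrow> 0"
    by real_asymp
  ultimately show ?thesis by (rule Lim_null_comparison[OF always_eventually])
qed

lemma dirichlet_kernel_integral_near_0_le: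
  fixes F :: "real \<Rightarrow> complex"
  assumes "0 \<le> r" "r \<le> 1/2" "continuous_on {-r..r} F"
    and lipschitz_at_0: "\<And>x. x \<in> {-r..r} \<Longrightarrow> norm (F x) \<le> B * \<bar>x\<bar>" and "0 \<le> B"
  shows "norm (integral {-r..r} (\<lambda>x. F x * dirichlet_kernel V x)) \<le> 2 * r * B"
proof -
  have "norm (F x * dirichlet_kernel V x) \<le> B" if "x \<in> {-r..r}" for x
  proof -
    have "norm (F x * dirichlet_kernel V x) \<le> B * \<bar>x\<bar> * norm (dirichlet_kernel V x)"
      using lipschitz_at_0[OF that] by (simp add: norm_mult mult_right_mono)
    also have "\<dots> \<le> B * 1"
      unfolding mult.assoc
      using abs_mult_norm_dirichlet_kernel_le[of x V] that assms by (intro mult_left_mono) auto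
    finally show ?thesis by simp
  qed
  hence "norm (integral {-r..r} (\<lambda>x. F x * dirichlet_kernel V x)) \<le> integral {-r..r} (\<lambda>x. B)"
    using assms
    by (intro integral_norm_bound_integral) (auto intro!: integrable_continuous_real continuous_intros)
  thus ?thesis using assms by simp
qed

lemma dirichlet_kernel_integral_tendsto_0:
  fixes F F' :: "real \<Rightarrow> complex"
  assumes F_deriv: "\<And>x. x \<in> {-1/2..1/2} \<Longrightarrow> (F has_vector_derivative F' x) (at x within {-1/2..1/2})"
    and F'_continuous: "continuous_on {-1/2..1/2} F'"
    and lipschitz_at_0: "\<And>x. x \<in> {-1/2..1/2} \<Longrightarrow> norm (F x) \<le> B * \<bar>x\<bar>" and B_pos: "B > 0"
  shows "(\<lambda>V. integral {-1/2..1/2} (\<lambda>x. F x * dirichlet_kernel V x)) \<longlonglongrightarrow> 0"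
proof (rule LIMSEQ_I)
  fix e :: real assume e_pos: "e > 0"
  define I where "I = (\<lambda>V c d. integral {c..d} (\<lambda>x. F x * dirichlet_kernel V x))"
  define r where "r = min (1/4) (e / (8 * B))"
  have r_bounds: "0 < r" "r < 1/2" using e_pos B_pos by (auto simp: r_def)
  have "r * B \<le> e / (8 * B) * B" using B_pos by (intro mult_right_mono) (auto simp: r_def)
  hence rB_le: "2 * r * B \<le> e / 4" using B_pos by simp
  have continuous_F: "continuous_on {-1/2..1/2} F"
    using F_deriv has_vector_derivative_continuous continuous_on_eq_continuous_within by blast
  hence integrable: "(\<lambda>x. F x * dirichlet_kernel V x) integrable_on {-1/2..1/2}" for V
    by (intro integrable_continuous_real continuous_intros)
  have pieces: "norm (I V (-1/2) (1/2)) \<le> norm (I V (-1/2) (-r)) + norm (I V (-r) r) + norm (I V r (1/2))" for V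
    using norm_integral_three_pieces_le[OF integrable[of V], of "-r" r 0] r_bounds by (simp add: I_def)
  have "norm (I V (-r) r) \<le> 2 * r * B" for V
    unfolding I_def using r_bounds B_pos lipschitz_at_0
    by (intro dirichlet_kernel_integral_near_0_le continuous_on_subset[OF continuous_F]) auto
  hence middle: "norm (I V (-r) r) \<le> e / 4" for V using rB_le order_trans by blast
  have "(\<lambda>V. I V (-1/2) (-r)) \<longlonglongrightarrow> 0" "(\<lambda>V. I V r (1/2)) \<longlonglongrightarrow> 0"
    unfolding I_def
    by (rule dirichlet_kernel_integral_tendsto_0_away[where F' = F'];
        use r_bounds in \<open>auto intro: has_vector_derivative_within_subset[OF F_deriv]
          continuous_on_subset[OF F'_continuous]\<close>)+
  hence "\<forall>\<^sub>F V in sequentially. norm (I V (-1/2) (-r)) < e / 4"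
    "\<forall>\<^sub>F V in sequentially. norm (I V r (1/2)) < e / 4"
    using e_pos by (auto simp: tendsto_iff dest!: spec[of _ "e / 4"])
  hence "\<forall>\<^sub>F V in sequentially. norm (I V (-1/2) (1/2)) < e"
  proof eventually_elim
    case (elim V)
    thus ?case using pieces[of V] middle[of V] e_pos by linarith
  qed
  thus "\<exists>no. \<forall>V\<ge>no. norm (integral {-1/2..1/2} (\<lambda>x. F x * dirichlet_kernel V x) - 0) < e"
    by (simp add: eventually_sequentially I_def)
qed

lemma dirichlet_kernel_integral_tendsto:
  fixes F F' :: "real \<Rightarrow> complex"
  assumes F_deriv: "\<And>x. x \<in> {-1/2..1/2} \<Longrightarrow> (F has_vector_derivative F' x) (at x within {-1/2..1/2})"
    and F'_continuous: "continuous_on {-1/2..1/2} F'"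
  shows "(\<lambda>V. integral {-1/2..1/2} (\<lambda>x. F x * dirichlet_kernel V x)) \<longlonglongrightarrow> F 0"
proof -
  obtain B where F'_bound: "\<And>x. x \<in> {-1/2..1/2} \<Longrightarrow> norm (F' x) \<le> B" "B > 0"
    using compact_imp_bounded[OF compact_continuous_image[OF F'_continuous]] bounded_pos
    by (metis compact_Icc image_eqI)
  have "norm (F x - F 0) \<le> B * norm (x - 0)" if "x \<in> {-1/2..1/2}" for x
  proof (rule differentiable_bound[of "{-1/2..1/2}" F "\<lambda>x h. h *\<^sub>R F' x" B])
    show "onorm (\<lambda>h. h *\<^sub>R F' y) \<le> B" if "y \<in> {-1/2..1/2}" for y
      by (intro onorm_le) (simp add: F'_bound(1)[OF that] mult.commute[of B] mult_left_mono)
  qed (use F_deriv that in \<open>auto simp: has_vector_derivative_def\<close>)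
  hence limit: "(\<lambda>V. integral {-1/2..1/2} (\<lambda>x. (F x - F 0) * dirichlet_kernel V x)) \<longlonglongrightarrow> 0"
    using F'_bound F_deriv F'_continuous
    by (intro dirichlet_kernel_integral_tendsto_0[where F' = F' and B = B])
      (auto intro!: derivative_eq_intros)
  have continuous_F: "continuous_on {-1/2..1/2} F"
    using F_deriv has_vector_derivative_continuous continuous_on_eq_continuous_within by blast
  have "integral {-1/2..1/2} (\<lambda>x. F x * dirichlet_kernel V x)
      = integral {-1/2..1/2} (\<lambda>x. (F x - F 0) * dirichlet_kernel V x) + F 0" for V
  proof -
    have "((\<lambda>x. (F x - F 0) * dirichlet_kernel V x + F 0 * dirichlet_kernel V x) has_integral
        integral {-1/2..1/2} (\<lambda>x. (F x - F 0) * dirichlet_kernel V x) + F 0 * 1) {-1/2..1/2}"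
      by (intro has_integral_add has_integral_mult_right dirichlet_kernel_has_integral integrable_integral
          integrable_continuous_real continuous_intros continuous_F)
    thus ?thesis by (simp add: integral_unique left_diff_distrib)
  qed
  thus ?thesis using tendsto_add[OF limit tendsto_const[of "F 0"]] by simp
qed

lemma dirichlet_kernel_integral_tendsto_shifted:
  fixes F F' :: "real \<Rightarrow> complex" and n :: int
  assumes F_deriv: "\<And>x. x \<in> {of_int n - 1/2..of_int n + 1/2} \<Longrightarrow> (F has_vector_derivative F' x) (at x)"
    and F'_continuous: "continuous_on {of_int n - 1/2..of_int n + 1/2} F'"
  shows "(\<lambda>V. integral {of_int n - 1/2..of_int n + 1/2} (\<lambda>x. F x * dirichlet_kernel V x)) \<longlonglongrightarrow> F (of_int n)"
proof -
  have "integral {-1/2..1/2} (\<lambda>x. F (x + of_int n) * dirichlet_kernel V x)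
      = integral {of_int n - 1/2..of_int n + 1/2} (\<lambda>x. F x * dirichlet_kernel V x)" for V
    using integral_shift_real_ivl[of "of_int n - 1/2" "of_int n" "of_int n + 1/2"
      "\<lambda>x. F x * dirichlet_kernel V x"]
    by (simp add: dirichlet_kernel_add_of_int)
  moreover have "(\<lambda>V. integral {-1/2..1/2} (\<lambda>x. F (x + of_int n) * dirichlet_kernel V x)) \<longlonglongrightarrow> F (0 + of_int n)"
  proof (rule dirichlet_kernel_integral_tendsto[where F' = "\<lambda>x. F' (x + of_int n)"])
    fix x :: real assume "x \<in> {-1/2..1/2}"
    hence "((F \<circ> (\<lambda>x. x + of_int n)) has_vector_derivative (1 *\<^sub>R F' (x + of_int n))) (at x)"
      by (intro vector_diff_chain_at F_deriv) (auto intro!: derivative_eq_intros)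
    thus "((\<lambda>x. F (x + of_int n)) has_vector_derivative F' (x + of_int n)) (at x within {-1/2..1/2})"
      by (simp add: o_def has_vector_derivative_at_within)
  next
    show "continuous_on {-1/2..1/2} (\<lambda>x. F' (x + of_int n))"
      by (rule continuous_on_compose2[OF F'_continuous]) (auto intro!: continuous_intros)
  qed
  ultimately show ?thesis by simp
qed

lemma dirichlet_kernel_integral_tendsto_sum:
  fixes F F' :: "real \<Rightarrow> complex" and A B :: nat
  assumes "A \<le> B"
    and F_deriv: "\<And>x. x \<in> {real A - 1/2..real B - 1/2} \<Longrightarrow> (F has_vector_derivative F' x) (at x)"
    and F'_continuous: "continuous_on {real A - 1/2..real B - 1/2} F'"
  shows "(\<lambda>V. integral {real A - 1/2..real B - 1/2} (\<lambda>x. F x * dirichlet_kernel V x))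
    \<longlonglongrightarrow> (\<Sum>n\<in>{A..<B}. F (real n))"
  using assms
proof (induction B rule: dec_induct)
  case base
  show ?case by simp
next
  case (step n)
  have "continuous_on {real A - 1/2..real (Suc n) - 1/2} F"
    by (intro continuous_at_imp_continuous_on ballI has_vector_derivative_continuous[OF step.prems(1)])
  hence split: "integral {real A - 1/2..real (Suc n) - 1/2} (\<lambda>x. F x * dirichlet_kernel V x)
      = integral {real A - 1/2..real n - 1/2} (\<lambda>x. F x * dirichlet_kernel V x)
        + integral {real n - 1/2..real n + 1/2} (\<lambda>x. F x * dirichlet_kernel V x)" for V
    using step.hyps Henstock_Kurzweil_Integration.integral_combine[of "real A - 1/2" "real n - 1/2"
      "real (Suc n) - 1/2"
        "\<lambda>x. F x * dirichlet_kernel V x"]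
    by (simp add: integrable_continuous_real continuous_intros add.commute)
  have "(\<lambda>V. integral {real A - 1/2..real n - 1/2} (\<lambda>x. F x * dirichlet_kernel V x)) \<longlonglongrightarrow> (\<Sum>n\<in>{A..<n}. F (real n))"
    by (rule step.IH[OF step.prems(1) continuous_on_subset[OF step.prems(2)]]) auto
  moreover have "(\<lambda>V. integral {real n - 1/2..real n + 1/2} (\<lambda>x. F x * dirichlet_kernel V x)) \<longlonglongrightarrow> F (real n)"
    using dirichlet_kernel_integral_tendsto_shifted[of "int n" F F'] step.hyps step.prems(1)
      continuous_on_subset[OF step.prems(2), of "{real n - 1/2..real n + 1/2}"] by auto
  ultimately show ?case unfolding split using tendsto_add step.hyps by fastforce
qed

lemma norm_alternating_harmonic_sum_le:
  fixes t :: real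
  assumes "1 \<le> t"
  shows "norm (\<Sum>j<J. of_real (1 / (t + real j)) * (-1::complex) ^ j) \<le> 1"
proof (cases "J = 0")
  case False
  have "(\<Sum>i<m. (-1::complex) ^ i) = (if even m then 0 else 1)" for m by (induction m) auto
  hence "norm (\<Sum>j<J. (1 / (t + real j)) *\<^sub>R (-1::complex) ^ j) \<le> 1 / (t + real 0) * 1"
    using assms False by (intro abel_summation_bound) (auto simp: frac_le)
  also have "\<dots> \<le> 1" using assms by simp
  finally show ?thesis by (simp add: scaleR_conv_of_real)
qed simp

lemma sum_recip_diff_le_harm:
  fixes s t :: real
  assumes "1 \<le> s" "s \<le> t" "t \<le> s + real n"
  shows "(\<Sum>j<J. 1 / (s + real j) - 1 / (t + real j)) \<le> harm n"
proof -
  have "(\<Sum>j<J. 1 / (s + real j) - 1 / (t + real j)) \<le> (\<Sum>j<J. 1 / (1 + real j) - 1 / (1 + real n + real j))"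
  proof (rule sum_mono)
    fix j
    have "1 / (s + real j) - 1 / (t + real j) = (1 / (s + real j)) * ((t - s) / (t + real j))"
      using assms by (simp add: field_simps)
    also have "\<dots> \<le> (1 / (1 + real j)) * (real n / (1 + real n + real j))"
    proof (rule mult_mono)
      have "(t - s) * (1 + real j) \<le> real n * (s + real j)"
        using assms by (intro mult_mono) auto
      hence "(t - s) * (1 + real n + real j) \<le> real n * (t + real j)"
        by (simp add: algebra_simps)
      thus "(t - s) / (t + real j) \<le> real n / (1 + real n + real j)"
        using assms by (simp add: divide_simps)
    qed (use assms in \<open>auto simp: frac_le\<close>)
    also have "\<dots> = 1 / (1 + real j) - 1 / (1 + real n + real j)"
      by (simp add: field_simps)
    finally show "1 / (s + real j) - 1 / (t + real j) \<le> 1 / (1 + real j) - 1 / (1 + real n + real j)" .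
  qed
  also have "\<dots> = harm J - harm (n + J) + harm n"
    by (induction J) (simp_all add: harm_Suc harm_expand(1) inverse_eq_divide algebra_simps)
  also have "\<dots> \<le> harm n" using harm_mono[of J "n + J"] by simp
  finally show ?thesis .
qed

lemma sum_recip_slope_diff_le_harm:
  fixes p \<sigma> :: int and u v :: real
  assumes \<sigma>_sign: "\<sigma> = 1 \<or> \<sigma> = -1" and far: "1 \<le> of_int \<sigma> * (of_int p - u)" "1 \<le> of_int \<sigma> * (of_int p - v)"
    and uv_bounds: "u \<le> v" "v - u \<le> real n"
  shows "(\<Sum>j<J. 1 / (u - of_int (p + \<sigma> * int j)) - 1 / (v - of_int (p + \<sigma> * int j))) \<le> harm n"
  using \<sigma>_sign
proof
  assume \<sigma>_sign: "\<sigma> = 1"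
  have "1 / (u - of_int (p + \<sigma> * int j)) - 1 / (v - of_int (p + \<sigma> * int j))
      = 1 / ((p - v) + real j) - 1 / ((p - u) + real j)" for j
    using \<sigma>_sign far by (simp add: field_simps)
  thus ?thesis using sum_recip_diff_le_harm[of "p - v" "p - u" n J] \<sigma>_sign far uv_bounds by simp
next
  assume \<sigma>_sign: "\<sigma> = -1"
  have "1 / (u - of_int (p + \<sigma> * int j)) - 1 / (v - of_int (p + \<sigma> * int j))
      = 1 / ((u - p) + real j) - 1 / ((v - p) + real j)" for j
    using \<sigma>_sign by (simp add: algebra_simps)
  thus ?thesis using sum_recip_diff_le_harm[of "u - p" "v - p" n J] \<sigma>_sign far uv_bounds by simp
qed

lemma ec_half_integer: "ec (real n - 1/2) = -1" "ec (- (real n - 1/2)) = -1"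
proof -
  have "ec (1/2) = -1" by (simp add: ec_def)
  thus "ec (real n - 1/2) = -1" "ec (- (real n - 1/2)) = -1"
    using ec_of_int[of "int n"] by (simp_all only: ec_minus) (simp_all add: ec_diff)
qed

text \<open>At a half-integer the factors \<open>ec (- m x)\<close> alternate in sign as \<open>m\<close> runs through the integers.\<close>
lemma half_integer_boundary_sum_le:
  fixes p \<sigma> :: int and x_eq slope :: real
  assumes \<sigma>_sign: "\<sigma> = 1 \<or> \<sigma> = -1" and x_eq: "x = real n - 1/2" and far: "1 \<le> of_int \<sigma> * (of_int p - slope)"
  shows "norm (\<Sum>j<J. ec (\<theta> - of_int (p + \<sigma> * int j) * x)
      / (2 * pi * \<i> * of_real (slope - of_int (p + \<sigma> * int j))))
    \<le> 1 / (2 * pi)"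
proof -
  define s where "s = of_int \<sigma> * (of_int p - slope)"
  have "ec (\<theta> - of_int (p + \<sigma> * int j) * x) / (2 * pi * \<i> * of_real (slope - of_int (p + \<sigma> * int j)))
      = (ec (\<theta> - of_int p * x) * (- of_int \<sigma>) / (2 * pi * \<i>)) * (of_real (1 / (s + real j)) * (-1) ^ j)" for j
  proof -
    have "\<theta> - of_int (p + \<sigma> * int j) * x = (\<theta> - of_int p * x) + of_nat j * (- of_int \<sigma> * x)"
      by (simp add: algebra_simps)
    moreover have "ec (- of_int \<sigma> * x) = -1"
      using \<sigma>_sign by (elim disjE) (simp_all only: x_eq, simp_all add: ec_half_integer[simplified])
    ultimately have "ec (\<theta> - of_int (p + \<sigma> * int j) * x) = ec (\<theta> - of_int p * x) * (-1) ^ j"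
      by (simp only: ec_add ec_mult_of_nat)
    moreover have "slope - of_int (p + \<sigma> * int j) = - of_int \<sigma> * (s + real j)"
      using \<sigma>_sign by (auto simp: s_def algebra_simps)
    ultimately show ?thesis
      by (simp only: of_real_mult of_real_minus of_real_of_int_eq) (use \<sigma>_sign in \<open>auto simp: mult_ac\<close>)
  qed
  hence "norm (\<Sum>j<J. ec (\<theta> - of_int (p + \<sigma> * int j) * x)
      / (2 * pi * \<i> * of_real (slope - of_int (p + \<sigma> * int j))))
      = 1 / (2 * pi) * norm (\<Sum>j<J. of_real (1 / (s + real j)) * (-1::complex) ^ j)"
    using \<sigma>_sign by (auto simp only: sum_distrib_left[symmetric] norm_mult norm_divide) (auto simp: norm_mult)
  also have "\<dots> \<le> 1 / (2 * pi) * 1"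
    using far by (intro mult_left_mono norm_alternating_harmonic_sum_le) (auto simp: s_def)
  finally show ?thesis by simp
qed

locale half_integer_phase = concave_phase g g' g'' "real A - 1/2" "real B - 1/2"
  for g g' g'' :: "real \<Rightarrow> real" and A B :: nat
begin

definition poisson_term :: "int \<Rightarrow> complex" where
  "poisson_term m = integral {real A - 1/2..real B - 1/2} (\<lambda>x. ec (g x - of_int m * x))"

lemma A_le_B: "A \<le> B"
  using a_le_b by simp

lemma norm_sum_poisson_terms_le:
  fixes p \<sigma> :: int
  assumes \<sigma>_sign: "\<sigma> = 1 \<or> \<sigma> = -1"
    and far: "\<And>x. x \<in> {real A - 1/2..real B - 1/2} \<Longrightarrow> 1 \<le> of_int \<sigma> * (of_int p - g' x)"
    and slope_diff_le: "g' (real A - 1/2) - g' (real B - 1/2) \<le> real n"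
  shows "norm (\<Sum>j<J. poisson_term (p + \<sigma> * int j)) \<le> 1 + harm n"
proof -
  define a where "a = real A - 1/2"
  define b where "b = real B - 1/2"
  have endpoints_in: "a \<in> {a..b}" "b \<in> {a..b}" using A_le_B by (auto simp: a_def b_def)
  define v where "v = (\<lambda>j. real_of_int (p + \<sigma> * int j))"
  define E where "E = (\<lambda>x j. ec (g x - v j * x) / (2 * pi * \<i> * of_real (g' x - v j)))"
  have remainder: "norm (poisson_term (p + \<sigma> * int j) - (E b j - E a j))
      \<le> (1 / (g' b - v j) - 1 / (g' a - v j)) / (2 * pi)" for j
  proof -
    have "g' x - v j \<noteq> 0" if "x \<in> {a..b}" for x
      using far[of x] that \<sigma>_sign by (auto simp: v_def a_def b_def)
    from concave_phase.integral_ec_by_parts[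
      OF concave_phase_minus_linear[of "v j"], folded a_def b_def, OF this]
    show ?thesis by (simp only: poisson_term_def E_def v_def a_def b_def)
  qed
  have remainders: "(\<Sum>j<J. 1 / (g' b - v j) - 1 / (g' a - v j)) \<le> harm n"
    unfolding v_def using deriv_antimono[of a b] far endpoints_in slope_diff_le
    by (intro sum_recip_slope_diff_le_harm[OF \<sigma>_sign]) (auto simp: a_def b_def)
  have boundary: "norm (\<Sum>j<J. E a j) \<le> 1 / (2 * pi)" "norm (\<Sum>j<J. E b j) \<le> 1 / (2 * pi)"
    unfolding E_def v_def
    by (rule half_integer_boundary_sum_le[OF \<sigma>_sign]; use far endpoints_in in \<open>simp add: a_def b_def\<close>)+
  have "norm (\<Sum>j<J. poisson_term (p + \<sigma> * int j) - (E b j - E a j))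
      \<le> (\<Sum>j<J. (1 / (g' b - v j) - 1 / (g' a - v j)) / (2 * pi))"
    by (intro sum_norm_le remainder)
  also have "\<dots> \<le> harm n / (2 * pi)"
    unfolding sum_divide_distrib[symmetric] by (intro divide_right_mono remainders) simp
  also have "(\<Sum>j<J. poisson_term (p + \<sigma> * int j) - (E b j - E a j))
      = (\<Sum>j<J. poisson_term (p + \<sigma> * int j)) - ((\<Sum>j<J. E b j) - (\<Sum>j<J. E a j))"
    by (simp add: sum_subtractf)
  finally have "norm (\<Sum>j<J. poisson_term (p + \<sigma> * int j)) \<le> (2 + harm n) / (2 * pi)"
    using boundary norm_triangle_ineq4[of "\<Sum>j<J. E b j" "\<Sum>j<J. E a j"]
      norm_triangle_sub[of "\<Sum>j<J. poisson_term (p + \<sigma> * int j)" "(\<Sum>j<J. E b j) - (\<Sum>j<J. E a j)"]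
    by (simp add: add_divide_distrib)
  also have "\<dots> \<le> (2 + harm n) / 2"
    using pi_gt3 harm_nonneg[of n, where 'a = real] by (intro divide_left_mono) auto
  also have "\<dots> \<le> 1 + harm n" using harm_nonneg[of n, where 'a = real] by simp
  finally show ?thesis .
qed

lemma sum_poisson_terms_tendsto:
  "(\<lambda>V. \<Sum>m\<in>{- int V..int V}. poisson_term m) \<longlonglongrightarrow> (\<Sum>n\<in>{A..<B}. ec (g (real n)))"
proof -
  let ?I = "{real A - 1/2..real B - 1/2}"
  have "integral ?I (\<lambda>x. ec (g x) * dirichlet_kernel V x) = (\<Sum>m\<in>{- int V..int V}. poisson_term m)" for V
  proof -
    have "dirichlet_kernel V x = (\<Sum>m\<in>{- int V..int V}. ec (- of_int m * x))" for x
      unfolding dirichlet_kernel_def by (rule sum.reindex_bij_witness[of _ uminus uminus]) auto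
    hence "integral ?I (\<lambda>x. ec (g x) * dirichlet_kernel V x)
        = integral ?I (\<lambda>x. \<Sum>m\<in>{- int V..int V}. ec (g x - of_int m * x))"
      by (simp add: sum_distrib_left flip: ec_add)
    also have "\<dots> = (\<Sum>m\<in>{- int V..int V}. poisson_term m)"
      unfolding poisson_term_def
      by (rule integral_sum) (auto intro!: integrable_continuous_real continuous_intros continuous_on_phase)
    finally show ?thesis .
  qed
  moreover have "(\<lambda>V. integral ?I (\<lambda>x. ec (g x) * dirichlet_kernel V x)) \<longlonglongrightarrow> (\<Sum>n\<in>{A..<B}. ec (g (real n)))"
  proof (rule dirichlet_kernel_integral_tendsto_sum[OF A_le_B])
    show "((\<lambda>x. ec (g x)) has_vector_derivative (2 * pi * \<i> * g' x * ec (g x))) (at x)" if "x \<in> ?I" for x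
      by (intro ec_has_vector_derivative phase_deriv that)
    show "continuous_on ?I (\<lambda>x. 2 * pi * \<i> * g' x * ec (g x))"
      by (intro continuous_intros continuous_on_phase continuous_on_deriv)
  qed
  ultimately show ?thesis by simp
qed

theorem truncated_poisson:
  assumes slope_range: "of_int m1 \<le> g' (real B - 1/2)" "g' (real A - 1/2) \<le> of_int m2"
    and slope_diff_le: "g' (real A - 1/2) - g' (real B - 1/2) \<le> real n"
  shows "norm ((\<Sum>n\<in>{A..<B}. ec (g (real n))) - (\<Sum>m\<in>{m1..m2}. poisson_term m)) \<le> 2 + 2 * harm n"
proof -
  have slope: "of_int m1 \<le> g' x" "g' x \<le> of_int m2" if "x \<in> {real A - 1/2..real B - 1/2}" for x
    using slope_range deriv_antimono[of "real A - 1/2" x] deriv_antimono[of x "real B - 1/2"] that by auto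
  hence "of_int m1 \<le> (of_int m2 :: real)" using a_le_b by (meson atLeastAtMost_iff order_refl order_trans)
  hence "m1 \<le> m2" by simp
  have upper_tail: "norm (\<Sum>j<J. poisson_term (m2 + 1 + 1 * int j)) \<le> 1 + harm n" for J
    using slope by (intro norm_sum_poisson_terms_le slope_diff_le) auto
  have lower_tail: "norm (\<Sum>j<J. poisson_term (m1 - 1 + (-1) * int j)) \<le> 1 + harm n" for J
    using slope by (intro norm_sum_poisson_terms_le slope_diff_le) auto
  have symmetric: "norm ((\<Sum>m\<in>{- int V..int V}. poisson_term m) - (\<Sum>m\<in>{m1..m2}. poisson_term m))
      \<le> 2 + 2 * harm n"
    if V_bounds: "int V \<ge> \<bar>m1\<bar>" "int V \<ge> \<bar>m2\<bar>" for V
  proof -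
    have "{- int V..int V} = ({- int V..m1 - 1} \<union> {m2 + 1..int V}) \<union> {m1..m2}"
      using V_bounds \<open>m1 \<le> m2\<close> by auto
    hence "(\<Sum>m\<in>{- int V..int V}. poisson_term m)
        = ((\<Sum>m\<in>{- int V..m1 - 1}. poisson_term m) + (\<Sum>m\<in>{m2 + 1..int V}. poisson_term m))
          + (\<Sum>m\<in>{m1..m2}. poisson_term m)"
      using \<open>m1 \<le> m2\<close> by (simp only:) (subst sum.union_disjoint; (subst sum.union_disjoint)?; auto)
    moreover have "(\<Sum>m\<in>{- int V..m1 - 1}. poisson_term m)
        = (\<Sum>j<nat (int V + m1). poisson_term (m1 - 1 + (-1) * int j))"
      by (rule sum.reindex_bij_witness[of _ "\<lambda>j. m1 - 1 + (-1) * int j" "\<lambda>m. nat (m1 - 1 - m)"])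
        (use V_bounds in auto)
    moreover have "(\<Sum>m\<in>{m2 + 1..int V}. poisson_term m)
        = (\<Sum>j<nat (int V - m2). poisson_term (m2 + 1 + 1 * int j))"
      by (rule sum.reindex_bij_witness[of _ "\<lambda>j. m2 + 1 + 1 * int j" "\<lambda>m. nat (m - m2 - 1)"])
        (use V_bounds in auto)
    ultimately show ?thesis
      using norm_triangle_mono[OF lower_tail[of "nat (int V + m1)"] upper_tail[of "nat (int V - m2)"]] by simp
  qed
  show ?thesis
  proof (rule Lim_norm_ubound[OF _ tendsto_diff[OF sum_poisson_terms_tendsto tendsto_const]])
    show "\<forall>\<^sub>F V in sequentially. norm ((\<Sum>m\<in>{- int V..int V}. poisson_term m) - (\<Sum>m\<in>{m1..m2}. poisson_term m))
        \<le> 2 + 2 * harm n"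
      unfolding eventually_sequentially
      by (rule exI[of _ "nat (max \<bar>m1\<bar> \<bar>m2\<bar>)"]) (use symmetric in auto)
  qed simp
qed

end

section \<open>Stationary phase\<close>

lemma limit_at_top_with_rate:
  fixes f :: "real \<Rightarrow> 'a::banach"
  assumes increment: "\<And>y z. 0 < y \<Longrightarrow> y \<le> z \<Longrightarrow> norm (f z - f y) \<le> C / y"
  obtains L where "\<And>y. 0 < y \<Longrightarrow> norm (f y - L) \<le> C / y"
proof -
  have "0 \<le> C" using order_trans[OF norm_ge_zero increment[of 1 1]] by simp
  have "Cauchy (\<lambda>n. f (real n))"
    unfolding Cauchy_altdef
  proof (intro allI impI)
    fix e :: real assume "e > 0"
    obtain M :: nat where M_large: "C / e < real M" using reals_Archimedean2 by blast
    moreover have "0 \<le> C / e" using \<open>0 \<le> C\<close> \<open>e > 0\<close> by simp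
    ultimately have "M > 0" by (cases M) auto
    have "dist (f (real m)) (f (real n)) < e" if "M \<le> m" "m < n" for m n
    proof -
      have "norm (f (real n) - f (real m)) \<le> C / real m" using that \<open>M > 0\<close> by (intro increment) auto
      also have "\<dots> \<le> C / real M" using that \<open>M > 0\<close> \<open>0 \<le> C\<close> by (intro divide_left_mono) auto
      also have "\<dots> < e" using M_large \<open>e > 0\<close> \<open>M > 0\<close> by (simp add: field_simps)
      finally show ?thesis by (simp add: dist_norm norm_minus_commute)
    qed
    thus "\<exists>M. \<forall>m\<ge>M. \<forall>n>m. dist (f (real m)) (f (real n)) < e" by blast
  qed
  then obtain L where L_limit: "(\<lambda>n. f (real n)) \<longlonglongrightarrow> L" by (auto simp: Cauchy_convergent_iff convergent_def)
  have "norm (f y - L) \<le> C / y" if "0 < y" for y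
  proof -
    obtain n0 where n0_large: "y \<le> real n0" using real_arch_simple by blast
    have "norm (f (real n) - f y) \<le> C / y" if "n \<ge> n0" for n
      using that n0_large \<open>0 < y\<close> by (intro increment) auto
    hence "\<forall>\<^sub>F n in sequentially. norm (f (real n) - f y) \<le> C / y"
      by (auto simp: eventually_sequentially)
    hence "norm (L - f y) \<le> C / y"
      by (intro Lim_norm_ubound[OF _ tendsto_diff[OF L_limit tendsto_const]]) auto
    thus ?thesis by (simp add: norm_minus_commute)
  qed
  thus ?thesis by (rule that)
qed

definition fresnel_constant :: complex where
  "fresnel_constant = Lim at_top (\<lambda>v. integral {0..v} (\<lambda>y. ec (- y\<^sup>2)))"

lemma norm_fresnel_integral_diff_le:
  assumes "0 < v"
  shows "norm (integral {0..v} (\<lambda>y. ec (- y\<^sup>2)) - fresnel_constant) \<le> 1 / v"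
proof -
  define F where "F = (\<lambda>v. integral {0..v} (\<lambda>y. ec (- y\<^sup>2)))"
  have "norm (F z - F y) \<le> 1 / y" if "0 < y" "y \<le> z" for y z
  proof -
    have "integral {0..y} (\<lambda>y. ec (- y\<^sup>2)) + integral {y..z} (\<lambda>y. ec (- y\<^sup>2))
        = integral {0..z} (\<lambda>y. ec (- y\<^sup>2))"
      by (rule Henstock_Kurzweil_Integration.integral_combine)
         (use that in \<open>auto intro!: integrable_continuous_real continuous_intros\<close>)
    hence "F z - F y = integral {y..z} (\<lambda>y. ec (- y\<^sup>2))" by (simp add: F_def algebra_simps)
    moreover interpret concave_phase "\<lambda>y. - y\<^sup>2" "\<lambda>y. - 2 * y" "\<lambda>_. - 2" y z
      by unfold_locales (use that in \<open>auto intro!: derivative_eq_intros\<close>)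
    have "norm (integral {y..z} (\<lambda>y. ec (- y\<^sup>2))) \<le> 1 / y"
      using that by (intro first_derivative_test) auto
    ultimately show ?thesis by simp
  qed
  then obtain L where L_rate: "\<And>v. 0 < v \<Longrightarrow> norm (F v - L) \<le> 1 / v"
    using limit_at_top_with_rate[of F 1] by blast
  have "((\<lambda>v. F v - L) \<longlongrightarrow> 0) at_top"
  proof (rule Lim_null_comparison)
    show "\<forall>\<^sub>F v in at_top. norm (F v - L) \<le> 1 / v"
      using eventually_gt_at_top[of 0] by eventually_elim (rule L_rate)
    show "((\<lambda>v::real. 1 / v) \<longlongrightarrow> 0) at_top" by real_asymp
  qed
  hence "fresnel_constant = L"
    unfolding fresnel_constant_def F_def[symmetric] by (intro tendsto_Lim) (auto simp: LIM_zero_iff)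
  thus ?thesis using L_rate[OF assms] by (simp add: F_def)
qed

lemma norm_scaled_fresnel_integral_diff_le:
  fixes t v :: real
  assumes "0 < t" "0 < v"
  shows "norm (integral {0..v} (\<lambda>y. ec (- (t * y\<^sup>2))) - fresnel_constant / sqrt t) \<le> 1 / (t * v)"
proof -
  have "((\<lambda>y. sqrt t *\<^sub>R ec (- (sqrt t * y)\<^sup>2))
      has_integral integral {sqrt t * 0..sqrt t * v} (\<lambda>y. ec (- y\<^sup>2))) {0..v}"
    by (rule has_integral_substitution[where c = 0 and d = "sqrt t * v"])
       (use assms in \<open>auto intro!: continuous_intros derivative_eq_intros mult_left_mono\<close>)
  hence "integral {0..v} (\<lambda>y. of_real (sqrt t) * ec (- (t * y\<^sup>2))) = integral {0..sqrt t * v} (\<lambda>y. ec (- y\<^sup>2))"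
    using assms by (simp add: scaleR_conv_of_real power_mult_distrib integral_unique del: integral_mult_right)
  hence "integral {0..v} (\<lambda>y. ec (- (t * y\<^sup>2))) = integral {0..sqrt t * v} (\<lambda>y. ec (- y\<^sup>2)) / sqrt t"
    using assms by (simp add: field_simps)
  hence "norm (integral {0..v} (\<lambda>y. ec (- (t * y\<^sup>2))) - fresnel_constant / sqrt t)
      = norm (integral {0..sqrt t * v} (\<lambda>y. ec (- y\<^sup>2)) - fresnel_constant) / sqrt t"
    using assms by (simp add: norm_divide flip: diff_divide_distrib)
  also have "\<dots> \<le> 1 / (sqrt t * v) / sqrt t"
    using assms by (intro divide_right_mono norm_fresnel_integral_diff_le) auto
  also have "\<dots> = 1 / (t * v)" using assms by (simp add: field_simps)
  finally show ?thesis .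
qed

lemma norm_two_sided_fresnel_integral_diff_le:
  fixes t u v :: real
  assumes "0 < t" "u < 0" "0 < v"
  shows "norm (integral {u..v} (\<lambda>y. ec (- (t * y\<^sup>2))) - 2 * fresnel_constant / sqrt t)
      \<le> 1 / (t * (- u)) + 1 / (t * v)"
proof -
  let ?f = "\<lambda>y. ec (- (t * y\<^sup>2))"
  have "integral {u..0} ?f = integral {0..- u} ?f"
    using Henstock_Kurzweil_Integration.integral_reflect_real[of 0 u ?f] by simp
  moreover have "integral {u..0} ?f + integral {0..v} ?f = integral {u..v} ?f"
    by (rule Henstock_Kurzweil_Integration.integral_combine)
       (use assms in \<open>auto intro!: integrable_continuous_real continuous_intros\<close>)
  ultimately have "integral {u..v} ?f - 2 * fresnel_constant / sqrt t
      = (integral {0..- u} ?f - fresnel_constant / sqrt t) + (integral {0..v} ?f - fresnel_constant / sqrt t)"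
    by (simp add: algebra_simps)
  thus ?thesis
    using norm_triangle_mono[OF norm_scaled_fresnel_integral_diff_le[of t "- u"]
        norm_scaled_fresnel_integral_diff_le[of t v]] assms by simp
qed

text \<open>
  A change of variables \<open>y\<close> that turns the phase into \<open>- y\<^sup>2\<close>, together with a splitting
  of the constant amplitude into a multiple of \<open>y'\<close>, which leads to a Fresnel integral,
  and a multiple of \<open>y y'\<close>, which can be integrated by parts.
\<close>
locale morse_chart =
  fixes y y' :: "real \<Rightarrow> real" and W W' :: "real \<Rightarrow> complex" and r c \<kappa> :: real
  assumes r_pos: "0 < r" and c_pos: "0 < c"
    and y_deriv: "\<And>u. u \<in> {-r..r} \<Longrightarrow> (y has_real_derivative y' u) (at u)"
    and continuous_y': "continuous_on {-r..r} y'"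
    and y_pos: "\<And>u. 0 \<le> u \<Longrightarrow> u \<le> r \<Longrightarrow> c * u \<le> y u"
    and y_neg: "\<And>u. -r \<le> u \<Longrightarrow> u \<le> 0 \<Longrightarrow> y u \<le> c * u"
    and W_deriv: "\<And>u. u \<in> {-r..r} \<Longrightarrow> (W has_vector_derivative W' u) (at u)"
    and continuous_W': "continuous_on {-r..r} W'"
    and amplitude: "\<And>u. u \<in> {-r..r} \<Longrightarrow> 1 = of_real (\<kappa> * y' u) - of_real (2 * y u * y' u) * W u"
begin

lemma continuous_y: "continuous_on {-r..r} y"
  by (auto intro!: continuous_at_imp_continuous_on DERIV_isCont y_deriv)

lemma continuous_W: "continuous_on {-r..r} W"
  by (intro continuous_at_imp_continuous_on ballI has_vector_derivative_continuous[OF W_deriv])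

definition gaussian :: "real \<Rightarrow> real \<Rightarrow> complex" where
  "gaussian t u = ec (- (t * (y u)\<^sup>2))"

lemma continuous_gaussian: "continuous_on {-r..r} (gaussian t)"
  unfolding gaussian_def[abs_def] by (intro continuous_intros continuous_y)

lemma gaussian_has_vector_derivative:
  assumes "u \<in> {-r..r}"
  shows "(gaussian t has_vector_derivative
      - (2 * pi * \<i> * t * of_real (2 * y u * y' u) * gaussian t u)) (at u within S)"
proof -
  have "((\<lambda>u. - (t * (y u)\<^sup>2)) has_real_derivative - (t * (2 * y u * y' u))) (at u within S)"
    using has_field_derivative_at_within[OF y_deriv[OF assms], of S] by (auto intro!: derivative_eq_intros)
  from ec_has_vector_derivative[OF this] show ?thesis
    unfolding gaussian_def[abs_def] by (simp add: mult_ac)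
qed

lemma fresnel_part_has_integral:
  assumes ab_order: "-r \<le> a" "a < 0" "0 < b" "b \<le> r"
  shows "((\<lambda>u. of_real (y' u) * gaussian t u) has_integral integral {y a..y b} (\<lambda>s. ec (- (t * s\<^sup>2)))) {a..b}"
proof -
  have sub: "{a..b} \<subseteq> {-r..r}" using ab_order by auto
  have "bounded (y ` {a..b})"
    by (intro compact_imp_bounded compact_continuous_image continuous_on_subset[OF continuous_y sub]) auto
  then obtain d where d_bound: "\<forall>s\<in>y ` {a..b}. norm s \<le> d"
    unfolding bounded_iff by blast
  have "y a \<le> c * a" "c * b \<le> y b" using y_neg[of a] y_pos[of b] ab_order by auto
  moreover have "c * a \<le> 0" "0 \<le> c * b" using ab_order c_pos by (auto simp: mult_le_0_iff)
  ultimately have "y a \<le> y b" by linarith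
  have "((\<lambda>u. y' u *\<^sub>R ec (- (t * (y u)\<^sup>2))) has_integral integral {y a..y b} (\<lambda>s. ec (- (t * s\<^sup>2)))) {a..b}"
  proof (rule has_integral_substitution[where c = "-d" and d = d])
    show "y ` {a..b} \<subseteq> {-d..d}" using d_bound by (force simp: abs_le_iff)
    show "(y has_field_derivative y' u) (at u within {a..b})" if "u \<in> {a..b}" for u
      using y_deriv sub that by (blast intro: has_field_derivative_at_within)
  qed (use ab_order \<open>y a \<le> y b\<close> in \<open>auto intro!: continuous_intros\<close>)
  thus ?thesis by (simp add: gaussian_def scaleR_conv_of_real)
qed

lemma remainder_part_eq:
  assumes t_pos: "0 < t" and ab_order: "-r \<le> a" "a \<le> b" "b \<le> r"
  shows "integral {a..b} (\<lambda>u. of_real (2 * y u * y' u) * W u * gaussian t u)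
    = (integral {a..b} (\<lambda>u. gaussian t u * W' u) - (gaussian t b * W b - gaussian t a * W a))
      / (2 * pi * \<i> * t)"
proof -
  define z where "z = 2 * pi * \<i> * complex_of_real t"
  have sub: "{a..b} \<subseteq> {-r..r}" using ab_order by auto
  have "(\<lambda>u. gaussian t u * W' u) integrable_on {a..b}"
    by (intro integrable_continuous_real continuous_intros continuous_on_subset[OF continuous_gaussian sub]
        continuous_on_subset[OF continuous_W' sub])
  moreover have "((\<lambda>u. gaussian t u * W' u - z * (of_real (2 * y u * y' u) * W u * gaussian t u)) has_integral
      (gaussian t b * W b - gaussian t a * W a)) {a..b}"
  proof (rule fundamental_theorem_of_calculus[OF ab_order(2)])
    fix u assume "u \<in> {a..b}"
    hence u_in: "u \<in> {-r..r}" using sub by auto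
    show "((\<lambda>u. gaussian t u * W u) has_vector_derivative
        gaussian t u * W' u - z * (of_real (2 * y u * y' u) * W u * gaussian t u)) (at u within {a..b})"
      using has_vector_derivative_mult[OF gaussian_has_vector_derivative[OF u_in, of t "{a..b}"]
          has_vector_derivative_at_within[OF W_deriv[OF u_in]]] by (simp add: z_def algebra_simps)
  qed
  ultimately have "((\<lambda>u. gaussian t u * W' u - (gaussian t u * W' u
      - z * (of_real (2 * y u * y' u) * W u * gaussian t u)))
      has_integral (integral {a..b} (\<lambda>u. gaussian t u * W' u)
        - (gaussian t b * W b - gaussian t a * W a))) {a..b}"
    by (rule has_integral_diff[OF integrable_integral])
  hence "z * integral {a..b} (\<lambda>u. of_real (2 * y u * y' u) * W u * gaussian t u)
      = integral {a..b} (\<lambda>u. gaussian t u * W' u) - (gaussian t b * W b - gaussian t a * W a)"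
    by (simp add: integral_unique flip: integral_mult_right)
  moreover have "z \<noteq> 0" using t_pos by (simp add: z_def)
  ultimately show ?thesis unfolding z_def[symmetric] by (simp add: field_simps)
qed

lemma remainder_part_bound:
  obtains M where "0 < M"
    "\<And>t a b. 0 < t \<Longrightarrow> -r \<le> a \<Longrightarrow> a \<le> b \<Longrightarrow> b \<le> r \<Longrightarrow>
       norm (integral {a..b} (\<lambda>u. of_real (2 * y u * y' u) * W u * gaussian t u)) \<le> M / t"
proof -
  obtain B where W_bound: "\<And>u. u \<in> {-r..r} \<Longrightarrow> norm (W u) \<le> B" "B > 0"
    using compact_imp_bounded[OF compact_continuous_image[OF continuous_W]] bounded_pos
    by (metis compact_Icc image_eqI)
  obtain B' where W'_bound: "\<And>u. u \<in> {-r..r} \<Longrightarrow> norm (W' u) \<le> B'" "B' > 0"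
    using compact_imp_bounded[OF compact_continuous_image[OF continuous_W']] bounded_pos
    by (metis compact_Icc image_eqI)
  define M where "M = 2 * r * B' + 2 * B"
  have M_pos: "0 < M" using W_bound W'_bound r_pos by (simp add: M_def add_pos_pos)
  have "norm (integral {a..b} (\<lambda>u. of_real (2 * y u * y' u) * W u * gaussian t u)) \<le> M / t"
    if t_pos: "0 < t" and ab_order: "-r \<le> a" "a \<le> b" "b \<le> r" for t a b
  proof -
    have sub: "{a..b} \<subseteq> {-r..r}" using ab_order by auto
    have "norm (integral {a..b} (\<lambda>u. gaussian t u * W' u)) \<le> integral {a..b} (\<lambda>_. B')"
      by (intro integral_norm_bound_integral integrable_continuous_real continuous_intros
          continuous_on_subset[OF continuous_gaussian sub] continuous_on_subset[OF continuous_W' sub])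
         (use W'_bound(1) sub in \<open>auto simp: norm_mult gaussian_def\<close>)
    also have "\<dots> \<le> 2 * r * B'" using ab_order W'_bound by (simp add: mult_right_mono)
    finally have "norm (integral {a..b} (\<lambda>u. gaussian t u * W' u)) \<le> 2 * r * B'" .
    moreover have "norm (gaussian t b * W b) \<le> B" "norm (gaussian t a * W a) \<le> B"
      using W_bound(1)[of a] W_bound(1)[of b] ab_order by (auto simp: norm_mult gaussian_def)
    ultimately have "norm (integral {a..b} (\<lambda>u. gaussian t u * W' u)
        - (gaussian t b * W b - gaussian t a * W a)) \<le> M"
      using norm_triangle_ineq4[of "integral {a..b} (\<lambda>u. gaussian t u * W' u)"
        "gaussian t b * W b - gaussian t a * W a"]
        norm_triangle_ineq4[of "gaussian t b * W b" "gaussian t a * W a"] by (simp add: M_def)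
    hence "norm (integral {a..b} (\<lambda>u. of_real (2 * y u * y' u) * W u * gaussian t u)) \<le> M / (2 * pi * t)"
      unfolding remainder_part_eq[OF that] norm_divide using t_pos by (simp add: norm_mult divide_right_mono)
    also have "\<dots> \<le> M / (1 * t)" using t_pos M_pos pi_gt3 by (intro divide_left_mono mult_right_mono) auto
    finally show ?thesis by simp
  qed
  thus thesis using that M_pos by blast
qed

lemma integral_gaussian_eq:
  assumes ab_order: "-r \<le> a" "a < 0" "0 < b" "b \<le> r"
  shows "integral {a..b} (gaussian t) = of_real \<kappa> * integral {y a..y b} (\<lambda>s. ec (- (t * s\<^sup>2)))
    - integral {a..b} (\<lambda>u. of_real (2 * y u * y' u) * W u * gaussian t u)"
proof (rule integral_unique, rule has_integral_eq)
  have sub: "{a..b} \<subseteq> {-r..r}" using ab_order by auto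
  have "(\<lambda>u. of_real (2 * y u * y' u) * W u * gaussian t u) integrable_on {a..b}"
    by (intro integrable_continuous_real continuous_intros continuous_on_subset[OF continuous_y sub]
        continuous_on_subset[OF continuous_y' sub] continuous_on_subset[OF continuous_W sub]
        continuous_on_subset[OF continuous_gaussian sub])
  thus "((\<lambda>u. of_real \<kappa> * (of_real (y' u) * gaussian t u) - of_real (2 * y u * y' u) * W u * gaussian t u)
      has_integral of_real \<kappa> * integral {y a..y b} (\<lambda>s. ec (- (t * s\<^sup>2)))
        - integral {a..b} (\<lambda>u. of_real (2 * y u * y' u) * W u * gaussian t u)) {a..b}"
    by (intro has_integral_diff has_integral_mult_right fresnel_part_has_integral ab_order integrable_integral)
  show "of_real \<kappa> * (of_real (y' u) * gaussian t u) - of_real (2 * y u * y' u) * W u * gaussian t u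
      = gaussian t u"
    if "u \<in> {a..b}" for u
    using arg_cong[OF amplitude, of u "\<lambda>z. z * gaussian t u"] that sub by (auto simp: algebra_simps)
qed

lemma fresnel_part_bound:
  assumes t_pos: "0 < t" and ab_order: "-r \<le> a" "a < 0" "0 < b" "b \<le> r"
  shows "norm (integral {y a..y b} (\<lambda>s. ec (- (t * s\<^sup>2))) - 2 * fresnel_constant / sqrt t)
    \<le> (1 / (-a) + 1 / b) / (c * t)"
proof -
  have ca_neg: "c * a < 0" and cb_pos: "0 < c * b" using ab_order c_pos by (auto simp: mult_less_0_iff)
  have ya_le: "y a \<le> c * a" and yb_ge: "c * b \<le> y b" using y_neg[of a] y_pos[of b] ab_order by auto
  have y_sign: "y a < 0" "0 < y b" using ya_le yb_ge ca_neg cb_pos by linarith+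
  have "norm (integral {y a..y b} (\<lambda>s. ec (- (t * s\<^sup>2))) - 2 * fresnel_constant / sqrt t)
      \<le> 1 / (t * (- y a)) + 1 / (t * y b)"
    using t_pos y_sign by (intro norm_two_sided_fresnel_integral_diff_le) auto
  also have "\<dots> \<le> 1 / (t * (- (c * a))) + 1 / (t * (c * b))"
    using t_pos ya_le yb_ge ca_neg cb_pos
    by (intro add_mono frac_le mult_left_mono mult_pos_pos[OF t_pos]) auto
  also have "\<dots> = (1 / (-a) + 1 / b) / (c * t)"
    using ab_order by (simp add: add_divide_distrib diff_divide_distrib mult_ac)
  finally show ?thesis .
qed

lemma stationary_phase:
  obtains C where "0 < C"
    "\<And>t a b. 0 < t \<Longrightarrow> -r \<le> a \<Longrightarrow> a < 0 \<Longrightarrow> 0 < b \<Longrightarrow> b \<le> r \<Longrightarrow>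
       norm (integral {a..b} (gaussian t) - 2 * of_real \<kappa> * fresnel_constant / sqrt t)
         \<le> C / t * (1 + 1 / (-a) + 1 / b)"
proof -
  obtain M where M_pos: "0 < M" and remainder: "\<And>t a b. 0 < t \<Longrightarrow> -r \<le> a \<Longrightarrow> a \<le> b \<Longrightarrow> b \<le> r \<Longrightarrow>
       norm (integral {a..b} (\<lambda>u. of_real (2 * y u * y' u) * W u * gaussian t u)) \<le> M / t"
    using remainder_part_bound by blast
  define C where "C = \<bar>\<kappa>\<bar> / c + M"
  show thesis
  proof (rule that)
    show "0 < C" using M_pos c_pos by (simp add: C_def add_nonneg_pos)
    fix t a b :: real
    assume t_pos: "0 < t" and ab_order: "-r \<le> a" "a < 0" "0 < b" "b \<le> r"
    define F where "F = integral {y a..y b} (\<lambda>s. ec (- (t * s\<^sup>2))) - 2 * fresnel_constant / sqrt t"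
    define R where "R = integral {a..b} (\<lambda>u. of_real (2 * y u * y' u) * W u * gaussian t u)"
    have "integral {a..b} (gaussian t) - 2 * of_real \<kappa> * fresnel_constant / sqrt t = of_real \<kappa> * F - R"
      unfolding integral_gaussian_eq[OF ab_order] F_def R_def by (simp add: algebra_simps)
    hence "norm (integral {a..b} (gaussian t) - 2 * of_real \<kappa> * fresnel_constant / sqrt t)
        \<le> \<bar>\<kappa>\<bar> * norm F + norm R"
      using norm_triangle_ineq4[of "of_real \<kappa> * F" R] by (simp add: norm_mult)
    also have "\<dots> \<le> \<bar>\<kappa>\<bar> * ((1 / (-a) + 1 / b) / (c * t)) + M / t"
      unfolding F_def R_def
      using t_pos ab_order by (intro add_mono mult_left_mono fresnel_part_bound remainder) auto
    also have "\<dots> = (\<bar>\<kappa>\<bar> / c * (1 / (-a) + 1 / b) + M * 1) / t"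
      by (simp add: add_divide_distrib)
    also have "\<dots> \<le> (\<bar>\<kappa>\<bar> / c * (1 + 1 / (-a) + 1 / b) + M * (1 + 1 / (-a) + 1 / b)) / t"
    proof (intro divide_right_mono add_mono mult_left_mono)
      have "0 \<le> 1 / (-a)" "0 \<le> 1 / b"
        using ab_order by (auto intro!: divide_nonneg_pos simp del: minus_divide_right)
      thus "1 \<le> 1 + 1 / (-a) + 1 / b" by linarith
    qed (use t_pos c_pos M_pos ab_order in auto)
    also have "\<dots> = C / t * (1 + 1 / (-a) + 1 / b)" by (simp add: C_def distrib_right)
    finally show "norm (integral {a..b} (gaussian t) - 2 * of_real \<kappa> * fresnel_constant / sqrt t)
        \<le> C / t * (1 + 1 / (-a) + 1 / b)" .
  qed
qed

end

lemma deriv2_power2_mult: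
  assumes "f holomorphic_on ball 0 R" "0 < R"
  shows "(deriv ^^ 2) (\<lambda>w. w\<^sup>2 * f w) 0 = 2 * f 0"
proof -
  have "(deriv ^^ 0) (\<lambda>w::complex. w\<^sup>2) 0 = 0" "(deriv ^^ 1) (\<lambda>w::complex. w\<^sup>2) 0 = 0"
    "(deriv ^^ 2) (\<lambda>w::complex. w\<^sup>2) 0 = 2"
    using higher_deriv_power[of 0 0 2 0] higher_deriv_power[of 1 0 2 0] higher_deriv_power[of 2 0 2 0]
    by (simp_all add: numeral_2_eq_2 pochhammer_rec)
  moreover have "{0..2} = {0, 1, 2::nat}" by auto
  moreover have "(deriv ^^ 2) (\<lambda>w. w\<^sup>2 * f w) 0
      = (\<Sum>i = 0..2. of_nat (2 choose i) * (deriv ^^ i) (\<lambda>w. w\<^sup>2) 0 * (deriv ^^ (2 - i)) f 0)"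
    by (rule higher_deriv_mult[of _ "ball 0 R"]) (use assms in \<open>auto intro!: holomorphic_intros\<close>)
  ultimately show ?thesis by simp
qed

lemma holomorphic_double_zero_eq_square:
  fixes K :: "complex \<Rightarrow> complex"
  assumes K_holomorphic: "K holomorphic_on ball 0 R" "0 < R" and K_at_0: "K 0 = 0" "deriv K 0 = 0"
    and K_deriv2: "(deriv ^^ 2) K 0 = 2 * q\<^sup>2" "q \<noteq> 0"
  obtains r G where "0 < r" "r \<le> R" "G holomorphic_on ball 0 r" "G 0 = q"
    "\<And>w. w \<in> ball 0 r \<Longrightarrow> G w \<noteq> 0" "\<And>w. w \<in> ball 0 r \<Longrightarrow> K w = (w * G w)\<^sup>2"
proof -
  obtain g r0 where r0_pos: "0 < r0" and g_holomorphic: "g holomorphic_on ball 0 r0"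
    and K_eq: "\<And>w. w \<in> ball 0 r0 \<Longrightarrow> K w - K 0 = ((w - 0) * g w)\<^sup>2" and g_nonzero: "\<And>w. w \<in> ball 0 r0 \<Longrightarrow> g w \<noteq> 0"
  proof (rule holomorphic_factor_order_of_zero_strong[OF K_holomorphic(1) open_ball, of 0 2])
    show "(deriv ^^ i) K 0 = 0" if "0 < i" "i < 2" for i
      using that K_at_0 by (cases "i = 1") auto
  qed (use K_holomorphic K_deriv2 in auto)
  have "(deriv ^^ 2) K 0 = (deriv ^^ 2) (\<lambda>w. w\<^sup>2 * (g w)\<^sup>2) 0"
  proof (rule higher_deriv_cong_ev)
    show "\<forall>\<^sub>F w in nhds 0. K w = w\<^sup>2 * (g w)\<^sup>2"
      unfolding eventually_nhds using r0_pos K_eq K_at_0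
      by (intro exI[of _ "ball 0 r0"]) (auto simp: power_mult_distrib)
  qed simp
  also have "\<dots> = 2 * (g 0)\<^sup>2"
    using r0_pos g_holomorphic by (intro deriv2_power2_mult) (auto intro!: holomorphic_intros)
  finally have g0_square: "(g 0)\<^sup>2 = q\<^sup>2" using K_deriv2 by simp
  have g0_nonzero: "g 0 \<noteq> 0" using g_nonzero[of 0] r0_pos by simp
  define r where "r = min r0 R"
  define G where "G = (\<lambda>w. q / g 0 * g w)"
  show thesis
  proof (rule that[of r G])
    show "0 < r" "r \<le> R" using r0_pos K_holomorphic(2) by (auto simp: r_def)
    show "G holomorphic_on ball 0 r"
      unfolding G_def
      using g0_nonzero
      by (intro holomorphic_intros holomorphic_on_subset[OF g_holomorphic]) (auto simp: r_def)
    show "G 0 = q" using g0_nonzero by (simp add: G_def)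
    fix w :: complex assume w_in: "w \<in> ball 0 r"
    thus "G w \<noteq> 0" using g_nonzero[of w] g0_nonzero K_deriv2 by (simp add: G_def r_def)
    have "(w * G w)\<^sup>2 = (w * g w)\<^sup>2"
      using g0_square g0_nonzero K_deriv2(2) by (simp add: G_def power_mult_distrib power_divide)
    thus "K w = (w * G w)\<^sup>2" using K_eq[of w] w_in K_at_0 by (simp add: r_def)
  qed
qed

lemma holomorphic_zero_eq_mult:
  assumes "h holomorphic_on ball 0 R" "0 < R" "h 0 = 0"
  obtains P where "P holomorphic_on ball 0 R" "\<And>w. h w = w * P w"
proof (rule that)
  show "(\<lambda>w. if w = 0 then deriv h 0 else (h w - h 0) / (w - 0)) holomorphic_on ball 0 R"
    using assms by (intro pole_lemma) auto
qed (use assms in auto)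

lemma holomorphic_deriv_close:
  assumes "Y holomorphic_on ball 0 R" "0 < R" "0 < e"
  obtains r where "0 < r" "r \<le> R" "\<And>w. w \<in> ball 0 r \<Longrightarrow> norm (deriv Y w - deriv Y 0) < e"
proof -
  have "isCont (deriv Y) 0"
    using holomorphic_on_imp_continuous_on[OF holomorphic_deriv[OF assms(1) open_ball]] assms(2)
    by (simp add: continuous_on_eq_continuous_at)
  then obtain d where d_close: "d > 0" "\<And>w. dist w 0 < d \<Longrightarrow> dist (deriv Y w) (deriv Y 0) < e"
    using \<open>0 < e\<close> unfolding continuous_at_eps_delta by blast
  show thesis
    by (rule that[of "min d R"]) (use d_close \<open>0 < R\<close> in \<open>auto simp: dist_norm dist_commute[of 0]\<close>)
qed

lemma holomorphic_morse_chart: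
  fixes K :: "complex \<Rightarrow> complex"
  assumes K_holomorphic: "K holomorphic_on ball 0 R" "0 < R" and K_at_0: "K 0 = 0" "deriv K 0 = 0"
    and K_deriv2: "(deriv ^^ 2) K 0 = 2 * q\<^sup>2" "q \<noteq> 0"
  obtains r Y W where "0 < r" "r \<le> R" "Y holomorphic_on ball 0 r" "W holomorphic_on ball 0 r"
    "Y 0 = 0" "deriv Y 0 = q" "\<And>w. w \<in> ball 0 r \<Longrightarrow> K w = (Y w)\<^sup>2"
    "\<And>w. w \<in> ball 0 r \<Longrightarrow> 1 = deriv Y w / q - 2 * Y w * deriv Y w * W w"
proof -
  obtain r0 G where r0_bounds: "0 < r0" "r0 \<le> R" and G_props: "G holomorphic_on ball 0 r0" "G 0 = q"
    and G_nonzero: "\<And>w. w \<in> ball 0 r0 \<Longrightarrow> G w \<noteq> 0" and K_eq: "\<And>w. w \<in> ball 0 r0 \<Longrightarrow> K w = (w * G w)\<^sup>2"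
    using holomorphic_double_zero_eq_square[OF assms] by blast
  define Y where "Y = (\<lambda>w. w * G w)"
  have Y_holomorphic: "Y holomorphic_on ball 0 r0" unfolding Y_def by (intro holomorphic_intros G_props)
  hence Y'_holomorphic: "deriv Y holomorphic_on ball 0 r0" by (rule holomorphic_deriv) simp
  have deriv_Y_0: "deriv Y 0 = q"
  proof (rule DERIV_imp_deriv)
    show "(Y has_field_derivative q) (at 0)"
      unfolding Y_def using holomorphic_derivI[OF G_props(1) open_ball, of 0] r0_bounds G_props(2)
      by (auto intro!: derivative_eq_intros)
  qed
  obtain r where r_bounds: "0 < r" "r \<le> r0" and close: "\<And>w. w \<in> ball 0 r \<Longrightarrow> norm (deriv Y w - q) < norm q"
    using holomorphic_deriv_close[OF Y_holomorphic r0_bounds(1), of "norm q"] deriv_Y_0 K_deriv2(2) by auto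
  have subset: "ball 0 r \<subseteq> ball (0::complex) r0" using r_bounds by auto
  have Y'_nonzero: "deriv Y w \<noteq> 0" if "w \<in> ball 0 r" for w using close[OF that] by auto
  obtain P where P_props: "P holomorphic_on ball 0 r" "\<And>w. 1 - deriv Y w / q = w * P w"
  proof (rule holomorphic_zero_eq_mult)
    show "(\<lambda>w. 1 - deriv Y w / q) holomorphic_on ball 0 r"
      using K_deriv2(2) by (auto intro!: holomorphic_intros holomorphic_on_subset[OF Y'_holomorphic subset])
  qed (use r_bounds deriv_Y_0 K_deriv2(2) in auto)
  define W where "W = (\<lambda>w. - P w / (2 * G w * deriv Y w))"
  show thesis
  proof (rule that[of r Y W])
    show "Y holomorphic_on ball 0 r" using Y_holomorphic subset by (rule holomorphic_on_subset)
    show "W holomorphic_on ball 0 r"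
      unfolding W_def using Y'_nonzero G_nonzero subset
      by (intro holomorphic_intros P_props(1) holomorphic_on_subset[OF Y'_holomorphic subset]
        holomorphic_on_subset[OF G_props(1) subset]) auto
    fix w :: complex assume w_in: "w \<in> ball 0 r"
    show "K w = (Y w)\<^sup>2" using K_eq[of w] w_in subset by (auto simp: Y_def)
    have "2 * Y w * deriv Y w * W w = - (w * P w)"
      using Y'_nonzero[OF w_in] G_nonzero[of w] w_in subset by (auto simp: W_def Y_def)
    also have "\<dots> = deriv Y w / q - 1" by (simp flip: P_props(2))
    finally show "1 = deriv Y w / q - 2 * Y w * deriv Y w * W w" by simp
  qed (use r_bounds r0_bounds deriv_Y_0 in \<open>auto simp: Y_def\<close>)
qed

lemma increasing_real_part:
  fixes Y :: "complex \<Rightarrow> complex" and q :: real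
  assumes Y_holomorphic: "Y holomorphic_on ball 0 r" and slope: "\<And>w. w \<in> ball 0 r \<Longrightarrow> m \<le> Re (deriv Y w)"
    and order: "-r < u" "u \<le> v" "v < r"
  shows "m * (v - u) \<le> Re (Y (of_real v)) - Re (Y (of_real u))"
proof (cases "u = v")
  case False
  have deriv: "((\<lambda>u. Re (Y (of_real u))) has_real_derivative Re (deriv Y (of_real u))) (at u)"
    if "\<bar>u\<bar> < r" for u
  proof -
    have "((\<lambda>u. Y (of_real u)) has_vector_derivative deriv Y (of_real u)) (at u)"
      using that by (intro has_vector_derivative_real_field holomorphic_derivI[OF Y_holomorphic]) auto
    from bounded_linear.has_vector_derivative[OF bounded_linear_Re this] show ?thesis
      by (simp add: has_real_derivative_iff_has_vector_derivative)
  qed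
  obtain z where mvt: "u < z" "z < v"
    "Re (Y (of_real v)) - Re (Y (of_real u)) = (v - u) * Re (deriv Y (of_real z))"
    using MVT2[of u v "\<lambda>u. Re (Y (of_real u))" "\<lambda>u. Re (deriv Y (of_real u))"] deriv order False by auto
  have "(v - u) * m \<le> (v - u) * Re (deriv Y (of_real z))"
    using mvt order by (intro mult_left_mono slope) auto
  thus ?thesis using mvt(3) by (simp add: mult.commute)
qed simp

lemma real_on_reals_if_square_real:
  fixes Y :: "complex \<Rightarrow> complex"
  assumes Y_holomorphic: "Y holomorphic_on ball 0 r" "Y 0 = 0"
    and slope: "\<And>w. w \<in> ball 0 r \<Longrightarrow> m \<le> Re (deriv Y w)" "m > 0"
    and square: "\<And>u. \<bar>u\<bar> < r \<Longrightarrow> Im ((Y (of_real u))\<^sup>2) = 0" and u_bounds: "\<bar>u\<bar> < r"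
  shows "Y (of_real u) = of_real (Re (Y (of_real u)))"
proof (cases "u = 0")
  case False
  have "Re (Y (of_real u)) \<noteq> 0"
  proof (cases "u > 0")
    case True
    thus ?thesis
      using increasing_real_part[OF Y_holomorphic(1) slope(1), of 0 u] u_bounds Y_holomorphic(2)
        mult_pos_pos[OF slope(2) True] by auto
  next
    case neg: False
    thus ?thesis
      using increasing_real_part[OF Y_holomorphic(1) slope(1), of u 0] u_bounds Y_holomorphic(2) False
        mult_pos_neg[OF slope(2), of u] by auto
  qed
  thus ?thesis using square[OF u_bounds] by (simp add: Im_power2 complex_eq_iff)
qed (simp add: Y_holomorphic)

lemma deriv_real_on_reals:
  fixes Y :: "complex \<Rightarrow> complex"
  assumes Y_holomorphic: "Y holomorphic_on ball 0 r"
    and real: "\<And>u. \<bar>u\<bar> < r \<Longrightarrow> Y (of_real u) = of_real (Re (Y (of_real u)))"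
    and u_bounds: "\<bar>u\<bar> < r"
  shows "((\<lambda>u. Re (Y (of_real u))) has_real_derivative Re (deriv Y (of_real u))) (at u)"
    and "deriv Y (of_real u) = of_real (Re (deriv Y (of_real u)))"
proof -
  have Y_deriv: "((\<lambda>u. Y (of_real u)) has_vector_derivative deriv Y (of_real u)) (at u)"
    by (intro has_vector_derivative_real_field holomorphic_derivI[OF Y_holomorphic]) (use u_bounds in auto)
  from bounded_linear.has_vector_derivative[OF bounded_linear_Re this]
  show Re_deriv: "((\<lambda>u. Re (Y (of_real u))) has_real_derivative Re (deriv Y (of_real u))) (at u)"
    by (simp add: has_real_derivative_iff_has_vector_derivative)
  show "deriv Y (of_real u) = of_real (Re (deriv Y (of_real u)))"
  proof (rule vector_derivative_unique_at[OF Y_deriv])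
    have "((\<lambda>u. complex_of_real (Re (Y (of_real u))))
        has_vector_derivative of_real (Re (deriv Y (of_real u)))) (at u)"
      by (intro has_vector_derivative_of_real Re_deriv)
    thus "((\<lambda>u. Y (of_real u)) has_vector_derivative of_real (Re (deriv Y (of_real u)))) (at u)"
      by (rule has_vector_derivative_transform_within_open[where S = "{-r<..<r}"])
        (use u_bounds real in \<open>auto simp: abs_less_iff\<close>)
  qed
qed

lemma morse_chart_holomorphic:
  fixes Y W :: "complex \<Rightarrow> complex" and q :: real
  assumes Y_holomorphic: "Y holomorphic_on ball 0 R" "Y 0 = 0" and W_holomorphic: "W holomorphic_on ball 0 R"
    and slope: "\<And>w. w \<in> ball 0 R \<Longrightarrow> q / 2 \<le> Re (deriv Y w)" and q_pos: "q > 0"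
    and split: "\<And>w. w \<in> ball 0 R \<Longrightarrow> 1 = deriv Y w / of_real q - 2 * Y w * deriv Y w * W w"
    and real: "\<And>u. \<bar>u\<bar> < R \<Longrightarrow> Y (of_real u) = of_real (Re (Y (of_real u)))" and r_bounds: "0 < r" "r < R"
  shows "morse_chart (\<lambda>u. Re (Y (of_real u))) (\<lambda>u. Re (deriv Y (of_real u)))
    (\<lambda>u. W (of_real u)) (\<lambda>u. deriv W (of_real u)) r (q / 2) (1 / q)"
proof
  have in_ball: "complex_of_real u \<in> ball 0 R" if "u \<in> {-r..r}" for u using that r_bounds by auto
  show "((\<lambda>u. Re (Y (of_real u))) has_real_derivative Re (deriv Y (of_real u))) (at u)" if "u \<in> {-r..r}" for u
    using that r_bounds by (intro deriv_real_on_reals[OF Y_holomorphic(1) real]) auto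
  show "continuous_on {-r..r} (\<lambda>u. Re (deriv Y (of_real u)))"
    by (intro continuous_intros
        continuous_on_compose2[OF holomorphic_on_imp_continuous_on[
          OF holomorphic_deriv[OF Y_holomorphic(1) open_ball]]])
       (use in_ball in auto)
  show "q / 2 * u \<le> Re (Y (of_real u))" if "0 \<le> u" "u \<le> r" for u
    using increasing_real_part[OF Y_holomorphic(1) slope, of 0 u] that r_bounds Y_holomorphic(2) by simp
  show "Re (Y (of_real u)) \<le> q / 2 * u" if "-r \<le> u" "u \<le> 0" for u
    using increasing_real_part[OF Y_holomorphic(1) slope, of u 0] that r_bounds Y_holomorphic(2) by simp
  show "((\<lambda>u. W (of_real u)) has_vector_derivative deriv W (of_real u)) (at u)" if "u \<in> {-r..r}" for u
    by (intro has_vector_derivative_real_field holomorphic_derivI[OF W_holomorphic open_ball] in_ball that)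
  show "continuous_on {-r..r} (\<lambda>u. deriv W (of_real u))"
    by (intro continuous_intros
        continuous_on_compose2[OF holomorphic_on_imp_continuous_on[
          OF holomorphic_deriv[OF W_holomorphic open_ball]]])
       (use in_ball in auto)
  show "1 = complex_of_real (1 / q * Re (deriv Y (of_real u)))
      - of_real (2 * Re (Y (of_real u)) * Re (deriv Y (of_real u))) * W (of_real u)"
      if u_in: "u \<in> {-r..r}" for u
  proof -
    have "\<bar>u\<bar> < R" using u_in r_bounds by auto
    hence "Y (of_real u) = of_real (Re (Y (of_real u)))"
      "deriv Y (of_real u) = of_real (Re (deriv Y (of_real u)))"
      using real deriv_real_on_reals(2)[OF Y_holomorphic(1) real] by blast+
    thus ?thesis using split[OF in_ball[OF u_in]] by (simp del: of_real_Re)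
  qed
qed (use q_pos r_bounds in auto)

lemma real_morse_chart:
  fixes K :: "complex \<Rightarrow> complex" and q :: real
  assumes K_holomorphic: "K holomorphic_on ball 0 R" "0 < R" and K_at_0: "K 0 = 0" "deriv K 0 = 0"
    and K_deriv2: "(deriv ^^ 2) K 0 = 2 * (of_real q)\<^sup>2" and q_pos: "q > 0"
    and real: "\<And>u. \<bar>u\<bar> < R \<Longrightarrow> Im (K (of_real u)) = 0"
  obtains r y y' W W' where "r < R" "morse_chart y y' W W' r (q / 2) (1 / q)"
    "\<And>u. u \<in> {-r..r} \<Longrightarrow> K (of_real u) = of_real ((y u)\<^sup>2)"
proof -
  obtain r1 Y W where r1_bounds: "0 < r1" "r1 \<le> R" and Y_holomorphic: "Y holomorphic_on ball 0 r1"
    and W_holomorphic: "W holomorphic_on ball 0 r1"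
    and Y_at_0: "Y 0 = 0" "deriv Y 0 = of_real q" and K_eq: "\<And>w. w \<in> ball 0 r1 \<Longrightarrow> K w = (Y w)\<^sup>2"
    and split: "\<And>w. w \<in> ball 0 r1 \<Longrightarrow> 1 = deriv Y w / of_real q - 2 * Y w * deriv Y w * W w"
    using holomorphic_morse_chart[OF K_holomorphic K_at_0 K_deriv2] q_pos by auto
  obtain r2 where r2_bounds: "0 < r2" "r2 \<le> r1"
    and close: "\<And>w. w \<in> ball 0 r2 \<Longrightarrow> norm (deriv Y w - of_real q) < q / 2"
    using holomorphic_deriv_close[OF Y_holomorphic r1_bounds(1), of "q / 2"] Y_at_0 q_pos by auto
  have subset: "ball 0 r2 \<subseteq> ball (0::complex) r1" using r2_bounds by auto
  have slope: "q / 2 \<le> Re (deriv Y w)" if "w \<in> ball 0 r2" for w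
    using close[OF that] abs_Re_le_cmod[of "deriv Y w - of_real q"] by auto
  have Y_r2: "Y holomorphic_on ball 0 r2" using Y_holomorphic subset by (rule holomorphic_on_subset)
  have Y_real: "Y (of_real u) = of_real (Re (Y (of_real u)))" if "\<bar>u\<bar> < r2" for u
  proof (rule real_on_reals_if_square_real[OF Y_r2 Y_at_0(1) slope _ _ that])
    show "Im ((Y (of_real u))\<^sup>2) = 0" if "\<bar>u\<bar> < r2" for u
      using K_eq[of "of_real u"] real[of u] that r1_bounds r2_bounds by auto
  qed (use q_pos in auto)
  show thesis
  proof (rule that)
    show "r2 / 2 < R" using r1_bounds r2_bounds by simp
    show "morse_chart (\<lambda>u. Re (Y (of_real u))) (\<lambda>u. Re (deriv Y (of_real u)))
        (\<lambda>u. W (of_real u)) (\<lambda>u. deriv W (of_real u)) (r2 / 2) (q / 2) (1 / q)"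
      using split subset r2_bounds holomorphic_on_subset[OF W_holomorphic subset]
      by (intro morse_chart_holomorphic[OF Y_r2 Y_at_0(1) _ slope q_pos _ Y_real]) auto
    fix u assume "u \<in> {- (r2 / 2)..r2 / 2}"
    hence "\<bar>u\<bar> < r2" using r2_bounds by auto
    thus "K (of_real u) = of_real ((Re (Y (of_real u)))\<^sup>2)"
      using K_eq[of "of_real u"] Y_real[of u] r2_bounds by auto
  qed
qed

theorem analytic_stationary_phase:
  fixes K :: "complex \<Rightarrow> complex" and q :: real
  assumes K_holomorphic: "K holomorphic_on ball 0 R" "0 < R" and K_at_0: "K 0 = 0" "deriv K 0 = 0"
    and K_deriv2: "(deriv ^^ 2) K 0 = 2 * (of_real q)\<^sup>2" and q_pos: "q > 0"
    and real: "\<And>u. \<bar>u\<bar> < R \<Longrightarrow> Im (K (of_real u)) = 0"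
  obtains r C where "0 < r" "r < R" "0 < C"
    "\<And>t a b. 0 < t \<Longrightarrow> -r \<le> a \<Longrightarrow> a < 0 \<Longrightarrow> 0 < b \<Longrightarrow> b \<le> r \<Longrightarrow>
       norm (integral {a..b} (\<lambda>u. ec (- (t * Re (K (of_real u)))))
         - 2 * of_real (1 / q) * fresnel_constant / sqrt t)
         \<le> C / t * (1 + 1 / (-a) + 1 / b)"
proof -
  obtain r y y' W W' where "r < R" and chart: "morse_chart y y' W W' r (q / 2) (1 / q)"
    and K_eq: "\<And>u. u \<in> {-r..r} \<Longrightarrow> K (of_real u) = of_real ((y u)\<^sup>2)"
    using real_morse_chart[OF assms] by blast
  interpret morse_chart y y' W W' r "q / 2" "1 / q" by (rule chart)
  have phase_integral: "integral {a..b} (\<lambda>u. ec (- (t * Re (K (of_real u))))) = integral {a..b} (gaussian t)"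
    if "-r \<le> a" "b \<le> r" for a b t
    by (rule integral_cong) (use that in \<open>simp add: gaussian_def K_eq\<close>)
  show thesis
  proof (rule stationary_phase)
    fix C
    assume "0 < C" "\<And>t a b. 0 < t \<Longrightarrow> -r \<le> a \<Longrightarrow> a < 0 \<Longrightarrow> 0 < b \<Longrightarrow> b \<le> r \<Longrightarrow>
      norm (integral {a..b} (gaussian t) - 2 * of_real (1 / q) * fresnel_constant / sqrt t)
        \<le> C / t * (1 + 1 / (-a) + 1 / b)"
    thus thesis by (intro that[OF r_pos \<open>r < R\<close>, of C]) (simp_all add: phase_integral)
  qed
qed

definition power_phase :: "real \<Rightarrow> real \<Rightarrow> real" where
  "power_phase \<alpha> s = sgn \<alpha> * (s powr \<alpha> - \<alpha> * s - (1 - \<alpha>))"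

definition stationary_constant :: "real \<Rightarrow> complex" where
  "stationary_constant \<alpha> = 2 * of_real (1 / sqrt (\<bar>\<alpha>\<bar> * (1 - \<alpha>) / 2)) * fresnel_constant"

definition stationary_phase_bound :: "real \<Rightarrow> real \<Rightarrow> bool" where
  "stationary_phase_bound \<alpha> C \<longleftrightarrow> 0 < C \<and> (\<forall>t a b. 0 < t \<longrightarrow> 0 < a \<longrightarrow> a < 1 \<longrightarrow> 1 < b \<longrightarrow>
     norm (integral {a..b} (\<lambda>s. ec (t * power_phase \<alpha> s)) - stationary_constant \<alpha> / sqrt t)
       \<le> C / t * (1 + 1 / (1 - a) + 1 / (b - 1)))"

lemma sgn_mult_self: "sgn \<alpha> * \<alpha> = \<bar>\<alpha>\<bar>" for \<alpha> :: real
  by (simp add: abs_sgn mult.commute)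

definition complex_power_phase :: "real \<Rightarrow> complex \<Rightarrow> complex" where
  "complex_power_phase \<alpha> z = - of_real (sgn \<alpha>) * ((1 + z) powr of_real \<alpha> - of_real \<alpha> * z - 1)"

lemma complex_power_phase_of_real:
  assumes "\<bar>u\<bar> < 1"
  shows "complex_power_phase \<alpha> (of_real u) = of_real (- power_phase \<alpha> (u + 1))"
proof -
  have "complex_of_real (1 + u) powr of_real \<alpha> = of_real ((1 + u) powr \<alpha>)"
    using assms by (intro powr_of_real) auto
  thus ?thesis by (simp add: complex_power_phase_def power_phase_def algebra_simps)
qed

lemma one_plus_powr_has_field_derivative:
  fixes w z :: complex
  assumes "z \<in> ball 0 1"
  shows "((\<lambda>z. (1 + z) powr w) has_field_derivative w * (1 + z) powr (w - 1)) (at z)"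
proof -
  have "\<bar>Re z\<bar> < 1" using abs_Re_le_cmod[of z] assms by (simp add: dist_norm)
  hence nonpos: "1 + z \<notin> \<real>\<^sub>\<le>\<^sub>0" by (auto simp: complex_nonpos_Reals_iff)
  have "((\<lambda>z. 1 + z) has_field_derivative 1) (at z)" by (auto intro!: derivative_eq_intros)
  from DERIV_chain2[OF has_field_derivative_powr[OF nonpos, of w] this] show ?thesis by simp
qed

lemma complex_power_phase_derivs:
  assumes \<alpha>_bounds: "\<alpha> < 1" "\<alpha> \<noteq> 0"
  shows "complex_power_phase \<alpha> holomorphic_on ball 0 1" "deriv (complex_power_phase \<alpha>) 0 = 0"
    "(deriv ^^ 2) (complex_power_phase \<alpha>) 0 = 2 * (of_real (sqrt (\<bar>\<alpha>\<bar> * (1 - \<alpha>) / 2)))\<^sup>2"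
proof -
  define s A where "s = complex_of_real (sgn \<alpha>)" and "A = complex_of_real \<alpha>"
  define K K' where "K = complex_power_phase \<alpha>" and "K' = (\<lambda>z. - s * (A * (1 + z) powr (A - 1) - A))"
  have K_deriv: "(K has_field_derivative K' z) (at z)" if "z \<in> ball 0 1" for z
  proof -
    have "((\<lambda>z. - s * ((1 + z) powr A - A * z - 1))
        has_field_derivative - s * (A * (1 + z) powr (A - 1) - A * 1 - 0)) (at z)"
      by (intro DERIV_cmult DERIV_diff one_plus_powr_has_field_derivative that DERIV_ident DERIV_const)
    thus ?thesis by (simp add: K_def K'_def complex_power_phase_def[abs_def] s_def A_def)
  qed
  thus "complex_power_phase \<alpha> holomorphic_on ball 0 1"
    unfolding holomorphic_on_def field_differentiable_def K_def using has_field_derivative_at_within by blast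
  show "deriv (complex_power_phase \<alpha>) 0 = 0"
    using DERIV_imp_deriv[OF K_deriv, of 0] by (simp add: K_def K'_def)
  have "(K' has_field_derivative - s * (A * ((A - 1) * (1 + 0) powr (A - 1 - 1)) - 0)) (at 0)"
    unfolding K'_def by (intro DERIV_cmult DERIV_diff one_plus_powr_has_field_derivative DERIV_const) simp
  moreover have "- s * (A * ((A - 1) * (1 + 0) powr (A - 1 - 1)) - 0) = of_real (\<bar>\<alpha>\<bar> * (1 - \<alpha>))"
    using \<alpha>_bounds by (auto simp: s_def A_def sgn_if abs_if algebra_simps)
  ultimately have "deriv K' 0 = of_real (\<bar>\<alpha>\<bar> * (1 - \<alpha>))" by (metis DERIV_imp_deriv)
  moreover have "\<forall>\<^sub>F z in nhds 0. deriv K z = K' z"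
    unfolding eventually_nhds by (intro exI[of _ "ball 0 1"]) (auto intro: DERIV_imp_deriv K_deriv)
  hence "deriv (deriv K) 0 = deriv K' 0" by (rule deriv_cong_ev) simp
  moreover have "2 * (complex_of_real (sqrt (\<bar>\<alpha>\<bar> * (1 - \<alpha>) / 2)))\<^sup>2 = of_real (\<bar>\<alpha>\<bar> * (1 - \<alpha>))"
    using \<alpha>_bounds by (simp flip: of_real_power)
  ultimately show "(deriv ^^ 2) (complex_power_phase \<alpha>) 0 = 2 * (of_real (sqrt (\<bar>\<alpha>\<bar> * (1 - \<alpha>) / 2)))\<^sup>2"
    by (simp add: K_def eval_nat_numeral)
qed

lemma power_stationary_phase_local:
  fixes \<alpha> :: real
  assumes \<alpha>_bounds: "\<alpha> < 1" "\<alpha> \<noteq> 0"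
  obtains r C where "0 < r" "r < 1" "0 < C"
    "\<And>t a b. 0 < t \<Longrightarrow> 1 - r \<le> a \<Longrightarrow> a < 1 \<Longrightarrow> 1 < b \<Longrightarrow> b \<le> 1 + r \<Longrightarrow>
       norm (integral {a..b} (\<lambda>s. ec (t * power_phase \<alpha> s)) - stationary_constant \<alpha> / sqrt t)
         \<le> C / t * (1 + 1 / (1 - a) + 1 / (b - 1))"
proof -
  define K where "K = complex_power_phase \<alpha>"
  define q where "q = sqrt (\<bar>\<alpha>\<bar> * (1 - \<alpha>) / 2)"
  have "q > 0" using \<alpha>_bounds by (simp add: q_def)
  have "K 0 = 0" by (simp add: K_def complex_power_phase_def)
  have "Im (K (of_real u)) = 0" if "\<bar>u\<bar> < 1" for u
    using that by (simp add: K_def complex_power_phase_of_real)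
  show thesis
  proof (rule analytic_stationary_phase[of K 1 q])
    fix r C :: real
    assume r_bounds: "0 < r" "r < 1" and C_pos: "0 < C"
      and bound: "\<And>t a b. 0 < t \<Longrightarrow> -r \<le> a \<Longrightarrow> a < 0 \<Longrightarrow> 0 < b \<Longrightarrow> b \<le> r \<Longrightarrow>
        norm (integral {a..b} (\<lambda>u. ec (- (t * Re (K (of_real u)))))
          - 2 * of_real (1 / q) * fresnel_constant / sqrt t)
          \<le> C / t * (1 + 1 / (-a) + 1 / b)"
    have "integral {a..b} (\<lambda>s. ec (t * power_phase \<alpha> s))
        = integral {a-1..b-1} (\<lambda>u. ec (- (t * Re (K (of_real u)))))"
      if "1 - r \<le> a" "b \<le> 1 + r" for a b t
    proof -
      have "integral {a..b} (\<lambda>s. ec (t * power_phase \<alpha> s))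
          = integral {a-1..b-1} (\<lambda>u. ec (t * power_phase \<alpha> (u + 1)))"
        by (rule integral_shift_real_ivl[symmetric])
      also have "\<dots> = integral {a-1..b-1} (\<lambda>u. ec (- (t * Re (K (of_real u)))))"
        by (rule integral_cong) (use that r_bounds in \<open>simp add: K_def complex_power_phase_of_real abs_less_iff\<close>)
      finally show ?thesis .
    qed
    moreover have "norm (integral {a-1..b-1} (\<lambda>u. ec (- (t * Re (K (of_real u)))))
        - stationary_constant \<alpha> / sqrt t)
        \<le> C / t * (1 + 1 / (1 - a) + 1 / (b - 1))"
      if "0 < t" "1 - r \<le> a" "a < 1" "1 < b" "b \<le> 1 + r" for t a b
      using bound[of t "a - 1" "b - 1"] that by (simp add: stationary_constant_def q_def)
    ultimately show thesis by (intro that[OF r_bounds C_pos]) simp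
  qed (use complex_power_phase_derivs[OF \<alpha>_bounds, folded K_def q_def] \<open>K 0 = 0\<close> \<open>q > 0\<close>
      \<open>\<And>u. \<bar>u\<bar> < 1 \<Longrightarrow> Im (K (of_real u)) = 0\<close> in auto)
qed

lemma concave_phase_power_phase:
  fixes \<alpha> :: real
  assumes \<alpha>_bounds: "\<alpha> < 1" and "0 < t" "0 < a" "a \<le> b"
  shows "concave_phase (\<lambda>s. t * power_phase \<alpha> s) (\<lambda>s. t * (\<bar>\<alpha>\<bar> * (s powr (\<alpha> - 1) - 1)))
    (\<lambda>s. t * (\<bar>\<alpha>\<bar> * ((\<alpha> - 1) * s powr (\<alpha> - 2)))) a b"
proof
  fix s assume "s \<in> {a..b}"
  hence s_pos: "0 < s" using assms by auto
  have "(power_phase \<alpha> has_real_derivative sgn \<alpha> * (\<alpha> * s powr (\<alpha> - 1) - \<alpha>)) (at s)"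
    unfolding power_phase_def[abs_def] using s_pos by (auto intro!: derivative_eq_intros)
  moreover have "sgn \<alpha> * (\<alpha> * s powr (\<alpha> - 1) - \<alpha>) = \<bar>\<alpha>\<bar> * (s powr (\<alpha> - 1) - 1)"
    unfolding sgn_mult_self[symmetric] by (simp add: algebra_simps)
  ultimately show "((\<lambda>s. t * power_phase \<alpha> s) has_real_derivative t * (\<bar>\<alpha>\<bar> * (s powr (\<alpha> - 1) - 1))) (at s)"
    by (intro DERIV_cmult) simp
  show "((\<lambda>s. t * (\<bar>\<alpha>\<bar> * (s powr (\<alpha> - 1) - 1)))
      has_real_derivative t * (\<bar>\<alpha>\<bar> * ((\<alpha> - 1) * s powr (\<alpha> - 2)))) (at s)"
    using s_pos by (auto intro!: derivative_eq_intros)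
  show "t * (\<bar>\<alpha>\<bar> * ((\<alpha> - 1) * s powr (\<alpha> - 2))) \<le> 0"
    using assms by (simp add: mult_nonneg_nonpos mult_nonpos_nonneg)
qed (use assms in \<open>auto intro!: continuous_intros\<close>)

lemma power_phase_integral_far:
  fixes \<alpha> :: real
  assumes \<alpha>_bounds: "\<alpha> < 1" "\<alpha> \<noteq> 0" and r_bounds: "0 < r" "r < 1"
  obtains l where "0 < l"
    "\<And>t a b. 0 < t \<Longrightarrow> 0 < a \<Longrightarrow> a \<le> b \<Longrightarrow> b \<le> 1 - r \<or> 1 + r \<le> a \<Longrightarrow>
       norm (integral {a..b} (\<lambda>s. ec (t * power_phase \<alpha> s))) \<le> 1 / (t * l)"
proof -
  define k where "k = (\<lambda>s. \<bar>\<alpha>\<bar> * (s powr (\<alpha> - 1) - 1))"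
  have k_antimono: "k s' \<le> k s" if "0 < s" "s \<le> s'" for s s'
    unfolding k_def using that \<alpha>_bounds by (intro mult_left_mono diff_right_mono powr_mono2') auto
  define l where "l = min (k (1 - r)) (- k (1 + r))"
  have "1 powr (\<alpha> - 1) < (1 - r) powr (\<alpha> - 1)" "(1 + r) powr (\<alpha> - 1) < 1 powr (\<alpha> - 1)"
    using r_bounds \<alpha>_bounds by (intro powr_less_mono2_neg; simp)+
  hence l_pos: "0 < l" using \<alpha>_bounds by (simp add: l_def k_def mult_pos_neg)
  show thesis
  proof (rule that[OF l_pos])
    fix t a b :: real
    assume t_pos: "0 < t" and ab_order: "0 < a" "a \<le> b" and far: "b \<le> 1 - r \<or> 1 + r \<le> a"
    interpret concave_phase "\<lambda>s. t * power_phase \<alpha> s" "\<lambda>s. t * k s"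
      "\<lambda>s. t * (\<bar>\<alpha>\<bar> * ((\<alpha> - 1) * s powr (\<alpha> - 2)))" a b
      unfolding k_def by (rule concave_phase_power_phase[OF \<alpha>_bounds(1) t_pos ab_order])
    have "(\<forall>s\<in>{a..b}. l \<le> k s) \<or> (\<forall>s\<in>{a..b}. k s \<le> - l)"
      using far
    proof
      assume "b \<le> 1 - r"
      hence "k (1 - r) \<le> k s" if "s \<in> {a..b}" for s using that ab_order by (intro k_antimono) auto
      thus ?thesis by (force simp: l_def)
    next
      assume "1 + r \<le> a"
      hence "k s \<le> k (1 + r)" if "s \<in> {a..b}" for s using that r_bounds by (intro k_antimono) auto
      thus ?thesis by (force simp: l_def)
    qed
    hence "(\<forall>s\<in>{a..b}. t * l \<le> t * k s) \<or> (\<forall>s\<in>{a..b}. t * k s \<le> t * (- l))"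
      using t_pos by (simp only: mult_le_cancel_left_pos)
    thus "norm (integral {a..b} (\<lambda>s. ec (t * power_phase \<alpha> s))) \<le> 1 / (t * l)"
      using t_pos l_pos by (intro first_derivative_test) auto
  qed
qed

lemma truncated_reciprocals_le:
  fixes a b r :: real
  assumes "0 < r" "a < 1" "1 < b"
  shows "1 + 1 / (1 - max a (1 - r)) + 1 / (min b (1 + r) - 1) \<le> (1 + 2 / r) * (1 + 1 / (1 - a) + 1 / (b - 1))"
proof -
  define X where "X = 1 + 1 / (1 - a) + 1 / (b - 1)"
  have nonneg: "0 \<le> 1 / (1 - a)" "0 \<le> 1 / (b - 1)" "0 \<le> 1 / r" using assms by auto
  hence "1 / (1 - max a (1 - r)) \<le> 1 / (1 - a) + 1 / r" "1 / (min b (1 + r) - 1) \<le> 1 / (b - 1) + 1 / r"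
    by (simp_all add: max_def min_def)
  hence "1 + 1 / (1 - max a (1 - r)) + 1 / (min b (1 + r) - 1) \<le> X + 2 / r * 1" by (simp add: X_def)
  also have "\<dots> \<le> X + 2 / r * X" using nonneg by (intro add_left_mono mult_left_mono) (auto simp: X_def)
  finally show ?thesis by (simp add: X_def distrib_right)
qed

lemma norm_power_phase_integral_diff_le:
  fixes \<alpha> :: real and z :: complex
  assumes "\<alpha> < 1" and pos: "0 < r" "0 < C" "0 < l" "0 < t" and ab_order: "0 < a" "a < 1" "1 < b"
    and near: "\<And>a b. 1 - r \<le> a \<Longrightarrow> a < 1 \<Longrightarrow> 1 < b \<Longrightarrow> b \<le> 1 + r \<Longrightarrow>
      norm (integral {a..b} (\<lambda>s. ec (t * power_phase \<alpha> s)) - z) \<le> C / t * (1 + 1 / (1 - a) + 1 / (b - 1))"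
    and far: "\<And>a b. 0 < a \<Longrightarrow> a \<le> b \<Longrightarrow> b \<le> 1 - r \<or> 1 + r \<le> a \<Longrightarrow>
      norm (integral {a..b} (\<lambda>s. ec (t * power_phase \<alpha> s))) \<le> 1 / (t * l)"
  shows "norm (integral {a..b} (\<lambda>s. ec (t * power_phase \<alpha> s)) - z)
    \<le> (C * (1 + 2 / r) + 2 / l) / t * (1 + 1 / (1 - a) + 1 / (b - 1))"
proof -
  define I where "I = (\<lambda>a b. integral {a..b} (\<lambda>s. ec (t * power_phase \<alpha> s)))"
  define X where "X = 1 + 1 / (1 - a) + 1 / (b - 1)"
  define a' where "a' = max a (1 - r)"
  define b' where "b' = min b (1 + r)"
  have "X \<ge> 1" using ab_order by (simp add: X_def)
  have a'_bounds: "a \<le> a'" "1 - r \<le> a'" "a' < 1" and b'_bounds: "b' \<le> b" "1 < b'" "b' \<le> 1 + r"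
    using ab_order \<open>0 < r\<close> by (auto simp: a'_def b'_def)
  have "(\<lambda>s. ec (t * power_phase \<alpha> s)) integrable_on {a..b}"
    using ab_order
    by (intro concave_phase.integrable_ec_phase[OF concave_phase_power_phase[OF \<open>\<alpha> < 1\<close> \<open>0 < t\<close>]]) auto
  hence "norm (I a b - z) \<le> norm (I a a') + norm (I a' b' - z) + norm (I b' b)"
    unfolding I_def using a'_bounds b'_bounds by (intro norm_integral_three_pieces_le) auto
  also have "\<dots> \<le> 1 / (t * l) + C / t * ((1 + 2 / r) * X) + 1 / (t * l)"
  proof (intro add_mono)
    show "norm (I a a') \<le> 1 / (t * l)"
    proof (cases "a = a'")
      case False
      hence "a' \<le> 1 - r" by (simp add: a'_def)
      thus ?thesis using far[OF ab_order(1) a'_bounds(1)] by (simp add: I_def)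
    qed (use pos in \<open>simp add: I_def\<close>)
    show "norm (I b' b) \<le> 1 / (t * l)"
    proof (cases "b' = b")
      case False
      hence "1 + r \<le> b'" by (simp add: b'_def)
      thus ?thesis using far[OF _ b'_bounds(1)] b'_bounds(2) by (simp add: I_def)
    qed (use pos in \<open>simp add: I_def\<close>)
    have "C / t * (1 + 1 / (1 - a') + 1 / (b' - 1)) \<le> C / t * ((1 + 2 / r) * X)"
      unfolding a'_def b'_def X_def using pos ab_order by (intro mult_left_mono truncated_reciprocals_le) auto
    thus "norm (I a' b' - z) \<le> C / t * ((1 + 2 / r) * X)"
      unfolding I_def using near[OF a'_bounds(2,3) b'_bounds(2,3)] by linarith
  qed
  also have "\<dots> = (C * (1 + 2 / r) * X + 2 / l * 1) / t" using pos by (simp add: field_simps)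
  also have "\<dots> \<le> (C * (1 + 2 / r) * X + 2 / l * X) / t"
    using \<open>X \<ge> 1\<close> pos by (intro divide_right_mono add_left_mono mult_left_mono) auto
  also have "\<dots> = (C * (1 + 2 / r) + 2 / l) / t * X" by (simp add: distrib_right)
  finally show ?thesis by (simp only: I_def X_def)
qed

theorem power_stationary_phase:
  fixes \<alpha> :: real
  assumes \<alpha>_bounds: "\<alpha> < 1" "\<alpha> \<noteq> 0"
  shows "\<exists>C. stationary_phase_bound \<alpha> C"
proof -
  obtain r C where r_bounds: "0 < r" "r < 1" and "0 < C"
    and near: "\<And>t a b. 0 < t \<Longrightarrow> 1 - r \<le> a \<Longrightarrow> a < 1 \<Longrightarrow> 1 < b \<Longrightarrow> b \<le> 1 + r \<Longrightarrow>
       norm (integral {a..b} (\<lambda>s. ec (t * power_phase \<alpha> s)) - stationary_constant \<alpha> / sqrt t)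
         \<le> C / t * (1 + 1 / (1 - a) + 1 / (b - 1))"
    using power_stationary_phase_local[OF \<alpha>_bounds] by blast
  obtain l where "0 < l" and far: "\<And>t a b. 0 < t \<Longrightarrow> 0 < a \<Longrightarrow> a \<le> b \<Longrightarrow> b \<le> 1 - r \<or> 1 + r \<le> a \<Longrightarrow>
       norm (integral {a..b} (\<lambda>s. ec (t * power_phase \<alpha> s))) \<le> 1 / (t * l)"
    using power_phase_integral_far[OF \<alpha>_bounds r_bounds] by blast
  have "0 < C * (1 + 2 / r) + 2 / l"
    using \<open>0 < C\<close> \<open>0 < l\<close> r_bounds by (auto intro!: add_pos_pos mult_pos_pos)
  moreover have "norm (integral {a..b} (\<lambda>s. ec (t * power_phase \<alpha> s)) - stationary_constant \<alpha> / sqrt t)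
      \<le> (C * (1 + 2 / r) + 2 / l) / t * (1 + 1 / (1 - a) + 1 / (b - 1))"
    if "0 < t" "0 < a" "a < 1" "1 < b" for t a b
    by (rule norm_power_phase_integral_diff_le[OF \<alpha>_bounds(1) r_bounds(1) \<open>0 < C\<close> \<open>0 < l\<close> that near[OF \<open>0 < t\<close>]
      far[OF \<open>0 < t\<close>]])
  ultimately show ?thesis unfolding stationary_phase_bound_def by blast
qed

section \<open>Mean values of exponential sums and additive energy\<close>

definition cauchy_weight :: "real \<Rightarrow> real" where
  "cauchy_weight y = 1 / (1 + y\<^sup>2)"

lemma cauchy_weight_nonneg: "0 \<le> cauchy_weight y"
  by (simp add: cauchy_weight_def)

lemma cauchy_weight_le_1: "cauchy_weight y \<le> 1"
  by (simp add: cauchy_weight_def add_pos_nonneg)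

lemma cauchy_weight_antimono:
  assumes "\<bar>x\<bar> \<le> \<bar>y\<bar>"
  shows "cauchy_weight y \<le> cauchy_weight x"
  using assms unfolding cauchy_weight_def abs_le_square_iff by (intro frac_le) (auto intro: add_pos_nonneg)

lemma cauchy_weight_scale:
  assumes "0 < X" "X \<le> X'"
  shows "cauchy_weight (X * y) \<le> (X' / X)\<^sup>2 * cauchy_weight (X' * y)"
proof -
  have "(X / X')\<^sup>2 \<le> 1" using assms by (simp add: power_le_one)
  hence "(X / X')\<^sup>2 * (1 + (X' * y)\<^sup>2) \<le> 1 + (X * y)\<^sup>2"
    using assms by (simp add: distrib_left power_mult_distrib power_divide)
  hence "1 / (1 + (X * y)\<^sup>2) \<le> 1 / ((X / X')\<^sup>2 * (1 + (X' * y)\<^sup>2))"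
    using assms by (intro frac_le) (auto intro!: mult_pos_pos add_pos_nonneg)
  thus ?thesis by (simp add: cauchy_weight_def power_divide)
qed

lemma le_cauchy_weight:
  assumes "x \<le> B" "y \<noteq> 0 \<Longrightarrow> x \<le> B / y\<^sup>2" "0 \<le> B"
  shows "x \<le> 2 * B * cauchy_weight y"
proof (cases "y\<^sup>2 \<le> 1")
  case True
  have "B * (1 + y\<^sup>2) \<le> B * 2" using True assms(3) by (intro mult_left_mono) auto
  hence "B \<le> 2 * B * cauchy_weight y" by (simp add: cauchy_weight_def field_simps add_pos_nonneg)
  thus ?thesis using assms(1) by simp
next
  case False
  hence "y \<noteq> 0" by auto
  have "B * (1 + y\<^sup>2) \<le> B * (2 * y\<^sup>2)" using False assms(3) by (intro mult_left_mono) auto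
  hence "B / y\<^sup>2 \<le> 2 * B * cauchy_weight y"
    using \<open>y \<noteq> 0\<close> by (simp add: cauchy_weight_def field_simps add_pos_nonneg)
  thus ?thesis using assms(2)[OF \<open>y \<noteq> 0\<close>] by simp
qed

lemma norm_sum_ec_square:
  fixes c :: "'a \<Rightarrow> complex" and \<phi> :: "'a \<Rightarrow> real"
  shows "complex_of_real ((norm (\<Sum>p\<in>P. c p * ec (x * \<phi> p)))\<^sup>2)
     = (\<Sum>p\<in>P. \<Sum>p'\<in>P. c p * cnj (c p') * ec (x * (\<phi> p - \<phi> p')))"
proof -
  have "complex_of_real ((norm (\<Sum>p\<in>P. c p * ec (x * \<phi> p)))\<^sup>2)
     = (\<Sum>p\<in>P. c p * ec (x * \<phi> p)) * cnj (\<Sum>p\<in>P. c p * ec (x * \<phi> p))"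
    by (rule complex_norm_square)
  also have "\<dots> = (\<Sum>p\<in>P. \<Sum>p'\<in>P. (c p * ec (x * \<phi> p)) * cnj (c p' * ec (x * \<phi> p')))"
    by (simp add: sum_product)
  also have "\<dots> = (\<Sum>p\<in>P. \<Sum>p'\<in>P. c p * cnj (c p') * ec (x * (\<phi> p - \<phi> p')))"
    by (intro sum.cong refl) (simp add: right_diff_distrib ec_diff mult_ac)
  finally show ?thesis .
qed

lemma tent_cos_has_integral:
  fixes X w :: real
  assumes "X > 0" "w \<noteq> 0"
  shows "((\<lambda>u. (1 - u / X) * cos (w * u)) has_integral (1 - cos (w * X)) / (w\<^sup>2 * X)) {0..X}"
proof -
  define G where "G = (\<lambda>u. (1 - u / X) * sin (w * u) / w - cos (w * u) / (w\<^sup>2 * X))"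
  have "(G has_real_derivative (1 - u / X) * cos (w * u)) (at u within {0..X})" for u
    unfolding G_def using assms by (auto intro!: derivative_eq_intros simp: field_simps power2_eq_square)
  hence "((\<lambda>u. (1 - u / X) * cos (w * u)) has_integral (G X - G 0)) {0..X}"
    using assms by (intro fundamental_theorem_of_calculus)
      (auto simp flip: has_real_derivative_iff_has_vector_derivative)
  moreover have "G X - G 0 = (1 - cos (w * X)) / (w\<^sup>2 * X)"
    using assms by (simp add: G_def diff_divide_distrib)
  ultimately show ?thesis by simp
qed

lemma tent_cos_integral_le:
  fixes X y :: real
  assumes X_pos: "X > 0"
  shows "\<bar>integral {0..X} (\<lambda>u. (1 - u / X) * cos (2 * pi * (u * y)))\<bar> \<le> X * cauchy_weight (X * y)"
proof -
  let ?I = "\<bar>integral {0..X} (\<lambda>u. (1 - u / X) * cos (2 * pi * (u * y)))\<bar>"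
  have "((\<lambda>u. 1 - u / X) has_integral ((X - X\<^sup>2 / (2 * X)) - (0 - 0\<^sup>2 / (2 * X)))) {0..X}"
    by (rule fundamental_theorem_of_calculus)
       (use X_pos in \<open>auto intro!: derivative_eq_intros simp flip: has_real_derivative_iff_has_vector_derivative\<close>)
  hence tent: "((\<lambda>u. 1 - u / X) has_integral X / 2) {0..X}"
    using X_pos by (simp add: power2_eq_square)
  have "norm (integral {0..X} (\<lambda>u. (1 - u / X) * cos (2 * pi * (u * y)))) \<le> integral {0..X} (\<lambda>u. 1 - u / X)"
  proof (rule integral_norm_bound_integral[OF _ has_integral_integrable[OF tent]])
    fix u assume "u \<in> {0..X}"
    hence "0 \<le> 1 - u / X" using X_pos by simp
    thus "norm ((1 - u / X) * cos (2 * pi * (u * y))) \<le> 1 - u / X"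
      by (simp add: abs_mult mult_left_le)
  qed (auto intro!: integrable_continuous_real continuous_intros simp: X_pos[THEN less_imp_neq, symmetric])
  hence trivial: "?I \<le> X / 2" using integral_unique[OF tent] by simp
  have "?I \<le> X / 2 / (X * y)\<^sup>2" if "X * y \<noteq> 0"
  proof -
    have "y \<noteq> 0" using that by auto
    have "?I = \<bar>(1 - cos (2 * pi * y * X)) / ((2 * pi * y)\<^sup>2 * X)\<bar>"
      using integral_unique[OF tent_cos_has_integral[OF X_pos, of "2 * pi * y"]] \<open>y \<noteq> 0\<close>
      by (simp add: mult_ac)
    also have "\<dots> = (1 - cos (2 * pi * y * X)) / ((2 * pi * y)\<^sup>2 * X)" using X_pos by (simp add: abs_of_nonneg)
    also have "\<dots> \<le> 2 / ((2 * 1 * y)\<^sup>2 * X)"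
      using X_pos \<open>y \<noteq> 0\<close> pi_gt3 cos_ge_minus_one[of "2 * pi * y * X"] unfolding power_mult_distrib
      by (intro frac_le mult_right_mono mult_left_mono power_mono) auto
    also have "\<dots> = X / 2 / (X * y)\<^sup>2" using X_pos \<open>y \<noteq> 0\<close> by (simp add: field_simps power2_eq_square)
    finally show ?thesis .
  qed
  from le_cauchy_weight[OF trivial this] show ?thesis using X_pos by simp
qed

lemma tent_integral_le:
  fixes X y :: real
  assumes X_pos: "X > 0"
  shows "norm (integral {-X..X} (\<lambda>u. of_real (1 - \<bar>u\<bar> / X) * ec (u * y))) \<le> 2 * X * cauchy_weight (X * y)"
proof -
  let ?f = "\<lambda>u. complex_of_real (1 - \<bar>u\<bar> / X) * ec (u * y)"
  define J where "J = integral {0..X} (\<lambda>u. (1 - u / X) * cos (2 * pi * (u * y)))"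
  have integrable: "?f integrable_on {a..b}" for a b
    by (intro integrable_continuous_real continuous_intros) (use X_pos in auto)
  have "integral {-X..0} ?f = integral {-X..-0} (\<lambda>u. cnj (?f (- u)))"
    by (simp add: ec_minus)
  also have "\<dots> = integral {0..X} (\<lambda>u. cnj (?f u))"
    by (rule Henstock_Kurzweil_Integration.integral_reflect_real)
  also have "\<dots> = cnj (integral {0..X} ?f)"
    by (rule integral_cnj[symmetric])
  finally have "integral {-X..X} ?f = cnj (integral {0..X} ?f) + integral {0..X} ?f"
    using Henstock_Kurzweil_Integration.integral_combine[of "-X" 0 X ?f] X_pos integrable by simp
  also have "\<dots> = of_real (2 * Re (integral {0..X} ?f))"
    by (simp add: complex_eq_iff)
  also have "Re (integral {0..X} ?f) = integral {0..X} (\<lambda>u. Re (?f u))"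
    by (rule integral_unique[OF has_integral_Re[OF integrable_integral[OF integrable]], symmetric])
  also have "\<dots> = J"
    unfolding J_def by (rule integral_cong) (simp add: Re_ec)
  finally have "norm (integral {-X..X} ?f) = 2 * \<bar>J\<bar>" by (simp add: norm_mult)
  thus ?thesis using tent_cos_integral_le[OF X_pos, of y] by (simp add: J_def)
qed

lemma mean_square_le_tent_mean_square:
  fixes g :: "real \<Rightarrow> real"
  assumes X_pos: "X > 0" and g_props: "\<And>S. continuous_on S g" "\<And>u. 0 \<le> g u"
  shows "integral {-X/2..X/2} g \<le> 2 * integral {-X..X} (\<lambda>u. (1 - \<bar>u\<bar> / X) * g u)"
proof -
  have integrable: "(\<lambda>u. (1 - \<bar>u\<bar> / X) * g u) integrable_on {a..b}" for a b
    by (intro integrable_continuous_real continuous_intros g_props) (use X_pos in auto)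
  have "integral {-X/2..X/2} g \<le> integral {-X/2..X/2} (\<lambda>u. 2 * ((1 - \<bar>u\<bar> / X) * g u))"
  proof (rule integral_le)
    fix u assume "u \<in> {-X/2..X/2}"
    hence "\<bar>u\<bar> / X \<le> 1 / 2" using X_pos by (auto simp: field_simps)
    hence "1 \<le> 2 * (1 - \<bar>u\<bar> / X)" by argo
    from mult_right_mono[OF this g_props(2)[of u]] show "g u \<le> 2 * ((1 - \<bar>u\<bar> / X) * g u)"
      by (simp add: mult_ac)
  qed (use X_pos in \<open>auto intro!: integrable_continuous_real continuous_intros g_props\<close>)
  also have "\<dots> = 2 * integral {-X/2..X/2} (\<lambda>u. (1 - \<bar>u\<bar> / X) * g u)" by simp
  also have "integral {-X/2..X/2} (\<lambda>u. (1 - \<bar>u\<bar> / X) * g u) \<le> integral {-X..X} (\<lambda>u. (1 - \<bar>u\<bar> / X) * g u)"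
    by (rule integral_subset_le) (use X_pos integrable g_props in \<open>auto simp: abs_le_iff intro!: mult_nonneg_nonneg\<close>)
  finally show ?thesis by simp
qed

lemma mean_square_window_centered:
  fixes c :: "'a \<Rightarrow> complex" and \<phi> :: "'a \<Rightarrow> real"
  assumes X_pos: "X > 0"
  shows "integral {-X/2..X/2} (\<lambda>x. (norm (\<Sum>p\<in>P. c p * ec (x * \<phi> p)))\<^sup>2)
     \<le> 4 * X * (\<Sum>p\<in>P. \<Sum>p'\<in>P. norm (c p) * norm (c p') * cauchy_weight (X * (\<phi> p - \<phi> p')))"
proof -
  define g where "g = (\<lambda>x. (norm (\<Sum>p\<in>P. c p * ec (x * \<phi> p)))\<^sup>2)"
  define k where "k = (\<lambda>u. 1 - \<bar>u\<bar> / X)"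
  have continuous: "continuous_on S g" "continuous_on S k" for S
    unfolding g_def k_def using X_pos by (auto intro!: continuous_intros)
  have kg_integrable: "(\<lambda>u. k u * g u) integrable_on {-X..X}"
    by (intro integrable_continuous_real continuous_intros continuous)
  have "integral {-X/2..X/2} g \<le> 2 * integral {-X..X} (\<lambda>u. k u * g u)"
    unfolding k_def by (rule mean_square_le_tent_mean_square[OF X_pos continuous(1)]) (simp add: g_def)
  also have "integral {-X..X} (\<lambda>u. k u * g u) \<le> norm (integral {-X..X} (\<lambda>u. complex_of_real (k u * g u)))"
    by (subst integral_unique[OF has_integral_of_real[OF integrable_integral[OF kg_integrable]]]) simp
  also have "integral {-X..X} (\<lambda>u. complex_of_real (k u * g u))
     = (\<Sum>p\<in>P. \<Sum>p'\<in>P. c p * cnj (c p') * integral {-X..X} (\<lambda>u. of_real (k u) * ec (u * (\<phi> p - \<phi> p'))))"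
  proof -
    have "complex_of_real (k u * g u) =
        (\<Sum>p\<in>P. \<Sum>p'\<in>P. c p * cnj (c p') * (of_real (k u) * ec (u * (\<phi> p - \<phi> p'))))" for u
      unfolding g_def of_real_mult norm_sum_ec_square by (simp add: sum_distrib_left mult_ac)
    hence "integral {-X..X} (\<lambda>u. complex_of_real (k u * g u))
        = integral {-X..X} (\<lambda>u. \<Sum>p\<in>P. \<Sum>p'\<in>P. c p * cnj (c p') * (of_real (k u) * ec (u * (\<phi> p - \<phi> p'))))"
      by simp
    also have "\<dots> = (\<Sum>p\<in>P. \<Sum>p'\<in>P. c p * cnj (c p')
        * integral {-X..X} (\<lambda>u. of_real (k u) * ec (u * (\<phi> p - \<phi> p'))))"
      by (cases "finite P") (simp_all add: integral_sum integrable_continuous_real continuous_intros continuous)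
    finally show ?thesis .
  qed
  also have "norm \<dots> \<le> (\<Sum>p\<in>P. \<Sum>p'\<in>P. norm (c p) * norm (c p') * (2 * X * cauchy_weight (X * (\<phi> p - \<phi> p'))))"
    unfolding k_def
    by (intro sum_norm_le) (simp only: norm_mult complex_mod_cnj, intro mult_left_mono tent_integral_le X_pos, simp)
  also have "2 * \<dots> = 4 * X * (\<Sum>p\<in>P. \<Sum>p'\<in>P. norm (c p) * norm (c p') * cauchy_weight (X * (\<phi> p - \<phi> p')))"
    by (simp add: sum_distrib_left mult_ac)
  finally show ?thesis by (simp add: g_def)
qed

lemma mean_square_window:
  fixes c :: "'a \<Rightarrow> complex" and \<phi> :: "'a \<Rightarrow> real"
  assumes X_pos: "X > 0"
  shows "integral {X0..X0+X} (\<lambda>x. (norm (\<Sum>p\<in>P. c p * ec (x * \<phi> p)))\<^sup>2)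
     \<le> 4 * X * (\<Sum>p\<in>P. \<Sum>p'\<in>P. norm (c p) * norm (c p') * cauchy_weight (X * (\<phi> p - \<phi> p')))"
proof -
  define m where "m = X0 + X / 2"
  have endpoints: "X0 - m = -X/2" "X0 + X - m = X/2" by (simp_all add: m_def)
  have "integral {X0..X0+X} (\<lambda>x. (norm (\<Sum>p\<in>P. c p * ec (x * \<phi> p)))\<^sup>2)
     = integral {X0 - m..X0 + X - m} (\<lambda>x. (norm (\<Sum>p\<in>P. c p * ec ((x + m) * \<phi> p)))\<^sup>2)"
    by (rule integral_shift_real_ivl[symmetric])
  also have "\<dots> = integral {-X/2..X/2} (\<lambda>x. (norm (\<Sum>p\<in>P. (c p * ec (m * \<phi> p)) * ec (x * \<phi> p)))\<^sup>2)"
    unfolding endpoints distrib_right ec_add by (simp only: mult_ac)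
  also have "\<dots> \<le> 4 * X * (\<Sum>p\<in>P. \<Sum>p'\<in>P. norm (c p * ec (m * \<phi> p)) * norm (c p' * ec (m * \<phi> p'))
      * cauchy_weight (X * (\<phi> p - \<phi> p')))"
    by (rule mean_square_window_centered[OF X_pos])
  finally show ?thesis by (simp add: norm_mult)
qed

lemma sin_le_taylor:
  fixes x :: real
  assumes "0 \<le> x"
  shows "sin x \<le> x - x ^ 3 / 6 + x ^ 5 / 120"
proof -
  have "(\<Sum>m<5. h m) = h 0 + h 1 + h 2 + h 3 + h 4" for h :: "nat \<Rightarrow> real"
    by (simp add: eval_nat_numeral)
  hence "(\<Sum>m<5. sin_coeff m * x ^ m) = x - x ^ 3 / 6"
    by (simp add: sin_coeff_def fact_numeral)
  moreover have "\<bar>sin x - (\<Sum>m<5. sin_coeff m * x ^ m)\<bar> \<le> inverse (fact 5) * \<bar>x\<bar> ^ 5"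
    by (rule Maclaurin_sin_bound)
  ultimately have "\<bar>sin x - (x - x ^ 3 / 6)\<bar> \<le> x ^ 5 / 120"
    using assms by (simp add: fact_numeral)
  thus ?thesis by linarith
qed

lemma one_minus_sinc_ge:
  fixes x :: real
  assumes "0 < x" "x \<le> 2"
  shows "x\<^sup>2 / 10 \<le> 1 - sin x / x"
proof -
  have "sin x / x \<le> (x - x ^ 3 / 6 + x ^ 5 / 120) / x"
    using sin_le_taylor[of x] assms by (intro divide_right_mono) auto
  also have "\<dots> = 1 - x\<^sup>2 / 6 + x\<^sup>2 * x\<^sup>2 / 120" using assms by (simp add: field_simps eval_nat_numeral)
  finally have "x\<^sup>2 / 6 - x\<^sup>2 * x\<^sup>2 / 120 \<le> 1 - sin x / x" by simp
  moreover have "x\<^sup>2 * x\<^sup>2 \<le> x\<^sup>2 * 2\<^sup>2"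
    using assms by (intro mult_left_mono power_mono) auto
  hence "x\<^sup>2 * x\<^sup>2 \<le> x\<^sup>2 * 4" by simp
  moreover have "0 \<le> x\<^sup>2" by simp
  ultimately show ?thesis by argo
qed

lemma cauchy_weight_le_sinc_defect:
  fixes x :: real
  assumes "x \<noteq> 0"
  shows "cauchy_weight (x / (2 * pi)) / 40 \<le> 2 / x\<^sup>2 * (1 - sin x / x)"
proof (cases "\<bar>x\<bar> \<ge> 2")
  case True
  have "\<bar>sin x / x\<bar> \<le> 1 / 2"
    unfolding abs_divide by (rule frac_le) (use True in auto)
  hence "1 - sin x / x \<ge> 1 / 2" by linarith
  hence "2 / x\<^sup>2 * (1 / 2) \<le> 2 / x\<^sup>2 * (1 - sin x / x)" by (intro mult_left_mono) auto
  moreover have "cauchy_weight (x / (2 * pi)) / 40 \<le> 1 / x\<^sup>2"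
    unfolding cauchy_weight_def divide_divide_eq_left
  proof (rule frac_le)
    have "pi\<^sup>2 \<le> 3.15\<^sup>2" using pi_approx by (intro power_mono) auto
    hence "(2 * pi)\<^sup>2 \<le> 40" by (simp add: power_mult_distrib power2_eq_square)
    hence "x\<^sup>2 / 40 \<le> (x / (2 * pi))\<^sup>2"
      unfolding power_divide by (intro divide_left_mono) auto
    thus "x\<^sup>2 \<le> (1 + (x / (2 * pi))\<^sup>2) * 40" by simp
  qed (use assms in auto)
  ultimately show ?thesis by argo
next
  case False
  have even: "2 / x\<^sup>2 * (1 - sin x / x) = 2 / \<bar>x\<bar>\<^sup>2 * (1 - sin \<bar>x\<bar> / \<bar>x\<bar>)"
    by (auto simp: abs_if)
  have "2 / \<bar>x\<bar>\<^sup>2 * (\<bar>x\<bar>\<^sup>2 / 10) \<le> 2 / x\<^sup>2 * (1 - sin x / x)"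
    unfolding even using False assms by (intro mult_left_mono one_minus_sinc_ge) auto
  hence "1 / 5 \<le> 2 / x\<^sup>2 * (1 - sin x / x)" using assms by simp
  thus ?thesis using cauchy_weight_le_1[of "x / (2 * pi)"] by argo
qed

lemma quadratic_kernel_integral_ge:
  fixes X y :: real
  assumes X_pos: "X > 0"
  shows "X / 40 * cauchy_weight (X * y) \<le> integral {0..X} (\<lambda>x. (1 - x / X)\<^sup>2 * cos (2 * pi * (x * y)))"
proof (cases "y = 0")
  case True
  have "((\<lambda>x. (1 - x / X)\<^sup>2) has_integral ((- X / 3 * (1 - X / X) ^ 3) - (- X / 3 * (1 - 0 / X) ^ 3))) {0..X}"
    by (rule fundamental_theorem_of_calculus)
       (use X_pos in \<open>auto intro!: derivative_eq_intros simp: power2_eq_square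
          simp flip: has_real_derivative_iff_has_vector_derivative\<close>)
  hence "integral {0..X} (\<lambda>x. (1 - x / X)\<^sup>2) = X / 3" using X_pos by (simp add: integral_unique)
  thus ?thesis using True X_pos by (simp add: cauchy_weight_def)
next
  case False
  define w where "w = 2 * pi * y"
  have w_bounds: "w \<noteq> 0" "w * X \<noteq> 0" using False X_pos by (auto simp: w_def)
  define G
    where "G = (\<lambda>x. (1 - x / X)\<^sup>2 * sin (w * x) / w - 2 * (1 - x / X) * cos (w * x) / (w\<^sup>2 * X)
        - 2 * sin (w * x) / (w ^ 3 * X\<^sup>2))"
  have "(G has_real_derivative (1 - x / X)\<^sup>2 * cos (w * x)) (at x within {0..X})" for x
    unfolding G_def using X_pos w_bounds
    by (auto intro!: derivative_eq_intros simp: field_simps power2_eq_square power3_eq_cube)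
  hence "((\<lambda>x. (1 - x / X)\<^sup>2 * cos (w * x)) has_integral (G X - G 0)) {0..X}"
    using X_pos by (intro fundamental_theorem_of_calculus)
      (auto simp flip: has_real_derivative_iff_has_vector_derivative)
  hence "integral {0..X} (\<lambda>x. (1 - x / X)\<^sup>2 * cos (2 * pi * (x * y))) = G X - G 0"
    by (simp add: integral_unique w_def mult_ac)
  also have "G X - G 0 = X * (2 / (w * X)\<^sup>2 * (1 - sin (w * X) / (w * X)))"
    using X_pos w_bounds by (simp add: G_def field_simps power2_eq_square power3_eq_cube)
  also have "\<dots> \<ge> X * (cauchy_weight (w * X / (2 * pi)) / 40)"
    using X_pos w_bounds by (intro mult_left_mono cauchy_weight_le_sinc_defect) auto
  finally show ?thesis by (simp add: w_def mult_ac)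
qed

lemma mean_square_lower:
  fixes \<phi> :: "'a \<Rightarrow> real"
  assumes X_pos: "X > 0"
  shows "(\<Sum>p\<in>P. \<Sum>p'\<in>P. cauchy_weight (X * (\<phi> p - \<phi> p')))
     \<le> 40 / X * integral {0..X} (\<lambda>x. (norm (\<Sum>p\<in>P. ec (x * \<phi> p)))\<^sup>2)"
proof (cases "finite P")
  case True
  define g where "g = (\<lambda>x. (norm (\<Sum>p\<in>P. ec (x * \<phi> p)))\<^sup>2)"
  have continuous_g: "continuous_on S g" for S unfolding g_def by (intro continuous_intros)
  have g_eq: "g x = (\<Sum>p\<in>P. \<Sum>p'\<in>P. cos (2 * pi * (x * (\<phi> p - \<phi> p'))))" for x
  proof -
    have "complex_of_real (g x) = (\<Sum>p\<in>P. \<Sum>p'\<in>P. ec (x * (\<phi> p - \<phi> p')))"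
      using norm_sum_ec_square[of "\<lambda>_. 1" x \<phi> P] by (simp add: g_def)
    hence "g x = Re (\<Sum>p\<in>P. \<Sum>p'\<in>P. ec (x * (\<phi> p - \<phi> p')))" by (metis Re_complex_of_real)
    thus ?thesis by (simp add: Re_ec)
  qed
  have "X / 40 * (\<Sum>p\<in>P. \<Sum>p'\<in>P. cauchy_weight (X * (\<phi> p - \<phi> p')))
      \<le> (\<Sum>p\<in>P. \<Sum>p'\<in>P. integral {0..X} (\<lambda>x. (1 - x / X)\<^sup>2 * cos (2 * pi * (x * (\<phi> p - \<phi> p')))))"
    unfolding sum_distrib_left by (intro sum_mono quadratic_kernel_integral_ge X_pos)
  also have "\<dots> = integral {0..X} (\<lambda>x. (1 - x / X)\<^sup>2 * g x)"
    using X_pos True unfolding g_eq sum_distrib_left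
    by (subst integral_sum, auto intro!: integrable_continuous_real continuous_intros sum.cong)
       (subst integral_sum, auto intro!: integrable_continuous_real continuous_intros)
  also have "\<dots> \<le> integral {0..X} g"
  proof (rule integral_le)
    fix x assume "x \<in> {0..X}"
    hence "(1 - x / X)\<^sup>2 \<le> 1\<^sup>2" using X_pos by (intro power_mono) (auto simp: field_simps)
    from mult_right_mono[OF this, of "g x"] show "(1 - x / X)\<^sup>2 * g x \<le> g x" by (simp add: g_def)
  qed (use X_pos in \<open>auto intro!: integrable_continuous_real continuous_intros continuous_g\<close>)
  finally show ?thesis using X_pos by (simp add: g_def field_simps)
qed simp

definition pair_sum :: "('a \<Rightarrow> real) \<Rightarrow> 'a \<times> 'a \<Rightarrow> real" where
  "pair_sum \<phi> p = \<phi> (fst p) + \<phi> (snd p)"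

text \<open>A smooth version of the number of \<open>a, b, c, d \<in> I\<close> with \<open>|\<phi> a + \<phi> b - \<phi> c - \<phi> d| \<le> 1 / X\<close>.\<close>
definition additive_energy :: "('a \<Rightarrow> real) \<Rightarrow> 'a set \<Rightarrow> real \<Rightarrow> real" where
  "additive_energy \<phi> I X = (\<Sum>p\<in>I \<times> I. \<Sum>p'\<in>I \<times> I. cauchy_weight (X * (pair_sum \<phi> p - pair_sum \<phi> p')))"

lemma sum_ec_power2:
  "(\<Sum>n\<in>I. c n * ec (x * \<phi> n))\<^sup>2 = (\<Sum>p\<in>I \<times> I. (c (fst p) * c (snd p)) * ec (x * pair_sum \<phi> p))"
  unfolding power2_eq_square sum_product sum.cartesian_product
  by (intro sum.cong refl) (auto simp: pair_sum_def distrib_left ec_add mult_ac)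

lemma norm_power4: "norm (z::complex) ^ 4 = (norm (z\<^sup>2))\<^sup>2"
  by (simp add: norm_power flip: power_mult)

lemma fourth_moment_window:
  fixes c :: "'a \<Rightarrow> complex" and \<phi> :: "'a \<Rightarrow> real"
  assumes X_pos: "X > 0" and norm_c_le: "\<And>n. n \<in> I \<Longrightarrow> norm (c n) \<le> K"
  shows "integral {X0..X0+X} (\<lambda>x. norm (\<Sum>n\<in>I. c n * ec (x * \<phi> n)) ^ 4) \<le> 4 * X * K ^ 4 * additive_energy \<phi> I X"
proof -
  have norm_cc_le: "norm (c (fst p) * c (snd p)) \<le> K\<^sup>2" if "p \<in> I \<times> I" for p
    unfolding norm_mult power2_eq_square
    using that order_trans[OF norm_ge_zero norm_c_le]
    by (intro mult_mono norm_c_le) (auto simp: mem_Times_iff)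
  have "integral {X0..X0+X} (\<lambda>x. norm (\<Sum>n\<in>I. c n * ec (x * \<phi> n)) ^ 4)
     \<le> 4 * X * (\<Sum>p\<in>I \<times> I. \<Sum>p'\<in>I \<times> I. norm (c (fst p) * c (snd p)) * norm (c (fst p') * c (snd p'))
         * cauchy_weight (X * (pair_sum \<phi> p - pair_sum \<phi> p')))"
    unfolding norm_power4 sum_ec_power2 by (rule mean_square_window[OF X_pos])
  also have "\<dots> \<le> 4 * X * (\<Sum>p\<in>I \<times> I. \<Sum>p'\<in>I \<times> I. (K\<^sup>2 * K\<^sup>2)
      * cauchy_weight (X * (pair_sum \<phi> p - pair_sum \<phi> p')))"
    using X_pos
    by (intro mult_left_mono sum_mono mult_right_mono mult_mono norm_cc_le cauchy_weight_nonneg) auto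
  also have "\<dots> = 4 * X * K ^ 4 * additive_energy \<phi> I X"
    unfolding additive_energy_def sum_distrib_left[symmetric] by (simp add: eval_nat_numeral mult_ac)
  finally show ?thesis .
qed

lemma additive_energy_le_fourth_moment:
  assumes X_pos: "X > 0"
  shows "additive_energy \<phi> I X \<le> 40 / X * integral {0..X} (\<lambda>x. norm (\<Sum>n\<in>I. ec (x * \<phi> n)) ^ 4)"
proof -
  have "(\<Sum>n\<in>I. ec (x * \<phi> n))\<^sup>2 = (\<Sum>p\<in>I \<times> I. ec (x * pair_sum \<phi> p))" for x
    using sum_ec_power2[of "\<lambda>_. 1" x \<phi> I] by simp
  thus ?thesis
    unfolding additive_energy_def norm_power4
    using mean_square_lower[OF X_pos, of "pair_sum \<phi>" "I \<times> I"] by simp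
qed

lemma additive_energy_nonneg: "additive_energy \<phi> I X \<ge> 0"
  unfolding additive_energy_def by (intro sum_nonneg cauchy_weight_nonneg)

lemma additive_energy_antimono:
  assumes "0 \<le> X" "X \<le> X'"
  shows "additive_energy \<phi> I X' \<le> additive_energy \<phi> I X"
  unfolding additive_energy_def
  using assms by (intro sum_mono cauchy_weight_antimono) (simp add: abs_mult mult_right_mono)

lemma additive_energy_scale:
  assumes "0 < X" "X \<le> X'"
  shows "additive_energy \<phi> I X \<le> (X' / X)\<^sup>2 * additive_energy \<phi> I X'"
  unfolding additive_energy_def sum_distrib_left by (intro sum_mono cauchy_weight_scale assms)

lemma additive_energy_le_card: "additive_energy \<phi> I X \<le> real (card I) ^ 4"
proof -
  have "additive_energy \<phi> I X \<le> (\<Sum>p\<in>I \<times> I. \<Sum>p'\<in>I \<times> I. 1)"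
    unfolding additive_energy_def by (intro sum_mono cauchy_weight_le_1)
  also have "\<dots> = real (card I) ^ 4" by (simp add: card_cartesian_product eval_nat_numeral)
  finally show ?thesis .
qed

lemma sum_additive_energy_disjoint_le:
  assumes fin: "finite I" "finite L" and sub: "\<And>l. l \<in> L \<Longrightarrow> B l \<subseteq> I"
    and disjoint: "\<And>l l'. l \<in> L \<Longrightarrow> l' \<in> L \<Longrightarrow> l \<noteq> l' \<Longrightarrow> B l \<inter> B l' = {}"
  shows "(\<Sum>l\<in>L. additive_energy \<phi> (B l) X) \<le> additive_energy \<phi> I X"
proof -
  define f where "f = (\<lambda>q. cauchy_weight (X * (pair_sum \<phi> (fst q) - pair_sum \<phi> (snd q))))"
  have energy_eq: "additive_energy \<phi> S X = sum f ((S \<times> S) \<times> (S \<times> S))" for S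
    unfolding additive_energy_def f_def by (subst sum.cartesian_product) (simp add: case_prod_unfold)
  have finite_B: "finite (B l)" if "l \<in> L" for l using sub[OF that] fin finite_subset by blast
  have "(\<Sum>l\<in>L. additive_energy \<phi> (B l) X) = sum f (\<Union>l\<in>L. (B l \<times> B l) \<times> (B l \<times> B l))"
    unfolding energy_eq
  proof (rule sum.UNION_disjoint[symmetric])
    show "\<forall>i\<in>L. \<forall>j\<in>L. i \<noteq> j \<longrightarrow> (B i \<times> B i) \<times> B i \<times> B i \<inter> (B j \<times> B j) \<times> B j \<times> B j = {}"
      using disjoint by blast
  qed (use fin finite_B in auto)
  also have "\<dots> \<le> sum f ((I \<times> I) \<times> (I \<times> I))"
  proof (rule sum_mono2)
    show "(\<Union>l\<in>L. (B l \<times> B l) \<times> (B l \<times> B l)) \<subseteq> (I \<times> I) \<times> (I \<times> I)" using sub by blast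
  qed (use fin in \<open>auto simp: f_def cauchy_weight_nonneg\<close>)
  finally show ?thesis by (simp only: energy_eq)
qed

lemma additive_energy_mono:
  assumes "finite I" "B \<subseteq> I"
  shows "additive_energy \<phi> B X \<le> additive_energy \<phi> I X"
  using sum_additive_energy_disjoint_le[of I "{()}" "\<lambda>_. B" \<phi> X] assms by simp

section \<open>The Rademacher--Menshov inequality\<close>

lemma sum_power4_le:
  fixes x :: "'a \<Rightarrow> real"
  shows "(\<Sum>a\<in>A. x a) ^ 4 \<le> real (card A) ^ 3 * (\<Sum>a\<in>A. x a ^ 4)"
proof -
  have cauchy_schwarz: "(\<Sum>a\<in>A. y a)\<^sup>2 \<le> real (card A) * (\<Sum>a\<in>A. (y a)\<^sup>2)" for y :: "'a \<Rightarrow> real"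
    using sum_squared_le_sum_of_squares[of y A] by (simp add: mult.commute)
  have "(\<Sum>a\<in>A. x a) ^ 4 = ((\<Sum>a\<in>A. x a)\<^sup>2)\<^sup>2" by simp
  also have "\<dots> \<le> (real (card A) * (\<Sum>a\<in>A. (x a)\<^sup>2))\<^sup>2" by (intro power_mono cauchy_schwarz) auto
  also have "\<dots> = real (card A) ^ 2 * (\<Sum>a\<in>A. (x a)\<^sup>2)\<^sup>2" by (simp add: power_mult_distrib)
  also have "\<dots> \<le> real (card A) ^ 2 * (real (card A) * (\<Sum>a\<in>A. ((x a)\<^sup>2)\<^sup>2))"
    by (intro mult_left_mono cauchy_schwarz) auto
  also have "\<dots> = real (card A) ^ 3 * (\<Sum>a\<in>A. x a ^ 4)" by (simp add: eval_nat_numeral mult_ac)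
  finally show ?thesis .
qed

lemma norm_diff_power4_le:
  fixes a b :: complex
  shows "norm (a - b) ^ 4 \<le> 8 * (norm a ^ 4 + norm b ^ 4)"
proof -
  have "norm (a - b) ^ 4 \<le> (norm a + norm b) ^ 4" by (intro power_mono norm_triangle_ineq4) auto
  also have "\<dots> \<le> 8 * (norm a ^ 4 + norm b ^ 4)"
    using sum_power4_le[of "\<lambda>i. if i then norm a else norm b" "{True, False}"] by simp
  finally show ?thesis .
qed

definition dyadic_moment :: "nat \<Rightarrow> nat \<Rightarrow> (nat \<Rightarrow> complex) \<Rightarrow> real" where
  "dyadic_moment k j z = (\<Sum>l<2^(k-j). norm (\<Sum>i\<in>{l*2^j..<(l+1)*2^j}. z i) ^ 4)"

lemma dyadic_moment_nonneg: "dyadic_moment k j z \<ge> 0"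
  unfolding dyadic_moment_def by (intro sum_nonneg) auto

lemma dyadic_moment_Suc:
  assumes "j \<le> k"
  shows "dyadic_moment (Suc k) j z = dyadic_moment k j z + dyadic_moment k j (\<lambda>i. z (i + 2^k))"
proof -
  define a where "a = (2::nat)^(k-j)"
  have blocks: "(2::nat) ^ (Suc k - j) = a + a" using assms by (simp add: a_def Suc_diff_le mult_2)
  have a_mult: "a * 2^j = 2^k" using assms by (simp add: a_def flip: power_add)
  have halves: "(\<Sum>l<a+a. h l) = (\<Sum>l<a. h l) + (\<Sum>l<a. h (l + a))" for h :: "nat \<Rightarrow> real"
    by (simp add: lessThan_atLeast0 sum.atLeastLessThan_concat[of 0 a "a+a", symmetric]
         sum.shift_bounds_nat_ivl[of h 0 a a, simplified, symmetric])
  have shift: "(\<Sum>i\<in>{(l+a)*2^j..<(l+a+1)*2^j}. z i) = (\<Sum>i\<in>{l*2^j..<(l+1)*2^j}. z (i + 2^k))" for l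
    using sum.shift_bounds_nat_ivl[of z "l*2^j" "2^k" "(l+1)*2^j"] a_mult
    by (simp add: distrib_right algebra_simps)
  show ?thesis unfolding dyadic_moment_def blocks halves shift by (simp add: a_def)
qed

lemma norm_partial_sum_le_dyadic_moments:
  fixes z :: "nat \<Rightarrow> complex"
  assumes "p < 2 ^ k"
  shows "norm (\<Sum>i<p. z i) \<le> (\<Sum>j<k. root 4 (dyadic_moment k j z))"
  using assms
proof (induction k arbitrary: p z)
  case (Suc k)
  have le_Suc: "(\<Sum>j<k. root 4 (dyadic_moment k j z)) \<le> (\<Sum>j<k. root 4 (dyadic_moment (Suc k) j z))"
    "(\<Sum>j<k. root 4 (dyadic_moment k j (\<lambda>i. z (i + 2^k)))) \<le> (\<Sum>j<k. root 4 (dyadic_moment (Suc k) j z))"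
    by (intro sum_mono; simp add: dyadic_moment_Suc dyadic_moment_nonneg)+
  show ?case
  proof (cases "p < 2 ^ k")
    case True
    have "0 \<le> root 4 (dyadic_moment (Suc k) k z)" by (simp add: dyadic_moment_nonneg)
    thus ?thesis using Suc.IH[OF True, of z] le_Suc(1) unfolding sum.lessThan_Suc by linarith
  next
    case False
    define p' where "p' = p - 2^k"
    have p_split: "p = p' + 2^k" "p' < 2^k" using False Suc.prems by (auto simp: p'_def)
    have "(\<Sum>i<p. z i) = (\<Sum>i<2^k. z i) + (\<Sum>i<p'. z (i + 2^k))"
      unfolding p_split(1) lessThan_atLeast0
      using sum.atLeastLessThan_concat[of 0 "2^k" "p' + 2^k" z] sum.shift_bounds_nat_ivl[of z 0 "2^k" p']
      by simp
    hence "norm (\<Sum>i<p. z i) \<le> norm (\<Sum>i<2^k. z i) + norm (\<Sum>i<p'. z (i + 2^k))"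
      by (simp add: norm_triangle_ineq)
    also have "norm (\<Sum>i<p'. z (i + 2^k)) \<le> (\<Sum>j<k. root 4 (dyadic_moment (Suc k) j z))"
      using Suc.IH[OF p_split(2), of "\<lambda>i. z (i + 2^k)"] le_Suc(2) by simp
    also have "norm (\<Sum>i<2^k. z i) \<le> root 4 (dyadic_moment (Suc k) k z)"
    proof -
      have "norm (\<Sum>i<2^k. z i) = root 4 (dyadic_moment k k z)"
        by (simp add: dyadic_moment_def lessThan_atLeast0 real_root_power_cancel)
      also have "\<dots> \<le> root 4 (dyadic_moment (Suc k) k z)"
        by (simp add: dyadic_moment_Suc dyadic_moment_nonneg)
      finally show ?thesis .
    qed
    finally show ?thesis by simp
  qed
qed simp

theorem rademacher_menshov:
  fixes z :: "nat \<Rightarrow> complex"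
  assumes "p \<le> 2 ^ k"
  shows "norm (\<Sum>i<p. z i) ^ 4 \<le> real (k + 1) ^ 3 * (\<Sum>j\<le>k. dyadic_moment k j z)"
proof (cases "p = 2^k")
  case True
  have "norm (\<Sum>i<p. z i) ^ 4 = dyadic_moment k k z" by (simp add: True dyadic_moment_def lessThan_atLeast0)
  also have "\<dots> \<le> 1 * (\<Sum>j\<le>k. dyadic_moment k j z)"
    using member_le_sum[of k "{..k}" "\<lambda>j. dyadic_moment k j z"] by (simp add: dyadic_moment_nonneg)
  also have "\<dots> \<le> real (k + 1) ^ 3 * (\<Sum>j\<le>k. dyadic_moment k j z)"
    by (intro mult_right_mono one_le_power sum_nonneg dyadic_moment_nonneg) auto
  finally show ?thesis .
next
  case False
  hence "norm (\<Sum>i<p. z i) \<le> (\<Sum>j<k. root 4 (dyadic_moment k j z))"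
    using assms by (intro norm_partial_sum_le_dyadic_moments) auto
  hence "norm (\<Sum>i<p. z i) ^ 4 \<le> (\<Sum>j<k. root 4 (dyadic_moment k j z)) ^ 4" by (intro power_mono) auto
  also have "\<dots> \<le> real (card {..<k}) ^ 3 * (\<Sum>j<k. root 4 (dyadic_moment k j z) ^ 4)" by (rule sum_power4_le)
  also have "\<dots> = real k ^ 3 * (\<Sum>j<k. dyadic_moment k j z)" by (simp add: dyadic_moment_nonneg)
  also have "\<dots> \<le> real (k + 1) ^ 3 * (\<Sum>j\<le>k. dyadic_moment k j z)"
    by (intro mult_mono power_mono sum_mono2 sum_nonneg) (auto simp: dyadic_moment_nonneg)
  finally show ?thesis .
qed

section \<open>The van der Corput B-process for power sums\<close>

definition dual_exponent :: "real \<Rightarrow> real" where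
  "dual_exponent \<alpha> = \<alpha> / (\<alpha> - 1)"

definition dual_coeff :: "real \<Rightarrow> real \<Rightarrow> real" where
  "dual_coeff \<alpha> x = (1 - \<alpha>) * \<bar>\<alpha>\<bar> powr (\<alpha> / (1 - \<alpha>)) * x powr (1 / (1 - \<alpha>))"

text \<open>
  For \<open>y\<close> between \<open>N / 2\<close> and \<open>2 N\<close>, the first derivative of the phase \<open>x y\<^sup>\<alpha>\<close> lies between
  \<open>slope_min \<alpha>\<close> and \<open>slope_max \<alpha>\<close> times \<open>x N\<^sup>\<alpha> / N\<close>, and the second derivative between
  \<open>curvature_min \<alpha>\<close> and \<open>curvature_max \<alpha>\<close> times \<open>x N\<^sup>\<alpha> / N\<^sup>2\<close>, up to sign.
\<close>
definition slope_min :: "real \<Rightarrow> real" where "slope_min \<alpha> = \<bar>\<alpha>\<bar> * 2 powr (\<alpha> - 1)"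
definition slope_max :: "real \<Rightarrow> real" where "slope_max \<alpha> = \<bar>\<alpha>\<bar> * 2 powr (1 - \<alpha>)"
definition curvature_min :: "real \<Rightarrow> real" where "curvature_min \<alpha> = \<bar>\<alpha>\<bar> * (1 - \<alpha>) * 2 powr (\<alpha> - 2)"
definition curvature_max :: "real \<Rightarrow> real" where "curvature_max \<alpha> = \<bar>\<alpha>\<bar> * (1 - \<alpha>) * 2 powr (2 - \<alpha>)"

lemma powr_comparable:
  fixes y M s :: real
  assumes "0 < M" "M / 2 \<le> y" "y \<le> 2 * M" "s \<le> 0"
  shows "2 powr s * M powr s \<le> y powr s" "y powr s \<le> 2 powr (- s) * M powr s"
proof -
  have "(2 * M) powr s \<le> y powr s" using assms by (intro powr_mono2') auto
  thus "2 powr s * M powr s \<le> y powr s" using assms by (simp add: powr_mult)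
  have "y powr s \<le> (M / 2) powr s" using assms by (intro powr_mono2') auto
  also have "\<dots> = 2 powr (- s) * M powr s" using assms by (simp add: powr_divide powr_minus_divide)
  finally show "y powr s \<le> 2 powr (- s) * M powr s" .
qed

locale power_sum =
  fixes \<alpha> x C :: real and N :: nat
  assumes \<alpha>_lt_1: "\<alpha> < 1" and \<alpha>_nonzero: "\<alpha> \<noteq> 0" and x_pos: "0 < x" and N_ge_1: "1 \<le> N"
    and stationary: "stationary_phase_bound \<alpha> C"
begin

definition T :: real where "T = x * real N powr \<alpha>"
definition phase :: "real \<Rightarrow> real" where "phase y = sgn \<alpha> * x * y powr \<alpha>"
definition phase' :: "real \<Rightarrow> real" where "phase' y = \<bar>\<alpha>\<bar> * x * y powr (\<alpha> - 1)"
definition phase'' :: "real \<Rightarrow> real" where "phase'' y = - (\<bar>\<alpha>\<bar> * (1 - \<alpha>) * x * y powr (\<alpha> - 2))"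
definition lo :: real where "lo = real N - 1/2"
definition hi :: real where "hi = real (2 * N) - 1/2"

lemma N_pos: "0 < real N"
  using N_ge_1 by simp

lemma T_pos: "T > 0"
  using x_pos N_pos by (simp add: T_def)

lemma C_pos: "C > 0"
  using stationary by (simp add: stationary_phase_bound_def)

lemma lo_hi_bounds: "real N / 2 \<le> lo" "lo < hi" "hi \<le> 2 * real N" "0 < lo" "0 < hi"
  using N_ge_1 by (auto simp: lo_def hi_def)

lemma phase_has_derivative:
  assumes "y > 0"
  shows "(phase has_real_derivative phase' y) (at y)"
proof -
  have "(phase has_real_derivative sgn \<alpha> * x * (\<alpha> * y powr (\<alpha> - 1))) (at y)"
    unfolding phase_def[abs_def] using assms by (auto intro!: derivative_eq_intros)
  moreover have "sgn \<alpha> * x * (\<alpha> * y powr (\<alpha> - 1)) = phase' y"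
    unfolding phase'_def sgn_mult_self[symmetric] by (simp add: mult_ac)
  ultimately show ?thesis by simp
qed

lemma phase'_has_derivative:
  assumes "y > 0"
  shows "(phase' has_real_derivative phase'' y) (at y)"
proof -
  have "(phase' has_real_derivative \<bar>\<alpha>\<bar> * x * ((\<alpha> - 1) * y powr (\<alpha> - 1 - 1))) (at y)"
    unfolding phase'_def[abs_def] using assms by (auto intro!: derivative_eq_intros)
  moreover have "\<bar>\<alpha>\<bar> * x * ((\<alpha> - 1) * y powr (\<alpha> - 1 - 1)) = phase'' y"
    unfolding phase''_def by (simp add: algebra_simps)
  ultimately show ?thesis by simp
qed

sublocale half_integer_phase phase phase' phase'' N "2 * N"
proof (unfold half_integer_phase_def, fold lo_def hi_def, unfold_locales)
  show "phase'' y \<le> 0" for y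
    using \<alpha>_lt_1 x_pos by (simp add: phase''_def)
  show "continuous_on {lo..hi} phase''"
    unfolding phase''_def[abs_def] using lo_hi_bounds by (intro continuous_intros) auto
qed (use lo_hi_bounds phase_has_derivative phase'_has_derivative in auto)

lemma poisson_term_eq: "poisson_term m = integral {lo..hi} (\<lambda>y. ec (phase y - of_int m * y))"
  by (simp only: poisson_term_def lo_def hi_def)

lemma phase'_strict_antimono: "0 < y \<Longrightarrow> y < z \<Longrightarrow> phase' z < phase' y"
  unfolding phase'_def using \<alpha>_lt_1 \<alpha>_nonzero x_pos powr_less_mono2_neg[of "\<alpha> - 1" y z] by simp

lemma phase'_hi_pos: "0 < phase' hi"
  using \<alpha>_nonzero x_pos lo_hi_bounds by (simp add: phase'_def)

lemma phase'_hi_less_lo: "phase' hi < phase' lo"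
  using phase'_strict_antimono lo_hi_bounds by simp

lemma phase'_bounds:
  assumes "real N / 2 \<le> y" "y \<le> 2 * real N"
  shows "slope_min \<alpha> * (T / real N) \<le> phase' y" "phase' y \<le> slope_max \<alpha> * (T / real N)"
proof -
  note comparable = powr_comparable[OF N_pos assms, of "\<alpha> - 1"]
  have scale: "x * real N powr (\<alpha> - 1) = T / real N"
    using N_pos by (simp add: T_def powr_diff)
  have "\<bar>\<alpha>\<bar> * x * (2 powr (\<alpha> - 1) * real N powr (\<alpha> - 1)) \<le> phase' y"
    unfolding phase'_def using comparable \<alpha>_lt_1 x_pos by (intro mult_left_mono) auto
  thus "slope_min \<alpha> * (T / real N) \<le> phase' y"
    by (simp add: slope_min_def mult_ac flip: scale)
  have "phase' y \<le> \<bar>\<alpha>\<bar> * x * (2 powr (1 - \<alpha>) * real N powr (\<alpha> - 1))"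
    unfolding phase'_def using comparable \<alpha>_lt_1 x_pos by (intro mult_left_mono) auto
  thus "phase' y \<le> slope_max \<alpha> * (T / real N)"
    by (simp add: slope_max_def mult_ac flip: scale)
qed

lemma phase''_bounds:
  assumes "real N / 2 \<le> y" "y \<le> 2 * real N"
  shows "phase'' y \<le> - (curvature_min \<alpha> * (T / (real N)\<^sup>2))"
    "- (curvature_max \<alpha> * (T / (real N)\<^sup>2)) \<le> phase'' y"
proof -
  note comparable = powr_comparable[OF N_pos assms, of "\<alpha> - 2"]
  have scale: "x * real N powr (\<alpha> - 2) = T / (real N)\<^sup>2"
    using N_pos by (simp add: T_def powr_diff powr_numeral)
  have "\<bar>\<alpha>\<bar> * (1 - \<alpha>) * x * (2 powr (\<alpha> - 2) * real N powr (\<alpha> - 2)) \<le> - phase'' y"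
    unfolding phase''_def minus_minus using comparable \<alpha>_lt_1 x_pos by (intro mult_left_mono) auto
  thus "phase'' y \<le> - (curvature_min \<alpha> * (T / (real N)\<^sup>2))"
    by (simp add: curvature_min_def mult_ac flip: scale)
  have "- phase'' y \<le> \<bar>\<alpha>\<bar> * (1 - \<alpha>) * x * (2 powr (2 - \<alpha>) * real N powr (\<alpha> - 2))"
    unfolding phase''_def minus_minus using comparable \<alpha>_lt_1 x_pos by (intro mult_left_mono) auto
  thus "- (curvature_max \<alpha> * (T / (real N)\<^sup>2)) \<le> phase'' y"
    by (simp add: curvature_max_def mult_ac flip: scale)
qed

definition stationary_point :: "real \<Rightarrow> real" where
  "stationary_point m = (\<bar>\<alpha>\<bar> * x / m) powr (1 / (1 - \<alpha>))"

definition phase_scale :: "real \<Rightarrow> real" where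
  "phase_scale m = x * stationary_point m powr \<alpha>"

definition dual_phase :: "real \<Rightarrow> real" where
  "dual_phase m = sgn \<alpha> * (1 - \<alpha>) * phase_scale m"

definition dual_weight :: "real \<Rightarrow> real" where
  "dual_weight m = stationary_point m / sqrt (phase_scale m)"

lemma stationary_point_pos: "m > 0 \<Longrightarrow> stationary_point m > 0"
  using \<alpha>_nonzero x_pos by (simp add: stationary_point_def)

lemma phase_scale_pos: "m > 0 \<Longrightarrow> phase_scale m > 0"
  using x_pos stationary_point_pos[of m] by (simp add: phase_scale_def)

lemma phase'_stationary_point:
  assumes "m > 0"
  shows "phase' (stationary_point m) = m"
proof -
  have "1 / (1 - \<alpha>) * (\<alpha> - 1) = - 1" using \<alpha>_lt_1 by (simp add: field_simps)
  hence "stationary_point m powr (\<alpha> - 1) = (\<bar>\<alpha>\<bar> * x / m) powr (- 1)"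
    unfolding stationary_point_def powr_powr by (simp only:)
  also have "\<dots> = m / (\<bar>\<alpha>\<bar> * x)"
    using assms x_pos \<alpha>_nonzero by (simp add: powr_minus_divide abs_mult)
  finally show ?thesis using \<alpha>_nonzero x_pos by (simp add: phase'_def)
qed

context
  fixes m :: real
  assumes slope: "phase' hi < m" "m < phase' lo"
begin

lemma frequency_pos: "0 < m"
  using slope phase'_hi_pos by linarith

lemma stationary_point_bounds: "lo < stationary_point m" "stationary_point m < hi"
proof -
  note m = frequency_pos phase'_stationary_point[OF frequency_pos] stationary_point_pos[OF frequency_pos]
  show "lo < stationary_point m"
    using phase'_strict_antimono[of "stationary_point m" lo] m slope
    by (cases "stationary_point m = lo") force+
  show "stationary_point m < hi"
    using phase'_strict_antimono[of hi "stationary_point m"] lo_hi_bounds m slope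
    by (cases "stationary_point m = hi") force+
qed

lemma stationary_point_near_N: "real N / 2 \<le> stationary_point m" "stationary_point m \<le> 2 * real N"
  using stationary_point_bounds lo_hi_bounds by auto

lemma stationary_point_powr_le:
  assumes "s \<ge> 0"
  shows "stationary_point m powr s / x \<le> 2 powr s * (real N powr (s + \<alpha>) / T)"
proof -
  have "stationary_point m powr s \<le> (2 * real N) powr s"
    using assms stationary_point_pos[OF frequency_pos] stationary_point_near_N by (intro powr_mono2) auto
  hence "stationary_point m powr s / x \<le> (2 * real N) powr s / x"
    using x_pos by (intro divide_right_mono) auto
  also have "\<dots> = 2 powr s * (real N powr (s + \<alpha>) / T)"
    using N_pos x_pos by (simp add: T_def powr_mult powr_add)
  finally show ?thesis .
qed

lemma stationary_point_div_scale_le: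
  "stationary_point m / phase_scale m \<le> 2 powr (1 - \<alpha>) * (real N / T)"
proof -
  have "stationary_point m / phase_scale m = stationary_point m powr (1 - \<alpha>) / x"
    using stationary_point_pos[OF frequency_pos] x_pos by (simp add: phase_scale_def powr_diff)
  thus ?thesis using stationary_point_powr_le[of "1 - \<alpha>"] \<alpha>_lt_1 N_pos by simp
qed

lemma stationary_point_square_div_scale_le:
  "(stationary_point m)\<^sup>2 / phase_scale m \<le> 2 powr (2 - \<alpha>) * ((real N)\<^sup>2 / T)"
proof -
  have "(stationary_point m)\<^sup>2 / phase_scale m = stationary_point m powr (2 - \<alpha>) / x"
    using stationary_point_pos[OF frequency_pos] x_pos by (simp add: phase_scale_def powr_diff powr_numeral)
  thus ?thesis using stationary_point_powr_le[of "2 - \<alpha>"] \<alpha>_lt_1 N_pos by (simp add: powr_numeral)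
qed

lemma dual_weight_le: "dual_weight m \<le> 2 powr (1 - \<alpha>/2) * (real N / sqrt T)"
proof (rule power2_le_imp_le)
  have "(2 powr (1 - \<alpha>/2))\<^sup>2 = (2::real) powr (2 - \<alpha>)"
    by (simp add: power2_eq_square flip: powr_add)
  moreover have "(dual_weight m)\<^sup>2 = (stationary_point m)\<^sup>2 / phase_scale m"
    using phase_scale_pos[OF frequency_pos] by (simp add: dual_weight_def power_divide)
  ultimately show "(dual_weight m)\<^sup>2 \<le> (2 powr (1 - \<alpha>/2) * (real N / sqrt T))\<^sup>2"
    using stationary_point_square_div_scale_le T_pos by (simp add: power_mult_distrib power_divide)
qed (use T_pos in simp)

lemma phase_eq_at_stationary_point:
  assumes "y > 0"
  shows "phase y - m * y = dual_phase m + phase_scale m * power_phase \<alpha> (y / stationary_point m)"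
proof -
  define X where "X = stationary_point m"
  have X_pos: "X > 0" by (simp add: X_def stationary_point_pos[OF frequency_pos])
  have "X powr (\<alpha> - 1) * X powr 1 = X powr \<alpha>" by (simp only: powr_add[symmetric]) simp
  moreover have "m = \<bar>\<alpha>\<bar> * (x * X powr (\<alpha> - 1))"
    using phase'_stationary_point[OF frequency_pos] X_pos
    by (simp add: phase'_def X_def sgn_mult_self flip: mult.assoc)
  ultimately have "m * X = sgn \<alpha> * \<alpha> * phase_scale m"
    using X_pos unfolding phase_scale_def X_def[symmetric] sgn_mult_self by (simp add: mult.assoc)
  hence "m * y = sgn \<alpha> * (phase_scale m * (\<alpha> * (y / X)))" using X_pos by (simp add: field_simps)
  moreover have "phase y = sgn \<alpha> * (phase_scale m * (y / X) powr \<alpha>)"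
    using assms X_pos by (simp add: phase_def phase_scale_def X_def[symmetric] powr_divide)
  ultimately show ?thesis
    unfolding power_phase_def dual_phase_def X_def[symmetric] by (simp add: algebra_simps)
qed

lemma poisson_integral_rescale:
  "integral {lo..hi} (\<lambda>y. ec (phase y - m * y)) = of_real (stationary_point m) * ec (dual_phase m)
     * integral {lo / stationary_point m..hi / stationary_point m} (\<lambda>s. ec (phase_scale m * power_phase \<alpha> s))"
proof -
  define X where "X = stationary_point m"
  have X_pos: "X > 0" by (simp add: X_def stationary_point_pos[OF frequency_pos])
  let ?F = "\<lambda>s. ec (phase_scale m * power_phase \<alpha> s)"
  have "continuous_on {lo / X..hi / X} ?F"
    by (intro continuous_on_ec concave_phase.continuous_on_phase[OF concave_phase_power_phase])
       (use lo_hi_bounds X_pos \<alpha>_lt_1 phase_scale_pos[OF frequency_pos] in \<open>auto intro: divide_right_mono\<close>)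
  hence "((\<lambda>y. (1 / X) *\<^sub>R ?F (y / X)) has_integral integral {lo / X..hi / X} ?F) {lo..hi}"
    by (intro has_integral_substitution[where c = "lo / X" and d = "hi / X"])
       (use lo_hi_bounds X_pos in \<open>auto intro!: derivative_eq_intros divide_right_mono\<close>)
  hence "integral {lo..hi} (\<lambda>y. of_real (1 / X) * ?F (y / X)) = integral {lo / X..hi / X} ?F"
    by (simp only: scaleR_conv_of_real integral_unique)
  hence "integral {lo..hi} (\<lambda>y. ?F (y / X)) = of_real X * integral {lo / X..hi / X} ?F"
    using X_pos by (simp add: field_simps)
  moreover have "integral {lo..hi} (\<lambda>y. ec (phase y - m * y))
      = integral {lo..hi} (\<lambda>y. ec (dual_phase m) * ?F (y / X))"
    by (intro integral_cong) (use lo_hi_bounds in \<open>auto simp: phase_eq_at_stationary_point X_def ec_add\<close>)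
  ultimately show ?thesis by (simp add: X_def mult_ac)
qed

lemma stationary_point_gap_le:
  assumes order: "lo \<le> y" "y < z" "z \<le> hi"
  shows "(stationary_point m)\<^sup>2 / phase_scale m * (1 / (z - y))
    \<le> 2 powr (2 - \<alpha>) * curvature_max \<alpha> * (1 / (phase' y - phase' z))"
proof -
  define k where "k = curvature_max \<alpha> * (T / (real N)\<^sup>2)"
  have slope_diff: "0 < phase' y - phase' z"
    using phase'_strict_antimono[of y z] order lo_hi_bounds by simp
  obtain t where mvt: "y < t" "t < z" "phase' z - phase' y = (z - y) * phase'' t"
    using MVT2[of y z phase' phase''] order lo_hi_bounds phase'_has_derivative by auto
  have "- k \<le> phase'' t" unfolding k_def using mvt order lo_hi_bounds by (intro phase''_bounds) auto
  hence "(z - y) * (- k) \<le> (z - y) * phase'' t" using order by (intro mult_left_mono) auto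
  hence "phase' y - phase' z \<le> k * (z - y)" using mvt by (simp add: algebra_simps)
  hence "1 / (z - y) \<le> k / (phase' y - phase' z)" using slope_diff order by (simp add: field_simps)
  moreover have "0 \<le> k" using \<alpha>_lt_1 T_pos by (simp add: k_def curvature_max_def)
  ultimately have "(stationary_point m)\<^sup>2 / phase_scale m * (1 / (z - y))
      \<le> 2 powr (2 - \<alpha>) * ((real N)\<^sup>2 / T) * (k / (phase' y - phase' z))"
    using stationary_point_square_div_scale_le order T_pos by (intro mult_mono) auto
  also have "\<dots> = 2 powr (2 - \<alpha>) * curvature_max \<alpha> * (1 / (phase' y - phase' z))"
    using T_pos N_pos by (simp add: k_def)
  finally show ?thesis .
qed

lemma poisson_integral_approx:
  "norm (integral {lo..hi} (\<lambda>y. ec (phase y - m * y))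
      - stationary_constant \<alpha> * (of_real (dual_weight m) * ec (dual_phase m)))
     \<le> C * (2 powr (1 - \<alpha>) * (real N / T) + 2 powr (2 - \<alpha>) * curvature_max \<alpha>
       * (1 / (phase' lo - m) + 1 / (m - phase' hi)))"
proof -
  define X where "X = stationary_point m"
  have X_pos: "X > 0" by (simp add: X_def stationary_point_pos[OF frequency_pos])
  note X_bounds = stationary_point_bounds[folded X_def]
  note scale_pos = phase_scale_pos[OF frequency_pos]
  define D
    where "D = integral {lo / X..hi / X} (\<lambda>s. ec (phase_scale m * power_phase \<alpha> s))
        - stationary_constant \<alpha> / sqrt (phase_scale m)"
  have D_bound: "norm D \<le> C / phase_scale m * (1 + 1 / (1 - lo / X) + 1 / (hi / X - 1))"
    using stationary scale_pos X_pos X_bounds lo_hi_bounds by (simp add: stationary_phase_bound_def D_def)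
  have "integral {lo..hi} (\<lambda>y. ec (phase y - m * y))
      - stationary_constant \<alpha> * (of_real (dual_weight m) * ec (dual_phase m))
      = of_real X * ec (dual_phase m) * D"
    unfolding poisson_integral_rescale D_def dual_weight_def X_def by (simp add: algebra_simps)
  hence "norm (integral {lo..hi} (\<lambda>y. ec (phase y - m * y))
      - stationary_constant \<alpha> * (of_real (dual_weight m) * ec (dual_phase m)))
      = X * norm D"
    using X_pos by (simp add: norm_mult)
  also have "\<dots> \<le> X * (C / phase_scale m * (1 + 1 / (1 - lo / X) + 1 / (hi / X - 1)))"
    using D_bound X_pos by (intro mult_left_mono) auto
  also have "\<dots> = C * (X / phase_scale m + X\<^sup>2 / phase_scale m * (1 / (X - lo))
      + X\<^sup>2 / phase_scale m * (1 / (hi - X)))"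
  proof -
    have "1 / (1 - lo / X) = X * (1 / (X - lo))" "1 / (hi / X - 1) = X * (1 / (hi - X))"
      using X_pos X_bounds by (simp_all add: field_simps)
    thus ?thesis by (simp add: algebra_simps power2_eq_square)
  qed
  also have "\<dots> \<le> C * (2 powr (1 - \<alpha>) * (real N / T) + 2 powr (2 - \<alpha>) * curvature_max \<alpha> * (1 / (phase' lo - m))
      + 2 powr (2 - \<alpha>) * curvature_max \<alpha> * (1 / (m - phase' hi)))"
  proof (intro mult_left_mono add_mono)
    show "X / phase_scale m \<le> 2 powr (1 - \<alpha>) * (real N / T)"
      unfolding X_def by (rule stationary_point_div_scale_le)
    show "X\<^sup>2 / phase_scale m * (1 / (X - lo)) \<le> 2 powr (2 - \<alpha>) * curvature_max \<alpha> * (1 / (phase' lo - m))"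
      using stationary_point_gap_le[of lo X] X_bounds phase'_stationary_point[OF frequency_pos]
      by (simp add: X_def)
    show "X\<^sup>2 / phase_scale m * (1 / (hi - X)) \<le> 2 powr (2 - \<alpha>) * curvature_max \<alpha> * (1 / (m - phase' hi))"
      using stationary_point_gap_le[of X hi] X_bounds phase'_stationary_point[OF frequency_pos]
      by (simp add: X_def)
  qed (use C_pos in simp)
  finally show ?thesis by (simp only: distrib_left add.assoc)
qed

end

lemma dual_weight_nonneg: "m > 0 \<Longrightarrow> dual_weight m \<ge> 0"
  using stationary_point_pos[of m] phase_scale_pos[of m] by (simp add: dual_weight_def)

lemma dual_weight_antimono:
  assumes "0 < m" "m \<le> m'"
  shows "dual_weight m' \<le> dual_weight m"
proof -
  have weight_eq: "dual_weight m = stationary_point m powr (1 - \<alpha>/2) / sqrt x" if "m > 0" for m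
  proof -
    have "sqrt (phase_scale m) = sqrt x * stationary_point m powr (\<alpha>/2)"
      unfolding phase_scale_def real_sqrt_mult
      using stationary_point_pos[OF that] by (simp add: powr_half_sqrt[symmetric] powr_powr)
    thus ?thesis using stationary_point_pos[OF that] by (simp add: dual_weight_def powr_diff)
  qed
  have "stationary_point m' \<le> stationary_point m"
    unfolding stationary_point_def using assms \<alpha>_lt_1 x_pos by (intro powr_mono2 divide_left_mono) auto
  hence "stationary_point m' powr (1 - \<alpha>/2) / sqrt x \<le> stationary_point m powr (1 - \<alpha>/2) / sqrt x"
    using \<alpha>_lt_1 stationary_point_pos[of m'] assms x_pos by (intro divide_right_mono powr_mono2) auto
  thus ?thesis using weight_eq[of m] weight_eq[of m'] assms by simp
qed

lemma dual_phase_eq: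
  assumes m_pos: "m > 0"
  shows "dual_phase m = sgn \<alpha> * (dual_coeff \<alpha> x * m powr dual_exponent \<alpha>)"
proof -
  have exponents: "1 / (1 - \<alpha>) * \<alpha> = \<alpha> / (1 - \<alpha>)" "1 + \<alpha> / (1 - \<alpha>) = 1 / (1 - \<alpha>)"
    "dual_exponent \<alpha> = - (\<alpha> / (1 - \<alpha>))"
    using \<alpha>_lt_1 by (simp_all add: dual_exponent_def field_simps)
  have "stationary_point m powr \<alpha> = (\<bar>\<alpha>\<bar> * x / m) powr (\<alpha> / (1 - \<alpha>))"
    unfolding stationary_point_def powr_powr exponents ..
  also have "\<dots> = \<bar>\<alpha>\<bar> powr (\<alpha> / (1 - \<alpha>)) * x powr (\<alpha> / (1 - \<alpha>)) * m powr dual_exponent \<alpha>"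
    unfolding exponents using x_pos m_pos by (simp add: powr_divide powr_mult powr_minus_divide)
  finally have "phase_scale m = \<bar>\<alpha>\<bar> powr (\<alpha> / (1 - \<alpha>)) * (x powr 1 * x powr (\<alpha> / (1 - \<alpha>)))
      * m powr dual_exponent \<alpha>"
    using x_pos by (simp add: phase_scale_def mult_ac)
  also have "x powr 1 * x powr (\<alpha> / (1 - \<alpha>)) = x powr (1 / (1 - \<alpha>))"
    unfolding powr_add[symmetric] exponents ..
  finally show ?thesis by (simp add: dual_phase_def dual_coeff_def mult_ac)
qed

lemma norm_poisson_term_le:
  "norm (poisson_term k) \<le> 4 / sqrt (curvature_min \<alpha>) * (real N / sqrt T)"
proof -
  define l where "l = curvature_min \<alpha> * (T / (real N)\<^sup>2)"
  have l_pos: "l > 0" using \<alpha>_lt_1 \<alpha>_nonzero T_pos N_pos by (simp add: l_def curvature_min_def)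
  interpret shifted: concave_phase "\<lambda>y. phase y - of_int k * y" "\<lambda>y. phase' y - of_int k" phase'' lo hi
    unfolding lo_def hi_def by (rule concave_phase_minus_linear)
  have "norm (poisson_term k) \<le> 4 / sqrt l"
    unfolding poisson_term_eq l_def
    using l_pos lo_hi_bounds by (intro shifted.second_derivative_test phase''_bounds) (auto simp: l_def)
  also have "4 / sqrt l = 4 / sqrt (curvature_min \<alpha>) * (real N / sqrt T)"
    unfolding l_def real_sqrt_mult real_sqrt_divide using N_pos by simp
  finally show ?thesis .
qed

end

lemma sum_recip_below_le_harm:
  fixes p q :: int and u :: real
  assumes "of_int q + 1 \<le> u"
  shows "(\<Sum>m\<in>{p..q}. 1 / (u - of_int m)) \<le> harm (nat (q - p + 1))"
proof -
  have "(\<Sum>m\<in>{p..q}. 1 / (u - of_int m)) \<le> (\<Sum>m\<in>{p..q}. 1 / (of_int q + 1 - of_int m))"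
    using assms by (intro sum_mono frac_le) auto
  also have "\<dots> = (\<Sum>j<nat (q - p + 1). inverse (real (Suc j)))"
    by (rule sum.reindex_bij_witness[of _ "\<lambda>j. q - int j" "\<lambda>m. nat (q - m)"]) (auto simp: inverse_eq_divide)
  finally show ?thesis by (simp add: harm_altdef)
qed

lemma sum_recip_above_le_harm:
  fixes p q :: int and v :: real
  assumes "v + 1 \<le> of_int p"
  shows "(\<Sum>m\<in>{p..q}. 1 / (of_int m - v)) \<le> harm (nat (q - p + 1))"
proof -
  have "(\<Sum>m\<in>{p..q}. 1 / (of_int m - v)) = (\<Sum>m\<in>{-q..-p}. 1 / (- v - of_int m))"
    by (rule sum.reindex_bij_witness[of _ uminus uminus]) auto
  also have "\<dots> \<le> harm (nat (- p - (- q) + 1))"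
    using assms by (intro sum_recip_below_le_harm) simp
  finally show ?thesis by simp
qed

lemma card_edge_integers_le:
  fixes u v :: real
  shows "card ({\<lfloor>v\<rfloor>..\<lceil>u\<rceil>} - {\<lceil>v\<rceil> + 1..\<lfloor>u\<rfloor> - 1}) \<le> 4"
proof -
  have "{\<lfloor>v\<rfloor>..\<lceil>u\<rceil>} - {\<lceil>v\<rceil> + 1..\<lfloor>u\<rfloor> - 1} \<subseteq> {\<lfloor>v\<rfloor>, \<lfloor>v\<rfloor> + 1, \<lceil>u\<rceil> - 1, \<lceil>u\<rceil>}"
  proof
    fix m assume "m \<in> {\<lfloor>v\<rfloor>..\<lceil>u\<rceil>} - {\<lceil>v\<rceil> + 1..\<lfloor>u\<rfloor> - 1}"
    moreover have "\<lceil>v\<rceil> \<le> \<lfloor>v\<rfloor> + 1" "\<lceil>u\<rceil> \<le> \<lfloor>u\<rfloor> + 1" by linarith+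
    ultimately show "m \<in> {\<lfloor>v\<rfloor>, \<lfloor>v\<rfloor> + 1, \<lceil>u\<rceil> - 1, \<lceil>u\<rceil>}" by auto
  qed
  hence "card ({\<lfloor>v\<rfloor>..\<lceil>u\<rceil>} - {\<lceil>v\<rceil> + 1..\<lfloor>u\<rfloor> - 1}) \<le> card {\<lfloor>v\<rfloor>, \<lfloor>v\<rfloor> + 1, \<lceil>u\<rceil> - 1, \<lceil>u\<rceil>}"
    by (rule card_mono[rotated]) simp
  also have "\<dots> \<le> 4" using card_length[of "[\<lfloor>v\<rfloor>, \<lfloor>v\<rfloor> + 1, \<lceil>u\<rceil> - 1, \<lceil>u\<rceil>]"] by simp
  finally show ?thesis .
qed

definition B_process_constant :: "real \<Rightarrow> real \<Rightarrow> real" where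
  "B_process_constant \<alpha> C = 2 + 4 * (4 / sqrt (curvature_min \<alpha>)) + C * (slope_max \<alpha> * 2 powr (1 - \<alpha>))
     + 2 * (C * (2 powr (2 - \<alpha>) * curvature_max \<alpha>))"

context power_sum
begin

definition n_freq :: nat where "n_freq = nat \<lceil>slope_max \<alpha> * (T / real N)\<rceil>"
definition all_freqs :: "int set" where "all_freqs = {\<lfloor>phase' hi\<rfloor>..\<lceil>phase' lo\<rceil>}"
definition inner_freqs :: "int set" where "inner_freqs = {\<lceil>phase' hi\<rceil> + 1..\<lfloor>phase' lo\<rfloor> - 1}"

lemma inner_freqs_slope:
  assumes "m \<in> inner_freqs"
  shows "phase' hi < of_int m" "of_int m < phase' lo"
  using assms unfolding inner_freqs_def by (auto; linarith)+

lemma phase'_lo_le: "phase' lo \<le> slope_max \<alpha> * (T / real N)"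
  using phase'_bounds(2)[of lo] lo_hi_bounds by simp

lemma phase'_hi_ge: "slope_min \<alpha> * (T / real N) \<le> phase' hi"
  using phase'_bounds(1)[of hi] lo_hi_bounds by simp

lemma phase'_lo_le_n_freq: "phase' lo \<le> real n_freq"
  using phase'_lo_le unfolding n_freq_def by linarith

lemma card_inner_freqs_le: "real (card inner_freqs) \<le> slope_max \<alpha> * (T / real N)"
proof -
  have "real (card inner_freqs) \<le> phase' lo"
    unfolding inner_freqs_def using phase'_hi_pos phase'_hi_less_lo by auto linarith+
  thus ?thesis using phase'_lo_le by linarith
qed

lemma sum_recip_gap_inner_freqs_le:
  "(\<Sum>m\<in>inner_freqs. 1 / (phase' lo - of_int m) + 1 / (of_int m - phase' hi)) \<le> 2 * harm n_freq"
proof -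
  have "nat (\<lfloor>phase' lo\<rfloor> - 1 - (\<lceil>phase' hi\<rceil> + 1) + 1) \<le> n_freq"
    using phase'_hi_pos phase'_lo_le_n_freq by linarith
  hence "harm (nat (\<lfloor>phase' lo\<rfloor> - 1 - (\<lceil>phase' hi\<rceil> + 1) + 1)) \<le> (harm n_freq :: real)"
    by (rule harm_mono)
  moreover have "(\<Sum>m\<in>inner_freqs. 1 / (phase' lo - of_int m))
      \<le> harm (nat (\<lfloor>phase' lo\<rfloor> - 1 - (\<lceil>phase' hi\<rceil> + 1) + 1))"
    unfolding inner_freqs_def by (rule sum_recip_below_le_harm) simp
  moreover have "(\<Sum>m\<in>inner_freqs. 1 / (of_int m - phase' hi))
      \<le> harm (nat (\<lfloor>phase' lo\<rfloor> - 1 - (\<lceil>phase' hi\<rceil> + 1) + 1))"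
    unfolding inner_freqs_def by (rule sum_recip_above_le_harm) simp
  ultimately show ?thesis unfolding sum.distrib by linarith
qed

lemma edge_poisson_terms_le:
  "norm (\<Sum>m\<in>all_freqs - inner_freqs. poisson_term m) \<le> 4 * (4 / sqrt (curvature_min \<alpha>) * (real N / sqrt T))"
proof -
  have "real (card (all_freqs - inner_freqs)) \<le> 4"
    using card_edge_integers_le[of "phase' hi" "phase' lo"] by (simp add: all_freqs_def inner_freqs_def)
  moreover have "norm (\<Sum>m\<in>all_freqs - inner_freqs. poisson_term m)
      \<le> real (card (all_freqs - inner_freqs)) * (4 / sqrt (curvature_min \<alpha>) * (real N / sqrt T))"
    by (intro sum_norm_bound norm_poisson_term_le)
  moreover have "0 \<le> 4 / sqrt (curvature_min \<alpha>) * (real N / sqrt T)"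
    using \<alpha>_lt_1 T_pos by (simp add: curvature_min_def)
  ultimately show ?thesis by (meson mult_right_mono order_trans)
qed

lemma inner_poisson_terms_approx:
  "norm (\<Sum>m\<in>inner_freqs. poisson_term m - stationary_constant \<alpha>
      * (of_real (dual_weight (of_int m)) * ec (dual_phase (of_int m))))
     \<le> C * (slope_max \<alpha> * 2 powr (1 - \<alpha>)) + 2 * (C * (2 powr (2 - \<alpha>) * curvature_max \<alpha>)) * harm n_freq"
proof -
  define D where "D = 2 powr (2 - \<alpha>) * curvature_max \<alpha>"
  have D_nonneg: "0 \<le> D" using \<alpha>_lt_1 by (simp add: D_def curvature_max_def)
  have "norm (\<Sum>m\<in>inner_freqs. poisson_term m - stationary_constant \<alpha>
      * (of_real (dual_weight (of_int m)) * ec (dual_phase (of_int m))))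
      \<le> (\<Sum>m\<in>inner_freqs.
        C * (2 powr (1 - \<alpha>) * (real N / T) + D * (1 / (phase' lo - of_int m) + 1 / (of_int m - phase' hi))))"
    unfolding poisson_term_eq D_def by (intro sum_norm_le poisson_integral_approx inner_freqs_slope)
  also have "\<dots> = C * (real (card inner_freqs) * (2 powr (1 - \<alpha>) * (real N / T))
      + D * (\<Sum>m\<in>inner_freqs. 1 / (phase' lo - of_int m) + 1 / (of_int m - phase' hi)))"
    by (simp only: sum_distrib_left[symmetric] sum.distrib) simp
  also have "\<dots> \<le> C * (slope_max \<alpha> * (T / real N) * (2 powr (1 - \<alpha>) * (real N / T)) + D * (2 * harm n_freq))"
    using C_pos T_pos D_nonneg card_inner_freqs_le sum_recip_gap_inner_freqs_le
    by (intro mult_left_mono add_mono mult_right_mono) auto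
  also have "\<dots> = C * (slope_max \<alpha> * 2 powr (1 - \<alpha>)) + 2 * (C * D) * harm n_freq"
    using T_pos N_pos by (simp add: algebra_simps)
  finally show ?thesis by (simp only: D_def)
qed

theorem van_der_corput_B:
  "norm ((\<Sum>n\<in>{N..<2*N}. ec (phase (real n)))
      - stationary_constant \<alpha> * (\<Sum>m\<in>inner_freqs. of_real (dual_weight (of_int m)) * ec (dual_phase (of_int m))))
    \<le> B_process_constant \<alpha> C * (1 + harm n_freq + real N / sqrt T)"
proof -
  define Q where "Q = real N / sqrt T"
  define h :: real where "h = harm n_freq"
  define dual_sum
    where "dual_sum = (\<Sum>m\<in>inner_freqs. of_real (dual_weight (of_int m)) * ec (dual_phase (of_int m)))"
  have poisson: "norm ((\<Sum>n\<in>{N..<2*N}. ec (phase (real n))) - (\<Sum>m\<in>all_freqs. poisson_term m)) \<le> 2 + 2 * h"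
    unfolding all_freqs_def h_def
  proof (rule truncated_poisson, fold lo_def hi_def)
    show "phase' lo - phase' hi \<le> real n_freq" using phase'_lo_le_n_freq phase'_hi_pos by linarith
  qed simp_all
  have "inner_freqs \<subseteq> all_freqs" "finite all_freqs" unfolding inner_freqs_def all_freqs_def by auto linarith+
  hence "(\<Sum>m\<in>all_freqs. poisson_term m) = (\<Sum>m\<in>all_freqs - inner_freqs. poisson_term m)
      + (\<Sum>m\<in>inner_freqs. poisson_term m)"
    by (rule sum.subset_diff)
  hence "(\<Sum>n\<in>{N..<2*N}. ec (phase (real n))) - stationary_constant \<alpha> * dual_sum
      = ((\<Sum>n\<in>{N..<2*N}. ec (phase (real n))) - (\<Sum>m\<in>all_freqs. poisson_term m))
        + (\<Sum>m\<in>all_freqs - inner_freqs. poisson_term m)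
        + (\<Sum>m\<in>inner_freqs. poisson_term m - stationary_constant \<alpha>
          * (of_real (dual_weight (of_int m)) * ec (dual_phase (of_int m))))"
    by (simp add: dual_sum_def sum_subtractf sum_distrib_left)
  also have "norm \<dots> \<le> (2 + 2 * h) + 4 * (4 / sqrt (curvature_min \<alpha>) * Q)
      + (C * (slope_max \<alpha> * 2 powr (1 - \<alpha>)) + 2 * (C * (2 powr (2 - \<alpha>) * curvature_max \<alpha>)) * h)"
    unfolding h_def Q_def
    by (intro norm_triangle_mono poisson[unfolded h_def] edge_poisson_terms_le inner_poisson_terms_approx)
  also have "\<dots> \<le> B_process_constant \<alpha> C * (1 + h + Q)"
  proof -
    have combine: "(2 + 2 * h) + 4 * (d * Q) + (k + 2 * f * h) \<le> (2 + 4 * d + k + 2 * f) * (1 + h + Q)"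
      if "d \<ge> 0" "k \<ge> 0" "f \<ge> 0" "h \<ge> 0" "Q \<ge> 0" for d k f h Q :: real
      using that by (simp add: algebra_simps add_nonneg_nonneg mult_nonneg_nonneg)
    show ?thesis
      unfolding B_process_constant_def using \<alpha>_lt_1 C_pos T_pos
      by (intro combine) (auto simp: h_def Q_def harm_nonneg curvature_min_def curvature_max_def slope_max_def)
  qed
  finally show ?thesis by (simp only: dual_sum_def h_def Q_def)
qed

end

definition dual_sums_le :: "real \<Rightarrow> real \<Rightarrow> nat \<Rightarrow> real \<Rightarrow> bool" where
  "dual_sums_le \<alpha> x N B \<longleftrightarrow> (\<forall>p q :: nat.
     (\<forall>m\<in>{p..<q}. slope_min \<alpha> * (x * real N powr \<alpha> / real N) \<le> real m
       \<and> real m \<le> slope_max \<alpha> * (x * real N powr \<alpha> / real N))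
     \<longrightarrow> norm (\<Sum>m\<in>{p..<q}. ec (dual_coeff \<alpha> x * real m powr dual_exponent \<alpha>)) \<le> B)"

lemma norm_sum_ec_sgn_mult:
  fixes c :: real
  assumes "c \<noteq> 0"
  shows "norm (\<Sum>i\<in>I. ec (sgn c * f i)) = norm (\<Sum>i\<in>I. ec (f i))"
  using assms norm_sum_ec_uminus[of f I] by (cases "c > 0") auto

lemma dual_sums_le_nonneg: "dual_sums_le \<alpha> x N B \<Longrightarrow> B \<ge> 0"
  unfolding dual_sums_le_def by (drule spec[of _ 0], drule spec[of _ 0]) simp

context power_sum
begin

lemma norm_sum_dual_phase_le:
  assumes "dual_sums_le \<alpha> x N B"
    and slope: "\<And>m. m \<in> {p..<q} \<Longrightarrow> phase' hi < real m" "\<And>m. m \<in> {p..<q} \<Longrightarrow> real m < phase' lo"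
  shows "norm (\<Sum>m\<in>{p..<q}. ec (dual_phase (real m))) \<le> B"
proof -
  have "norm (\<Sum>m\<in>{p..<q}. ec (dual_phase (real m)))
      = norm (\<Sum>m\<in>{p..<q}. ec (sgn \<alpha> * (dual_coeff \<alpha> x * real m powr dual_exponent \<alpha>)))"
    by (intro arg_cong[of _ _ norm] sum.cong refl arg_cong[of _ _ ec] dual_phase_eq
        less_trans[OF phase'_hi_pos slope(1)])
  also have "\<dots> \<le> B"
    unfolding norm_sum_ec_sgn_mult[OF \<alpha>_nonzero]
  proof (rule assms(1)[unfolded dual_sums_le_def, rule_format])
    show "slope_min \<alpha> * (x * real N powr \<alpha> / real N) \<le> real m
        \<and> real m \<le> slope_max \<alpha> * (x * real N powr \<alpha> / real N)"
      if "m \<in> {p..<q}" for m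
      using slope[OF that] phase'_lo_le phase'_hi_ge by (auto simp: T_def)
  qed
  finally show ?thesis .
qed

lemma weighted_dual_sum_le:
  assumes dual_sums: "dual_sums_le \<alpha> x N B"
  shows "norm (\<Sum>m\<in>inner_freqs. of_real (dual_weight (of_int m)) * ec (dual_phase (of_int m)))
    \<le> 2 powr (1 - \<alpha>/2) * (real N / sqrt T) * B"
proof -
  define p where "p = nat (\<lceil>phase' hi\<rceil> + 1)"
  define q where "q = nat \<lfloor>phase' lo\<rfloor>"
  have slope: "phase' hi < real m" "real m < phase' lo" if "p \<le> m" "m < q" for m
    using that phase'_hi_pos unfolding p_def q_def by linarith+
  have "(\<Sum>m\<in>inner_freqs. of_real (dual_weight (of_int m)) * ec (dual_phase (of_int m)))
      = (\<Sum>m\<in>{p..<q}. dual_weight (real m) *\<^sub>R ec (dual_phase (real m)))"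
  proof (rule sum.reindex_bij_witness[of _ int nat])
    have nonneg: "0 \<le> i" if "i \<in> inner_freqs" for i
      using that phase'_hi_pos unfolding inner_freqs_def atLeastAtMost_iff by linarith
    show "int (nat i) = i" "dual_weight (real (nat i)) *\<^sub>R ec (dual_phase (real (nat i)))
        = of_real (dual_weight (of_int i)) * ec (dual_phase (of_int i))" if "i \<in> inner_freqs" for i
      using nonneg[OF that] by (simp_all add: scaleR_conv_of_real)
    show "nat i \<in> {p..<q}" if "i \<in> inner_freqs" for i
      using nonneg[OF that] that
      unfolding inner_freqs_def p_def q_def atLeastAtMost_iff atLeastLessThan_iff by linarith
    show "int m \<in> inner_freqs" if "m \<in> {p..<q}" for m
      using that by (auto simp: inner_freqs_def p_def q_def)
  qed simp
  also have "norm \<dots> \<le> 2 powr (1 - \<alpha>/2) * (real N / sqrt T) * B"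
  proof (cases "p < q")
    case True
    have m_pos: "0 < real m" if "p \<le> m" "m < q" for m using slope(1)[OF that] phase'_hi_pos by linarith
    have "norm (\<Sum>m\<in>{p..<q}. dual_weight (real m) *\<^sub>R ec (dual_phase (real m))) \<le> dual_weight (real p) * B"
      using True slope
      by (intro abel_summation_bound_interval norm_sum_dual_phase_le[OF dual_sums] dual_weight_antimono
          dual_weight_nonneg m_pos) auto
    also have "\<dots> \<le> 2 powr (1 - \<alpha>/2) * (real N / sqrt T) * B"
      using slope[of p] True dual_sums_le_nonneg[OF dual_sums] dual_weight_le by (intro mult_right_mono) auto
    finally show ?thesis .
  qed (use dual_sums_le_nonneg[OF dual_sums] T_pos in simp)
  finally show ?thesis .
qed

end

theorem power_sum_reflection:
  fixes \<alpha> :: real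
  assumes \<alpha>_bounds: "\<alpha> < 1" "\<alpha> \<noteq> 0"
  obtains M where "M > 0"
    "\<And>N x B. N \<ge> 1 \<Longrightarrow> x > 0 \<Longrightarrow> dual_sums_le \<alpha> x N B \<Longrightarrow>
      norm (\<Sum>n\<in>{N..<2*N}. ec (x * real n powr \<alpha>))
        \<le> M * (1 + harm (nat \<lceil>slope_max \<alpha> * (x * real N powr \<alpha> / real N)\<rceil>)
          + real N / sqrt (x * real N powr \<alpha>) * (1 + B))"
proof -
  obtain C where stationary: "stationary_phase_bound \<alpha> C" using power_stationary_phase[OF \<alpha>_bounds] by blast
  define K where "K = B_process_constant \<alpha> C"
  define L where "L = norm (stationary_constant \<alpha>) * 2 powr (1 - \<alpha>/2)"
  have K_pos: "K > 0" and L_nonneg: "L \<ge> 0"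
    using stationary \<alpha>_bounds
    by (auto simp: K_def L_def B_process_constant_def stationary_phase_bound_def curvature_min_def
        curvature_max_def slope_max_def intro!: add_pos_nonneg)
  show thesis
  proof (rule that[of "K + L"])
    show "K + L > 0" using K_pos L_nonneg by simp
    fix N :: nat and x B :: real
    assume "N \<ge> 1" "x > 0" and dual_sums: "dual_sums_le \<alpha> x N B"
    then interpret power_sum \<alpha> x C N using \<alpha>_bounds stationary by unfold_locales auto
    define Q where "Q = real N / sqrt T"
    define h :: real where "h = harm n_freq"
    have nonneg: "h \<ge> 0" "Q \<ge> 0" using T_pos by (auto simp: h_def Q_def harm_nonneg)
    define S where "S = (\<Sum>n\<in>{N..<2*N}. ec (phase (real n)))"
    define D where "D = (\<Sum>m\<in>inner_freqs. of_real (dual_weight (of_int m)) * ec (dual_phase (of_int m)))"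
    have "norm (\<Sum>n\<in>{N..<2*N}. ec (x * real n powr \<alpha>)) = norm S"
      using norm_sum_ec_sgn_mult[OF \<alpha>_bounds(2), of "\<lambda>n. x * real n powr \<alpha>" "{N..<2*N}"]
      by (simp add: S_def phase_def mult.assoc)
    also have "\<dots> \<le> norm (S - stationary_constant \<alpha> * D) + norm (stationary_constant \<alpha>) * norm D"
      using norm_triangle_sub[of S "stationary_constant \<alpha> * D"] by (simp add: norm_mult add.commute)
    also have "\<dots> \<le> K * (1 + h + Q) + norm (stationary_constant \<alpha>) * (2 powr (1 - \<alpha>/2) * Q * B)"
      unfolding S_def D_def K_def h_def Q_def
      by (intro add_mono mult_left_mono van_der_corput_B weighted_dual_sum_le dual_sums) simp
    also have "\<dots> = K * (1 + h + Q) + L * (Q * B)" by (simp add: L_def)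
    also have "\<dots> \<le> (K + L) * (1 + h + Q * (1 + B))"
    proof -
      have "0 \<le> B" using dual_sums by (rule dual_sums_le_nonneg)
      thus ?thesis
        using K_pos L_nonneg nonneg by (simp add: algebra_simps add_nonneg_nonneg mult_nonneg_nonneg)
    qed
    finally show "norm (\<Sum>n\<in>{N..<2*N}. ec (x * real n powr \<alpha>))
        \<le> (K + L) * (1 + harm (nat \<lceil>slope_max \<alpha> * (x * real N powr \<alpha> / real N)\<rceil>)
          + real N / sqrt (x * real N powr \<alpha>) * (1 + B))"
      by (simp only: h_def Q_def T_def n_freq_def)
  qed
qed

section \<open>Additive energy of powers\<close>

definition dyadic_block :: "nat \<Rightarrow> nat set" where
  "dyadic_block l = {2^l..<2^(l+1)}"

lemma mem_dyadic_block_iff: "m \<in> dyadic_block l \<longleftrightarrow> 0 < m \<and> floor_log m = l"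
proof
  assume m_in_block: "m \<in> dyadic_block l"
  hence "0 < m"
    using zero_less_power[of "2::nat" l] unfolding dyadic_block_def atLeastLessThan_iff by linarith
  thus "0 < m \<and> floor_log m = l" using m_in_block floor_log_eqI[of m l] by (auto simp: dyadic_block_def)
next
  assume "0 < m \<and> floor_log m = l"
  thus "m \<in> dyadic_block l"
    using floor_log_exp2_le[of m] floor_log_exp2_gt[of m] by (auto simp: dyadic_block_def)
qed

lemma card_dyadic_block: "card (dyadic_block l) = 2 ^ l"
  by (simp add: dyadic_block_def)

lemma finite_dyadic_block: "finite (dyadic_block l)"
  by (simp add: dyadic_block_def)

definition block_moments :: "real \<Rightarrow> nat \<Rightarrow> real \<Rightarrow> real" where
  "block_moments \<beta> l u = (\<Sum>j\<le>l. dyadic_moment l j (\<lambda>i. ec (u * real (i + 2^l) powr \<beta>)))"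

lemma block_moments_nonneg: "block_moments \<beta> l u \<ge> 0"
  unfolding block_moments_def by (intro sum_nonneg dyadic_moment_nonneg)

lemma continuous_on_dyadic_moment: "continuous_on S (\<lambda>u. dyadic_moment l j (\<lambda>i. ec (u * f i)))"
  unfolding dyadic_moment_def by (intro continuous_intros)

lemma continuous_on_block_moments: "continuous_on S (block_moments \<beta> l)"
  unfolding block_moments_def[abs_def] by (intro continuous_intros continuous_on_dyadic_moment)

lemma norm_interval_sum_le_block_moments:
  assumes "{p..<q} \<subseteq> dyadic_block l"
  shows "norm (\<Sum>m\<in>{p..<q}. ec (u * real m powr \<beta>)) ^ 4 \<le> 16 * real (l + 1) ^ 3 * block_moments \<beta> l u"
proof (cases "p < q")
  case True
  define z where "z = (\<lambda>i. ec (u * real (i + 2^l) powr \<beta>))"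
  obtain p' q' where shift: "p = p' + 2^l" "q = q' + 2^l" and range: "p' \<le> q'" "q' \<le> 2^l"
    using True assms that[of "p - 2^l" "q - 2^l"] by (auto simp: dyadic_block_def)
  have "(\<Sum>m\<in>{p..<q}. ec (u * real m powr \<beta>)) = (\<Sum>i\<in>{p'..<q'}. z i)"
    unfolding shift z_def by (rule sum.shift_bounds_nat_ivl)
  also have "\<dots> = (\<Sum>i<q'. z i) - (\<Sum>i<p'. z i)"
    using sum.atLeastLessThan_concat[of 0 p' q' z] range by (simp add: lessThan_atLeast0 algebra_simps)
  finally have "norm (\<Sum>m\<in>{p..<q}. ec (u * real m powr \<beta>)) ^ 4
      \<le> 8 * (norm (\<Sum>i<q'. z i) ^ 4 + norm (\<Sum>i<p'. z i) ^ 4)"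
    by (simp only: norm_diff_power4_le)
  also have "\<dots> \<le> 8 * (real (l + 1) ^ 3 * block_moments \<beta> l u + real (l + 1) ^ 3 * block_moments \<beta> l u)"
    unfolding block_moments_def z_def using range by (intro mult_left_mono add_mono rademacher_menshov) auto
  also have "\<dots> = 16 * real (l + 1) ^ 3 * block_moments \<beta> l u" by algebra
  finally show ?thesis .
qed (use block_moments_nonneg in simp)

definition blocks_majorant :: "real \<Rightarrow> nat set \<Rightarrow> real \<Rightarrow> real" where
  "blocks_majorant \<beta> L u = real (card L) ^ 3 * (\<Sum>l\<in>L. 16 * real (l + 1) ^ 3 * block_moments \<beta> l u)"

lemma blocks_majorant_nonneg: "blocks_majorant \<beta> L u \<ge> 0"
  unfolding blocks_majorant_def by (intro mult_nonneg_nonneg sum_nonneg block_moments_nonneg) auto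

lemma continuous_on_blocks_majorant: "continuous_on S (blocks_majorant \<beta> L)"
  unfolding blocks_majorant_def[abs_def] by (intro continuous_intros continuous_on_block_moments)

lemma norm_interval_sum_le_blocks_majorant:
  assumes "finite L" and cover: "{p..<q} \<subseteq> (\<Union>l\<in>L. dyadic_block l)"
  shows "norm (\<Sum>m\<in>{p..<q}. ec (u * real m powr \<beta>)) ^ 4 \<le> blocks_majorant \<beta> L u"
proof -
  define B where "B = (\<lambda>l. {p..<q} \<inter> dyadic_block l)"
  have "{p..<q} = (\<Union>l\<in>L. B l)" using cover by (auto simp: B_def)
  hence "(\<Sum>m\<in>{p..<q}. ec (u * real m powr \<beta>)) = (\<Sum>m\<in>(\<Union>l\<in>L. B l). ec (u * real m powr \<beta>))" by simp
  also have "\<dots> = (\<Sum>l\<in>L. \<Sum>m\<in>B l. ec (u * real m powr \<beta>))"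
    by (rule sum.UNION_disjoint) (use assms in \<open>auto simp: B_def mem_dyadic_block_iff\<close>)
  finally have "norm (\<Sum>m\<in>{p..<q}. ec (u * real m powr \<beta>)) ^ 4
      \<le> (\<Sum>l\<in>L. norm (\<Sum>m\<in>B l. ec (u * real m powr \<beta>))) ^ 4"
    by (intro power_mono) (auto intro: norm_sum)
  also have "\<dots> \<le> real (card L) ^ 3 * (\<Sum>l\<in>L. norm (\<Sum>m\<in>B l. ec (u * real m powr \<beta>)) ^ 4)"
    by (rule sum_power4_le)
  also have "\<dots> \<le> blocks_majorant \<beta> L u"
    unfolding blocks_majorant_def
  proof (intro mult_left_mono sum_mono)
    fix l
    have "B l = {max p (2^l)..<min q (2^(l+1))}" by (auto simp: B_def dyadic_block_def)
    thus "norm (\<Sum>m\<in>B l. ec (u * real m powr \<beta>)) ^ 4 \<le> 16 * real (l + 1) ^ 3 * block_moments \<beta> l u"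
      using norm_interval_sum_le_block_moments[of "max p (2^l)" "min q (2^(l+1))" l u \<beta>]
      by (simp add: dyadic_block_def)
  qed auto
  finally show ?thesis .
qed

lemma integral_dyadic_moment_le:
  assumes Y_pos: "Y > 0" and "j \<le> l"
  shows "integral {u..u+Y} (\<lambda>v. dyadic_moment l j (\<lambda>i. ec (v * real (i + 2^l) powr \<beta>)))
    \<le> 4 * Y * additive_energy (\<lambda>m. real m powr \<beta>) (dyadic_block l) Y"
proof -
  define B where "B = (\<lambda>k. {k*2^j + 2^l..<(k+1)*2^j + 2^l :: nat})"
  have shift: "(\<Sum>i\<in>{k*2^j..<(k+1)*2^j}. ec (v * real (i + 2^l) powr \<beta>)) = (\<Sum>m\<in>B k. 1 * ec (v * real m powr \<beta>))"
    for k v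
    unfolding B_def mult_1 by (rule sum.shift_bounds_nat_ivl[symmetric])
  have "integral {u..u+Y} (\<lambda>v. dyadic_moment l j (\<lambda>i. ec (v * real (i + 2^l) powr \<beta>)))
      = (\<Sum>k<2^(l-j). integral {u..u+Y} (\<lambda>v. norm (\<Sum>m\<in>B k. 1 * ec (v * real m powr \<beta>)) ^ 4))"
    unfolding dyadic_moment_def shift
    by (rule integral_sum) (auto intro!: integrable_continuous_real continuous_intros)
  also have "\<dots> \<le> (\<Sum>k<2^(l-j). 4 * Y * 1 ^ 4 * additive_energy (\<lambda>m. real m powr \<beta>) (B k) Y)"
    by (intro sum_mono fourth_moment_window Y_pos) auto
  also have "\<dots> = 4 * Y * (\<Sum>k<2^(l-j). additive_energy (\<lambda>m. real m powr \<beta>) (B k) Y)"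
    by (simp add: sum_distrib_left)
  also have "\<dots> \<le> 4 * Y * additive_energy (\<lambda>m. real m powr \<beta>) (dyadic_block l) Y"
  proof (intro mult_left_mono sum_additive_energy_disjoint_le finite_dyadic_block)
    fix k assume "k \<in> {..<(2::nat)^(l-j)}"
    hence "(k + 1) * 2^j \<le> 2^(l-j) * (2::nat)^j" by (intro mult_right_mono) auto
    also have "\<dots> = 2^l" using \<open>j \<le> l\<close> by (simp flip: power_add)
    finally show "B k \<subseteq> dyadic_block l" by (auto simp: B_def dyadic_block_def)
  next
    fix k k' :: nat assume "k \<noteq> k'"
    hence "(k + 1) * 2^j \<le> k' * (2::nat)^j \<or> (k' + 1) * 2^j \<le> k * (2::nat)^j"
      by (cases "k < k'") (auto intro!: mult_right_mono simp del: mult_Suc)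
    thus "B k \<inter> B k' = {}" by (auto simp: B_def)
  qed (use Y_pos in auto)
  finally show ?thesis .
qed

lemma integral_block_moments_le:
  assumes "Y > 0"
  shows "integral {u..u+Y} (block_moments \<beta> l)
    \<le> 4 * Y * real (l + 1) * additive_energy (\<lambda>m. real m powr \<beta>) (dyadic_block l) Y"
proof -
  have "integral {u..u+Y} (block_moments \<beta> l)
      = (\<Sum>j\<le>l. integral {u..u+Y} (\<lambda>v. dyadic_moment l j (\<lambda>i. ec (v * real (i + 2^l) powr \<beta>))))"
    unfolding block_moments_def[abs_def]
    by (rule integral_sum) (auto intro!: integrable_continuous_real continuous_on_dyadic_moment)
  also have "\<dots> \<le> (\<Sum>j\<le>l. 4 * Y * additive_energy (\<lambda>m. real m powr \<beta>) (dyadic_block l) Y)"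
    using assms by (intro sum_mono integral_dyadic_moment_le) auto
  finally show ?thesis by (simp add: algebra_simps)
qed

text \<open>
  The scale \<open>2\<^sup>l\<^sup>(\<^sup>2\<^sup>-\<^sup>\<beta>\<^sup>)\<close> is the largest at which the diagonal \<open>{a, b} = {c, d}\<close> is still expected to
  dominate the additive energy of the \<open>\<beta>\<close>-th powers in the block.
\<close>
definition block_energy :: "real \<Rightarrow> nat \<Rightarrow> real" where
  "block_energy \<beta> l = additive_energy (\<lambda>m. real m powr \<beta>) (dyadic_block l) ((2^l) powr (2 - \<beta>))"

lemma block_energy_nonneg: "block_energy \<beta> l \<ge> 0"
  unfolding block_energy_def by (rule additive_energy_nonneg)

lemma block_energy_le: "block_energy \<beta> l \<le> 2 ^ (4 * l)"
  using additive_energy_le_card[of "\<lambda>m. real m powr \<beta>" "dyadic_block l"]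
  by (simp add: block_energy_def card_dyadic_block mult.commute flip: power_mult)

definition blocks_energy :: "real \<Rightarrow> nat set \<Rightarrow> real" where
  "blocks_energy \<beta> L = real (card L) ^ 3 * (\<Sum>l\<in>L. real (l + 1) ^ 4 * block_energy \<beta> l)"

lemma blocks_energy_nonneg: "blocks_energy \<beta> L \<ge> 0"
  unfolding blocks_energy_def by (intro mult_nonneg_nonneg sum_nonneg block_energy_nonneg) auto

lemma integral_blocks_majorant_le:
  assumes "finite L" "Y > 0"
    and energy: "\<And>l. l \<in> L \<Longrightarrow> additive_energy (\<lambda>m. real m powr \<beta>) (dyadic_block l) Y \<le> C * block_energy \<beta> l"
  shows "integral {u..u+Y} (blocks_majorant \<beta> L) \<le> 64 * Y * C * blocks_energy \<beta> L"
proof -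
  have "integral {u..u+Y} (blocks_majorant \<beta> L)
      = real (card L) ^ 3 * (\<Sum>l\<in>L. 16 * real (l + 1) ^ 3 * integral {u..u+Y} (block_moments \<beta> l))"
    unfolding blocks_majorant_def[abs_def] using assms(1)
    by (simp add: integral_sum integrable_continuous_real continuous_intros continuous_on_block_moments)
  also have "\<dots> \<le> real (card L) ^ 3
      * (\<Sum>l\<in>L. 16 * real (l + 1) ^ 3 * (4 * Y * real (l + 1) * (C * block_energy \<beta> l)))"
  proof (intro mult_left_mono sum_mono)
    fix l assume "l \<in> L"
    have "integral {u..u+Y} (block_moments \<beta> l)
        \<le> 4 * Y * real (l + 1) * additive_energy (\<lambda>m. real m powr \<beta>) (dyadic_block l) Y"
      by (rule integral_block_moments_le[OF \<open>Y > 0\<close>])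
    also have "\<dots> \<le> 4 * Y * real (l + 1) * (C * block_energy \<beta> l)"
      using \<open>Y > 0\<close> by (intro mult_left_mono energy \<open>l \<in> L\<close>) auto
    finally show "integral {u..u+Y} (block_moments \<beta> l) \<le> 4 * Y * real (l + 1) * (C * block_energy \<beta> l)" .
  qed auto
  also have "\<dots> = 64 * Y * C * blocks_energy \<beta> L"
  proof -
    have "16 * a ^ 3 * (4 * Y * a * (C * b)) = 64 * Y * C * (a ^ 4 * b)" for a b :: real by algebra
    thus ?thesis unfolding blocks_energy_def by (simp only: sum_distrib_left[symmetric]) (simp only: mult_ac)
  qed
  finally show ?thesis .
qed

lemma integral_power_substitution_le:
  fixes f :: "real \<Rightarrow> real" and c s x0 :: real
  assumes f_props: "continuous_on UNIV f" "\<And>u. f u \<ge> 0" and pos: "c > 0" "s > 0" "x0 > 0"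
  shows "integral {x0..2*x0} (\<lambda>x. f (c * x powr s))
    \<le> 2 * x0 / (s * (c * x0 powr s)) * integral {c * x0 powr s..c * (2*x0) powr s} f"
proof -
  define u where "u = (\<lambda>x. c * x powr s)"
  define u' where "u' = (\<lambda>x. s * u x / x)"
  define r where "r = s * u x0 / (2 * x0)"
  have u_x0: "u x0 > 0" using pos by (simp add: u_def)
  have r_pos: "r > 0" using pos u_x0 by (simp add: r_def)
  have mono: "u x \<le> u y" if "0 < x" "x \<le> y" for x y
    unfolding u_def using that pos by (intro mult_left_mono powr_mono2) auto
  have deriv: "(u has_real_derivative u' x) (at x within {x0..2*x0})" if "x \<in> {x0..2*x0}" for x
  proof -
    have "x > 0" using that pos by auto
    hence "(u has_real_derivative (c * (s * x powr (s - 1)))) (at x)"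
      unfolding u_def by (auto intro!: derivative_eq_intros)
    moreover have "c * (s * x powr (s - 1)) = u' x" using \<open>x > 0\<close> by (simp add: u'_def u_def powr_diff)
    ultimately show ?thesis by (metis has_field_derivative_at_within)
  qed
  have substitution: "((\<lambda>x. u' x *\<^sub>R f (u x)) has_integral (integral {u x0..u (2*x0)} f)) {x0..2*x0}"
    by (rule has_integral_substitution[where c = "u x0" and d = "u (2*x0)"])
       (use pos mono deriv in \<open>auto intro: continuous_on_subset[OF f_props(1)]\<close>)
  have continuous: "continuous_on {x0..2*x0} (\<lambda>x. f (u x))"
    using pos unfolding u_def by (intro continuous_on_compose2[OF f_props(1)] continuous_intros) auto
  have "r * integral {x0..2*x0} (\<lambda>x. f (u x)) = integral {x0..2*x0} (\<lambda>x. r * f (u x))" by simp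
  also have "\<dots> \<le> integral {u x0..u (2*x0)} f"
  proof (rule has_integral_le[OF integrable_integral substitution])
    show "(\<lambda>x. r * f (u x)) integrable_on {x0..2*x0}"
      by (intro integrable_continuous_real continuous_intros continuous)
    show "r * f (u x) \<le> u' x *\<^sub>R f (u x)" if "x \<in> {x0..2*x0}" for x
    proof -
      have "r \<le> u' x"
        unfolding r_def u'_def using that pos u_x0 mono[of x0 x] by (intro frac_le mult_left_mono) auto
      thus ?thesis using f_props(2)[of "u x"] by (simp add: mult_right_mono)
    qed
  qed
  finally have "integral {x0..2*x0} (\<lambda>x. f (u x)) \<le> 1 / r * integral {u x0..u (2*x0)} f"
    using r_pos by (simp add: field_simps)
  thus ?thesis by (simp add: r_def u_def)
qed

text \<open>The indices of the dyadic blocks that meet the range of dual frequencies.\<close>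
definition dual_levels :: "real \<Rightarrow> nat \<Rightarrow> nat \<Rightarrow> nat set" where
  "dual_levels \<alpha> j i = {l. 2^l * 2^j \<le> 2 * slope_max \<alpha> * 2^i \<and> slope_min \<alpha> * 2^i \<le> 2 * 2^l * (2::real)^j}"

context
  fixes \<alpha> :: real
  assumes \<alpha>_bounds: "\<alpha> < 1" "\<alpha> \<noteq> 0"
begin

lemma slope_min_pos: "slope_min \<alpha> > 0" and slope_max_pos: "slope_max \<alpha> > 0"
  using \<alpha>_bounds by (simp_all add: slope_min_def slope_max_def)

definition max_dual_levels :: nat where
  "max_dual_levels = nat \<lfloor>4 * slope_max \<alpha> / slope_min \<alpha>\<rfloor> + 1"

lemma dual_levels_le:
  assumes "l0 \<in> dual_levels \<alpha> j i" "l0 + d \<in> dual_levels \<alpha> j i"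
  shows "d < max_dual_levels"
proof -
  have "2^d * (slope_min \<alpha> * 2^i) \<le> 2^d * (2 * 2^l0 * 2^j)"
    using assms(1) by (intro mult_left_mono) (auto simp: dual_levels_def)
  also have "\<dots> = 2 * (2^(l0 + d) * 2^j)" by (simp add: power_add)
  also have "\<dots> \<le> 2 * (2 * slope_max \<alpha> * 2^i)"
    using assms(2) by (intro mult_left_mono) (auto simp: dual_levels_def)
  finally have "(2^d * slope_min \<alpha>) * 2^i \<le> (4 * slope_max \<alpha>) * 2^i" by (simp add: mult_ac)
  hence "2^d * slope_min \<alpha> \<le> 4 * slope_max \<alpha>" by (rule mult_right_le_imp_le) simp
  hence "2^d \<le> 4 * slope_max \<alpha> / slope_min \<alpha>" using slope_min_pos by (simp add: field_simps)
  hence "real d \<le> 4 * slope_max \<alpha> / slope_min \<alpha>"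
    using of_nat_less_two_power[of d, where 'a = real] by linarith
  thus ?thesis by (simp add: max_dual_levels_def less_Suc_eq_le le_nat_iff le_floor_iff)
qed

lemma finite_dual_levels: "finite (dual_levels \<alpha> j i)"
  and card_dual_levels_le: "card (dual_levels \<alpha> j i) \<le> max_dual_levels"
proof -
  have "finite (dual_levels \<alpha> j i) \<and> card (dual_levels \<alpha> j i) \<le> max_dual_levels"
  proof (cases "dual_levels \<alpha> j i = {}")
    case False
    define l0 where "l0 = (LEAST l. l \<in> dual_levels \<alpha> j i)"
    have l0_in: "l0 \<in> dual_levels \<alpha> j i" unfolding l0_def using False by (metis LeastI ex_in_conv)
    have "dual_levels \<alpha> j i \<subseteq> {l0..<l0 + max_dual_levels}"
    proof
      fix l assume l_in: "l \<in> dual_levels \<alpha> j i"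
      then obtain d where "l = l0 + d" using Least_le[of "\<lambda>l. l \<in> dual_levels \<alpha> j i" l] unfolding l0_def
        by (metis le_iff_add)
      thus "l \<in> {l0..<l0 + max_dual_levels}" using dual_levels_le[OF l0_in, of d] l_in by simp
    qed
    from finite_subset[OF this] card_mono[OF _ this] show ?thesis by simp
  qed simp
  thus "finite (dual_levels \<alpha> j i)" "card (dual_levels \<alpha> j i) \<le> max_dual_levels" by blast+
qed

lemma dual_frequencies_in_levels:
  assumes t_bounds: "2^i \<le> t" "t \<le> 2 * 2^i"
    and m_bounds: "slope_min \<alpha> * (t / 2^j) \<le> real m" "real m \<le> slope_max \<alpha> * (t / 2^j)"
  shows "m \<in> (\<Union>l\<in>dual_levels \<alpha> j i. dyadic_block l)"
proof -
  have "0 < t" using t_bounds(1) zero_less_power[of "2::real" i] by linarith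
  hence "0 < slope_min \<alpha> * (t / 2^j)" using slope_min_pos by simp
  hence "0 < m" using m_bounds by (cases m) auto
  define l where "l = floor_log m"
  have m_block: "m \<in> dyadic_block l" using \<open>0 < m\<close> by (simp add: mem_dyadic_block_iff l_def)
  hence "real (2^l) \<le> real m" "real m < real (2^(l+1))"
    unfolding of_nat_le_iff of_nat_less_iff by (simp_all add: dyadic_block_def)
  hence l_bounds: "2^l \<le> real m" "real m < 2 * 2^l" by simp_all
  have "slope_max \<alpha> * (t / 2^j) \<le> slope_max \<alpha> * (2 * 2^i / 2^j)"
    using t_bounds slope_max_pos by (intro mult_left_mono divide_right_mono) auto
  hence "2^l \<le> slope_max \<alpha> * (2 * 2^i / 2^j)" using l_bounds m_bounds(2) by linarith
  moreover have "slope_min \<alpha> * (2^i / 2^j) \<le> slope_min \<alpha> * (t / 2^j)"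
    using t_bounds slope_min_pos by (intro mult_left_mono divide_right_mono) auto
  hence "slope_min \<alpha> * (2^i / 2^j) \<le> 2 * 2^l" using l_bounds m_bounds(1) by linarith
  ultimately have "l \<in> dual_levels \<alpha> j i" by (simp add: dual_levels_def field_simps)
  thus ?thesis using m_block by blast
qed

abbreviation dual_majorant :: "nat \<Rightarrow> nat \<Rightarrow> real \<Rightarrow> real" where
  "dual_majorant j i x \<equiv> blocks_majorant (dual_exponent \<alpha>) (dual_levels \<alpha> j i) (dual_coeff \<alpha> x)"

lemma dual_sums_le_majorant:
  assumes t_bounds: "2^i \<le> x * (2^j) powr \<alpha>" "x * (2^j) powr \<alpha> \<le> 2 * 2^i"
  shows "dual_sums_le \<alpha> x (2^j) (root 4 (dual_majorant j i x))"
  unfolding dual_sums_le_def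
proof (intro allI impI)
  fix p q :: nat
  assume slopes: "\<forall>m\<in>{p..<q}. slope_min \<alpha> * (x * real (2^j) powr \<alpha> / real (2^j)) \<le> real m
    \<and> real m \<le> slope_max \<alpha> * (x * real (2^j) powr \<alpha> / real (2^j))"
  let ?S = "\<Sum>m\<in>{p..<q}. ec (dual_coeff \<alpha> x * real m powr dual_exponent \<alpha>)"
  have "norm ?S ^ 4 \<le> dual_majorant j i x"
    using slopes
    by (intro norm_interval_sum_le_blocks_majorant finite_dual_levels subsetI
      dual_frequencies_in_levels[OF t_bounds]) auto
  hence "root 4 (norm ?S ^ 4) \<le> root 4 (dual_majorant j i x)" by simp
  thus "norm ?S \<le> root 4 (dual_majorant j i x)" by (simp add: real_root_power_cancel)
qed

end

lemma additive_energy_le_of_scale: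
  assumes "0 < c" "c \<le> 1" "0 < X" "c * X \<le> Y"
  shows "additive_energy \<phi> I Y \<le> 1 / c\<^sup>2 * additive_energy \<phi> I X"
proof -
  have "additive_energy \<phi> I Y \<le> additive_energy \<phi> I (c * X)"
    using assms by (intro additive_energy_antimono) auto
  also have "\<dots> \<le> (X / (c * X))\<^sup>2 * additive_energy \<phi> I X"
    using assms by (intro additive_energy_scale) (auto intro: mult_left_le_one_le)
  also have "\<dots> = 1 / c\<^sup>2 * additive_energy \<phi> I X" using assms by (simp add: power_divide)
  finally show ?thesis .
qed

lemma sum4_power4_le:
  fixes a b c d :: real
  shows "(a + b + c + d) ^ 4 \<le> 64 * (a ^ 4 + b ^ 4 + c ^ 4 + d ^ 4)"
  using sum_power4_le[of "\<lambda>i. [a, b, c, d] ! i" "{..<4}"] by (simp add: eval_nat_numeral)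

lemma power4_le_of_le_reflection:
  fixes F M h H J Q B :: real
  assumes F_bounds: "0 \<le> F" "F \<le> M * (1 + h + Q * (1 + B))" and h_bounds: "0 \<le> h" "h \<le> H * J" and "1 \<le> J"
  shows "F ^ 4 \<le> 64 * M ^ 4 * (1 + H ^ 4) * (J ^ 4 + Q ^ 4 * (1 + B ^ 4))"
proof -
  have "F ^ 4 \<le> (M * (1 + h + Q + Q * B)) ^ 4"
    using F_bounds by (intro power_mono) (simp_all add: distrib_left)
  also have "\<dots> \<le> M ^ 4 * (64 * (1 ^ 4 + h ^ 4 + Q ^ 4 + (Q * B) ^ 4))"
    unfolding power_mult_distrib[of M] by (intro mult_left_mono sum4_power4_le) simp
  also have "\<dots> = 64 * M ^ 4 * ((1 + h ^ 4) + Q ^ 4 * (1 + B ^ 4))"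
    by (simp add: power_mult_distrib algebra_simps)
  also have "\<dots> \<le> 64 * M ^ 4 * ((1 + H ^ 4) * J ^ 4 + (1 + H ^ 4) * (Q ^ 4 * (1 + B ^ 4)))"
  proof (intro mult_left_mono add_mono)
    have "h ^ 4 \<le> (H * J) ^ 4" using h_bounds by (intro power_mono) auto
    moreover have "1 \<le> J ^ 4" using \<open>1 \<le> J\<close> by (intro one_le_power)
    ultimately show "1 + h ^ 4 \<le> (1 + H ^ 4) * J ^ 4"
      unfolding power_mult_distrib distrib_right by linarith
    have "1 * (Q ^ 4 * (1 + B ^ 4)) \<le> (1 + H ^ 4) * (Q ^ 4 * (1 + B ^ 4))"
      by (intro mult_right_mono mult_nonneg_nonneg) auto
    thus "Q ^ 4 * (1 + B ^ 4) \<le> (1 + H ^ 4) * (Q ^ 4 * (1 + B ^ 4))" by simp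
  qed simp
  also have "\<dots> = 64 * M ^ 4 * (1 + H ^ 4) * (J ^ 4 + Q ^ 4 * (1 + B ^ 4))" by algebra
  finally show ?thesis .
qed

lemma harm_le_ln: "n > 0 \<Longrightarrow> harm n \<le> 1 + ln (real n)"
  using euler_mascheroni_sequence_decreasing[of 1 n] by (simp add: harm_expand)

lemma harm_dyadic_le:
  assumes K_pos: "0 < K" and t_bounds: "0 < t" "t \<le> 2 * (2^j)\<^sup>2"
  shows "harm (nat \<lceil>K * (t / 2^j)\<rceil>) \<le> (2 + ln (2 * K + 1)) * real (1 + j)"
proof -
  define n where "n = nat \<lceil>K * (t / 2^j)\<rceil>"
  have pos: "K * (t / 2^j) > 0" using K_pos t_bounds by simp
  hence "n > 0" by (simp add: n_def)
  have "t / 2^j \<le> 2 * 2^j" using t_bounds by (simp add: divide_le_eq power2_eq_square)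
  hence "K * (t / 2^j) \<le> K * (2 * 2^j)" using K_pos by (intro mult_left_mono) auto
  hence "real n \<le> K * (2 * 2^j) + 1" unfolding n_def using pos by linarith
  also have "\<dots> \<le> (2 * K + 1) * 2^j" by (simp add: algebra_simps)
  finally have "ln (real n) \<le> ln ((2 * K + 1) * 2^j)" using \<open>n > 0\<close> K_pos by simp
  also have "\<dots> = ln (2 * K + 1) + real j * ln 2" using K_pos by (simp add: ln_mult ln_realpow)
  also have "real j * ln 2 \<le> real j * 1" using ln_2_less_1 by (intro mult_left_mono) auto
  finally have "harm n \<le> 1 + ln (2 * K + 1) + real j"
    using harm_le_ln[OF \<open>n > 0\<close>] by linarith
  also have "\<dots> \<le> (2 + ln (2 * K + 1)) * real (1 + j)"
  proof -
    have "0 \<le> ln (2 * K + 1) * real j" using K_pos by simp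
    thus ?thesis by (simp add: algebra_simps)
  qed
  finally show ?thesis by (simp only: n_def)
qed

definition block_sum :: "real \<Rightarrow> nat \<Rightarrow> real \<Rightarrow> complex" where
  "block_sum \<alpha> j x = (\<Sum>n\<in>dyadic_block j. ec (x * real n powr \<alpha>))"

lemma continuous_on_block_sum: "continuous_on S (block_sum \<alpha> j)"
  unfolding block_sum_def[abs_def] by (intro continuous_intros)

lemma norm_block_sum_le: "norm (block_sum \<alpha> j x) \<le> 2 ^ j"
  using norm_sum_ec_le_card[of "\<lambda>n. x * real n powr \<alpha>" "dyadic_block j"]
  by (simp add: block_sum_def card_dyadic_block)

definition dyadic_window :: "real \<Rightarrow> nat \<Rightarrow> nat \<Rightarrow> real" where
  "dyadic_window \<alpha> j i = 2^i * (2^j) powr (- \<alpha>)"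

lemma dyadic_window_pos: "dyadic_window \<alpha> j i > 0"
  by (simp add: dyadic_window_def)

definition dual_scale_ratio :: "real \<Rightarrow> real" where
  "dual_scale_ratio \<alpha> = (1 - \<alpha>) * \<bar>\<alpha>\<bar> powr (\<alpha> / (1 - \<alpha>)) / (2 * slope_max \<alpha>) powr (2 - dual_exponent \<alpha>)"

definition fourth_moment_bound :: "real \<Rightarrow> real \<Rightarrow> bool" where
  "fourth_moment_bound \<alpha> C \<longleftrightarrow> C > 0 \<and> (\<forall>j i. 2^i \<le> (2^j :: real)\<^sup>2 \<longrightarrow>
     integral {dyadic_window \<alpha> j i..2 * dyadic_window \<alpha> j i} (\<lambda>x. norm (block_sum \<alpha> j x) ^ 4)
       \<le> C * dyadic_window \<alpha> j i * (real (1 + j) ^ 4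
           + (2^j) ^ 4 / (2^i)\<^sup>2 * (1 + blocks_energy (dual_exponent \<alpha>) (dual_levels \<alpha> j i))))"

lemma integral_le_of_majorant:
  fixes f g :: "real \<Rightarrow> real"
  assumes f_continuous: "continuous_on {w..2*w} f" and g_continuous: "continuous_on {w..2*w} g"
    and f_le: "\<And>x. x \<in> {w..2*w} \<Longrightarrow> f x \<le> M * (J + Q * (1 + g x))"
    and integral_g_le: "integral {w..2*w} g \<le> D * w * E"
    and nonneg: "0 \<le> w" "0 \<le> M" "0 \<le> J" "0 \<le> Q" "0 \<le> D" "0 \<le> E"
  shows "integral {w..2*w} f \<le> M * (1 + D) * w * (J + Q * (1 + E))"
proof -
  define I where "I = integral {w..2*w} g"
  have "((\<lambda>x. J) has_integral J * w) {w..2*w}" "((\<lambda>x. 1) has_integral w) {w..2*w}"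
    using has_integral_const_real[of J w "2*w"] has_integral_const_real[of "1::real" w "2*w"] nonneg
    by (simp_all add: mult.commute)
  moreover have "(g has_integral I) {w..2*w}"
    unfolding I_def by (intro integrable_integral integrable_continuous_real g_continuous)
  ultimately have majorant: "((\<lambda>x. M * (J + Q * (1 + g x))) has_integral M * (J * w + Q * (w + I))) {w..2*w}"
    by (intro has_integral_mult_right has_integral_add)
  have "integral {w..2*w} f \<le> M * (J * w + Q * (w + I))"
    by (rule has_integral_le[OF integrable_integral majorant]) (intro integrable_continuous_real f_continuous f_le)+
  also have "\<dots> \<le> M * (J * w + Q * (w + D * w * E))"
    using integral_g_le nonneg by (intro mult_left_mono add_left_mono) (auto simp: I_def)
  also have "\<dots> = M * w * (J + Q * (1 + D * E))" by (simp add: algebra_simps)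
  also have "\<dots> \<le> M * w * ((1 + D) * J + Q * ((1 + D) * (1 + E)))"
    using nonneg by (intro mult_left_mono add_mono) (auto simp: algebra_simps)
  also have "\<dots> = M * (1 + D) * w * (J + Q * (1 + E))" by algebra
  finally show ?thesis .
qed

context
  fixes \<alpha> :: real
  assumes \<alpha>_bounds: "\<alpha> < 1" "\<alpha> \<noteq> 0"
begin

lemma dyadic_window_range:
  assumes "x \<in> {dyadic_window \<alpha> j i..2 * dyadic_window \<alpha> j i}"
  shows "2^i \<le> x * (2^j) powr \<alpha>" "x * (2^j) powr \<alpha> \<le> 2 * 2^i"
proof -
  have window: "dyadic_window \<alpha> j i * (2^j) powr \<alpha> = 2^i" by (simp add: dyadic_window_def powr_minus)
  show "2^i \<le> x * (2^j) powr \<alpha>"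
    unfolding window[symmetric] using assms by (intro mult_right_mono) auto
  have "x * (2^j) powr \<alpha> \<le> (2 * dyadic_window \<alpha> j i) * (2^j) powr \<alpha>"
    using assms by (intro mult_right_mono) auto
  thus "x * (2^j) powr \<alpha> \<le> 2 * 2^i" by (simp only: mult.assoc window)
qed

lemma norm_block_sum_power4_le:
  obtains M where "M > 0"
    "\<And>j i x. 2^i \<le> (2^j :: real)\<^sup>2 \<Longrightarrow> x \<in> {dyadic_window \<alpha> j i..2 * dyadic_window \<alpha> j i} \<Longrightarrow>
       norm (block_sum \<alpha> j x) ^ 4 \<le> M * (real (1 + j) ^ 4 + (2^j) ^ 4 / (2^i)\<^sup>2 * (1 + dual_majorant \<alpha> j i x))"
proof (rule power_sum_reflection[OF \<alpha>_bounds])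
  fix M0 :: real
  assume "M0 > 0" and reflection: "\<And>N x B. N \<ge> 1 \<Longrightarrow> x > 0 \<Longrightarrow> dual_sums_le \<alpha> x N B \<Longrightarrow>
      norm (\<Sum>n\<in>{N..<2*N}. ec (x * real n powr \<alpha>))
        \<le> M0 * (1 + harm (nat \<lceil>slope_max \<alpha> * (x * real N powr \<alpha> / real N)\<rceil>)
          + real N / sqrt (x * real N powr \<alpha>) * (1 + B))"
  define H where "H = 2 + ln (2 * slope_max \<alpha> + 1)"
  show thesis
  proof (rule that[of "64 * M0 ^ 4 * (1 + H ^ 4)"])
    show "64 * M0 ^ 4 * (1 + H ^ 4) > 0" using \<open>M0 > 0\<close> by (simp add: add_pos_nonneg)
    fix j i :: nat and x :: real
    assume scale_le: "2^i \<le> (2^j :: real)\<^sup>2" and x_in: "x \<in> {dyadic_window \<alpha> j i..2 * dyadic_window \<alpha> j i}"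
    define t where "t = x * (2^j) powr \<alpha>"
    define B where "B = root 4 (dual_majorant \<alpha> j i x)"
    define h :: real where "h = harm (nat \<lceil>slope_max \<alpha> * (t / 2^j)\<rceil>)"
    define Q where "Q = 2^j / sqrt t"
    have t_bounds: "2^i \<le> t" "t \<le> 2 * 2^i" "0 < t"
      using dyadic_window_range[OF x_in] zero_less_power[of "2::real" i] unfolding t_def by linarith+
    have "0 < x" using x_in dyadic_window_pos[of \<alpha> j i] by auto
    have B_power4: "B ^ 4 = dual_majorant \<alpha> j i x" by (simp add: B_def blocks_majorant_nonneg)
    have "t \<le> 2 * (2^j)\<^sup>2" using t_bounds scale_le by linarith
    hence h_bounds: "h \<le> H * real (1 + j)" "0 \<le> h"
      unfolding h_def H_def
      using harm_dyadic_le[OF slope_max_pos[OF \<alpha>_bounds] \<open>0 < t\<close>] by (auto simp: harm_nonneg)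
    have "Q ^ 4 = (2^j) ^ 4 / t\<^sup>2"
      using t_bounds by (simp add: Q_def power_divide power4_eq_xxxx power2_eq_square)
    also have "\<dots> \<le> (2^j) ^ 4 / (2^i)\<^sup>2" using t_bounds by (intro divide_left_mono power_mono) auto
    finally have Q_bounds: "Q ^ 4 \<le> (2^j) ^ 4 / (2^i)\<^sup>2" .
    have "norm (block_sum \<alpha> j x) \<le> M0 * (1 + h + Q * (1 + B))"
      using reflection[of "2^j" x B] dual_sums_le_majorant[OF \<alpha>_bounds dyadic_window_range[OF x_in]] \<open>0 < x\<close>
      by (simp add: block_sum_def dyadic_block_def h_def Q_def t_def B_def)
    hence "norm (block_sum \<alpha> j x) ^ 4 \<le> 64 * M0 ^ 4 * (1 + H ^ 4) * (real (1 + j) ^ 4 + Q ^ 4 * (1 + B ^ 4))"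
      using h_bounds by (intro power4_le_of_le_reflection) auto
    also have "\<dots> \<le> 64 * M0 ^ 4 * (1 + H ^ 4) * (real (1 + j) ^ 4 + (2^j) ^ 4 / (2^i)\<^sup>2 * (1 + B ^ 4))"
      using Q_bounds by (intro mult_left_mono add_left_mono mult_right_mono) auto
    finally show "norm (block_sum \<alpha> j x) ^ 4
        \<le> 64 * M0 ^ 4 * (1 + H ^ 4) * (real (1 + j) ^ 4 + (2^j) ^ 4 / (2^i)\<^sup>2 * (1 + dual_majorant \<alpha> j i x))"
      by (simp only: B_power4)
  qed
qed

lemma two_minus_dual_exponent: "2 - dual_exponent \<alpha> = 1 + 1 / (1 - \<alpha>)"
  using \<alpha>_bounds by (simp add: dual_exponent_def field_simps)

lemma dual_scale_ratio_pos: "dual_scale_ratio \<alpha> > 0"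
  using \<alpha>_bounds slope_max_pos[OF \<alpha>_bounds] by (simp add: dual_scale_ratio_def)

lemma dual_scale_le:
  assumes scale_le: "2^i \<le> (2^j :: real)\<^sup>2" and l_in: "l \<in> dual_levels \<alpha> j i"
  shows "dual_scale_ratio \<alpha> * (2^l) powr (2 - dual_exponent \<alpha>) \<le> dual_coeff \<alpha> (dyadic_window \<alpha> j i)"
proof -
  define s where "s = 1 / (1 - \<alpha>)"
  define W where "W = (2::real)^i / 2^j"
  have s_eq: "s > 0" "(1 - \<alpha>) * s = 1" using \<alpha>_bounds by (auto simp: s_def)
  have W_bounds: "0 < W" "W \<le> 2^j" using scale_le by (auto simp: W_def divide_le_eq power2_eq_square)
  have "dyadic_window \<alpha> j i = W * (2^j) powr (1 - \<alpha>)"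
    by (simp add: dyadic_window_def W_def powr_diff powr_minus_divide)
  hence window: "dyadic_window \<alpha> j i powr s = W powr s * 2^j"
    using W_bounds s_eq by (simp add: powr_mult powr_powr)
  have "2^l \<le> 2 * slope_max \<alpha> * W" using l_in by (simp add: dual_levels_def W_def field_simps)
  hence "(2^l) powr (1 + s) \<le> (2 * slope_max \<alpha> * W) powr (1 + s)" using s_eq by (intro powr_mono2) auto
  also have "\<dots> = (2 * slope_max \<alpha>) powr (1 + s) * (W powr s * W)"
    using slope_max_pos[OF \<alpha>_bounds] W_bounds by (simp add: powr_mult powr_add)
  also have "\<dots> \<le> (2 * slope_max \<alpha>) powr (1 + s) * (W powr s * 2^j)"
    using W_bounds by (intro mult_left_mono) auto
  finally have "dual_scale_ratio \<alpha> * (2^l) powr (1 + s)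
      \<le> dual_scale_ratio \<alpha> * ((2 * slope_max \<alpha>) powr (1 + s) * (W powr s * 2^j))"
    using dual_scale_ratio_pos by (intro mult_left_mono) auto
  also have "\<dots> = dual_coeff \<alpha> (dyadic_window \<alpha> j i)"
    using slope_max_pos[OF \<alpha>_bounds]
    by (simp add: dual_scale_ratio_def dual_coeff_def two_minus_dual_exponent window flip: s_def)
  finally show ?thesis by (simp only: two_minus_dual_exponent s_def)
qed

lemma continuous_on_dual_majorant: "0 < a \<Longrightarrow> continuous_on {a..b} (dual_majorant \<alpha> j i)"
  unfolding dual_coeff_def
  by (rule continuous_on_compose2[OF continuous_on_blocks_majorant[of UNIV]]) (auto intro!: continuous_intros)

lemma additive_energy_dual_window_le:
  assumes scale_le: "2^i \<le> (2^j :: real)\<^sup>2" and l_in: "l \<in> dual_levels \<alpha> j i" and "r > 0"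
  shows "additive_energy (\<lambda>m. real m powr dual_exponent \<alpha>)
      (dyadic_block l) (r * dual_coeff \<alpha> (dyadic_window \<alpha> j i))
    \<le> 1 / (min 1 (r * dual_scale_ratio \<alpha>))\<^sup>2 * block_energy (dual_exponent \<alpha>) l"
  unfolding block_energy_def
proof (rule additive_energy_le_of_scale)
  show "0 < min 1 (r * dual_scale_ratio \<alpha>)" using \<open>r > 0\<close> dual_scale_ratio_pos by simp
  have "min 1 (r * dual_scale_ratio \<alpha>) * (2^l) powr (2 - dual_exponent \<alpha>)
      \<le> r * (dual_scale_ratio \<alpha> * (2^l) powr (2 - dual_exponent \<alpha>))"
    unfolding mult.assoc[symmetric] by (intro mult_right_mono) auto
  also have "\<dots> \<le> r * dual_coeff \<alpha> (dyadic_window \<alpha> j i)"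
    using \<open>r > 0\<close> by (intro mult_left_mono dual_scale_le[OF scale_le l_in]) auto
  finally show "min 1 (r * dual_scale_ratio \<alpha>) * (2^l) powr (2 - dual_exponent \<alpha>)
      \<le> r * dual_coeff \<alpha> (dyadic_window \<alpha> j i)" .
qed auto

lemma integral_dual_majorant_le:
  obtains D where "D > 0" "\<And>j i. 2^i \<le> (2^j :: real)\<^sup>2 \<Longrightarrow>
    integral {dyadic_window \<alpha> j i..2 * dyadic_window \<alpha> j i} (dual_majorant \<alpha> j i)
      \<le> D * dyadic_window \<alpha> j i * blocks_energy (dual_exponent \<alpha>) (dual_levels \<alpha> j i)"
proof -
  define s where "s = 1 / (1 - \<alpha>)"
  define b where "b = (1 - \<alpha>) * \<bar>\<alpha>\<bar> powr (\<alpha> / (1 - \<alpha>))"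
  define r where "r = 2 powr s - (1::real)"
  define c where "c = min 1 (r * dual_scale_ratio \<alpha>)"
  define D where "D = 128 * r / (s * c\<^sup>2)"
  have pos: "s > 0" "b > 0" using \<alpha>_bounds by (auto simp: s_def b_def)
  hence "r > 0" by (simp add: r_def)
  hence "c > 0" using dual_scale_ratio_pos by (simp add: c_def)
  show thesis
  proof (rule that[of D])
    show "D > 0" using pos \<open>r > 0\<close> \<open>c > 0\<close> by (simp add: D_def)
    fix j i :: nat assume scale_le: "2^i \<le> (2^j :: real)\<^sup>2"
    define w where "w = dyadic_window \<alpha> j i"
    define u where "u = b * w powr s"
    define L where "L = dual_levels \<alpha> j i"
    have w_pos: "w > 0" by (simp add: w_def dyadic_window_pos)
    hence u_props: "u > 0" "b * (2 * w) powr s = u + r * u"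
      using pos by (simp_all add: u_def r_def powr_mult algebra_simps)
    have coeff: "dual_coeff \<alpha> x = b * x powr s" for x by (simp add: dual_coeff_def b_def s_def)
    have "integral {u..u + r * u} (blocks_majorant (dual_exponent \<alpha>) L)
        \<le> 64 * (r * u) * (1 / c\<^sup>2) * blocks_energy (dual_exponent \<alpha>) L"
    proof (rule integral_blocks_majorant_le)
      show "additive_energy (\<lambda>m. real m powr dual_exponent \<alpha>) (dyadic_block l) (r * u)
          \<le> 1 / c\<^sup>2 * block_energy (dual_exponent \<alpha>) l"
        if "l \<in> L" for l
        using additive_energy_dual_window_le[OF scale_le, of l r] that \<open>r > 0\<close>
        by (simp add: L_def c_def u_def coeff w_def)
    qed (use u_props \<open>r > 0\<close> in \<open>simp_all add: L_def finite_dual_levels[OF \<alpha>_bounds]\<close>)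
    hence "2 * w / (s * u) * integral {u..u + r * u} (blocks_majorant (dual_exponent \<alpha>) L)
        \<le> 2 * w / (s * u) * (64 * (r * u) * (1 / c\<^sup>2) * blocks_energy (dual_exponent \<alpha>) L)"
      using w_pos u_props pos by (intro mult_left_mono) auto
    also have "\<dots> = D * w * blocks_energy (dual_exponent \<alpha>) L" using u_props by (simp add: D_def)
    finally have "2 * w / (s * u) * integral {u..u + r * u} (blocks_majorant (dual_exponent \<alpha>) L)
        \<le> D * w * blocks_energy (dual_exponent \<alpha>) L" .
    moreover have "integral {w..2*w} (\<lambda>x. blocks_majorant (dual_exponent \<alpha>) L (b * x powr s))
        \<le> 2 * w / (s * u) * integral {u..u + r * u} (blocks_majorant (dual_exponent \<alpha>) L)"
      using integral_power_substitution_le[OF continuous_on_blocks_majorant blocks_majorant_nonneg pos(2,1) w_pos]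
      by (simp only: u_props(2) u_def[symmetric])
    ultimately show "integral {dyadic_window \<alpha> j i..2 * dyadic_window \<alpha> j i} (dual_majorant \<alpha> j i)
        \<le> D * dyadic_window \<alpha> j i * blocks_energy (dual_exponent \<alpha>) (dual_levels \<alpha> j i)"
      unfolding w_def[symmetric] L_def[symmetric] coeff by linarith
  qed
qed

theorem dyadic_fourth_moment: "\<exists>C. fourth_moment_bound \<alpha> C"
proof -
  obtain M where M_pos: "M > 0"
    and pointwise: "\<And>j i x. 2^i \<le> (2^j :: real)\<^sup>2 \<Longrightarrow> x \<in> {dyadic_window \<alpha> j i..2 * dyadic_window \<alpha> j i} \<Longrightarrow>
       norm (block_sum \<alpha> j x) ^ 4 \<le> M * (real (1 + j) ^ 4 + (2^j) ^ 4 / (2^i)\<^sup>2 * (1 + dual_majorant \<alpha> j i x))"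
    using norm_block_sum_power4_le by blast
  obtain D where D_pos: "D > 0" and majorant: "\<And>j i. 2^i \<le> (2^j :: real)\<^sup>2 \<Longrightarrow>
    integral {dyadic_window \<alpha> j i..2 * dyadic_window \<alpha> j i} (dual_majorant \<alpha> j i)
      \<le> D * dyadic_window \<alpha> j i * blocks_energy (dual_exponent \<alpha>) (dual_levels \<alpha> j i)"
    using integral_dual_majorant_le by blast
  have "integral {dyadic_window \<alpha> j i..2 * dyadic_window \<alpha> j i} (\<lambda>x. norm (block_sum \<alpha> j x) ^ 4)
       \<le> M * (1 + D) * dyadic_window \<alpha> j i * (real (1 + j) ^ 4
           + (2^j) ^ 4 / (2^i)\<^sup>2 * (1 + blocks_energy (dual_exponent \<alpha>) (dual_levels \<alpha> j i)))"
    if scale_le: "2^i \<le> (2^j :: real)\<^sup>2" for j i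
  proof (rule integral_le_of_majorant[OF _ _ pointwise[OF scale_le] majorant[OF scale_le]])
    show "continuous_on S (\<lambda>x. norm (block_sum \<alpha> j x) ^ 4)" for S
      by (intro continuous_intros continuous_on_block_sum)
    show "continuous_on {dyadic_window \<alpha> j i..2 * dyadic_window \<alpha> j i} (dual_majorant \<alpha> j i)"
      by (rule continuous_on_dual_majorant) (simp add: dyadic_window_pos)
  qed (use M_pos D_pos in \<open>simp_all add: dyadic_window_pos less_imp_le blocks_energy_nonneg\<close>)
  thus ?thesis using M_pos D_pos unfolding fourth_moment_bound_def by (intro exI[of _ "M * (1 + D)"]) auto
qed

definition level_constant :: "real \<Rightarrow> real" where
  "level_constant \<kappa> = real (max_dual_levels \<alpha>) ^ 4 * (2 * slope_max \<alpha>) powr (2 + \<kappa>)"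

lemma level_constant_nonneg: "level_constant \<kappa> \<ge> 0"
  by (simp add: level_constant_def)

lemma blocks_energy_dual_levels_le:
  assumes \<kappa>_pos: "\<kappa> > 0" and K_nonneg: "K \<ge> 0" and small: "2 * slope_max \<alpha> * 2^i < (2^j)\<^sup>2"
    and energy: "\<And>l. l < j \<Longrightarrow> block_energy \<beta> l \<le> K * (2^l) powr (2 + \<kappa>)"
  shows "blocks_energy \<beta> (dual_levels \<alpha> j i) \<le> level_constant \<kappa> * K * real (1 + j) ^ 4
      * (2^i / 2^j) powr (2 + \<kappa>)"
proof -
  define L where "L = dual_levels \<alpha> j i"
  define k where "k = real (max_dual_levels \<alpha>)"
  define e where "e = real (1 + j) ^ 4 * (K * ((2 * slope_max \<alpha>) powr (2 + \<kappa>) * (2^i / 2^j) powr (2 + \<kappa>)))"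
  have "e \<ge> 0" using K_nonneg by (simp add: e_def)
  have card: "real (card L) \<le> k" by (simp add: L_def k_def card_dual_levels_le[OF \<alpha>_bounds])
  have "real (l + 1) ^ 4 * block_energy \<beta> l \<le> e" if "l \<in> L" for l
  proof -
    have l_bounds: "2^l * 2^j \<le> 2 * slope_max \<alpha> * 2^i" using that by (simp add: L_def dual_levels_def)
    hence "2^l * 2^j < (2::real)^j * 2^j" using small unfolding power2_eq_square by linarith
    hence "l < j" by simp
    have "2^l \<le> 2 * slope_max \<alpha> * (2^i / 2^j)" using l_bounds by (simp add: field_simps)
    hence "(2^l) powr (2 + \<kappa>) \<le> (2 * slope_max \<alpha> * (2^i / 2^j)) powr (2 + \<kappa>)"
      using \<kappa>_pos by (intro powr_mono2) auto
    also have "\<dots> = (2 * slope_max \<alpha>) powr (2 + \<kappa>) * (2^i / 2^j) powr (2 + \<kappa>)"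
      using slope_max_pos[OF \<alpha>_bounds] by (simp only: powr_mult)
    finally have "block_energy \<beta> l \<le> K * ((2 * slope_max \<alpha>) powr (2 + \<kappa>) * (2^i / 2^j) powr (2 + \<kappa>))"
      using energy[OF \<open>l < j\<close>] K_nonneg by (meson mult_left_mono order_trans)
    thus ?thesis unfolding e_def using \<open>l < j\<close> by (intro mult_mono power_mono block_energy_nonneg) auto
  qed
  hence "(\<Sum>l\<in>L. real (l + 1) ^ 4 * block_energy \<beta> l) \<le> real (card L) * e" by (rule sum_bounded_above)
  hence "blocks_energy \<beta> L \<le> real (card L) ^ 3 * (real (card L) * e)"
    unfolding blocks_energy_def by (intro mult_left_mono) auto
  also have "\<dots> \<le> k ^ 3 * (k * e)" using card \<open>e \<ge> 0\<close> by (intro mult_mono power_mono) auto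
  also have "\<dots> = level_constant \<kappa> * K * real (1 + j) ^ 4 * (2^i / 2^j) powr (2 + \<kappa>)"
    by (simp add: e_def level_constant_def k_def eval_nat_numeral)
  finally show ?thesis by (simp only: L_def)
qed

lemma weighted_blocks_energy_le:
  assumes \<kappa>_pos: "\<kappa> > 0" and K_nonneg: "K \<ge> 0" and small: "2 * slope_max \<alpha> * 2^i < (2^j)\<^sup>2"
    and energy: "\<And>l. l < j \<Longrightarrow> block_energy \<beta> l \<le> K * (2^l) powr (2 + \<kappa>)" and P_bounds: "2^i \<le> P"
  shows "(2^j) ^ 4 / (2^i)\<^sup>2 * blocks_energy \<beta> (dual_levels \<alpha> j i)
    \<le> level_constant \<kappa> * K * real (1 + j) ^ 4 * ((2^j) powr (2 - \<kappa>) * P powr \<kappa>)"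
proof -
  define N where "N = (2::real)^j"
  define c where "c = level_constant \<kappa> * K * real (1 + j) ^ 4"
  have N_pos: "N > 0" by (simp add: N_def)
  have "c \<ge> 0" using K_nonneg level_constant_nonneg by (simp add: c_def)
  have "N^4 / (2^i)\<^sup>2 * blocks_energy \<beta> (dual_levels \<alpha> j i) \<le> N^4 / (2^i)\<^sup>2 * (c * (2^i / N) powr (2 + \<kappa>))"
    using blocks_energy_dual_levels_le[OF \<kappa>_pos K_nonneg small energy]
    by (intro mult_left_mono) (auto simp: N_def c_def)
  also have "\<dots> = c * (N powr (2 - \<kappa>) * (2^i) powr \<kappa>)"
  proof -
    have "N^4 = N powr (2 - \<kappa>) * (N powr 2 * N powr \<kappa>)"
      unfolding powr_add[symmetric] using N_pos by (simp add: powr_numeral)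
    moreover have "(2^i / N) powr (2 + \<kappa>) = (2^i)\<^sup>2 * (2^i) powr \<kappa> / (N powr 2 * N powr \<kappa>)"
      using N_pos by (simp add: powr_divide powr_add powr_numeral)
    ultimately show ?thesis using N_pos by simp
  qed
  also have "\<dots> \<le> c * (N powr (2 - \<kappa>) * P powr \<kappa>)"
    using P_bounds \<kappa>_pos \<open>c \<ge> 0\<close> by (intro mult_left_mono powr_mono2) auto
  finally show ?thesis by (simp only: N_def c_def)
qed

end

lemma integral_dyadic_split:
  fixes f :: "real \<Rightarrow> real"
  assumes "\<And>S. continuous_on S f" and "a > 0"
  shows "integral {0..2^n * a} f = integral {0..a} f + (\<Sum>i<n. integral {2^i * a..2 * (2^i * a)} f)"
proof (induction n)
  case (Suc n)
  have "integral {0..2^n * a} f + integral {2^n * a..2 * (2^n * a)} f = integral {0..2 * (2^n * a)} f"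
    using assms
    by (intro Henstock_Kurzweil_Integration.integral_combine) (auto intro!: integrable_continuous_real)
  thus ?case using Suc by (simp add: mult.assoc)
qed simp

lemma block_energy_le_fourth_moment:
  assumes "2^n \<le> (2^j :: real)\<^sup>2"
  shows "block_energy \<alpha> j \<le> 40 / dyadic_window \<alpha> j n
      * integral {0..dyadic_window \<alpha> j n} (\<lambda>x. norm (block_sum \<alpha> j x) ^ 4)"
proof -
  have "dyadic_window \<alpha> j n \<le> (2^j)\<^sup>2 * (2^j) powr (- \<alpha>)"
    unfolding dyadic_window_def using assms by (intro mult_right_mono) auto
  also have "\<dots> = (2^j) powr (2 - \<alpha>)" by (simp add: powr_diff powr_minus_divide powr_numeral)
  finally have "block_energy \<alpha> j \<le> additive_energy (\<lambda>m. real m powr \<alpha>) (dyadic_block j) (dyadic_window \<alpha> j n)"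
    unfolding block_energy_def using dyadic_window_pos[of \<alpha> j n] by (intro additive_energy_antimono) auto
  also have "\<dots> \<le> 40 / dyadic_window \<alpha> j n * integral {0..dyadic_window \<alpha> j n} (\<lambda>x. norm (block_sum \<alpha> j x) ^ 4)"
    unfolding block_sum_def by (rule additive_energy_le_fourth_moment[OF dyadic_window_pos])
  finally show ?thesis .
qed

lemma block_energy_le_of_window_moments:
  assumes n_bounds: "2^n \<le> (2^j :: real)\<^sup>2" and nonneg: "C \<ge> 0" "G \<ge> 0"
    and moments: "\<And>i. i < n \<Longrightarrow>
        integral {dyadic_window \<alpha> j i..2 * dyadic_window \<alpha> j i} (\<lambda>x. norm (block_sum \<alpha> j x) ^ 4)
      \<le> C * dyadic_window \<alpha> j i * (G + (2^j) ^ 4 / (2^i)\<^sup>2)"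
  shows "block_energy \<alpha> j \<le> 40 * ((1 + 2 * C) * ((2^j) ^ 4 / 2^n) + C * G)"
proof -
  define f where "f = (\<lambda>x. norm (block_sum \<alpha> j x) ^ 4)"
  define a where "a = (2^j) powr (- \<alpha>)"
  define N where "N = (2::real) ^ j"
  have a_pos: "a > 0" and window: "dyadic_window \<alpha> j i = 2^i * a" for i
    by (simp_all add: a_def dyadic_window_def)
  have continuous: "continuous_on S f" for S
    unfolding f_def by (intro continuous_intros continuous_on_block_sum)
  have "f x \<le> N^4" for x unfolding f_def N_def by (intro power_mono norm_block_sum_le) auto
  hence "integral {0..a} f \<le> integral {0..a} (\<lambda>x. N^4)"
    by (intro integral_le integrable_continuous_real continuous) auto
  hence initial: "integral {0..a} f \<le> N^4 * a" using a_pos by (simp add: mult.commute)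
  have "integral {0..2^n * a} f = integral {0..a} f + (\<Sum>i<n. integral {2^i * a..2 * (2^i * a)} f)"
    by (rule integral_dyadic_split[OF continuous a_pos])
  also have "\<dots> \<le> N^4 * a + (\<Sum>i<n. C * a * (2^i * G + N^4 * (1/2)^i))"
  proof (intro add_mono initial sum_mono)
    fix i assume "i \<in> {..<n}"
    hence "integral {2^i * a..2 * (2^i * a)} f \<le> C * (2^i * a) * (G + N^4 / (2^i)\<^sup>2)"
      using moments[of i] by (simp add: f_def N_def window)
    also have "\<dots> = C * a * (2^i * G + N^4 * (1/2)^i)" by (simp add: power2_eq_square power_divide field_simps)
    finally show "integral {2^i * a..2 * (2^i * a)} f \<le> C * a * (2^i * G + N^4 * (1/2)^i)" .
  qed
  also have "\<dots> = N^4 * a + C * a * ((\<Sum>i<n. 2^i) * G + N^4 * (\<Sum>i<n. (1/2)^i))"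
    by (simp only: sum_distrib_left[symmetric] sum_distrib_right[symmetric] sum.distrib)
  also have "\<dots> \<le> N^4 * a + C * a * (2^n * G + N^4 * 2)"
  proof -
    have "(\<Sum>i<n. (2::real)^i) \<le> 2^n" using geometric_sum[of "2::real" n] by simp
    moreover have "(\<Sum>i<n. (1/2::real)^i) \<le> 2" using geometric_sum[of "1/2::real" n] by simp
    ultimately show ?thesis
      using nonneg a_pos by (intro add_mono mult_left_mono mult_right_mono) (auto simp: N_def)
  qed
  finally have moment: "integral {0..2^n * a} f \<le> N^4 * a + C * a * (2^n * G + N^4 * 2)" .
  have "block_energy \<alpha> j \<le> 40 / (2^n * a) * integral {0..2^n * a} f"
    using block_energy_le_fourth_moment[OF n_bounds, of \<alpha>] by (simp only: f_def window)
  also have "\<dots> \<le> 40 / (2^n * a) * (N^4 * a + C * a * (2^n * G + N^4 * 2))"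
    using a_pos by (intro mult_left_mono moment) auto
  also have "\<dots> = 40 * ((1 + 2 * C) * (N^4 / 2^n) + C * G)" using a_pos by (simp add: field_simps)
  finally show ?thesis by (simp only: N_def)
qed

lemma ceiling_power2_bounds:
  fixes r :: real
  assumes "0 \<le> r"
  defines "n \<equiv> nat \<lceil>r\<rceil>"
  shows "2 powr r \<le> 2^n" "2^n \<le> 2 * 2 powr r" "i < n \<Longrightarrow> 2^i \<le> 2 powr r"
proof -
  have "r \<le> real n" "real n \<le> r + 1" using assms unfolding n_def by linarith+
  hence "2 powr r \<le> 2 powr real n" "2 powr real n \<le> 2 powr (r + 1)" by (auto intro: powr_mono)
  thus "2 powr r \<le> 2^n" "2^n \<le> 2 * 2 powr r" by (simp_all add: powr_realpow powr_add)
  assume "i < n"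
  hence "real i \<le> r" unfolding n_def by linarith
  hence "2 powr real i \<le> 2 powr r" by (intro powr_mono) auto
  thus "2^i \<le> 2 powr r" by (simp add: powr_realpow)
qed

lemma block_energy_le_iterate:
  fixes \<alpha> \<kappa> C K P :: real
  assumes \<alpha>_bounds: "\<alpha> < 1" "\<alpha> \<noteq> 0" and "\<kappa> > 0" and moments: "fourth_moment_bound \<alpha> C"
    and n_bounds: "2^n \<le> (2^j :: real)\<^sup>2" and P_bounds: "\<And>i. i < n \<Longrightarrow> 2^i \<le> P" "2 * slope_max \<alpha> * P < (2^j)\<^sup>2"
    and energy_le: "K \<ge> 0" "\<And>l. l < j \<Longrightarrow> block_energy (dual_exponent \<alpha>) l \<le> K * (2^l) powr (2 + \<kappa>)"
  shows "block_energy \<alpha> j \<le> 40 * ((1 + 2 * C) * ((2^j) ^ 4 / 2^n)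
    + C * (real (1 + j) ^ 4 + level_constant \<alpha> \<kappa> * K * real (1 + j) ^ 4 * ((2^j) powr (2 - \<kappa>) * P powr \<kappa>)))"
proof (rule block_energy_le_of_window_moments[OF n_bounds])
  define E where "E = level_constant \<alpha> \<kappa> * K * real (1 + j) ^ 4 * ((2^j) powr (2 - \<kappa>) * P powr \<kappa>)"
  show C_nonneg: "C \<ge> 0" using moments by (simp add: fourth_moment_bound_def)
  show "0 \<le> real (1 + j) ^ 4 + level_constant \<alpha> \<kappa> * K * real (1 + j) ^ 4 * ((2^j) powr (2 - \<kappa>) * P powr \<kappa>)"
    using energy_le(1) level_constant_nonneg[OF \<alpha>_bounds] by simp
  fix i assume "i < n"
  have "2 * slope_max \<alpha> * 2^i \<le> 2 * slope_max \<alpha> * P"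
    using P_bounds(1)[OF \<open>i < n\<close>] slope_max_pos[OF \<alpha>_bounds] by (intro mult_left_mono) auto
  hence "2 * slope_max \<alpha> * 2^i < (2^j)\<^sup>2" using P_bounds(2) by linarith
  hence energy: "(2^j) ^ 4 / (2^i)\<^sup>2 * blocks_energy (dual_exponent \<alpha>) (dual_levels \<alpha> j i) \<le> E"
    unfolding E_def
    by (rule weighted_blocks_energy_le[OF \<alpha>_bounds \<open>\<kappa> > 0\<close> energy_le(1) _ energy_le(2) P_bounds(1)[OF \<open>i < n\<close>]])
  have "2^i \<le> (2^j :: real)\<^sup>2" using n_bounds \<open>i < n\<close> power_increasing[of i n "2::real"] by linarith
  hence "integral {dyadic_window \<alpha> j i..2 * dyadic_window \<alpha> j i} (\<lambda>x. norm (block_sum \<alpha> j x) ^ 4)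
      \<le> C * dyadic_window \<alpha> j i * (real (1 + j) ^ 4
          + (2^j) ^ 4 / (2^i)\<^sup>2 * (1 + blocks_energy (dual_exponent \<alpha>) (dual_levels \<alpha> j i)))"
    using moments unfolding fourth_moment_bound_def by blast
  also have "\<dots> \<le> C * dyadic_window \<alpha> j i * (real (1 + j) ^ 4 + E + (2^j) ^ 4 / (2^i)\<^sup>2)"
    using energy C_nonneg dyadic_window_pos[of \<alpha> j i] by (intro mult_left_mono) (auto simp: distrib_left)
  finally show "integral {dyadic_window \<alpha> j i..2 * dyadic_window \<alpha> j i} (\<lambda>x. norm (block_sum \<alpha> j x) ^ 4)
      \<le> C * dyadic_window \<alpha> j i * (real (1 + j) ^ 4 + level_constant \<alpha> \<kappa> * K * real (1 + j) ^ 4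
          * ((2^j) powr (2 - \<kappa>) * P powr \<kappa>) + (2^j) ^ 4 / (2^i)\<^sup>2)"
    by (simp only: E_def)
qed

lemma block_energy_step:
  fixes \<alpha> \<kappa> C K :: real
  assumes \<alpha>_bounds: "\<alpha> < 1" "\<alpha> \<noteq> 0" and \<kappa>_bounds: "0 < \<kappa>" "\<kappa> \<le> 1" and moments: "fourth_moment_bound \<alpha> C"
    and j_large: "2 \<le> (2^j) powr \<kappa>" "2 * slope_max \<alpha> < (2^j) powr \<kappa>" "real (1 + j) ^ 4 \<le> (2^j)\<^sup>2"
    and energy_le: "K \<ge> 0" "\<And>l. l < j \<Longrightarrow> block_energy (dual_exponent \<alpha>) l \<le> K * (2^l) powr (2 + \<kappa>)"
  shows "block_energy \<alpha> j \<le> (40 * (1 + 3 * C)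
    + 40 * C * level_constant \<alpha> \<kappa> * K * (real (1 + j) ^ 4 * (2^j) powr (- (\<kappa>\<^sup>2)))) * (2^j) powr (2 + \<kappa>)"
proof -
  define N where "N = (2::real)^j"
  define P where "P = N powr (2 - \<kappa>)"
  define n where "n = nat \<lceil>real j * (2 - \<kappa>)\<rceil>"
  define J where "J = real (1 + j) ^ 4"
  define E where "E = level_constant \<alpha> \<kappa> * K * J * (N powr (2 - \<kappa>) * P powr \<kappa>)"
  have N_ge_1: "N \<ge> 1" by (simp add: N_def)
  have C_pos: "C > 0" using moments by (simp add: fourth_moment_bound_def)
  have "P = 2 powr (real j * (2 - \<kappa>))" by (simp add: P_def N_def powr_powr powr_realpow[symmetric])
  hence n_bounds: "P \<le> 2^n" "2^n \<le> 2 * P" and below_n: "\<And>i. i < n \<Longrightarrow> 2^i \<le> P"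
    using ceiling_power2_bounds[of "real j * (2 - \<kappa>)"] \<kappa>_bounds by (auto simp: n_def)
  have P_pos: "P > 0" using N_ge_1 by (simp add: P_def)
  have P_eq: "N powr \<kappa> * P = N\<^sup>2" using N_ge_1 by (simp add: P_def powr_numeral flip: powr_add)
  have "2 * P \<le> N powr \<kappa> * P" using P_pos j_large(1) by (intro mult_right_mono) (auto simp: N_def)
  hence n_le: "2^n \<le> N\<^sup>2" using n_bounds P_eq by linarith
  have "2 * slope_max \<alpha> * P < N powr \<kappa> * P"
    using j_large(2) P_pos by (intro mult_strict_right_mono) (auto simp: N_def)
  hence "block_energy \<alpha> j \<le> 40 * ((1 + 2 * C) * (N^4 / 2^n) + C * (J + E))"
    using block_energy_le_iterate[OF \<alpha>_bounds \<kappa>_bounds(1) moments _ below_n _ energy_le, of n] n_le P_eq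
    by (simp only: N_def J_def E_def)
  also have "\<dots> \<le> 40 * ((1 + 2 * C) * N powr (2 + \<kappa>) + C * (N powr (2 + \<kappa>) + E))"
  proof (intro mult_left_mono add_mono order_refl)
    have "N^4 / 2^n \<le> N^4 / P" using n_bounds P_pos by (intro divide_left_mono) auto
    also have "\<dots> = P * N powr (2 + \<kappa>) / P" using N_ge_1 by (simp add: P_def powr_numeral flip: powr_add)
    finally show "N^4 / 2^n \<le> N powr (2 + \<kappa>)" using P_pos by simp
    have "J \<le> N powr 2" using j_large(3) N_ge_1 by (simp add: J_def N_def powr_numeral)
    also have "\<dots> \<le> N powr (2 + \<kappa>)" using N_ge_1 \<kappa>_bounds by (intro powr_mono) auto
    finally show "J \<le> N powr (2 + \<kappa>)" .
  qed (use C_pos in auto)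
  also have "N powr (2 - \<kappa>) * P powr \<kappa> = N powr (- (\<kappa>\<^sup>2)) * N powr (2 + \<kappa>)"
    by (simp add: P_def powr_powr power2_eq_square algebra_simps flip: powr_add)
  hence "E = level_constant \<alpha> \<kappa> * K * (J * N powr (- (\<kappa>\<^sup>2))) * N powr (2 + \<kappa>)" by (simp add: E_def)
  finally show ?thesis by (simp add: N_def J_def algebra_simps)
qed

lemma eventually_block_energy_le:
  fixes \<alpha> \<kappa> :: real
  assumes \<alpha>_bounds: "\<alpha> < 1" "\<alpha> \<noteq> 0" and \<kappa>_bounds: "0 < \<kappa>" "\<kappa> \<le> 1"
  obtains C j0 where "C > 0"
    "\<And>j K. j \<ge> j0 \<Longrightarrow> K \<ge> 0 \<Longrightarrow> (\<And>l. l < j \<Longrightarrow> block_energy (dual_exponent \<alpha>) l \<le> K * (2^l) powr (2 + \<kappa>)) \<Longrightarrow>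
        block_energy \<alpha> j \<le> (C + K / 2) * (2^j) powr (2 + \<kappa>)"
proof -
  obtain C where moments: "fourth_moment_bound \<alpha> C" using dyadic_fourth_moment[OF \<alpha>_bounds] by blast
  hence "C > 0" by (simp add: fourth_moment_bound_def)
  define B where "B = 40 * C * level_constant \<alpha> \<kappa>"
  have "\<forall>\<^sub>F j :: nat in sequentially. real (1 + j) ^ 4 \<le> (2^j)\<^sup>2" by real_asymp
  moreover have "filterlim (\<lambda>j::nat. (2^j :: real) powr \<kappa>) at_top sequentially" using \<kappa>_bounds by real_asymp
  hence "\<forall>\<^sub>F j :: nat in sequentially. (2^j) powr \<kappa> > max 2 (2 * slope_max \<alpha>)"
    by (simp only: filterlim_at_top_dense)
  moreover have "(\<lambda>j::nat. B * (real (1 + j) ^ 4 * (2^j) powr (- (\<kappa>\<^sup>2)))) \<longlonglongrightarrow> 0" using \<kappa>_bounds by real_asymp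
  hence "\<forall>\<^sub>F j :: nat in sequentially. B * (real (1 + j) ^ 4 * (2^j) powr (- (\<kappa>\<^sup>2))) < 1 / 2"
    by (rule order_tendstoD(2)) simp
  ultimately have "\<forall>\<^sub>F j :: nat in sequentially. real (1 + j) ^ 4 \<le> (2^j)\<^sup>2
      \<and> (2^j) powr \<kappa> > max 2 (2 * slope_max \<alpha>) \<and> B * (real (1 + j) ^ 4 * (2^j) powr (- (\<kappa>\<^sup>2))) < 1 / 2"
    by eventually_elim auto
  then obtain j0 where j0_large: "\<And>j::nat. j \<ge> j0 \<Longrightarrow> real (1 + j) ^ 4 \<le> (2^j)\<^sup>2
      \<and> (2^j) powr \<kappa> > max 2 (2 * slope_max \<alpha>) \<and> B * (real (1 + j) ^ 4 * (2^j) powr (- (\<kappa>\<^sup>2))) < 1 / 2"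
    unfolding eventually_sequentially by blast
  show thesis
  proof (rule that[of "40 * (1 + 3 * C)" j0])
    show "40 * (1 + 3 * C) > 0" using \<open>C > 0\<close> by simp
    fix j :: nat and K :: real
    assume j_ge: "j \<ge> j0"
      and energy_le: "K \<ge> 0" "\<And>l. l < j \<Longrightarrow> block_energy (dual_exponent \<alpha>) l \<le> K * (2^l) powr (2 + \<kappa>)"
    have "block_energy \<alpha> j \<le> (40 * (1 + 3 * C) + K * (B * (real (1 + j) ^ 4 * (2^j) powr (- (\<kappa>\<^sup>2)))))
        * (2^j) powr (2 + \<kappa>)"
      using block_energy_step[OF \<alpha>_bounds \<kappa>_bounds moments _ _ _ energy_le] j0_large[OF j_ge]
      by (simp add: B_def mult_ac)
    also have "\<dots> \<le> (40 * (1 + 3 * C) + K * (1 / 2)) * (2^j) powr (2 + \<kappa>)"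
      using energy_le(1) j0_large[OF j_ge] by (intro mult_right_mono add_left_mono mult_left_mono) auto
    finally show "block_energy \<alpha> j \<le> (40 * (1 + 3 * C) + K / 2) * (2^j) powr (2 + \<kappa>)" by simp
  qed
qed

theorem block_energy_bound:
  fixes \<alpha> \<kappa> :: real
  assumes \<alpha>_bounds: "\<alpha> < 1" "\<alpha> \<noteq> 0" and \<kappa>_bounds: "0 < \<kappa>" "\<kappa> \<le> 1"
  obtains K where "K > 0" "\<And>j. block_energy \<alpha> j \<le> K * (2^j) powr (2 + \<kappa>)"
proof -
  define \<beta> where "\<beta> = dual_exponent \<alpha>"
  have \<beta>_bounds: "\<beta> < 1" "\<beta> \<noteq> 0" and dual_\<beta>: "dual_exponent \<beta> = \<alpha>"
    using \<alpha>_bounds by (auto simp: \<beta>_def dual_exponent_def field_simps)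
  obtain C1 j1 where C1_pos: "C1 > 0" and step_\<alpha>: "\<And>j K. j \<ge> j1 \<Longrightarrow> K \<ge> 0 \<Longrightarrow>
      (\<And>l. l < j \<Longrightarrow> block_energy \<beta> l \<le> K * (2^l) powr (2 + \<kappa>))
        \<Longrightarrow> block_energy \<alpha> j \<le> (C1 + K / 2) * (2^j) powr (2 + \<kappa>)"
    using eventually_block_energy_le[OF \<alpha>_bounds \<kappa>_bounds] unfolding \<beta>_def by metis
  obtain C2 j2 where C2_pos: "C2 > 0" and step_\<beta>: "\<And>j K. j \<ge> j2 \<Longrightarrow> K \<ge> 0 \<Longrightarrow>
      (\<And>l. l < j \<Longrightarrow> block_energy \<alpha> l \<le> K * (2^l) powr (2 + \<kappa>))
        \<Longrightarrow> block_energy \<beta> j \<le> (C2 + K / 2) * (2^j) powr (2 + \<kappa>)"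
    using eventually_block_energy_le[OF \<beta>_bounds \<kappa>_bounds] unfolding dual_\<beta> by metis
  define j0 where "j0 = max j1 j2"
  define K where "K = 2 * (C1 + C2) + 2^(4*j0)"
  have K_bounds: "K > 0" "C1 + K / 2 \<le> K" "C2 + K / 2 \<le> K"
    using C1_pos C2_pos by (auto simp: K_def add_pos_pos)
  have "block_energy \<alpha> j \<le> K * (2^j) powr (2 + \<kappa>) \<and> block_energy \<beta> j \<le> K * (2^j) powr (2 + \<kappa>)" for j
  proof (induction j rule: less_induct)
    case (less j)
    have powr_ge_1: "(2^j) powr (2 + \<kappa>) \<ge> (1::real)" using \<kappa>_bounds by (intro ge_one_powr_ge_zero) auto
    show ?case
    proof (cases "j \<ge> j0")
      case True
      have "block_energy \<alpha> j \<le> (C1 + K / 2) * (2^j) powr (2 + \<kappa>)"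
        "block_energy \<beta> j \<le> (C2 + K / 2) * (2^j) powr (2 + \<kappa>)"
        using step_\<alpha>[of j K] step_\<beta>[of j K] True less K_bounds by (auto simp: j0_def)
      thus ?thesis using K_bounds powr_ge_1 by (meson mult_right_mono order_trans zero_le_one)
    next
      case False
      have "block_energy \<gamma> j \<le> K * (2^j) powr (2 + \<kappa>)" for \<gamma>
      proof -
        have "block_energy \<gamma> j \<le> 2^(4*j)" by (rule block_energy_le)
        also have "\<dots> \<le> 2^(4*j0)" using False by (intro power_increasing) auto
        also have "\<dots> \<le> K * 1" using C1_pos C2_pos by (simp add: K_def)
        also have "\<dots> \<le> K * (2^j) powr (2 + \<kappa>)" using powr_ge_1 K_bounds by (intro mult_left_mono) auto
        finally show ?thesis .
      qed
      thus ?thesis by blast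
    qed
  qed
  thus thesis using that[OF K_bounds(1)] by blast
qed

section \<open>Counting nearly equal products\<close>

lemma card_spaced_le:
  fixes R :: "real set"
  assumes fin: "finite R" and \<delta>_pos: "\<delta> > 0" and l_nonneg: "l \<ge> 0"
    and spaced: "\<And>r s. r \<in> R \<Longrightarrow> s \<in> R \<Longrightarrow> r \<noteq> s \<Longrightarrow> \<delta> \<le> \<bar>r - s\<bar>"
    and diameter: "\<And>r s. r \<in> R \<Longrightarrow> s \<in> R \<Longrightarrow> \<bar>r - s\<bar> \<le> l"
  shows "real (card R) \<le> 1 + l / \<delta>"
proof (cases "R = {}")
  case True thus ?thesis using l_nonneg \<delta>_pos by simp
next
  case False
  define m where "m = Min R"
  have m_least: "m \<in> R" "\<And>r. r \<in> R \<Longrightarrow> m \<le> r" using fin False by (auto simp: m_def)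
  define f where "f = (\<lambda>r. nat \<lfloor>(r - m) / \<delta>\<rfloor>)"
  have "inj_on f R"
  proof (rule inj_onI, rule ccontr)
    fix r s assume collision: "r \<in> R" "s \<in> R" "f r = f s" "r \<noteq> s"
    have "(r - m) / \<delta> \<ge> 0" "(s - m) / \<delta> \<ge> 0" using m_least collision \<delta>_pos by auto
    hence "\<lfloor>(r - m) / \<delta>\<rfloor> = \<lfloor>(s - m) / \<delta>\<rfloor>" using collision by (simp add: f_def eq_nat_nat_iff)
    hence "\<bar>(r - m) / \<delta> - (s - m) / \<delta>\<bar> < 1" by linarith
    hence "\<bar>(r - s) / \<delta>\<bar> < 1" by (simp add: diff_divide_distrib)
    hence "\<bar>r - s\<bar> < \<delta>" using \<delta>_pos by (simp add: abs_divide)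
    thus False using spaced[of r s] collision by simp
  qed
  moreover have "f ` R \<subseteq> {..nat \<lfloor>l / \<delta>\<rfloor>}"
  proof safe
    fix r assume "r \<in> R"
    hence "r - m \<le> l" using diameter[of r m] m_least by auto
    hence "(r - m) / \<delta> \<le> l / \<delta>" using \<delta>_pos by (intro divide_right_mono) auto
    thus "f r \<le> nat \<lfloor>l / \<delta>\<rfloor>" by (simp add: f_def nat_mono floor_mono)
  qed
  ultimately have "card R \<le> card {..nat \<lfloor>l / \<delta>\<rfloor>}" by (intro card_inj_on_le) auto
  also have "real (card {..nat \<lfloor>l / \<delta>\<rfloor>}) \<le> 1 + l / \<delta>" using l_nonneg \<delta>_pos by simp
  finally show ?thesis by simp
qed

definition multiples_upto :: "nat \<Rightarrow> real \<Rightarrow> nat set" where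
  "multiples_upto e M = {a. e dvd a \<and> 0 < a \<and> real a \<le> M}"

lemma
  assumes e_pos: "e > 0" and M_nonneg: "M \<ge> 0"
  shows finite_multiples_upto: "finite (multiples_upto e M)"
    and card_multiples_upto_le: "real (card (multiples_upto e M)) \<le> M / real e"
proof -
  have subset: "multiples_upto e M \<subseteq> (\<lambda>k. e * k) ` {1..nat \<lfloor>M / real e\<rfloor>}"
  proof
    fix a assume "a \<in> multiples_upto e M"
    then obtain k where a_multiple: "a = e * k" "0 < a" "real a \<le> M" by (auto simp: multiples_upto_def)
    have "real k \<le> M / real e" using a_multiple e_pos by (simp add: field_simps)
    hence "k \<le> nat \<lfloor>M / real e\<rfloor>" by (simp add: le_nat_iff le_floor_iff)
    thus "a \<in> (\<lambda>k. e * k) ` {1..nat \<lfloor>M / real e\<rfloor>}" using a_multiple by auto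
  qed
  show "finite (multiples_upto e M)" by (rule finite_subset[OF subset]) simp
  have "card (multiples_upto e M) \<le> card {1..nat \<lfloor>M / real e\<rfloor>}" using surj_card_le[OF _ subset] by simp
  also have "real (card {1..nat \<lfloor>M / real e\<rfloor>}) \<le> M / real e" using M_nonneg by simp
  finally show "real (card (multiples_upto e M)) \<le> M / real e" by simp
qed

lemma cross_product_gcd_eq:
  fixes a b c d :: nat
  assumes "a * d = b * c" "gcd a c = gcd b d" "gcd a c > 0"
  shows "a = b" "c = d"
proof -
  have "a * gcd b d = b * gcd a c" "c * gcd b d = d * gcd a c"
    using assms(1) by (metis gcd_mult_distrib_nat mult.commute)+
  thus "a = b" "c = d" using assms(2,3) by auto
qed

lemma distinct_ratios_spaced:
  fixes a b c d :: nat and M :: real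
  assumes "gcd a b = e" "gcd c d = e" "(a, b) \<noteq> (c, d)" and b_bounds: "0 < b" "real b \<le> M"
    and d_bounds: "0 < d" "real d \<le> M"
  shows "(real e)\<^sup>2 / M\<^sup>2 \<le> \<bar>real a / real b - real c / real d\<bar>"
proof -
  have "a * d \<noteq> c * b" using cross_product_gcd_eq[of a d c b] assms by auto
  have "e dvd a" "e dvd b" "e dvd c" "e dvd d" using assms(1,2) gcd_dvd1 gcd_dvd2 by metis+
  hence "int (e * e) dvd int (a * d) - int (c * b)"
    by (intro dvd_diff) (auto simp only: of_nat_dvd_iff intro!: mult_dvd_mono)
  moreover have "int (a * d) - int (c * b) \<noteq> 0" using \<open>a * d \<noteq> c * b\<close> by linarith
  ultimately have "int (e * e) \<le> \<bar>int (a * d) - int (c * b)\<bar>" by (metis dvd_imp_le_int abs_of_nat)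
  hence "real (e * e) \<le> \<bar>real (a * d) - real (c * b)\<bar>" by linarith
  hence "(real e)\<^sup>2 / M\<^sup>2 \<le> \<bar>real (a * d) - real (c * b)\<bar> / (real b * real d)"
    unfolding power2_eq_square using b_bounds d_bounds by (intro frac_le mult_mono) auto
  moreover have "real a / real b - real c / real d = (real (a * d) - real (c * b)) / (real b * real d)"
    using b_bounds d_bounds by (simp add: field_simps)
  ultimately show ?thesis by (simp add: abs_divide abs_mult)
qed

lemma powr_diff_ge:
  fixes \<gamma> x y :: real
  assumes "0 < \<gamma>" "\<gamma> < 1" "0 < x" "x \<le> y" "y \<le> 2"
  shows "\<gamma> / 2 * (y - x) \<le> y powr \<gamma> - x powr \<gamma>"
proof (cases "x = y")
  case False
  hence "x < y" using assms by simp
  have "\<exists>z>x. z < y \<and> y powr \<gamma> - x powr \<gamma> = (y - x) * (\<gamma> * z powr (\<gamma> - 1))"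
    by (rule MVT2[OF \<open>x < y\<close>]) (use assms in \<open>auto intro!: derivative_eq_intros\<close>)
  then obtain z where z_bounds: "x < z" "z < y"
    and mvt: "y powr \<gamma> - x powr \<gamma> = (y - x) * (\<gamma> * z powr (\<gamma> - 1))" by blast
  have "(1/2::real) = 2 powr (-1)" by (simp add: powr_minus_divide)
  also have "\<dots> \<le> 2 powr (\<gamma> - 1)" using assms by (intro powr_mono) auto
  also have "\<dots> \<le> z powr (\<gamma> - 1)" using z_bounds assms by (intro powr_mono2') auto
  finally have "(y - x) * (\<gamma> * (1/2)) \<le> (y - x) * (\<gamma> * z powr (\<gamma> - 1))"
    using assms by (intro mult_left_mono) auto
  thus ?thesis using mvt by (simp add: mult_ac)
qed simp

lemma abs_powr_diff_ge:
  fixes \<gamma> r s :: real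
  assumes "0 < \<gamma>" "\<gamma> < 1" "0 < r" "r \<le> 2" "0 < s" "s \<le> 2"
  shows "\<gamma> / 2 * \<bar>r - s\<bar> \<le> \<bar>r powr \<gamma> - s powr \<gamma>\<bar>"
proof (cases r s rule: le_cases)
  case le
  thus ?thesis using powr_diff_ge[of \<gamma> r s] assms by (simp add: abs_if)
next
  case ge
  thus ?thesis using powr_diff_ge[of \<gamma> s r] assms by (simp add: abs_if)
qed

definition close_pairs :: "'a set \<Rightarrow> ('a \<Rightarrow> real) \<Rightarrow> real \<Rightarrow> ('a \<times> 'a) set" where
  "close_pairs P x \<Delta> = {(p, p'). p \<in> P \<and> p' \<in> P \<and> \<bar>x p - x p'\<bar> \<le> \<Delta>}"

lemma finite_close_pairs: "finite P \<Longrightarrow> finite (close_pairs P x \<Delta>)"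
  by (rule finite_subset[of _ "P \<times> P"]) (auto simp: close_pairs_def)

locale nearly_equal_products =
  fixes \<gamma> N \<Delta> :: real and H :: nat
  assumes N_ge_1: "1 \<le> N" and \<gamma>_bounds: "1/2 \<le> \<gamma>" "\<gamma> < 1" and \<Delta>_le: "\<Delta> * N powr \<gamma> \<le> 1/4"
    and H_bounds: "1 \<le> H" "real H ^ 2 < N powr (2 * \<gamma>)"
begin

definition near :: "((nat \<times> nat) \<times> nat \<times> nat) set" where
  "near = close_pairs ({1..H} \<times> {a. N / 2 \<le> real a \<and> real a < N}) (\<lambda>(h, a). real h * real a powr \<gamma>) \<Delta>"

definition gcd_class :: "nat \<Rightarrow> nat \<Rightarrow> ((nat \<times> nat) \<times> nat \<times> nat) set" where
  "gcd_class d e = {((h, a), (h', a')). ((h, a), (h', a')) \<in> near \<and> gcd h h' = d \<and> gcd a a' = e}"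

definition fibre :: "nat \<Rightarrow> nat \<Rightarrow> nat \<Rightarrow> (nat \<times> nat) set" where
  "fibre e h h' = {(a, a'). ((h, a), (h', a')) \<in> near \<and> gcd a a' = e}"

definition tolerance :: real where
  "tolerance = N powr (- 2 * \<gamma>) / 2"

definition fibre_weight :: real where
  "fibre_weight = 2 * N powr (2 - 2 * \<gamma>) / \<gamma>"

lemma tolerance_pos: "tolerance > 0"
  using N_ge_1 by (simp add: tolerance_def)

lemma fibre_weight_nonneg: "fibre_weight \<ge> 0"
  using \<gamma>_bounds by (simp add: fibre_weight_def)

lemma near_bounds:
  assumes "((h, a), (h', a')) \<in> near"
  shows "0 < h" "h \<le> H" "0 < h'" "h' \<le> H" "0 < a" "N / 2 \<le> real a" "real a < N" "0 < a'" "N / 2 \<le> real a'"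
    "real a' < N"
  using assms N_ge_1 by (auto simp: near_def close_pairs_def intro!: Nat.gr0I)

lemma finite_near: "finite near"
proof -
  have "{a. N / 2 \<le> real a \<and> real a < N} \<subseteq> {..nat \<lfloor>N\<rfloor>}" by (auto simp: le_nat_floor)
  thus ?thesis
    unfolding near_def
    by (intro finite_close_pairs finite_cartesian_product finite_subset[OF _ finite_atMost]) auto
qed

lemma finite_gcd_class: "finite (gcd_class d e)"
  by (rule finite_subset[OF _ finite_near]) (auto simp: gcd_class_def)

lemma finite_fibre: "finite (fibre e h h')"
proof (rule finite_subset)
  show "fibre e h h' \<subseteq> {..nat \<lfloor>N\<rfloor>} \<times> {..nat \<lfloor>N\<rfloor>}"
  proof (rule subrelI)
    fix a a' assume "(a, a') \<in> fibre e h h'"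
    hence "real a < N" "real a' < N" using near_bounds[of h a h' a'] by (simp_all add: fibre_def)
    thus "(a, a') \<in> {..nat \<lfloor>N\<rfloor>} \<times> {..nat \<lfloor>N\<rfloor>}" by (simp add: le_nat_floor)
  qed
qed simp

lemma near_ratio:
  assumes near: "((h, a), (h', a')) \<in> near"
  shows "\<bar>real h / real h' - (real a' / real a) powr \<gamma>\<bar> \<le> tolerance / real h'"
proof -
  note bounds = near_bounds[OF near]
  have powr_pos: "real a powr \<gamma> > 0" "N powr \<gamma> > 0" using bounds N_ge_1 by simp_all
  have "real h / real h' - (real a' / real a) powr \<gamma>
      = (real h * real a powr \<gamma> - real h' * real a' powr \<gamma>) / (real h' * real a powr \<gamma>)"
    using bounds by (simp add: powr_divide field_simps)
  hence "\<bar>real h / real h' - (real a' / real a) powr \<gamma>\<bar>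
      = \<bar>real h * real a powr \<gamma> - real h' * real a' powr \<gamma>\<bar> / (real h' * real a powr \<gamma>)"
    using bounds by (simp add: abs_divide abs_mult)
  also have "\<dots> \<le> \<Delta> / (real h' * real a powr \<gamma>)"
    using near by (intro divide_right_mono) (auto simp: near_def close_pairs_def)
  also have "\<dots> = \<Delta> / real a powr \<gamma> / real h'" by simp
  also have "\<dots> \<le> tolerance / real h'"
  proof (intro divide_right_mono)
    have "N powr \<gamma> \<le> (2 * real a) powr \<gamma>" using bounds N_ge_1 \<gamma>_bounds by (intro powr_mono2) auto
    also have "\<dots> \<le> 2 powr 1 * real a powr \<gamma>"
      unfolding powr_mult using \<gamma>_bounds by (intro mult_right_mono powr_mono) auto
    finally have N_powr_le: "N powr \<gamma> / 2 \<le> real a powr \<gamma>" by simp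
    have "\<Delta> / real a powr \<gamma> \<le> (1 / 4 / N powr \<gamma>) / real a powr \<gamma>"
      using \<Delta>_le powr_pos by (intro divide_right_mono) (auto simp: field_simps)
    also have "\<dots> \<le> (1 / 4 / N powr \<gamma>) / (N powr \<gamma> / 2)"
      using N_powr_le powr_pos by (intro divide_left_mono) auto
    also have "\<dots> = tolerance"
      by (simp add: tolerance_def powr_minus_divide flip: powr_add)
    finally show "\<Delta> / real a powr \<gamma> \<le> tolerance" .
  qed simp
  finally show ?thesis .
qed

lemma inj_on_gcd_class: "inj_on (\<lambda>((h, a), (h', a')). (a, a')) (gcd_class d e)"
proof -
  have "(h1, h1') = (h2, h2')"
    if "((h1, a), (h1', a')) \<in> gcd_class d e" "((h2, a), (h2', a')) \<in> gcd_class d e"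
    for h1 h1' h2 h2' a a'
  proof (rule ccontr)
    assume distinct: "(h1, h1') \<noteq> (h2, h2')"
    have near1: "((h1, a), (h1', a')) \<in> near" "gcd h1 h1' = d"
      and near2: "((h2, a), (h2', a')) \<in> near" "gcd h2 h2' = d"
      using that by (auto simp: gcd_class_def)
    note bounds = near_bounds[OF near1(1)] near_bounds[OF near2(1)]
    have "d \<noteq> 0" using near1 bounds by auto
    hence "1 \<le> d" by simp
    hence "1 / (real H)\<^sup>2 \<le> (real d)\<^sup>2 / (real H)\<^sup>2" by (intro divide_right_mono one_le_power) auto
    also have "\<dots> \<le> \<bar>real h1 / real h1' - real h2 / real h2'\<bar>"
      using distinct near1 near2 bounds by (intro distinct_ratios_spaced) auto
    also have "\<dots> \<le> tolerance / real h1' + tolerance / real h2'"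
      using near_ratio[OF near1(1)] near_ratio[OF near2(1)] by linarith
    also have "\<dots> \<le> tolerance / 1 + tolerance / 1"
      using bounds tolerance_pos by (intro add_mono divide_left_mono) auto
    also have "\<dots> = 1 / N powr (2 * \<gamma>)" by (simp add: tolerance_def powr_minus_divide)
    also have "\<dots> < 1 / (real H)\<^sup>2" using H_bounds N_ge_1 by (intro divide_strict_left_mono mult_pos_pos) auto
    finally show False by simp
  qed
  thus ?thesis by (auto simp: inj_on_def)
qed

lemma card_gcd_class_le_numerators:
  assumes "e > 0"
  shows "real (card (gcd_class d e)) \<le> (N / real e)\<^sup>2"
proof -
  have "(\<lambda>((h, a), (h', a')). (a, a')) ` gcd_class d e \<subseteq> multiples_upto e N \<times> multiples_upto e N"
    by (auto simp: gcd_class_def multiples_upto_def dest: near_bounds intro: less_imp_le)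
  hence "card (gcd_class d e) \<le> card (multiples_upto e N \<times> multiples_upto e N)"
    using assms N_ge_1 by (intro card_inj_on_le[OF inj_on_gcd_class]) (auto simp: finite_multiples_upto)
  hence "real (card (gcd_class d e)) \<le> (real (card (multiples_upto e N)))\<^sup>2"
    by (simp add: card_cartesian_product power2_eq_square flip: of_nat_mult)
  also have "\<dots> \<le> (N / real e)\<^sup>2"
    using assms N_ge_1 by (intro power_mono card_multiples_upto_le) auto
  finally show ?thesis .
qed

lemma fibre_ratios_spaced:
  assumes "(a, a') \<in> fibre e h h'" "(b, b') \<in> fibre e h h'" "(a, a') \<noteq> (b, b')"
  shows "(real e)\<^sup>2 / N\<^sup>2 \<le> \<bar>real a' / real a - real b' / real b\<bar>"
proof -
  have "((h, a), (h', a')) \<in> near" "gcd a a' = e" "((h, b), (h', b')) \<in> near" "gcd b b' = e"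
    using assms by (auto simp: fibre_def)
  thus ?thesis using assms(3) near_bounds[of h a h' a'] near_bounds[of h b h' b']
    by (intro distinct_ratios_spaced) (auto simp: gcd.commute)
qed

lemma fibre_ratios_close:
  assumes "(a, a') \<in> fibre e h h'" "(b, b') \<in> fibre e h h'"
  shows "\<bar>real a' / real a - real b' / real b\<bar> \<le> 4 * tolerance / (\<gamma> * real h')"
proof -
  define r where "r = real a' / real a"
  define s where "s = real b' / real b"
  have near: "((h, a), (h', a')) \<in> near" "((h, b), (h', b')) \<in> near" using assms by (simp_all add: fibre_def)
  have "0 < r" "r \<le> 2" "0 < s" "s \<le> 2"
    using near_bounds[OF near(1)] near_bounds[OF near(2)] by (simp_all add: r_def s_def field_simps)
  hence "\<gamma> / 2 * \<bar>r - s\<bar> \<le> \<bar>r powr \<gamma> - s powr \<gamma>\<bar>" using \<gamma>_bounds by (intro abs_powr_diff_ge) auto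
  also have "\<dots> \<le> tolerance / real h' + tolerance / real h'"
    using near_ratio[OF near(1)] near_ratio[OF near(2)] unfolding r_def s_def by linarith
  finally have "\<bar>r - s\<bar> * \<gamma> \<le> 4 * (tolerance / real h')" by (simp add: field_simps)
  hence "\<bar>r - s\<bar> \<le> 4 * (tolerance / real h') / \<gamma>" using \<gamma>_bounds by (subst pos_le_divide_eq) auto
  thus ?thesis by (simp add: r_def s_def mult.commute)
qed

lemma card_fibre_le:
  assumes "e > 0" "h' > 0"
  shows "real (card (fibre e h h')) \<le> 1 + fibre_weight / (real h' * (real e)\<^sup>2)"
proof -
  define r where "r = (\<lambda>(a::nat, a'::nat). real a' / real a)"
  have spaced: "(real e)\<^sup>2 / N\<^sup>2 \<le> \<bar>r p - r q\<bar>" if "p \<in> fibre e h h'" "q \<in> fibre e h h'" "p \<noteq> q" for p q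
    using that by (cases p, cases q) (auto simp: r_def intro: fibre_ratios_spaced)
  have close: "\<bar>r p - r q\<bar> \<le> 4 * tolerance / (\<gamma> * real h')" if "p \<in> fibre e h h'" "q \<in> fibre e h h'" for p q
    using that by (cases p, cases q) (auto simp: r_def intro: fibre_ratios_close)
  have "0 < (real e)\<^sup>2 / N\<^sup>2" using \<open>e > 0\<close> N_ge_1 by simp
  hence "inj_on r (fibre e h h')" using spaced by (force intro!: inj_onI)
  hence "real (card (fibre e h h')) = real (card (r ` fibre e h h'))" by (simp add: card_image)
  also have "\<dots> \<le> 1 + (4 * tolerance / (\<gamma> * real h')) / ((real e)\<^sup>2 / N\<^sup>2)"
  proof (rule card_spaced_le)
    show "(real e)\<^sup>2 / N\<^sup>2 \<le> \<bar>x - y\<bar>" if "x \<in> r ` fibre e h h'" "y \<in> r ` fibre e h h'" "x \<noteq> y" for x y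
      using that spaced by blast
    show "\<bar>x - y\<bar> \<le> 4 * tolerance / (\<gamma> * real h')" if "x \<in> r ` fibre e h h'" "y \<in> r ` fibre e h h'" for x y
      using that close by blast
  qed (use finite_fibre assms N_ge_1 tolerance_pos \<gamma>_bounds in auto)
  also have "N powr (2 - 2 * \<gamma>) = N\<^sup>2 * N powr (- 2 * \<gamma>)"
    using N_ge_1 by (simp add: powr_diff powr_minus_divide powr_numeral)
  hence "(4 * tolerance / (\<gamma> * real h')) / ((real e)\<^sup>2 / N\<^sup>2) = fibre_weight / (real h' * (real e)\<^sup>2)"
    by (simp add: fibre_weight_def tolerance_def mult_ac)
  finally show ?thesis .
qed

lemma card_gcd_class_le_denominators:
  assumes d_pos: "d > 0" and e_pos: "e > 0"
  shows "real (card (gcd_class d e)) \<le> (real H / real d)\<^sup>2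
      + (real H / real d) * (fibre_weight * harm H / real e)"
proof -
  define D where "D = multiples_upto d (real H)"
  have D_props: "finite D" "real (card D) \<le> real H / real d" "D \<subseteq> {1..H}"
    using d_pos finite_multiples_upto card_multiples_upto_le
    unfolding D_def by (simp_all, auto simp: multiples_upto_def)
  define F where "F = (\<lambda>(h, h'). (\<lambda>(a, a'). ((h, a), (h', a'))) ` fibre e h h')"
  have "gcd_class d e \<subseteq> (\<Union>p\<in>D \<times> D. F p)"
  proof
    fix t assume t_in: "t \<in> gcd_class d e"
    obtain h a h' a' where t_eq: "t = ((h, a), (h', a'))" by (metis surj_pair)
    have "((h, a), (h', a')) \<in> near" "gcd h h' = d" "gcd a a' = e"
      using t_in by (auto simp: gcd_class_def t_eq)
    hence "(h, h') \<in> D \<times> D" "t \<in> F (h, h')"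
      using near_bounds[of h a h' a'] by (auto simp: D_def multiples_upto_def F_def fibre_def t_eq)
    thus "t \<in> (\<Union>p\<in>D \<times> D. F p)" by blast
  qed
  hence "card (gcd_class d e) \<le> card (\<Union>p\<in>D \<times> D. F p)"
    using D_props finite_fibre by (intro card_mono) (auto simp: F_def)
  also have "\<dots> \<le> (\<Sum>p\<in>D \<times> D. card (F p))" using D_props by (intro card_UN_le) auto
  finally have "real (card (gcd_class d e)) \<le> (\<Sum>p\<in>D \<times> D. real (card (F p)))" by (simp flip: of_nat_sum)
  also have "\<dots> \<le> (\<Sum>p\<in>D \<times> D. 1 + fibre_weight / (real (snd p) * (real e)\<^sup>2))"
  proof (intro sum_mono)
    fix p assume p_in: "p \<in> D \<times> D"
    have "card (F p) \<le> card (fibre e (fst p) (snd p))"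
      unfolding F_def by (simp add: case_prod_unfold card_image_le[OF finite_fibre])
    thus "real (card (F p)) \<le> 1 + fibre_weight / (real (snd p) * (real e)\<^sup>2)"
      using card_fibre_le[OF e_pos, of "snd p" "fst p"] p_in by (auto simp: D_def multiples_upto_def)
  qed
  also have "\<dots> = real (card D) * (\<Sum>h'\<in>D. 1 + fibre_weight / (real e)\<^sup>2 * (1 / real h'))"
    by (simp add: sum.cartesian_product' case_prod_unfold mult.commute)
  also have "\<dots> = real (card D) * (real (card D) + fibre_weight / (real e)\<^sup>2 * (\<Sum>h'\<in>D. 1 / real h'))"
    by (simp only: sum.distrib sum_distrib_left[symmetric]) simp
  also have "\<dots> \<le> (real H / real d) * (real H / real d + fibre_weight / real e * harm H)"
  proof (intro mult_mono add_mono D_props)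
    have "(\<Sum>h'\<in>D. 1 / real h') \<le> (\<Sum>h'\<in>{1..H}. 1 / real h')" using D_props by (intro sum_mono2) auto
    thus "(\<Sum>h'\<in>D. 1 / real h') \<le> harm H" by (simp add: harm_def inverse_eq_divide)
    show "fibre_weight / (real e)\<^sup>2 \<le> fibre_weight / real e"
      using fibre_weight_nonneg e_pos by (intro divide_left_mono) (auto simp: power2_eq_square)
  qed (use fibre_weight_nonneg in \<open>auto intro!: sum_nonneg add_nonneg_nonneg divide_nonneg_nonneg mult_nonneg_nonneg
    simp: harm_nonneg\<close>)
  finally show ?thesis by (simp add: power2_eq_square algebra_simps)
qed

lemma card_gcd_class_le:
  assumes "d > 0" "e > 0"
  shows "real (card (gcd_class d e)) \<le> (real H * N + real H * fibre_weight * harm H)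
      * (1 / real d * (1 / real e))"
proof -
  define A where "A = real H / real d"
  define B where "B = N / real e"
  define Y where "Y = A * (fibre_weight * harm H / real e)"
  have nonneg: "A \<ge> 0" "B \<ge> 0" "Y \<ge> 0"
    using N_ge_1 fibre_weight_nonneg by (auto simp: A_def B_def Y_def harm_nonneg)
  have "real (card (gcd_class d e)) \<le> A * B + Y"
  proof (cases "A \<le> B")
    case True
    have "A * A \<le> A * B" using True nonneg by (intro mult_left_mono) auto
    thus ?thesis using card_gcd_class_le_denominators[OF assms] by (simp add: A_def Y_def power2_eq_square)
  next
    case False
    have "B * B \<le> A * B" using False nonneg by (intro mult_right_mono) auto
    thus ?thesis
      using card_gcd_class_le_numerators[OF assms(2), of d] nonneg by (simp add: B_def power2_eq_square)
  qed
  thus ?thesis by (simp add: A_def B_def Y_def add_divide_distrib distrib_right mult_ac)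
qed

theorem card_near_le: "real (card near) \<le> 5 * (harm H)\<^sup>2 * harm (nat \<lfloor>N\<rfloor>) * (real H * N)"
proof -
  define n where "n = nat \<lfloor>N\<rfloor>"
  define c where "c = real H * N + real H * fibre_weight * harm H"
  have "near \<subseteq> (\<Union>p\<in>{1..H} \<times> {1..n}. gcd_class (fst p) (snd p))"
  proof
    fix t assume t_in: "t \<in> near"
    obtain h a h' a' where t_eq: "t = ((h, a), (h', a'))" by (metis surj_pair)
    note bounds = near_bounds[OF t_in[unfolded t_eq]]
    have "gcd h h' \<in> {1..H}" using bounds le_trans[OF gcd_le1_nat[of h h'], of H] by (auto simp: Suc_le_eq)
    moreover have "gcd a a' \<in> {1..n}"
      using bounds le_trans[OF gcd_le1_nat[of a a'], of n] le_nat_floor[of a N]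
      by (auto simp: Suc_le_eq n_def)
    ultimately show "t \<in> (\<Union>p\<in>{1..H} \<times> {1..n}. gcd_class (fst p) (snd p))"
      using t_in by (force simp: gcd_class_def t_eq)
  qed
  hence "card near \<le> card (\<Union>p\<in>{1..H} \<times> {1..n}. gcd_class (fst p) (snd p))"
    using finite_gcd_class by (intro card_mono) auto
  also have "\<dots> \<le> (\<Sum>p\<in>{1..H} \<times> {1..n}. card (gcd_class (fst p) (snd p)))" by (intro card_UN_le) auto
  finally have "real (card near) \<le> (\<Sum>p\<in>{1..H} \<times> {1..n}. real (card (gcd_class (fst p) (snd p))))"
    by (simp flip: of_nat_sum)
  also have "\<dots> \<le> (\<Sum>p\<in>{1..H} \<times> {1..n}. c * (1 / real (fst p) * (1 / real (snd p))))"
    unfolding c_def by (intro sum_mono card_gcd_class_le) auto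
  also have "\<dots> = c * (\<Sum>d\<in>{1..H}. \<Sum>e\<in>{1..n}. 1 / real d * (1 / real e))"
    by (simp add: sum_distrib_left sum.cartesian_product case_prod_unfold)
  also have "\<dots> = c * (harm H * harm n)" by (simp add: sum_product harm_def inverse_eq_divide)
  also have "\<dots> \<le> (5 * (real H * N) * harm H) * (harm H * harm n)"
  proof (intro mult_right_mono)
    have harm_ge_1: "harm H \<ge> (1::real)"
      using harm_mono[OF H_bounds(1), where 'a = real] by (simp add: harm_expand)
    have "N powr (2 - 2 * \<gamma>) \<le> N powr 1" using N_ge_1 \<gamma>_bounds by (intro powr_mono) auto
    hence "2 * N powr (2 - 2 * \<gamma>) / \<gamma> \<le> 2 * N / (1/2)" using N_ge_1 \<gamma>_bounds by (intro frac_le) auto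
    hence "fibre_weight \<le> 4 * N" by (simp add: fibre_weight_def)
    hence "real H * N * 1 + real H * fibre_weight * harm H \<le> real H * N * harm H + real H * (4 * N) * harm H"
      using harm_ge_1 N_ge_1 by (intro add_mono mult_left_mono mult_right_mono) (auto simp: harm_nonneg)
    thus "c \<le> 5 * (real H * N) * harm H" by (simp add: c_def algebra_simps)
  qed (auto simp: harm_nonneg)
  finally show ?thesis by (simp add: n_def power2_eq_square mult_ac)
qed

end

section \<open>The double large sieve\<close>

lemma integral_power2_le:
  fixes f :: "real \<Rightarrow> real"
  assumes "a \<le> b" and f_continuous: "continuous_on {a..b} f"
  shows "(integral {a..b} f)\<^sup>2 \<le> (b - a) * integral {a..b} (\<lambda>x. (f x)\<^sup>2)"
proof (cases "a = b")
  case False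
  define I where "I = integral {a..b} f"
  define Q where "Q = integral {a..b} (\<lambda>x. (f x)\<^sup>2)"
  define m where "m = I / (b - a)"
  have m_eq: "m * (b - a) = I" using False by (simp add: m_def)
  have integrable: "f integrable_on {a..b}" "(\<lambda>x. (f x)\<^sup>2) integrable_on {a..b}"
    by (auto intro!: integrable_continuous_real continuous_intros f_continuous)
  have "((\<lambda>x. (f x)\<^sup>2 - 2 * m * f x + m\<^sup>2) has_integral (Q - 2 * m * I + m\<^sup>2 * (b - a))) {a..b}"
    unfolding I_def Q_def
    using has_integral_const_real[of "m\<^sup>2" a b] \<open>a \<le> b\<close>
    by (intro has_integral_add has_integral_diff has_integral_mult_right integrable_integral integrable)
      (simp add: mult.commute)
  moreover have "0 \<le> (f x)\<^sup>2 - 2 * m * f x + m\<^sup>2" for x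
    using zero_le_power2[of "f x - m"] by (simp only: power2_diff) (simp add: algebra_simps)
  ultimately have "0 \<le> Q - 2 * m * I + m\<^sup>2 * (b - a)" by (rule has_integral_nonneg)
  also have "\<dots> = Q - m * I" using m_eq by (simp add: power2_eq_square algebra_simps)
  finally have "(b - a) * (m * I) \<le> (b - a) * Q" using \<open>a \<le> b\<close> by (intro mult_left_mono) auto
  moreover have "(b - a) * (m * I) = I\<^sup>2" by (simp add: power2_eq_square m_eq[symmetric])
  ultimately show ?thesis by (simp add: I_def Q_def)
qed simp

lemma ec_local_average:
  fixes \<Delta> f :: real
  assumes f_pos: "f > 0" and \<Delta>_bounds: "\<Delta> > 0" "4 * \<Delta> * f \<le> 1"
  obtains I :: real where "\<And>x. ((\<lambda>t. ec (t * f)) has_integral of_real I * ec (x * f)) {x-\<Delta>..x+\<Delta>}" "I \<ge> \<Delta>"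
proof
  define I where "I = sin (pi * (2 * \<Delta> * f)) / (pi * f)"
  have "2 * (2 * \<Delta> * f) \<le> \<bar>sin (pi * (2 * \<Delta> * f))\<bar>"
    using abs_sin_pi_ge[of "2 * \<Delta> * f"] f_pos \<Delta>_bounds by simp
  also have "\<bar>sin (pi * (2 * \<Delta> * f))\<bar> = sin (pi * (2 * \<Delta> * f))"
    using f_pos \<Delta>_bounds by (intro abs_of_nonneg sin_ge_zero) auto
  finally have "2 * (2 * \<Delta> * f) / (pi * f) \<le> I" unfolding I_def using f_pos by (intro divide_right_mono) auto
  moreover have "\<Delta> \<le> 2 * (2 * \<Delta> * f) / (pi * f)" using f_pos \<Delta>_bounds pi_less_4 by (simp add: field_simps)
  ultimately show "I \<ge> \<Delta>" by linarith
  show "((\<lambda>t. ec (t * f)) has_integral of_real I * ec (x * f)) {x-\<Delta>..x+\<Delta>}" for x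
  proof -
    have "ec (\<Delta> * f) - cnj (ec (\<Delta> * f)) = 2 * \<i> * sin (pi * (2 * \<Delta> * f))"
      by (simp add: ec_def complex_eq_iff mult_ac)
    moreover have "ec ((x + \<Delta>) * f) = ec (x * f) * ec (\<Delta> * f)"
      "ec ((x - \<Delta>) * f) = ec (x * f) * cnj (ec (\<Delta> * f))"
      by (simp_all only: distrib_right left_diff_distrib ec_add ec_diff)
    ultimately have "ec ((x + \<Delta>) * f) - ec ((x - \<Delta>) * f) = ec (x * f) * (2 * \<i> * sin (pi * (2 * \<Delta> * f)))"
      by (simp only: right_diff_distrib[symmetric])
    thus ?thesis
      using ec_mult_has_integral[of f "x - \<Delta>" "x + \<Delta>"] f_pos \<Delta>_bounds by (simp add: I_def mult_ac)
  qed
qed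

lemma norm_sum_ec_power2_le_local_mean:
  fixes \<phi> :: "'a \<Rightarrow> real"
  assumes fin: "finite B" and \<phi>_bounds: "\<And>b. b \<in> B \<Longrightarrow> 0 < \<phi> b \<and> 4 * \<Delta> * \<phi> b \<le> 1" and \<Delta>_pos: "\<Delta> > 0"
  obtains c :: "'a \<Rightarrow> complex" where "\<And>b. b \<in> B \<Longrightarrow> norm (c b) \<le> 1 / \<Delta>"
    "\<And>y. (norm (\<Sum>b\<in>B. ec (y * \<phi> b)))\<^sup>2 \<le> 2 * \<Delta> * integral {y-\<Delta>..y+\<Delta>} (\<lambda>t. (norm (\<Sum>b\<in>B. c b * ec (t * \<phi> b)))\<^sup>2)"
proof -
  have "\<exists>I. \<forall>b\<in>B. (\<forall>y. ((\<lambda>t. ec (t * \<phi> b)) has_integral of_real (I b) * ec (y * \<phi> b)) {y-\<Delta>..y+\<Delta>}) \<and> I b \<ge> \<Delta>"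
  proof (rule bchoice, rule ballI)
    fix b assume "b \<in> B"
    show "\<exists>I. (\<forall>y. ((\<lambda>t. ec (t * \<phi> b)) has_integral of_real I * ec (y * \<phi> b)) {y-\<Delta>..y+\<Delta>}) \<and> I \<ge> \<Delta>"
      by (rule ec_local_average[of "\<phi> b" \<Delta>]) (use \<phi>_bounds[OF \<open>b \<in> B\<close>] \<Delta>_pos in blast)+
  qed
  then obtain I
    where I_props: "\<And>b y. b \<in> B \<Longrightarrow> ((\<lambda>t. ec (t * \<phi> b)) has_integral of_real (I b) * ec (y * \<phi> b)) {y-\<Delta>..y+\<Delta>}"
    "\<And>b. b \<in> B \<Longrightarrow> I b \<ge> \<Delta>" by blast
  have I_pos: "I b > 0" if "b \<in> B" for b using I_props(2)[OF that] \<Delta>_pos by linarith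
  define F where "F = (\<lambda>t. \<Sum>b\<in>B. of_real (1 / I b) * ec (t * \<phi> b))"
  have continuous: "continuous_on S F" for S unfolding F_def by (intro continuous_intros)
  show thesis
  proof (rule that[of "\<lambda>b. of_real (1 / I b)"])
    show "norm (complex_of_real (1 / I b)) \<le> 1 / \<Delta>" if "b \<in> B" for b
      using I_props(2)[OF that] I_pos[OF that] \<Delta>_pos by (simp add: norm_divide frac_le)
    fix y
    have "(F has_integral (\<Sum>b\<in>B. of_real (1 / I b) * (of_real (I b) * ec (y * \<phi> b)))) {y-\<Delta>..y+\<Delta>}"
      unfolding F_def by (intro has_integral_sum fin has_integral_mult_right I_props)
    also have "(\<Sum>b\<in>B. of_real (1 / I b) * (of_real (I b) * ec (y * \<phi> b))) = (\<Sum>b\<in>B. ec (y * \<phi> b))"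
      using I_pos by (intro sum.cong refl) force
    finally have "norm (\<Sum>b\<in>B. ec (y * \<phi> b)) = norm (integral {y-\<Delta>..y+\<Delta>} F)" by (simp add: integral_unique)
    also have "\<dots> \<le> integral {y-\<Delta>..y+\<Delta>} (\<lambda>t. norm (F t))"
      by (rule integral_norm_bound_integral)
        (auto intro!: integrable_continuous_real continuous_intros continuous)
    finally have "(norm (\<Sum>b\<in>B. ec (y * \<phi> b)))\<^sup>2 \<le> (integral {y-\<Delta>..y+\<Delta>} (\<lambda>t. norm (F t)))\<^sup>2"
      by (intro power_mono) auto
    also have "\<dots> \<le> ((y + \<Delta>) - (y - \<Delta>)) * integral {y-\<Delta>..y+\<Delta>} (\<lambda>t. (norm (F t))\<^sup>2)"
      by (rule integral_power2_le) (use \<Delta>_pos in \<open>auto intro!: continuous_intros continuous\<close>)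
    finally show "(norm (\<Sum>b\<in>B. ec (y * \<phi> b)))\<^sup>2
        \<le> 2 * \<Delta> * integral {y-\<Delta>..y+\<Delta>} (\<lambda>t. (norm (\<Sum>b\<in>B. of_real (1 / I b) * ec (t * \<phi> b)))\<^sup>2)"
      by (simp add: F_def)
  qed
qed

lemma integral_cells:
  fixes f :: "real \<Rightarrow> real"
  assumes "\<And>S. continuous_on S f" and "\<Delta> > 0"
  shows "integral {s..s + real n * \<Delta>} f = (\<Sum>i<n. integral {s + real i * \<Delta>..s + real (i + 1) * \<Delta>} f)"
proof (induction n)
  case (Suc n)
  have "integral {s..s + real n * \<Delta>} f + integral {s + real n * \<Delta>..s + real (n + 1) * \<Delta>} f
      = integral {s..s + real (n + 1) * \<Delta>} f"
    using assms by (intro Henstock_Kurzweil_Integration.integral_combine)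
      (auto intro!: integrable_continuous_real mult_right_mono)
  thus ?case using Suc by simp
qed simp

lemma sum_window_integrals_power2_le:
  fixes f :: "real \<Rightarrow> real"
  assumes f_continuous: "\<And>S. continuous_on S f" and \<Delta>_pos: "\<Delta> > 0"
  shows "(\<Sum>i<n. (integral {s + real i * \<Delta>..s + real (i + q) * \<Delta>} f)\<^sup>2)
    \<le> (real q)\<^sup>2 * \<Delta> * integral {s..s + real (n + q) * \<Delta>} (\<lambda>t. (f t)\<^sup>2)"
proof -
  define cell where "cell = (\<lambda>i. integral {s + real i * \<Delta>..s + real (i + 1) * \<Delta>} (\<lambda>t. (f t)\<^sup>2))"
  have continuous: "continuous_on S (\<lambda>t. (f t)\<^sup>2)" for S by (intro continuous_intros f_continuous)
  have cell_nonneg: "cell i \<ge> 0" for i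
    unfolding cell_def by (intro integral_nonneg integrable_continuous_real continuous) auto
  have "(\<Sum>i<n. (integral {s + real i * \<Delta>..s + real (i + q) * \<Delta>} f)\<^sup>2)
      \<le> (\<Sum>i<n. real q * \<Delta> * (\<Sum>l<q. cell (i + l)))"
  proof (rule sum_mono)
    fix i
    have "(integral {s + real i * \<Delta>..s + real (i + q) * \<Delta>} f)\<^sup>2
        \<le> ((s + real (i + q) * \<Delta>) - (s + real i * \<Delta>))
          * integral {s + real i * \<Delta>..s + real (i + q) * \<Delta>} (\<lambda>t. (f t)\<^sup>2)"
      using \<Delta>_pos f_continuous by (intro integral_power2_le) (auto intro!: mult_right_mono)
    also have "integral {s + real i * \<Delta>..s + real (i + q) * \<Delta>} (\<lambda>t. (f t)\<^sup>2) = (\<Sum>l<q. cell (i + l))"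
      using integral_cells[OF continuous \<Delta>_pos, of "s + real i * \<Delta>" q] by (simp add: cell_def algebra_simps)
    finally show "(integral {s + real i * \<Delta>..s + real (i + q) * \<Delta>} f)\<^sup>2 \<le> real q * \<Delta> * (\<Sum>l<q. cell (i + l))"
      by (simp add: algebra_simps)
  qed
  also have "\<dots> = real q * \<Delta> * (\<Sum>l<q. \<Sum>i<n. cell (i + l))"
    unfolding sum_distrib_left[symmetric] by (subst sum.swap) simp
  also have "\<dots> \<le> real q * \<Delta> * (\<Sum>l<q. \<Sum>i<n+q. cell i)"
  proof (intro mult_left_mono sum_mono)
    fix l assume "l \<in> {..<q}"
    have "(\<Sum>i<n. cell (i + l)) = (\<Sum>i\<in>(\<lambda>i. i + l) ` {..<n}. cell i)" by (subst sum.reindex) auto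
    also have "\<dots> \<le> (\<Sum>i<n+q. cell i)" using \<open>l \<in> {..<q}\<close> by (intro sum_mono2) (auto simp: cell_nonneg)
    finally show "(\<Sum>i<n. cell (i + l)) \<le> (\<Sum>i<n+q. cell i)" .
  qed (use \<Delta>_pos in auto)
  also have "(\<Sum>i<n+q. cell i) = integral {s..s + real (n + q) * \<Delta>} (\<lambda>t. (f t)\<^sup>2)"
    unfolding cell_def by (rule integral_cells[OF continuous \<Delta>_pos, symmetric])
  finally show ?thesis by (simp add: power2_eq_square mult_ac)
qed

lemma sum_fibre_cards_power2_le:
  assumes fin: "finite P" and k_less: "\<And>p. p \<in> P \<Longrightarrow> k p < (n :: nat)"
    and close: "\<And>p p'. p \<in> P \<Longrightarrow> p' \<in> P \<Longrightarrow> k p = k p' \<Longrightarrow> \<bar>x p - x p'\<bar> \<le> \<Delta>"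
  shows "(\<Sum>i<n. (real (card {p\<in>P. k p = i}))\<^sup>2) \<le> real (card (close_pairs P x \<Delta>))"
proof -
  have "(\<Sum>i<n. (real (card {p\<in>P. k p = i}))\<^sup>2) = real (\<Sum>i<n. card ({p\<in>P. k p = i} \<times> {p\<in>P. k p = i}))"
    by (simp add: card_cartesian_product power2_eq_square)
  also have "\<dots> = real (card (\<Union>i\<in>{..<n}. {p\<in>P. k p = i} \<times> {p\<in>P. k p = i}))"
    using fin by (subst card_UN_disjoint) auto
  also have "\<dots> \<le> real (card (close_pairs P x \<Delta>))"
    using fin close by (intro of_nat_mono card_mono finite_close_pairs) (auto simp: close_pairs_def)
  finally show ?thesis .
qed

lemma sum_local_integrals_le:
  fixes x :: "'a \<Rightarrow> real" and f :: "real \<Rightarrow> real"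
  assumes fin: "finite P" and x_bounds: "\<And>p. p \<in> P \<Longrightarrow> 0 \<le> x p \<and> x p < real n * \<Delta>" and \<Delta>_pos: "\<Delta> > 0"
    and f_props: "\<And>S. continuous_on S f" "\<And>t. 0 \<le> f t"
  shows "(\<Sum>p\<in>P. integral {x p - \<Delta>..x p + \<Delta>} f)
    \<le> sqrt (real (card (close_pairs P x \<Delta>)) * (9 * \<Delta> * integral {-\<Delta>..-\<Delta> + real (n + 3) * \<Delta>} (\<lambda>t. (f t)\<^sup>2)))"
proof -
  define k where "k = (\<lambda>p. nat \<lfloor>x p / \<Delta>\<rfloor>)"
  define w where "w = (\<lambda>i::nat. integral {-\<Delta> + real i * \<Delta>..-\<Delta> + real (i + 3) * \<Delta>} f)"
  have k_bounds: "real (k p) * \<Delta> \<le> x p" "x p < (real (k p) + 1) * \<Delta>" if "p \<in> P" for p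
  proof -
    have "0 \<le> x p / \<Delta>" using x_bounds[OF that] \<Delta>_pos by simp
    hence "real (k p) \<le> x p / \<Delta>" "x p / \<Delta> < real (k p) + 1" unfolding k_def by linarith+
    thus "real (k p) * \<Delta> \<le> x p" "x p < (real (k p) + 1) * \<Delta>" using \<Delta>_pos by (simp_all add: field_simps)
  qed
  have k_less: "k p < n" if "p \<in> P" for p
  proof -
    have "real (k p) * \<Delta> < real n * \<Delta>" using k_bounds(1)[OF that] x_bounds[OF that] by linarith
    thus ?thesis using \<Delta>_pos by simp
  qed
  have "(\<Sum>p\<in>P. integral {x p - \<Delta>..x p + \<Delta>} f) \<le> (\<Sum>p\<in>P. w (k p))"
    unfolding w_def using k_bounds(1) less_imp_le[OF k_bounds(2)] f_props
    by (intro sum_mono integral_subset_le integrable_continuous_real) (auto simp: algebra_simps)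
  also have "\<dots> = (\<Sum>i<n. \<Sum>p\<in>{p\<in>P. k p = i}. w (k p))"
    by (rule sum.group[symmetric]) (use fin k_less in auto)
  also have "\<dots> = (\<Sum>i<n. real (card {p\<in>P. k p = i}) * w i)" by (intro sum.cong refl) simp
  also have "\<dots> \<le> sqrt ((\<Sum>i<n. (real (card {p\<in>P. k p = i}))\<^sup>2) * (\<Sum>i<n. (w i)\<^sup>2))"
    by (rule real_le_rsqrt) (rule Cauchy_Schwarz_ineq_sum)
  also have "\<dots> \<le> sqrt (real (card (close_pairs P x \<Delta>))
      * (9 * \<Delta> * integral {-\<Delta>..-\<Delta> + real (n + 3) * \<Delta>} (\<lambda>t. (f t)\<^sup>2)))"
  proof (intro real_sqrt_le_mono mult_mono sum_nonneg)
    show "(\<Sum>i<n. (real (card {p\<in>P. k p = i}))\<^sup>2) \<le> real (card (close_pairs P x \<Delta>))"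
    proof (rule sum_fibre_cards_power2_le[OF fin k_less])
      show "\<bar>x p - x p'\<bar> \<le> \<Delta>" if "p \<in> P" "p' \<in> P" "k p = k p'" for p p'
        using k_bounds[OF that(1)] k_bounds[OF that(2)] that(3) by (auto simp: distrib_right)
    qed
    show "(\<Sum>i<n. (w i)\<^sup>2) \<le> 9 * \<Delta> * integral {-\<Delta>..-\<Delta> + real (n + 3) * \<Delta>} (\<lambda>t. (f t)\<^sup>2)"
      unfolding w_def using sum_window_integrals_power2_le[OF f_props(1) \<Delta>_pos, of "-\<Delta>" 3 n] by simp
  qed auto
  finally show ?thesis .
qed

theorem double_large_sieve:
  fixes x :: "'a \<Rightarrow> real" and \<phi> :: "'b \<Rightarrow> real"
  assumes "finite P" "finite B"
    and x_bounds: "\<And>p. p \<in> P \<Longrightarrow> 0 \<le> x p \<and> x p \<le> X"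
    and \<phi>_bounds: "\<And>b. b \<in> B \<Longrightarrow> 0 < \<phi> b \<and> 4 * \<Delta> * \<phi> b \<le> 1" and \<Delta>_pos: "\<Delta> > 0" and X_pos: "X > 0"
  shows "(\<Sum>p\<in>P. (norm (\<Sum>b\<in>B. ec (x p * \<phi> b)))\<^sup>2)
    \<le> 12 * sqrt (real (card (close_pairs P x \<Delta>)) * ((X + 4 * \<Delta>) / \<Delta>) * additive_energy \<phi> B X)"
proof -
  obtain c :: "'b \<Rightarrow> complex" where norm_c_le: "\<And>b. b \<in> B \<Longrightarrow> norm (c b) \<le> 1 / \<Delta>"
    and local_mean: "\<And>y. (norm (\<Sum>b\<in>B. ec (y * \<phi> b)))\<^sup>2
      \<le> 2 * \<Delta> * integral {y-\<Delta>..y+\<Delta>} (\<lambda>t. (norm (\<Sum>b\<in>B. c b * ec (t * \<phi> b)))\<^sup>2)"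
    by (rule norm_sum_ec_power2_le_local_mean[of B \<phi> \<Delta>, OF \<open>finite B\<close> \<phi>_bounds \<Delta>_pos], assumption, rule that)
  define f where "f = (\<lambda>t. (norm (\<Sum>b\<in>B. c b * ec (t * \<phi> b)))\<^sup>2)"
  define n where "n = nat \<lfloor>X / \<Delta>\<rfloor> + 1"
  define Y where "Y = real (n + 3) * \<Delta>"
  define K where "K = real (card (close_pairs P x \<Delta>))"
  define E where "E = additive_energy \<phi> B X"
  have "0 \<le> X / \<Delta>" using X_pos \<Delta>_pos by simp
  hence "real n \<le> X / \<Delta> + 1" "X / \<Delta> < real n" unfolding n_def by linarith+
  hence n_bounds: "real n * \<Delta> \<le> X + \<Delta>" "X < real n * \<Delta>" using \<Delta>_pos by (simp_all add: field_simps)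
  hence Y_bounds: "X \<le> Y" "Y \<le> X + 4 * \<Delta>" using \<Delta>_pos by (simp_all add: Y_def distrib_right)
  have "integral {-\<Delta>..-\<Delta> + Y} (\<lambda>t. (f t)\<^sup>2) = integral {-\<Delta>..-\<Delta> + Y} (\<lambda>t. norm (\<Sum>b\<in>B. c b * ec (t * \<phi> b)) ^ 4)"
    by (simp add: f_def flip: power_mult)
  also have "\<dots> \<le> 4 * Y * (1 / \<Delta>) ^ 4 * additive_energy \<phi> B Y"
    using X_pos Y_bounds by (intro fourth_moment_window norm_c_le) auto
  also have "\<dots> \<le> 4 * (X + 4 * \<Delta>) * (1 / \<Delta>) ^ 4 * E"
    unfolding E_def
    using X_pos \<Delta>_pos Y_bounds by (intro mult_mono additive_energy_antimono additive_energy_nonneg) auto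
  finally have moment: "integral {-\<Delta>..-\<Delta> + Y} (\<lambda>t. (f t)\<^sup>2) \<le> 4 * (X + 4 * \<Delta>) * (1 / \<Delta>) ^ 4 * E" .
  have "(\<Sum>p\<in>P. (norm (\<Sum>b\<in>B. ec (x p * \<phi> b)))\<^sup>2) \<le> (\<Sum>p\<in>P. 2 * \<Delta> * integral {x p - \<Delta>..x p + \<Delta>} f)"
    unfolding f_def by (intro sum_mono local_mean)
  also have "\<dots> = 2 * \<Delta> * (\<Sum>p\<in>P. integral {x p - \<Delta>..x p + \<Delta>} f)" by (simp add: sum_distrib_left)
  also have "\<dots> \<le> 2 * \<Delta> * sqrt (K * (9 * \<Delta> * integral {-\<Delta>..-\<Delta> + Y} (\<lambda>t. (f t)\<^sup>2)))"
    unfolding K_def Y_def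
  proof (intro mult_left_mono sum_local_integrals_le)
    show "0 \<le> x p \<and> x p < real n * \<Delta>" if "p \<in> P" for p using x_bounds[OF that] n_bounds by auto
  qed (use assms in \<open>auto simp: f_def intro!: continuous_intros\<close>)
  also have "\<dots> \<le> 2 * \<Delta> * sqrt (K * (9 * \<Delta> * (4 * (X + 4 * \<Delta>) * (1 / \<Delta>) ^ 4 * E)))"
    using \<Delta>_pos by (intro mult_left_mono real_sqrt_le_mono moment) (auto simp: K_def)
  also have "K * (9 * \<Delta> * (4 * (X + 4 * \<Delta>) * (1 / \<Delta>) ^ 4 * E)) = (6 / \<Delta>)\<^sup>2 * (K * ((X + 4 * \<Delta>) / \<Delta>) * E)"
    using \<Delta>_pos by (simp add: field_simps eval_nat_numeral)
  also have "2 * \<Delta> * sqrt \<dots> = 12 * sqrt (K * ((X + 4 * \<Delta>) / \<Delta>) * E)"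
    unfolding real_sqrt_mult[of "(6 / \<Delta>)\<^sup>2"] using \<Delta>_pos by simp
  finally show ?thesis by (simp only: K_def E_def)
qed

section \<open>Gaps modulo one force large exponential sums\<close>

definition num_sums :: "nat \<Rightarrow> nat \<Rightarrow> nat \<Rightarrow> nat" where
  "num_sums k L j = card {f \<in> {..<k} \<rightarrow>\<^sub>E {..<L}. (\<Sum>a<k. f a) = j}"

lemma sum_num_sums:
  fixes h :: "nat \<Rightarrow> 'a :: semiring_1"
  assumes "k \<ge> 1"
  shows "(\<Sum>j<k * L. of_nat (num_sums k L j) * h j) = (\<Sum>f\<in>{..<k} \<rightarrow>\<^sub>E {..<L}. h (\<Sum>a<k. f a))"
proof -
  have "(\<Sum>a<k. f a) < k * L" if "f \<in> {..<k} \<rightarrow>\<^sub>E {..<L}" for f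
  proof -
    have "(\<Sum>a<k. f a) < (\<Sum>a<k. L)" using that assms by (intro sum_strict_mono) (auto simp: lessThan_empty_iff)
    thus ?thesis by simp
  qed
  hence "(\<Sum>f\<in>{..<k} \<rightarrow>\<^sub>E {..<L}. h (\<Sum>a<k. f a))
      = (\<Sum>j<k * L. \<Sum>f\<in>{f \<in> {..<k} \<rightarrow>\<^sub>E {..<L}. (\<Sum>a<k. f a) = j}. h (\<Sum>a<k. f a))"
    by (intro sum.group[symmetric] finite_PiE) auto
  also have "\<dots> = (\<Sum>j<k * L. of_nat (num_sums k L j) * h j)"
    by (intro sum.cong refl) (simp add: num_sums_def)
  finally show ?thesis ..
qed

lemma sum_num_sums_eq_power:
  assumes "k \<ge> 1"
  shows "(\<Sum>j<k * L. num_sums k L j) = L ^ k"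
  using sum_num_sums[OF assms, of L "\<lambda>_. 1 :: nat"] by (simp add: card_PiE)

lemma sum_num_sums_ec:
  assumes "k \<ge> 1"
  shows "(\<Sum>j<k * L. of_nat (num_sums k L j) * ec (t * real j)) = (\<Sum>i<L. ec (real i * t)) ^ k"
proof -
  have ec_sum: "ec (t * real (sum f A)) = (\<Prod>a\<in>A. ec (real (f a) * t))" if "finite A" for f and A :: "nat set"
    using that by (induction A rule: finite_induct) (simp_all add: distrib_left ec_add mult.commute)
  have "(\<Sum>i<L. ec (real i * t)) ^ k = (\<Prod>a<k. \<Sum>i<L. ec (real i * t))" by simp
  also have "\<dots> = (\<Sum>f\<in>{..<k} \<rightarrow>\<^sub>E {..<L}. \<Prod>a<k. ec (real (f a) * t))" by (rule prod_sum_PiE) auto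
  also have "\<dots> = (\<Sum>f\<in>{..<k} \<rightarrow>\<^sub>E {..<L}. ec (t * real (\<Sum>a<k. f a)))" by (simp only: ec_sum finite_lessThan)
  also have "\<dots> = (\<Sum>j<k * L. of_nat (num_sums k L j) * ec (t * real j))"
    by (rule sum_num_sums[OF assms, symmetric])
  finally show ?thesis ..
qed

lemma sum_num_sums_power2_ge:
  assumes "k \<ge> 1" "L \<ge> 1"
  shows "real L ^ (2 * k) / real (k * L) \<le> (\<Sum>j<k * L. (real (num_sums k L j))\<^sup>2)"
proof -
  have "(\<Sum>j<k * L. real (num_sums k L j))\<^sup>2 \<le> (\<Sum>j<k * L. (real (num_sums k L j))\<^sup>2) * real (card {..<k * L})"
    by (rule sum_squared_le_sum_of_squares)
  moreover have "(\<Sum>j<k * L. real (num_sums k L j)) = real L ^ k"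
    using sum_num_sums_eq_power[OF assms(1), of L] by (simp flip: of_nat_sum of_nat_power)
  ultimately show ?thesis using assms by (simp add: divide_le_eq mult.commute flip: power_mult)
qed

lemma toeplitz_row_le:
  fixes S :: "int \<Rightarrow> real"
  assumes S_props: "\<And>h. 0 \<le> S h" "\<And>h. S (- h) = S h" and "j < J"
  shows "(\<Sum>i\<in>{..<J} - {j}. S (int j - int i)) \<le> 2 * (\<Sum>h\<in>{1..J}. S (int h))"
proof -
  have "(\<Sum>i\<in>{..<J} - {j}. S (int j - int i)) = (\<Sum>i\<in>{..<j}. S (int j - int i))
      + (\<Sum>i\<in>{j<..<J}. S (int j - int i))"
    using \<open>j < J\<close> by (subst sum.union_disjoint[symmetric]) (auto intro!: sum.cong)
  also have "(\<Sum>i\<in>{..<j}. S (int j - int i)) = (\<Sum>h\<in>(\<lambda>i. j - i) ` {..<j}. S (int h))"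
    by (subst sum.reindex) (auto simp: inj_on_def of_nat_diff)
  also have "\<dots> \<le> (\<Sum>h\<in>{1..J}. S (int h))" using \<open>j < J\<close> S_props by (intro sum_mono2) auto
  also have "(\<Sum>i\<in>{j<..<J}. S (int j - int i)) = (\<Sum>i\<in>{j<..<J}. S (int (i - j)))"
  proof (rule sum.cong[OF refl])
    fix i assume "i \<in> {j<..<J}"
    thus "S (int j - int i) = S (int (i - j))" using S_props(2)[of "int (i - j)"] by (simp add: of_nat_diff)
  qed
  also have "\<dots> = (\<Sum>h\<in>(\<lambda>i. i - j) ` {j<..<J}. S (int h))"
    by (subst sum.reindex) (auto simp: inj_on_def)
  also have "\<dots> \<le> (\<Sum>h\<in>{1..J}. S (int h))" using S_props by (intro sum_mono2) auto
  finally show ?thesis by simp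
qed

text \<open>Schur's test for the Toeplitz matrix with entries \<open>S (i - j)\<close>.\<close>
lemma toeplitz_off_diagonal_le:
  fixes c :: "nat \<Rightarrow> real" and S :: "int \<Rightarrow> real"
  assumes c_nonneg: "\<And>j. 0 \<le> c j" and S_props: "\<And>h. 0 \<le> S h" "\<And>h. S (- h) = S h"
  shows "(\<Sum>j<J. \<Sum>i\<in>{..<J} - {j}. c j * c i * S (int j - int i)) \<le> 2 * (\<Sum>j<J. (c j)\<^sup>2) * (\<Sum>h\<in>{1..J}. S (int h))"
proof -
  define Q where "Q = {..<J} \<times> {..<J} - Id"
  define s where "s = (\<Sum>h\<in>{1..J}. S (int h))"
  have pairs: "(\<Sum>j<J. \<Sum>i\<in>{..<J} - {j}. g j i) = (\<Sum>(j, i)\<in>Q. g j i)" for g :: "nat \<Rightarrow> nat \<Rightarrow> real"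
  proof -
    have "Q = (SIGMA j:{..<J}. {..<J} - {j})" by (auto simp: Q_def)
    thus ?thesis by (simp add: sum.Sigma)
  qed
  have "(\<Sum>(j, i)\<in>Q. c j * c i * S (int j - int i))
      \<le> (\<Sum>(j, i)\<in>Q. (c j)\<^sup>2 / 2 * S (int j - int i) + (c i)\<^sup>2 / 2 * S (int j - int i))"
  proof (intro sum_mono, clarify)
    fix j i
    have "c j * c i \<le> ((c j)\<^sup>2 + (c i)\<^sup>2) / 2" using sum_squares_bound[of "c j" "c i"] by simp
    from mult_right_mono[OF this S_props(1)[of "int j - int i"]]
    show "c j * c i * S (int j - int i) \<le> (c j)\<^sup>2 / 2 * S (int j - int i) + (c i)\<^sup>2 / 2 * S (int j - int i)"
      by (simp add: add_divide_distrib distrib_right)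
  qed
  also have "\<dots> = (\<Sum>(j, i)\<in>Q. (c j)\<^sup>2 / 2 * S (int j - int i)) + (\<Sum>(j, i)\<in>Q. (c i)\<^sup>2 / 2 * S (int j - int i))"
    by (simp add: case_prod_unfold sum.distrib)
  also have "(\<Sum>(j, i)\<in>Q. (c i)\<^sup>2 / 2 * S (int j - int i)) = (\<Sum>(j, i)\<in>Q. (c j)\<^sup>2 / 2 * S (int j - int i))"
  proof (rule sum.reindex_bij_witness[of _ prod.swap prod.swap])
    show "(case prod.swap p of (j, i) \<Rightarrow> (c j)\<^sup>2 / 2 * S (int j - int i))
        = (case p of (j, i) \<Rightarrow> (c i)\<^sup>2 / 2 * S (int j - int i))" for p
      using S_props(2)[of "int (fst p) - int (snd p)"] by (simp add: case_prod_unfold)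
  qed (auto simp: Q_def)
  also have "(\<Sum>(j, i)\<in>Q. (c j)\<^sup>2 / 2 * S (int j - int i))
      = (\<Sum>j<J. (c j)\<^sup>2 / 2 * (\<Sum>i\<in>{..<J} - {j}. S (int j - int i)))"
    unfolding pairs[symmetric] by (simp add: sum_distrib_left)
  also have "\<dots> \<le> (\<Sum>j<J. (c j)\<^sup>2 / 2 * (2 * s))"
    unfolding s_def using S_props by (intro sum_mono mult_left_mono toeplitz_row_le) auto
  also have "\<dots> = (\<Sum>j<J. (c j)\<^sup>2) * s" by (simp add: sum_distrib_right)
  finally show ?thesis by (simp add: pairs s_def mult_ac)
qed

lemma norm_geometric_ec_sum_le:
  assumes w_pos: "w > 0" and far: "\<And>n::int. w / 2 \<le> \<bar>t - of_int n\<bar>"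
  shows "norm (\<Sum>i<L. ec (real i * t)) \<le> 2 / w"
proof -
  define r where "r = t - of_int (round t)"
  have r_bounds: "\<bar>r\<bar> \<le> 1/2" using of_int_round_abs_le[of t] by (simp add: r_def abs_minus_commute)
  have "ec t = ec (r + of_int (round t))" by (simp add: r_def)
  hence ec_t: "ec t = ec r" by (simp only: ec_add ec_of_int mult_1_right)
  have "(norm (ec r - 1))\<^sup>2 = (cos (2 * pi * r) - 1)\<^sup>2 + (sin (2 * pi * r))\<^sup>2"
    by (simp add: cmod_power2 ec_def)
  also have "\<dots> = 2 - 2 * cos (2 * pi * r)"
    using sin_cos_squared_add[of "2 * pi * r"] by (simp add: power2_eq_square algebra_simps)
  also have "\<dots> = (2 * \<bar>sin (pi * r)\<bar>)\<^sup>2"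
    using cos_double_sin[of "pi * r"] by (simp add: power_mult_distrib mult.assoc)
  finally have "norm (ec t - 1) = 2 * \<bar>sin (pi * r)\<bar>" unfolding ec_t by (rule power2_eq_imp_eq) auto
  hence w_le: "w \<le> norm (ec t - 1)" using abs_sin_pi_ge[OF r_bounds] far[of "round t"] by (simp add: r_def)
  hence "ec t \<noteq> 1" using w_pos by auto
  have "(\<Sum>i<L. ec (real i * t)) = (\<Sum>i<L. ec t ^ i)" by (simp add: ec_mult_of_nat)
  also have "\<dots> = (ec t ^ L - 1) / (ec t - 1)" using geometric_sum[OF \<open>ec t \<noteq> 1\<close>] by simp
  finally have "norm (\<Sum>i<L. ec (real i * t)) = norm (ec t ^ L - 1) / norm (ec t - 1)"
    by (simp add: norm_divide)
  also have "\<dots> \<le> 2 / w"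
  proof (rule frac_le)
    show "norm (ec t ^ L - 1) \<le> 2" using norm_triangle_ineq4[of "ec t ^ L" 1] by (simp add: norm_power)
  qed (use w_pos w_le in auto)
  finally show ?thesis .
qed

lemma mean_square_at_points_ge:
  fixes \<theta> :: "'a \<Rightarrow> real" and c :: "nat \<Rightarrow> real"
  assumes c_nonneg: "\<And>j. 0 \<le> c j"
  shows "(\<Sum>j<J. (c j)\<^sup>2) * (real (card P) - 2 * (\<Sum>h\<in>{1..J}. norm (\<Sum>p\<in>P. ec (real h * \<theta> p))))
    \<le> (\<Sum>p\<in>P. (norm (\<Sum>j<J. of_real (c j) * ec (\<theta> p * real j)))\<^sup>2)"
proof -
  define S where "S = (\<lambda>h::int. norm (\<Sum>p\<in>P. ec (of_int h * \<theta> p)))"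
  define T where "T = (\<lambda>j i. of_real (c j * c i) * (\<Sum>p\<in>P. ec (\<theta> p * (real j - real i))))"
  define E where "E = (\<Sum>j<J. (c j)\<^sup>2)"
  define V where "V = (\<Sum>p\<in>P. (norm (\<Sum>j<J. of_real (c j) * ec (\<theta> p * real j)))\<^sup>2)"
  have S_even: "S (- h) = S h" for h using norm_sum_ec_uminus[of "\<lambda>p. of_int h * \<theta> p" P] by (simp add: S_def)
  have "complex_of_real V = (\<Sum>p\<in>P. \<Sum>j<J. \<Sum>i<J. of_real (c j * c i) * ec (\<theta> p * (real j - real i)))"
    unfolding V_def of_real_sum norm_sum_ec_square by simp
  also have "\<dots> = (\<Sum>j<J. \<Sum>i<J. T j i)"
    unfolding T_def sum_distrib_left by (subst sum.swap, rule sum.cong[OF refl], rule sum.swap)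
  also have "\<dots> = (\<Sum>j<J. T j j + (\<Sum>i\<in>{..<J} - {j}. T j i))"
    by (intro sum.cong refl) (simp add: sum.remove)
  also have "\<dots> = of_real (E * real (card P)) + (\<Sum>j<J. \<Sum>i\<in>{..<J} - {j}. T j i)"
    by (simp add: sum.distrib T_def E_def sum_distrib_right power2_eq_square)
  finally have "complex_of_real (E * real (card P) - V) = - (\<Sum>j<J. \<Sum>i\<in>{..<J} - {j}. T j i)" by simp
  hence "\<bar>E * real (card P) - V\<bar> = norm (\<Sum>j<J. \<Sum>i\<in>{..<J} - {j}. T j i)"
    by (metis norm_minus_cancel norm_of_real)
  also have "\<dots> \<le> (\<Sum>j<J. \<Sum>i\<in>{..<J} - {j}. c j * c i * S (int j - int i))"
    by (intro order_trans[OF norm_sum] sum_mono) (simp add: T_def S_def norm_mult c_nonneg mult.commute)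
  also have "\<dots> \<le> 2 * E * (\<Sum>h\<in>{1..J}. S (int h))"
    unfolding E_def by (intro toeplitz_off_diagonal_le c_nonneg S_even) (simp add: S_def)
  finally have "E * real (card P) - V \<le> 2 * E * (\<Sum>h\<in>{1..J}. S (int h))" by linarith
  thus ?thesis by (simp add: E_def V_def S_def algebra_simps)
qed

theorem gap_forces_exponential_sum:
  fixes \<theta> :: "'a \<Rightarrow> real"
  assumes w_pos: "w > 0" and L_ge_1: "L \<ge> 1" and k_ge_1: "k \<ge> 1"
    and far: "\<And>p (n::int). p \<in> P \<Longrightarrow> w / 2 \<le> \<bar>\<theta> p - of_int n\<bar>"
    and large: "2 * real (k * L) \<le> (real L * w / 2) ^ (2 * k)"
  shows "real (card P) \<le> 4 * (\<Sum>h\<in>{1..k * L}. norm (\<Sum>p\<in>P. ec (real h * \<theta> p)))"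
proof -
  define E where "E = (\<Sum>j<k * L. (real (num_sums k L j))\<^sup>2)"
  define s where "s = (\<Sum>h\<in>{1..k * L}. norm (\<Sum>p\<in>P. ec (real h * \<theta> p)))"
  have kL_pos: "0 < real (k * L)" using L_ge_1 k_ge_1 by simp
  have E_ge: "real L ^ (2 * k) / real (k * L) \<le> E"
    unfolding E_def by (rule sum_num_sums_power2_ge[OF k_ge_1 L_ge_1])
  hence "E > 0" using kL_pos L_ge_1 by (intro less_le_trans[OF _ E_ge] divide_pos_pos) auto
  have "2 * real (k * L) * (2 / w) ^ (2 * k) \<le> (real L * w / 2) ^ (2 * k) * (2 / w) ^ (2 * k)"
    using large w_pos by (intro mult_right_mono) auto
  also have "\<dots> = real L ^ (2 * k)" using w_pos by (simp flip: power_mult_distrib)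
  finally have "2 * (2 / w) ^ (2 * k) \<le> real L ^ (2 * k) / real (k * L)"
    using kL_pos by (simp add: le_divide_eq mult_ac)
  hence kernel: "(2 / w) ^ (2 * k) \<le> E / 2" using E_ge by linarith
  have "(norm (\<Sum>j<k * L. of_real (real (num_sums k L j)) * ec (\<theta> p * real j)))\<^sup>2 \<le> E / 2" if "p \<in> P" for p
  proof -
    have "norm (\<Sum>j<k * L. of_real (real (num_sums k L j)) * ec (\<theta> p * real j))
        = norm (\<Sum>i<L. ec (real i * \<theta> p)) ^ k"
      using sum_num_sums_ec[OF k_ge_1, of L "\<theta> p"] by (simp add: norm_power)
    also have "\<dots> \<le> (2 / w) ^ k" using that by (intro power_mono norm_geometric_ec_sum_le w_pos far) auto
    finally have "(norm (\<Sum>j<k * L. of_real (real (num_sums k L j)) * ec (\<theta> p * real j)))\<^sup>2 \<le> ((2 / w) ^ k)\<^sup>2"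
      by (intro power_mono) auto
    also have "((2 / w) ^ k)\<^sup>2 = (2 / w) ^ (2 * k)" by (simp add: mult.commute flip: power_mult)
    finally show ?thesis using kernel by linarith
  qed
  hence "(\<Sum>p\<in>P. (norm (\<Sum>j<k * L. of_real (real (num_sums k L j)) * ec (\<theta> p * real j)))\<^sup>2)
      \<le> real (card P) * (E / 2)"
    by (rule sum_bounded_above)
  moreover have "E * (real (card P) - 2 * s)
      \<le> (\<Sum>p\<in>P. (norm (\<Sum>j<k * L. of_real (real (num_sums k L j)) * ec (\<theta> p * real j)))\<^sup>2)"
    unfolding E_def s_def by (rule mean_square_at_points_ge) simp
  ultimately have "E * (real (card P) - 2 * s) \<le> E * (real (card P) / 2)" by (simp add: mult.commute)
  hence "real (card P) - 2 * s \<le> real (card P) / 2" using \<open>E > 0\<close> by (simp only: mult_le_cancel_left_pos)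
  thus ?thesis by (simp add: s_def)
qed

section \<open>Bilinear sums over products\<close>

definition upper_half :: "real \<Rightarrow> nat set" where
  "upper_half N = {m. 0 < m \<and> N / 2 \<le> real m \<and> real m < N}"

lemma
  assumes "A \<subseteq> upper_half N" and "N \<ge> 0"
  shows finite_subset_upper_half: "finite A" and card_subset_upper_half_le: "real (card A) \<le> N"
proof -
  have subset: "A \<subseteq> {1..nat \<lfloor>N\<rfloor>}" using assms(1) by (auto simp: upper_half_def le_nat_iff le_floor_iff)
  show "finite A" by (rule finite_subset[OF subset]) simp
  have "card A \<le> nat \<lfloor>N\<rfloor>" using card_mono[OF _ subset] by simp
  thus "real (card A) \<le> N" using \<open>N \<ge> 0\<close> by linarith
qed

lemma upper_half_subset_dyadic_blocks:
  assumes "N \<ge> 2"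
  obtains j where "2 ^ (j + 1) \<le> N" "upper_half N \<subseteq> dyadic_block j \<union> dyadic_block (j + 1)"
proof -
  define n where "n = nat \<lfloor>N / 2\<rfloor>"
  define j where "j = floor_log n"
  have n_bounds: "n \<ge> 1" "real n \<le> N / 2" "N / 2 < real n + 1" using assms unfolding n_def by linarith+
  hence "n \<in> dyadic_block j" by (simp add: mem_dyadic_block_iff j_def)
  hence "2 ^ j \<le> n" "n + 1 \<le> 2 ^ (j + 1)" by (auto simp: dyadic_block_def)
  hence "real (2 ^ j) \<le> real n" "real (n + 1) \<le> real (2 ^ (j + 1))" unfolding of_nat_le_iff by auto
  hence j_bounds: "real (2 ^ j) \<le> N / 2" "N / 2 < real (2 ^ (j + 1))" using n_bounds by linarith+
  show thesis
  proof (rule that[of j])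
    show "2 ^ (j + 1) \<le> N" using j_bounds(1) by simp
    show "upper_half N \<subseteq> dyadic_block j \<union> dyadic_block (j + 1)"
    proof
      fix m assume "m \<in> upper_half N"
      hence "N / 2 \<le> real m" "real m < N" by (simp_all add: upper_half_def)
      moreover have "real (2 ^ (j + 2)) = 2 * real (2 ^ (j + 1))" by simp
      ultimately have "real (2 ^ j) \<le> real m" "real m < real (2 ^ (j + 2))" using j_bounds by linarith+
      hence "2 ^ j \<le> m" "m < 2 ^ (j + 2)" unfolding of_nat_le_iff of_nat_less_iff by auto
      thus "m \<in> dyadic_block j \<union> dyadic_block (j + 1)" by (auto simp: dyadic_block_def)
    qed
  qed
qed

locale bilinear_sum =
  fixes \<gamma> N \<kappa> K :: real and H :: nat and A :: "nat set"
  assumes N_ge_2: "2 \<le> N" and exponent: "1/2 \<le> \<gamma>" "\<gamma> < 1" and \<kappa>_pos: "0 < \<kappa>"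
    and K_pos: "0 < K" and energy: "\<And>j. block_energy \<gamma> j \<le> K * (2 ^ j) powr (2 + \<kappa>)"
    and H_ge: "N powr (2 - 2 * \<gamma>) \<le> real H" and H_less: "real H ^ 2 < N powr (2 * \<gamma>)"
    and A_subset: "A \<subseteq> upper_half N" and log_le: "(1 + ln N) ^ 3 \<le> N powr \<kappa>"
begin

lemma one_le_H: "1 \<le> real H"
proof -
  have "1 \<le> N powr (2 - 2 * \<gamma>)" using N_ge_2 exponent by (intro ge_one_powr_ge_zero) auto
  thus ?thesis using H_ge by linarith
qed

lemma H_le_N: "real H \<le> N"
proof -
  have "real H ^ 2 < N powr 2"
    by (rule less_le_trans[OF H_less]) (use N_ge_2 exponent in \<open>intro powr_mono, auto\<close>)
  hence "real H ^ 2 < N ^ 2" using N_ge_2 by simp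
  hence "real H < N" by (rule power2_less_imp_less) (use N_ge_2 in simp)
  thus ?thesis by simp
qed

definition \<Delta> :: real where "\<Delta> = 1 / (4 * N powr \<gamma>)"
definition X :: real where "X = real H * N powr \<gamma>"
definition point :: "nat \<times> nat \<Rightarrow> real" where "point = (\<lambda>(h, a). real h * real a powr \<gamma>)"

lemma \<Delta>_pos: "\<Delta> > 0" and X_pos: "X > 0"
  using N_ge_2 one_le_H by (simp_all add: \<Delta>_def X_def)

sublocale nearly_equal_products \<gamma> N \<Delta> H
  using N_ge_2 exponent one_le_H H_less by unfold_locales (simp_all add: \<Delta>_def)

lemma card_close_pairs_le:
  "real (card (close_pairs ({1..H} \<times> A) point \<Delta>)) \<le> 5 * N powr \<kappa> * (real H * N)"
proof -
  have "close_pairs ({1..H} \<times> A) point \<Delta> \<subseteq> near"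
    using A_subset by (auto simp: near_def close_pairs_def point_def upper_half_def)
  hence "real (card (close_pairs ({1..H} \<times> A) point \<Delta>)) \<le> real (card near)"
    by (intro of_nat_mono card_mono finite_near)
  also have "\<dots> \<le> 5 * (harm H)\<^sup>2 * harm (nat \<lfloor>N\<rfloor>) * (real H * N)" by (rule card_near_le)
  also have "\<dots> \<le> 5 * (1 + ln N)\<^sup>2 * (1 + ln N) * (real H * N)"
  proof (intro mult_mono power_mono order_refl)
    show "harm H \<le> 1 + ln N"
      by (rule order_trans[OF harm_le_ln]) (use one_le_H H_le_N in auto)
    have "real (nat \<lfloor>N\<rfloor>) \<le> N" "real (nat \<lfloor>N\<rfloor>) \<ge> 1" using N_ge_2 by linarith+
    thus "harm (nat \<lfloor>N\<rfloor>) \<le> 1 + ln N" by (intro order_trans[OF harm_le_ln]) auto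
  qed (use N_ge_2 in \<open>auto simp: harm_nonneg\<close>)
  also have "\<dots> = 5 * (1 + ln N) ^ 3 * (real H * N)" by (simp add: eval_nat_numeral)
  also have "\<dots> \<le> 5 * N powr \<kappa> * (real H * N)"
    using log_le N_ge_2 by (intro mult_right_mono mult_left_mono) auto
  finally show ?thesis .
qed

lemma energy_in_block_le:
  assumes "B \<subseteq> dyadic_block j" "2 ^ j \<le> N"
  shows "additive_energy (\<lambda>m. real m powr \<gamma>) B X \<le> K * N powr (2 + \<kappa>)"
proof -
  have "additive_energy (\<lambda>m. real m powr \<gamma>) B X \<le> additive_energy (\<lambda>m. real m powr \<gamma>) (dyadic_block j) X"
    by (rule additive_energy_mono[OF finite_dyadic_block assms(1)])
  also have "\<dots> \<le> block_energy \<gamma> j"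
    unfolding block_energy_def
  proof (rule additive_energy_antimono)
    have "(2^j) powr (2 - \<gamma>) \<le> N powr (2 - \<gamma>)" using assms exponent by (intro powr_mono2) auto
    also have "\<dots> = N powr (2 - 2 * \<gamma>) * N powr \<gamma>" by (simp flip: powr_add)
    also have "\<dots> \<le> X" unfolding X_def using H_ge by (intro mult_right_mono) auto
    finally show "(2^j) powr (2 - \<gamma>) \<le> X" .
  qed simp
  also have "\<dots> \<le> K * (2 ^ j) powr (2 + \<kappa>)" by (rule energy)
  also have "\<dots> \<le> K * N powr (2 + \<kappa>)" using assms K_pos \<kappa>_pos by (intro mult_left_mono powr_mono2) auto
  finally show ?thesis .
qed

lemma num_cells_le: "(X + 4 * \<Delta>) / \<Delta> \<le> 8 * real H * N powr (2 * \<gamma>)"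
proof -
  have "(X + 4 * \<Delta>) / \<Delta> = X / \<Delta> + 4" using \<Delta>_pos by (simp add: add_divide_distrib)
  also have "X / \<Delta> = 4 * (real H * N powr (2 * \<gamma>))" by (simp add: X_def \<Delta>_def mult.assoc flip: powr_add)
  finally have "(X + 4 * \<Delta>) / \<Delta> = 4 * (real H * N powr (2 * \<gamma>)) + 4" .
  moreover have "1 * 1 \<le> real H * N powr (2 * \<gamma>)"
    using one_le_H N_ge_2 exponent by (intro mult_mono ge_one_powr_ge_zero) auto
  ultimately show ?thesis by simp
qed

lemma block_mean_square_le:
  assumes "B \<subseteq> dyadic_block j" "2 ^ j \<le> N" "B \<subseteq> upper_half N"
  shows "(\<Sum>p\<in>{1..H} \<times> A. (norm (\<Sum>b\<in>B. ec (point p * real b powr \<gamma>)))\<^sup>2)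
    \<le> 12 * sqrt (40 * K) * (real H * N powr (3/2 + \<gamma> + \<kappa>))"
proof -
  define Q where "Q = real (card (close_pairs ({1..H} \<times> A) point \<Delta>))"
  define q where "q = additive_energy (\<lambda>m. real m powr \<gamma>) B X"
  define Y where "Y = real H * N powr (3/2 + \<gamma> + \<kappa>)"
  have "(\<Sum>p\<in>{1..H} \<times> A. (norm (\<Sum>b\<in>B. ec (point p * real b powr \<gamma>)))\<^sup>2) \<le> 12 * sqrt (Q * ((X + 4 * \<Delta>) / \<Delta>) * q)"
    unfolding Q_def q_def
  proof (rule double_large_sieve)
    show "finite ({1..H} \<times> A)" "finite B"
      using finite_subset_upper_half[OF A_subset] finite_subset_upper_half[OF assms(3)] N_ge_2 by auto
    show "0 \<le> point p \<and> point p \<le> X" if "p \<in> {1..H} \<times> A" for p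
      using that A_subset exponent unfolding point_def X_def
      by (auto simp: upper_half_def intro!: mult_mono powr_mono2)
    fix b assume "b \<in> B"
    hence b_bounds: "0 < real b" "real b \<le> N" using assms(3) by (auto simp: upper_half_def)
    hence "\<Delta> * real b powr \<gamma> \<le> \<Delta> * N powr \<gamma>" using \<Delta>_pos exponent by (intro mult_left_mono powr_mono2) auto
    thus "0 < real b powr \<gamma> \<and> 4 * \<Delta> * real b powr \<gamma> \<le> 1" using b_bounds N_ge_2 by (simp add: \<Delta>_def)
  qed (use \<Delta>_pos X_pos in auto)
  also have "Q * ((X + 4 * \<Delta>) / \<Delta>) * q \<le> (5 * N powr \<kappa> * (real H * N)) * (8 * real H * N powr (2 * \<gamma>))
      * (K * N powr (2 + \<kappa>))"
    using card_close_pairs_le num_cells_le energy_in_block_le[OF assms(1,2)] X_pos \<Delta>_pos N_ge_2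
    by (intro mult_mono) (auto simp: Q_def q_def additive_energy_nonneg)
  also have "\<dots> = 40 * K * (real H ^ 2 * (N powr \<kappa> * N powr 1 * N powr (2 * \<gamma>) * N powr (2 + \<kappa>)))"
    using N_ge_2 by (simp add: power2_eq_square)
  also have "N powr \<kappa> * N powr 1 * N powr (2 * \<gamma>) * N powr (2 + \<kappa>) = (N powr (3/2 + \<gamma> + \<kappa>)) ^ 2"
    unfolding power2_eq_square powr_add[symmetric] by (simp add: algebra_simps)
  also have "sqrt (40 * K * (real H ^ 2 * (N powr (3/2 + \<gamma> + \<kappa>)) ^ 2)) = sqrt (40 * K) * Y"
    by (simp add: real_sqrt_mult Y_def)
  finally show ?thesis by (simp add: Y_def)
qed

lemma block_sum_le:
  assumes "B \<subseteq> dyadic_block j" "2 ^ j \<le> N" "B \<subseteq> upper_half N"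
  shows "(\<Sum>p\<in>{1..H} \<times> A. norm (\<Sum>b\<in>B. ec (point p * real b powr \<gamma>)))
    \<le> sqrt (12 * sqrt (40 * K)) * (real H * N powr (5/4 + \<gamma>/2 + \<kappa>/2))"
proof -
  define F where "F = (\<lambda>p. norm (\<Sum>b\<in>B. ec (point p * real b powr \<gamma>)))"
  define c where "c = 12 * sqrt (40 * K)"
  have card: "real (card ({1..H} \<times> A)) \<le> real H * N"
    using card_subset_upper_half_le[OF A_subset] N_ge_2 by (simp add: card_cartesian_product mult_left_mono)
  have "(\<Sum>p\<in>{1..H} \<times> A. F p)\<^sup>2 \<le> (\<Sum>p\<in>{1..H} \<times> A. (F p)\<^sup>2) * real (card ({1..H} \<times> A))"
    by (rule sum_squared_le_sum_of_squares)
  also have "\<dots> \<le> (c * (real H * N powr (3/2 + \<gamma> + \<kappa>))) * (real H * N)"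
    unfolding F_def c_def using block_mean_square_le[OF assms] card K_pos by (intro mult_mono) auto
  also have "\<dots> = c * (real H ^ 2 * (N powr (3/2 + \<gamma> + \<kappa>) * N powr 1))"
    using N_ge_2 by (simp add: power2_eq_square)
  also have "N powr (3/2 + \<gamma> + \<kappa>) * N powr 1 = (N powr (5/4 + \<gamma>/2 + \<kappa>/2)) ^ 2"
    unfolding power2_eq_square powr_add[symmetric] by (simp add: algebra_simps)
  finally have "(\<Sum>p\<in>{1..H} \<times> A. F p)\<^sup>2 \<le> c * (real H * N powr (5/4 + \<gamma>/2 + \<kappa>/2)) ^ 2"
    by (simp only: power_mult_distrib)
  hence "(\<Sum>p\<in>{1..H} \<times> A. F p) \<le> sqrt (c * (real H * N powr (5/4 + \<gamma>/2 + \<kappa>/2)) ^ 2)"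
    by (rule real_le_rsqrt)
  also have "\<dots> = sqrt c * (real H * N powr (5/4 + \<gamma>/2 + \<kappa>/2))" by (simp add: real_sqrt_mult)
  finally show ?thesis by (simp only: F_def c_def)
qed

lemma norm_product_sums_le:
  "(\<Sum>h\<in>{1..H}. norm (\<Sum>p\<in>A \<times> B. ec (real h * (real (fst p * snd p) powr \<gamma> + t))))
    \<le> (\<Sum>p\<in>{1..H} \<times> A. norm (\<Sum>b\<in>B. ec (point p * real b powr \<gamma>)))"
proof -
  have "norm (\<Sum>p\<in>A \<times> B. ec (real h * (real (fst p * snd p) powr \<gamma> + t)))
      \<le> (\<Sum>a\<in>A. norm (\<Sum>b\<in>B. ec (point (h, a) * real b powr \<gamma>)))" for h
  proof -
    have "(\<Sum>p\<in>A \<times> B. ec (real h * (real (fst p * snd p) powr \<gamma> + t)))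
        = (\<Sum>p\<in>A \<times> B. ec (point (h, fst p) * real (snd p) powr \<gamma>)) * ec (real h * t)"
      unfolding sum_distrib_right ec_add[symmetric]
      by (intro sum.cong refl) (simp add: point_def powr_mult algebra_simps)
    also have "(\<Sum>p\<in>A \<times> B. ec (point (h, fst p) * real (snd p) powr \<gamma>))
        = (\<Sum>a\<in>A. \<Sum>b\<in>B. ec (point (h, a) * real b powr \<gamma>))"
      by (simp add: sum.cartesian_product split_def)
    finally show ?thesis by (simp add: norm_mult norm_sum)
  qed
  hence "(\<Sum>h\<in>{1..H}. norm (\<Sum>p\<in>A \<times> B. ec (real h * (real (fst p * snd p) powr \<gamma> + t))))
      \<le> (\<Sum>h\<in>{1..H}. \<Sum>a\<in>A. norm (\<Sum>b\<in>B. ec (point (h, a) * real b powr \<gamma>)))"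
    by (intro sum_mono)
  thus ?thesis by (simp add: sum.cartesian_product split_def)
qed

theorem bilinear_sum_le:
  assumes B_subset: "B \<subseteq> upper_half N"
  shows "(\<Sum>h\<in>{1..H}. norm (\<Sum>p\<in>A \<times> B. ec (real h * (real (fst p * snd p) powr \<gamma> + t))))
    \<le> 2 * sqrt (12 * sqrt (40 * K)) * (real H * N powr (5/4 + \<gamma>/2 + \<kappa>/2))"
proof -
  define R where "R = sqrt (12 * sqrt (40 * K)) * (real H * N powr (5/4 + \<gamma>/2 + \<kappa>/2))"
  define G where "G = (\<lambda>C p. \<Sum>b\<in>C. ec (point p * real b powr \<gamma>))"
  obtain j where j_blocks: "2 ^ (j + 1) \<le> N" "upper_half N \<subseteq> dyadic_block j \<union> dyadic_block (j + 1)"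
    using upper_half_subset_dyadic_blocks[OF N_ge_2] by blast
  define B1 where "B1 = B \<inter> dyadic_block j"
  define B2 where "B2 = B \<inter> dyadic_block (j + 1)"
  have B_eq: "B = B1 \<union> B2" using B_subset j_blocks(2) by (auto simp: B1_def B2_def)
  have "G B p = G B1 p + G B2 p" for p
    unfolding G_def B_eq
    by (rule sum.union_disjoint) (auto simp: B1_def B2_def finite_dyadic_block mem_dyadic_block_iff)
  hence split: "norm (G B p) \<le> norm (G B1 p) + norm (G B2 p)" for p by (simp add: norm_triangle_ineq)
  have "(\<Sum>h\<in>{1..H}. norm (\<Sum>p\<in>A \<times> B. ec (real h * (real (fst p * snd p) powr \<gamma> + t))))
      \<le> (\<Sum>p\<in>{1..H} \<times> A. norm (G B p))"
    unfolding G_def by (rule norm_product_sums_le)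
  also have "\<dots> \<le> (\<Sum>p\<in>{1..H} \<times> A. norm (G B1 p) + norm (G B2 p))" by (intro sum_mono split)
  also have "\<dots> \<le> R + R"
    unfolding sum.distrib G_def R_def
  proof (intro add_mono block_sum_le)
    show "2 ^ j \<le> N" by (rule order_trans[OF _ j_blocks(1)]) simp
  qed (use B_subset j_blocks(1) in \<open>auto simp: B1_def B2_def\<close>)
  finally show ?thesis by (simp only: R_def mult_2 distrib_right)
qed

end

section \<open>Products in a Piatetski-Shapiro sequence\<close>

definition piatetski_shapiro :: "real \<Rightarrow> nat set" where
  "piatetski_shapiro c = {m. \<exists>n::nat. 0 < n \<and> int m = \<lfloor>real n powr c\<rfloor>}"

lemma powr_succ_diff_ge:
  fixes \<gamma> m M :: real
  assumes \<gamma>_bounds: "0 < \<gamma>" "\<gamma> < 1" and m_bounds: "0 < m" "m + 1 \<le> M"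
  shows "\<gamma> * M powr (\<gamma> - 1) \<le> (m + 1) powr \<gamma> - m powr \<gamma>"
proof -
  have "\<exists>z>m. z < m + 1 \<and> (m + 1) powr \<gamma> - m powr \<gamma> = (m + 1 - m) * (\<gamma> * z powr (\<gamma> - 1))"
    using m_bounds by (intro MVT2) (auto intro!: derivative_eq_intros)
  then obtain z where z_bounds: "m < z" "z < m + 1" and mvt: "(m + 1) powr \<gamma> - m powr \<gamma> = \<gamma> * z powr (\<gamma> - 1)"
    by auto
  have "M powr (\<gamma> - 1) \<le> z powr (\<gamma> - 1)" using z_bounds m_bounds \<gamma>_bounds by (intro powr_mono2') auto
  thus ?thesis using mvt \<gamma>_bounds by simp
qed

lemma piatetski_shapiro_gap:
  fixes c w :: real and m :: nat
  assumes c_bounds: "c > 1" and m_avoids: "m > 0" "m \<notin> piatetski_shapiro c"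
    and w_le: "w \<le> (real m + 1) powr (1 / c) - real m powr (1 / c)"
  shows "w / 2 \<le> \<bar>real m powr (1 / c) + w / 2 - of_int k\<bar>"
proof (rule ccontr)
  assume "\<not> ?thesis"
  hence k_bounds: "real m powr (1 / c) < of_int k" "of_int k < (real m + 1) powr (1 / c)"
    using w_le by linarith+
  have "0 < real m powr (1 / c)" using m_avoids by simp
  hence "(0::real) < of_int k" using k_bounds(1) by linarith
  define n where "n = nat k"
  have n_eq: "real n = of_int k" "n > 0" using \<open>(0::real) < of_int k\<close> by (auto simp: n_def)
  have "(real m powr (1 / c)) powr c < real n powr c"
    using k_bounds(1) n_eq c_bounds by (intro powr_less_mono2) auto
  hence lower: "real m < real n powr c" using c_bounds m_avoids by (simp add: powr_powr)
  have "real n powr c < ((real m + 1) powr (1 / c)) powr c"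
    using k_bounds(2) n_eq c_bounds by (intro powr_less_mono2) auto
  hence upper: "real n powr c < real m + 1" using c_bounds by (simp add: powr_powr)
  have "\<lfloor>real n powr c\<rfloor> = int m" using lower upper by (intro floor_unique) auto
  hence "m \<in> piatetski_shapiro c"
    unfolding piatetski_shapiro_def mem_Collect_eq using n_eq(2) by (intro exI[of _ n]) simp
  thus False using m_avoids(2) by simp
qed

text \<open>A lower bound for the gaps between the \<open>\<gamma>\<close>-th powers of the integers up to \<open>2 N\<^sup>2\<close>.\<close>
definition root_gap :: "real \<Rightarrow> real \<Rightarrow> real" where
  "root_gap \<gamma> N = \<gamma> * (2 * N powr 2) powr (\<gamma> - 1)"

lemma product_root_far_from_ints:
  assumes "c > 1" "N \<ge> 2" "a \<in> upper_half N" "b \<in> upper_half N" "a * b \<notin> piatetski_shapiro c"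
  shows "root_gap (1 / c) N / 2 \<le> \<bar>real (a * b) powr (1 / c) + root_gap (1 / c) N / 2 - of_int k\<bar>"
proof (rule piatetski_shapiro_gap)
  show pos: "0 < a * b" using assms by (simp add: upper_half_def)
  have "real a * real b \<le> N * N" using assms by (intro mult_mono) (auto simp: upper_half_def)
  moreover have "2 * 2 \<le> N * N" using assms by (intro mult_mono) auto
  moreover have "N powr 2 = N * N" using assms by (simp add: power2_eq_square)
  ultimately have "real (a * b) + 1 \<le> 2 * N powr 2" unfolding of_nat_mult by linarith
  thus "root_gap (1 / c) N \<le> (real (a * b) + 1) powr (1 / c) - real (a * b) powr (1 / c)"
    unfolding root_gap_def using assms(1) pos by (intro powr_succ_diff_ge) (auto simp del: of_nat_mult)
qed (use assms in auto)

lemma root_gap_pos: "0 < \<gamma> \<Longrightarrow> 0 < N \<Longrightarrow> 0 < root_gap \<gamma> N"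
  by (simp add: root_gap_def)

lemma root_gap_ge:
  assumes "0 < \<gamma>"
  shows "\<gamma> / 2 * N powr (2 * \<gamma> - 2) \<le> root_gap \<gamma> N"
proof -
  have "2 powr (-1) * N powr (2 * \<gamma> - 2) \<le> 2 powr (\<gamma> - 1) * N powr (2 * \<gamma> - 2)"
    using assms by (intro mult_right_mono powr_mono) auto
  also have "\<dots> = (2 * N powr 2) powr (\<gamma> - 1)" by (simp add: powr_mult powr_powr algebra_simps)
  finally have "\<gamma> * (2 powr (-1) * N powr (2 * \<gamma> - 2)) \<le> root_gap \<gamma> N"
    unfolding root_gap_def using assms by (intro mult_left_mono) auto
  thus ?thesis by (simp add: powr_minus)
qed

lemma kernel_power_ge:
  assumes N_ge_1: "N \<ge> 1" and \<gamma>_pos: "0 < \<gamma>" and k_bounds: "1 \<le> real k * \<epsilon>"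
    and L_bounds: "N powr (2 - 2 * \<gamma> + \<epsilon>) \<le> real L" "real L \<le> 2 * N"
    and large: "4 * real k * N \<le> (\<gamma> / 4) ^ (2 * k) * N powr 2"
  shows "2 * real (k * L) \<le> (real L * root_gap \<gamma> N / 2) ^ (2 * k)"
proof -
  have "N powr (2 - 2 * \<gamma> + \<epsilon>) * (\<gamma> / 2 * N powr (2 * \<gamma> - 2)) \<le> real L * root_gap \<gamma> N"
    using L_bounds(1) \<gamma>_pos root_gap_ge[OF \<gamma>_pos] by (intro mult_mono) auto
  moreover have "N powr (2 - 2 * \<gamma> + \<epsilon>) * (\<gamma> / 2 * N powr (2 * \<gamma> - 2)) = \<gamma> / 2 * N powr \<epsilon>"
    by (simp flip: powr_add)
  ultimately have base: "\<gamma> / 4 * N powr \<epsilon> \<le> real L * root_gap \<gamma> N / 2" by linarith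
  have "N powr 2 \<le> N powr (\<epsilon> * real (2 * k))"
    using N_ge_1 k_bounds by (intro powr_mono) (auto simp: mult.commute)
  also have "\<dots> = (N powr \<epsilon>) ^ (2 * k)" using N_ge_1 by (simp add: powr_realpow[symmetric] powr_powr)
  finally have N_le: "N powr 2 \<le> (N powr \<epsilon>) ^ (2 * k)" .
  have "2 * real k * real L \<le> 2 * real k * (2 * N)" using L_bounds(2) by (intro mult_left_mono) auto
  hence "2 * real (k * L) \<le> (\<gamma> / 4) ^ (2 * k) * N powr 2" using large unfolding of_nat_mult by linarith
  also have "\<dots> \<le> (\<gamma> / 4) ^ (2 * k) * (N powr \<epsilon>) ^ (2 * k)" using N_le \<gamma>_pos by (intro mult_left_mono) auto
  also have "\<dots> = (\<gamma> / 4 * N powr \<epsilon>) ^ (2 * k)" by (simp only: power_mult_distrib)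
  also have "\<dots> \<le> (real L * root_gap \<gamma> N / 2) ^ (2 * k)" using base \<gamma>_pos by (intro power_mono) auto
  finally show ?thesis .
qed

lemma bilinear_sum_kernel_length:
  fixes \<gamma> \<epsilon> N K :: real and k L :: nat
  assumes \<gamma>_bounds: "1/2 \<le> \<gamma>" "\<gamma> < 1" and "0 < \<epsilon>" "k \<ge> 1"
    and energy_le: "0 < K" "\<And>j. block_energy \<gamma> j \<le> K * (2 ^ j) powr (2 + \<epsilon>)"
    and N_large: "N \<ge> 2" "(1 + ln N) ^ 3 \<le> N powr \<epsilon>"
      "(2 * real k)\<^sup>2 * N powr (2 * (2 - 2 * \<gamma> + \<epsilon>)) < N powr (2 * \<gamma>)"
    and L_bounds: "N powr (2 - 2 * \<gamma> + \<epsilon>) \<le> real L" "real L \<le> 2 * N powr (2 - 2 * \<gamma> + \<epsilon>)"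
    and "A \<subseteq> upper_half N"
  shows "bilinear_sum \<gamma> N \<epsilon> K (k * L) A"
proof
  have "N powr (2 - 2 * \<gamma>) \<le> N powr (2 - 2 * \<gamma> + \<epsilon>)" using N_large \<open>0 < \<epsilon>\<close> by (intro powr_mono) auto
  also have "\<dots> \<le> 1 * real L" using L_bounds(1) by simp
  also have "\<dots> \<le> real (k * L)" unfolding of_nat_mult using \<open>k \<ge> 1\<close> by (intro mult_right_mono) auto
  finally show "N powr (2 - 2 * \<gamma>) \<le> real (k * L)" .
  have "real (k * L) \<le> 2 * real k * N powr (2 - 2 * \<gamma> + \<epsilon>)"
    using mult_left_mono[OF L_bounds(2), of "real k"] by simp
  hence "(real (k * L))\<^sup>2 \<le> (2 * real k * N powr (2 - 2 * \<gamma> + \<epsilon>))\<^sup>2" by (rule power_mono) simp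
  also have "\<dots> = (2 * real k)\<^sup>2 * N powr (2 * (2 - 2 * \<gamma> + \<epsilon>))"
    unfolding power_mult_distrib mult_2 powr_add power2_eq_square by simp
  finally show "(real (k * L))\<^sup>2 < N powr (2 * \<gamma>)" using N_large(3) by simp
qed (use assms in auto)

lemma card_mult_le_of_no_product:
  fixes c \<epsilon> N K :: real and k :: nat
  defines "\<gamma> \<equiv> 1 / c"
  assumes c_bounds: "1 < c" "c \<le> 2" and \<epsilon>_bounds: "0 < \<epsilon>" "2 + \<epsilon> < 3 * \<gamma>" and k_bounds: "1 \<le> real k * \<epsilon>"
    and energy_le: "0 < K" "\<And>j. block_energy \<gamma> j \<le> K * (2 ^ j) powr (2 + \<epsilon>)"
    and N_large: "N \<ge> 2" "(1 + ln N) ^ 3 \<le> N powr \<epsilon>" "4 * real k * N \<le> (\<gamma> / 4) ^ (2 * k) * N powr 2"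
      "(2 * real k)\<^sup>2 * N powr (2 * (2 - 2 * \<gamma> + \<epsilon>)) < N powr (2 * \<gamma>)"
    and avoids: "A \<subseteq> upper_half N" "B \<subseteq> upper_half N" "\<forall>a\<in>A. \<forall>b\<in>B. a * b \<notin> piatetski_shapiro c"
  shows "real (card A) * real (card B) \<le> 16 * real k * sqrt (12 * sqrt (40 * K))
      * N powr (13/4 - 3/2 * \<gamma> + 3/2 * \<epsilon>)"
proof -
  define L where "L = nat \<lceil>N powr (2 - 2 * \<gamma> + \<epsilon>)\<rceil>"
  define R where "R = 2 * sqrt (12 * sqrt (40 * K))"
  have \<gamma>_bounds: "1/2 \<le> \<gamma>" "\<gamma> < 1" using c_bounds by (auto simp: \<gamma>_def field_simps)
  have "k \<ge> 1" using k_bounds by (cases k) auto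
  have "1 \<le> N powr (2 - 2 * \<gamma> + \<epsilon>)" using N_large \<gamma>_bounds \<epsilon>_bounds by (intro ge_one_powr_ge_zero) auto
  hence L_bounds: "N powr (2 - 2 * \<gamma> + \<epsilon>) \<le> real L" "real L \<le> 2 * N powr (2 - 2 * \<gamma> + \<epsilon>)" "L \<ge> 1"
    unfolding L_def by linarith+
  have "N powr (2 - 2 * \<gamma> + \<epsilon>) \<le> N powr 1" using N_large \<gamma>_bounds \<epsilon>_bounds by (intro powr_mono) auto
  hence L_le: "real L \<le> 2 * N" using L_bounds(2) N_large by simp
  have "2 * real (k * L) \<le> (real L * root_gap \<gamma> N / 2) ^ (2 * k)"
    by (rule kernel_power_ge[OF _ _ k_bounds L_bounds(1) L_le N_large(3)]) (use N_large \<gamma>_bounds in auto)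
  moreover have "root_gap \<gamma> N / 2 \<le> \<bar>real (fst p * snd p) powr \<gamma> + root_gap \<gamma> N / 2 - of_int n\<bar>"
    if "p \<in> A \<times> B" for p n
    unfolding \<gamma>_def by (rule product_root_far_from_ints) (use that avoids c_bounds N_large in auto)
  ultimately have "real (card (A \<times> B))
      \<le> 4 * (\<Sum>h\<in>{1..k * L}. norm (\<Sum>p\<in>A \<times> B. ec (real h * (real (fst p * snd p) powr \<gamma> + root_gap \<gamma> N / 2))))"
    using N_large \<gamma>_bounds root_gap_pos by (intro gap_forces_exponential_sum[OF _ L_bounds(3) \<open>k \<ge> 1\<close>]) auto
  also have "\<dots> \<le> 4 * (R * (real (k * L) * N powr (5/4 + \<gamma>/2 + \<epsilon>/2)))"
    unfolding R_def using \<open>k \<ge> 1\<close>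
    by (intro mult_left_mono bilinear_sum.bilinear_sum_le[OF bilinear_sum_kernel_length]
      \<gamma>_bounds \<epsilon>_bounds(1) energy_le N_large(1,2,4) L_bounds(1,2) avoids) auto
  also have "\<dots> = 4 * R * real k * (real L * N powr (5/4 + \<gamma>/2 + \<epsilon>/2))" by simp
  also have "\<dots> \<le> 4 * R * real k * ((2 * N powr (2 - 2 * \<gamma> + \<epsilon>)) * N powr (5/4 + \<gamma>/2 + \<epsilon>/2))"
    using L_bounds(2) energy_le by (intro mult_left_mono mult_right_mono) (auto simp: R_def)
  also have "\<dots> = 8 * R * real k * (N powr (2 - 2 * \<gamma> + \<epsilon>) * N powr (5/4 + \<gamma>/2 + \<epsilon>/2))" by simp
  also have "N powr (2 - 2 * \<gamma> + \<epsilon>) * N powr (5/4 + \<gamma>/2 + \<epsilon>/2) = N powr (13/4 - 3/2 * \<gamma> + 3/2 * \<epsilon>)"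
    unfolding powr_add[symmetric] by (simp add: algebra_simps)
  finally show ?thesis by (simp add: card_cartesian_product R_def mult_ac)
qed

lemma eventually_powr_less:
  fixes C D p q :: real
  assumes "p < q" "D > 0"
  shows "eventually (\<lambda>N. C * N powr p < D * N powr q) at_top"
proof -
  have "((\<lambda>N. C * N powr (p - q)) \<longlongrightarrow> C * 0) at_top"
    by (intro tendsto_mult tendsto_const tendsto_neg_powr filterlim_ident) (use assms in simp)
  hence "eventually (\<lambda>N. C * N powr (p - q) < D) at_top" using assms by (intro order_tendstoD(2)) auto
  thus ?thesis using eventually_gt_at_top[of 0]
  proof eventually_elim
    case (elim N)
    hence "C * N powr (p - q) * N powr q < D * N powr q" by (intro mult_strict_right_mono) auto
    moreover have "N powr (p - q) * N powr q = N powr p" by (simp flip: powr_add)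
    ultimately show ?case by (simp only: mult.assoc)
  qed
qed

lemma eventually_at_top_pos_bound:
  fixes P :: "real \<Rightarrow> bool"
  assumes "eventually P at_top"
  shows "\<exists>b>0. \<forall>x>b. P x"
proof -
  obtain b where "\<And>x. x > b \<Longrightarrow> P x" using assms unfolding eventually_at_top_dense by blast
  thus ?thesis by (intro exI[of _ "max b 1"]) simp
qed

theorem card_mult_bound_of_no_product:
  fixes c \<epsilon> :: real
  assumes c_bounds: "1 < c" and \<epsilon>_bounds: "0 < \<epsilon>" "2 + \<epsilon> < 3 / c"
  obtains D where "eventually (\<lambda>N. \<forall>A B. A \<subseteq> upper_half N \<longrightarrow> B \<subseteq> upper_half N \<longrightarrow>
    (\<forall>a\<in>A. \<forall>b\<in>B. a * b \<notin> piatetski_shapiro c) \<longrightarrow>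
    real (card A) * real (card B) \<le> D * N powr (13/4 - 3/2 * (1/c) + 3/2 * \<epsilon>)) at_top"
proof -
  define \<gamma> where "\<gamma> = 1 / c"
  have "2 * c < 2 * c + \<epsilon> * c" using c_bounds \<epsilon>_bounds by simp
  also have "\<dots> < 3" using c_bounds \<epsilon>_bounds by (simp add: field_simps)
  finally have "c < 3 / 2" by simp
  hence \<gamma>_bounds: "0 < \<gamma>" "\<gamma> < 1" "2 + \<epsilon> < 3 * \<gamma>" using c_bounds \<epsilon>_bounds by (auto simp: \<gamma>_def)
  obtain K where energy_le: "K > 0" "\<And>j. block_energy \<gamma> j \<le> K * (2 ^ j) powr (2 + \<epsilon>)"
    using block_energy_bound[of \<gamma> \<epsilon>] \<gamma>_bounds \<epsilon>_bounds by auto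
  define k where "k = nat \<lceil>1 / \<epsilon>\<rceil>"
  have "1 / \<epsilon> \<le> real k" using \<epsilon>_bounds by (simp add: k_def)
  hence k_bounds: "1 \<le> real k * \<epsilon>" using \<epsilon>_bounds by (simp add: field_simps)
  have "eventually (\<lambda>N. (1 + ln N) ^ 3 \<le> N powr \<epsilon>) at_top" using \<epsilon>_bounds(1) by real_asymp
  moreover have "eventually (\<lambda>N. 4 * real k * N powr 1 < (\<gamma> / 4) ^ (2 * k) * N powr 2) at_top"
    using \<gamma>_bounds by (intro eventually_powr_less) auto
  moreover have "eventually (\<lambda>N. (2 * real k)\<^sup>2 * N powr (2 * (2 - 2 * \<gamma> + \<epsilon>)) < 1 * N powr (2 * \<gamma>)) at_top"
    using \<gamma>_bounds by (intro eventually_powr_less) auto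
  ultimately have "eventually (\<lambda>N. \<forall>A B. A \<subseteq> upper_half N \<longrightarrow> B \<subseteq> upper_half N \<longrightarrow>
      (\<forall>a\<in>A. \<forall>b\<in>B. a * b \<notin> piatetski_shapiro c) \<longrightarrow> real (card A) * real (card B)
        \<le> 16 * real k * sqrt (12 * sqrt (40 * K)) * N powr (13/4 - 3/2 * (1/c) + 3/2 * \<epsilon>)) at_top"
    using eventually_ge_at_top[of 2]
  proof eventually_elim
    case (elim N)
    show ?case
      using c_bounds \<open>c < 3 / 2\<close> \<epsilon>_bounds \<gamma>_bounds(3) k_bounds energy_le elim unfolding \<gamma>_def
      by (intro allI impI card_mult_le_of_no_product[of c \<epsilon> k K N]) auto
  qed
  thus thesis by (rule that)
qed

theorem theorem1:
  fixes c :: real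
  assumes "1 < c" and "c < 6 / 5"
  shows "\<exists>\<delta>>0. \<forall>C>0. \<exists>N\<^sub>0>0. \<forall>N::real. N > N\<^sub>0 \<longrightarrow>
           (\<forall>A B :: nat set.
              A \<subseteq> {m. 0 < m \<and> N / 2 \<le> real m \<and> real m < N} \<longrightarrow>
              B \<subseteq> {m. 0 < m \<and> N / 2 \<le> real m \<and> real m < N} \<longrightarrow>
              real (card A) * real (card B) \<ge> C * N powr (2 - 2 * \<delta>) \<longrightarrow>
              (\<exists>a\<in>A. \<exists>b\<in>B. \<exists>n::nat. 0 < n \<and> int (a * b) = \<lfloor>real n powr c\<rfloor>))"
proof -
  define \<tau> where "\<tau> = 1 / c - 5/6"
  have \<tau>_bounds: "0 < \<tau>" "2 + \<tau>/3 < 3 / c" using assms by (auto simp: \<tau>_def field_simps)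
  have exponent: "13/4 - 3/2 * (1/c) + 3/2 * (\<tau>/3) = 2 - \<tau>" by (simp add: \<tau>_def diff_divide_distrib)
  obtain D where D_bound: "eventually (\<lambda>N. \<forall>A B. A \<subseteq> upper_half N \<longrightarrow> B \<subseteq> upper_half N \<longrightarrow>
      (\<forall>a\<in>A. \<forall>b\<in>B. a * b \<notin> piatetski_shapiro c) \<longrightarrow> real (card A) * real (card B) \<le> D * N powr (2 - \<tau>)) at_top"
    using card_mult_bound_of_no_product[of c "\<tau>/3"] assms \<tau>_bounds unfolding exponent by auto
  have "\<exists>N\<^sub>0>0. \<forall>N>N\<^sub>0. \<forall>A B. A \<subseteq> upper_half N \<longrightarrow> B \<subseteq> upper_half N \<longrightarrow>
      real (card A) * real (card B) \<ge> C * N powr (2 - 2 * (\<tau>/4)) \<longrightarrow> (\<exists>a\<in>A. \<exists>b\<in>B. a * b \<in> piatetski_shapiro c)"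
    if "C > 0" for C
  proof -
    have "eventually (\<lambda>N. D * N powr (2 - \<tau>) < C * N powr (2 - 2 * (\<tau>/4))) at_top"
      using \<tau>_bounds that by (intro eventually_powr_less) auto
    with D_bound have "eventually (\<lambda>N. \<forall>A B. A \<subseteq> upper_half N \<longrightarrow> B \<subseteq> upper_half N \<longrightarrow>
        real (card A) * real (card B) \<ge> C * N powr (2 - 2 * (\<tau>/4))
          \<longrightarrow> (\<exists>a\<in>A. \<exists>b\<in>B. a * b \<in> piatetski_shapiro c)) at_top"
      by eventually_elim (meson leD order_trans)
    thus ?thesis by (rule eventually_at_top_pos_bound)
  qed
  thus ?thesis
    unfolding piatetski_shapiro_def upper_half_def mem_Collect_eq
    using \<tau>_bounds(1) by (intro exI[of _ "\<tau>/4"]) auto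
qed

end
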